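(* Let $\alpha>d/2$, let $\mu_{0,\alpha}=\mathcal N(0,\mathcal C^{\alpha/2})$, and for $y\in\mathbb R^J$ let $\mu^y$ be the posterior probability measure given by $$\frac{\mathrm d\mu^y}{\mathrm d\mu_{0,\alpha}}(v)=\frac1Z\exp\left(-\frac{1}{2\varepsilon^{2c}}\Bigl|\Sigma^{-\frac12}\bigl(y-KS(v)\bigr)\Bigr|^2\right),$$ where $Z=Z(y)\in(0,\infty)$ is the normalization constant. Then: (i) the measure $\mu^y$ is locally Lipschitz continuous with respect to $y\in\mathbb R^J$ in the Hellinger distance; more precisely, for every constant $\rho>0$ there is a constant $L=L(\rho)$ such that, whenever $|y|<\rho$ and $|y'|<\rho$, $$d_{\rm hell}(\mu^y,\mu^{y'})\le L(\rho)\,|y-y'|;$$ (ii) if $\alpha>1+d/2$ then $u=S(v)$, with $v\sim\mu^y$, has finite total variation norm on $D$, almost surely.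
   Context: $D=(0,1)^d$, $d=2,3$, is the unit cube and $H=L^2(D)$. $H^k_\#(D)$ denotes the periodic functions in the Sobolev space $H^k(D)$, and $X$ is the space of periodic functions in $C(\bar D)$. $K:L^1(D)\to\mathbb R^J$ is a bounded linear operator, $\Sigma\in\mathbb R^{J\times J}$ is a positive definite covariance matrix, $\varepsilon\in(0,1)$ and $c\ge0$ are constants, and $|\cdot|$ is the Euclidean norm on $\mathbb R^J$. Covariance operator: fix constants $\delta>0$, $\tau>0$, $q\ge 0$, $a_1,a_2,a_3\ge 0$. The operator $\mathcal C:H\to H$ is the solution operator $f\mapsto\zeta$ of the (weakly formulated) elliptic problem with periodic boundary conditions: given $f\in H$ find $\zeta\in H^2_\#(D)$ with $$\delta\varepsilon^{-2a_1}\Delta^2\zeta-q\delta\varepsilon^{-2a_2}\Delta\zeta+\tau^2\delta\varepsilon^{-2a_3}\zeta=f .$$ $\mathcal C^{\alpha/2}$ is the fractional power of this positive self-adjoint operator. The thresholding function $S:\mathbb R\to\{-1,0,1\}$ is $S(t)=1$ for $t>0$, $S(0)=0$, $S(t)=-1$ for $t<0$, applied pointwise to functions. The measure $\mu^y$ is the posterior distribution of $v|y$ for the model $y=KS(v)+\varepsilon^c\eta$ with prior $v\sim\mu_{0,\alpha}$ and independent noise $\eta\sim\mathcal N(0,\Sigma)$. The Hellinger distance between measures $\mu,\mu'$, defined with respect to any common reference measure $\mu_0$ (but independent of its choice), is $$d_{\rm hell}(\mu,\mu')=\left(\int_X\left(\sqrt{\frac{\mathrm d\mu}{\mathrm d\mu_0}}-\sqrt{\frac{\mathrm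 d\mu'}{\mathrm d\mu_0}}\right)^2\mathrm d\mu_0\right)^{1/2}.$$ The total variation of $u$ is $\int_D|\nabla u|$. *)

theory Defs
  imports "HOL-Probability.Probability"
begin

section \<open>Function spaces on domains of \<open>\<real>\<^sup>d\<close>\<close>

text \<open>
  Elements of Lebesgue and Sobolev spaces over an open set \<open>\<Omega>\<close> are represented by functions on the
  whole of \<open>\<real>\<^sup>d\<close>, of which only the values on \<open>\<Omega>\<close> matter, up to null sets.
\<close>

definition unit_cube :: "(real ^ 'd::finite) set" where
  "unit_cube = box 0 (\<chi> i. 1)"

definition L1_space :: "(real ^ 'd::finite) set \<Rightarrow> (real ^ 'd \<Rightarrow> real) set" where
  "L1_space \<Omega> = {f. integrable (lebesgue_on \<Omega>) f}"

definition L2_space :: "(real ^ 'd::finite) set \<Rightarrow> (real ^ 'd \<Rightarrow> real) set" where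
  "L2_space \<Omega> = {f. f \<in> borel_measurable (lebesgue_on \<Omega>) \<and>
                     integrable (lebesgue_on \<Omega>) (\<lambda>x. (f x)\<^sup>2)}"

definition L2_inner ::
    "(real ^ 'd::finite) set \<Rightarrow> (real ^ 'd \<Rightarrow> real) \<Rightarrow> (real ^ 'd \<Rightarrow> real) \<Rightarrow> real" where
  "L2_inner \<Omega> f g = (LINT x|lebesgue_on \<Omega>. f x * g x)"

definition L2_nrm :: "(real ^ 'd::finite) set \<Rightarrow> (real ^ 'd \<Rightarrow> real) \<Rightarrow> real" where
  "L2_nrm \<Omega> f = sqrt (L2_inner \<Omega> f f)"

text \<open>
  The bound forces \<open>K f = K g\<close> whenever \<open>f = g\<close> almost everywhere, so that \<open>K\<close> is an operator on the
  quotient space \<open>L\<^sup>1(\<Omega>)\<close>.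
\<close>

definition bounded_linear_L1 ::
    "(real ^ 'd::finite) set \<Rightarrow> ((real ^ 'd \<Rightarrow> real) \<Rightarrow> real ^ 'j::finite) \<Rightarrow> bool" where
  "bounded_linear_L1 \<Omega> K \<longleftrightarrow>
     (\<forall>f\<in>L1_space \<Omega>. \<forall>g\<in>L1_space \<Omega>. K (\<lambda>x. f x + g x) = K f + K g) \<and>
     (\<forall>f\<in>L1_space \<Omega>. \<forall>r. K (\<lambda>x. r * f x) = r *\<^sub>R K f) \<and>
     (\<exists>B. \<forall>f\<in>L1_space \<Omega>. norm (K f) \<le> B * (LINT x|lebesgue_on \<Omega>. \<bar>f x\<bar>))"


subsection \<open>Smooth test functions and weak derivatives\<close>

definition partial_deriv :: "'d::finite \<Rightarrow> (real ^ 'd \<Rightarrow> real) \<Rightarrow> real ^ 'd \<Rightarrow> real" where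
  "partial_deriv i \<phi> x = frechet_derivative \<phi> (at x) (axis i 1)"

definition smooth_fun :: "(real ^ 'd::finite \<Rightarrow> real) \<Rightarrow> bool" where
  "smooth_fun \<phi> \<longleftrightarrow> (\<forall>is. foldr partial_deriv is \<phi> differentiable_on UNIV)"

definition test_fun :: "(real ^ 'd::finite) set \<Rightarrow> (real ^ 'd \<Rightarrow> real) \<Rightarrow> bool" where
  "test_fun \<Omega> \<phi> \<longleftrightarrow>
     smooth_fun \<phi> \<and> compact (closure {x. \<phi> x \<noteq> 0}) \<and> closure {x. \<phi> x \<noteq> 0} \<subseteq> \<Omega>"

definition locally_integrable :: "(real ^ 'd::finite) set \<Rightarrow> (real ^ 'd \<Rightarrow> real) \<Rightarrow> bool" where
  "locally_integrable \<Omega> f \<longleftrightarrow> (\<forall>C. compact C \<and> C \<subseteq> \<Omega> \<longrightarrow> integrable (lebesgue_on C) f)"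

definition weak_pderiv ::
    "(real ^ 'd::finite) set \<Rightarrow> 'd \<Rightarrow> (real ^ 'd \<Rightarrow> real) \<Rightarrow> (real ^ 'd \<Rightarrow> real) \<Rightarrow> bool" where
  "weak_pderiv \<Omega> i u g \<longleftrightarrow>
     locally_integrable \<Omega> u \<and> locally_integrable \<Omega> g \<and>
     (\<forall>\<phi>. test_fun \<Omega> \<phi> \<longrightarrow>
        (LINT x|lebesgue_on \<Omega>. u x * partial_deriv i \<phi> x) = - (LINT x|lebesgue_on \<Omega>. g x * \<phi> x))"

text \<open>A weak derivative is unique up to null sets, so the choice is immaterial below.\<close>

definition wpd ::
    "(real ^ 'd::finite) set \<Rightarrow> 'd \<Rightarrow> (real ^ 'd \<Rightarrow> real) \<Rightarrow> real ^ 'd \<Rightarrow> real" where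
  "wpd \<Omega> i u = (SOME g. weak_pderiv \<Omega> i u g)"

definition weak_laplacian ::
    "(real ^ 'd::finite) set \<Rightarrow> (real ^ 'd \<Rightarrow> real) \<Rightarrow> real ^ 'd \<Rightarrow> real" where
  "weak_laplacian \<Omega> u x = (\<Sum>i\<in>UNIV. wpd \<Omega> i (wpd \<Omega> i u) x)"

fun sobolev :: "(real ^ 'd::finite) set \<Rightarrow> nat \<Rightarrow> (real ^ 'd \<Rightarrow> real) set" where
  "sobolev \<Omega> 0 = L2_space \<Omega>"
| "sobolev \<Omega> (Suc k) = {u \<in> L2_space \<Omega>. \<forall>i. \<exists>g\<in>sobolev \<Omega> k. weak_pderiv \<Omega> i u g}"


subsection \<open>Periodic functions\<close>

definition per_ext :: "(real ^ 'd::finite \<Rightarrow> real) \<Rightarrow> real ^ 'd \<Rightarrow> real" where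
  "per_ext u x = u (\<chi> i. frac (x $ i))"

text \<open>
  \<open>H\<^sup>k\<^sub>#(D)\<close>: functions on the cube \<open>D\<close> whose periodic extension is in \<open>H\<^sup>k\<close> locally on \<open>\<real>\<^sup>d\<close>, i.e.
  no jumps of \<open>u\<close> or of its derivatives of order \<open>< k\<close> between opposite faces. Taking \<open>\<Omega> = D\<close>, where
  the extension agrees with \<open>u\<close>, such a \<open>u\<close> lies in \<open>H\<^sup>k(D)\<close>.
\<close>

definition sobolev_per :: "nat \<Rightarrow> (real ^ 'd::finite \<Rightarrow> real) set" where
  "sobolev_per k = {u. \<forall>\<Omega>. open \<Omega> \<and> bounded \<Omega> \<longrightarrow> per_ext u \<in> sobolev \<Omega> k}"

text \<open>
  The space \<open>X\<close> of periodic functions in \<open>C(closure D)\<close>. A function is identified with its continuous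
  periodic extension to \<open>\<real>\<^sup>d\<close>; the supremum norm is unaffected by this.
\<close>

definition X_space :: "((real ^ 'd::finite) \<Rightarrow>\<^sub>C real) set" where
  "X_space = {v. \<forall>x i. apply_bcontfun v (x + axis i 1) = apply_bcontfun v x}"

definition X_borel :: "((real ^ 'd::finite) \<Rightarrow>\<^sub>C real) measure" where
  "X_borel = restrict_space borel X_space"


section \<open>The covariance operator and its fractional powers\<close>

text \<open>
  Weak form of
  \<open>\<delta> \<epsilon>\<^bsup>-2a\<^sub>1\<^esup> \<Delta>\<^sup>2\<zeta> - q \<delta> \<epsilon>\<^bsup>-2a\<^sub>2\<^esup> \<Delta>\<zeta> + \<tau>\<^sup>2 \<delta> \<epsilon>\<^bsup>-2a\<^sub>3\<^esup> \<zeta> = f\<close>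
  with periodic boundary conditions.
\<close>

definition cov_weak_solution ::
    "real \<Rightarrow> real \<Rightarrow> real \<Rightarrow> real \<Rightarrow> real \<Rightarrow> real \<Rightarrow> real \<Rightarrow>
     (real ^ 'd::finite \<Rightarrow> real) \<Rightarrow> (real ^ 'd \<Rightarrow> real) \<Rightarrow> bool" where
  "cov_weak_solution \<epsilon> \<delta> \<tau> q a1 a2 a3 f \<zeta> \<longleftrightarrow>
     \<zeta> \<in> sobolev_per 2 \<and>
     (\<forall>\<phi>\<in>sobolev_per 2.
        \<delta> * \<epsilon> powr (-2 * a1)
            * L2_inner unit_cube (weak_laplacian unit_cube \<zeta>) (weak_laplacian unit_cube \<phi>)
        + q * \<delta> * \<epsilon> powr (-2 * a2)
            * (\<Sum>i\<in>UNIV. L2_inner unit_cube (wpd unit_cube i \<zeta>) (wpd unit_cube i \<phi>))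
        + \<tau>\<^sup>2 * \<delta> * \<epsilon> powr (-2 * a3) * L2_inner unit_cube \<zeta> \<phi>
        = L2_inner unit_cube f \<phi>)"

definition cov_op ::
    "real \<Rightarrow> real \<Rightarrow> real \<Rightarrow> real \<Rightarrow> real \<Rightarrow> real \<Rightarrow> real \<Rightarrow>
     (real ^ 'd::finite \<Rightarrow> real) \<Rightarrow> real ^ 'd \<Rightarrow> real" where
  "cov_op \<epsilon> \<delta> \<tau> q a1 a2 a3 f = (SOME \<zeta>. cov_weak_solution \<epsilon> \<delta> \<tau> q a1 a2 a3 f \<zeta>)"

definition orthonormal_eigenbasis ::
    "(real ^ 'd::finite) set \<Rightarrow> ((real ^ 'd \<Rightarrow> real) \<Rightarrow> real ^ 'd \<Rightarrow> real) \<Rightarrow>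
     (nat \<Rightarrow> real ^ 'd \<Rightarrow> real) \<Rightarrow> (nat \<Rightarrow> real) \<Rightarrow> bool" where
  "orthonormal_eigenbasis \<Omega> A e lam \<longleftrightarrow>
     (\<forall>n. e n \<in> L2_space \<Omega>) \<and>
     (\<forall>m n. L2_inner \<Omega> (e m) (e n) = (if m = n then 1 else 0)) \<and>
     (\<forall>f\<in>L2_space \<Omega>. (\<forall>n. L2_inner \<Omega> f (e n) = 0) \<longrightarrow> (AE x in lebesgue_on \<Omega>. f x = 0)) \<and>
     (\<forall>n. 0 \<le> lam n) \<and>
     (\<forall>n. AE x in lebesgue_on \<Omega>. A (e n) x = lam n * e n x)"

text \<open>
  \<open>A\<^sup>s f = (\<Sum>n. \<lambda>\<^sub>n\<^sup>s \<langle>f, e\<^sub>n\<rangle> e\<^sub>n)\<close>, converging in \<open>L\<^sup>2(\<Omega>)\<close>, for a compact positive self-adjoint operator \<open>A\<close>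
  with eigenpairs \<open>(\<lambda>\<^sub>n, e\<^sub>n)\<close>. As an element of \<open>L\<^sup>2(\<Omega>)\<close> it does not depend on the eigenbasis.
\<close>

definition frac_power ::
    "(real ^ 'd::finite) set \<Rightarrow> ((real ^ 'd \<Rightarrow> real) \<Rightarrow> real ^ 'd \<Rightarrow> real) \<Rightarrow> real \<Rightarrow>
     (real ^ 'd \<Rightarrow> real) \<Rightarrow> real ^ 'd \<Rightarrow> real" where
  "frac_power \<Omega> A s f = (SOME g. g \<in> L2_space \<Omega> \<and>
     (\<exists>e lam. orthonormal_eigenbasis \<Omega> A e lam \<and>
        (\<lambda>N. L2_nrm \<Omega> (\<lambda>x. g x - (\<Sum>n<N. lam n powr s * L2_inner \<Omega> f (e n) * e n x))) \<longlonglongrightarrow> 0))"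


section \<open>Gaussian measures, posterior, Hellinger distance, total variation\<close>

definition normal_law :: "real \<Rightarrow> real \<Rightarrow> real measure" where
  "normal_law m var =
     (if var = 0 then return borel m else density lborel (normal_density m (sqrt var)))"

text \<open>
  \<open>\<mu>\<close> is the Gaussian measure \<open>N(m, Q)\<close>, with covariance operator \<open>Q\<close> on \<open>H = L\<^sup>2(D)\<close>, as a Borel
  probability measure on \<open>X\<close>.
\<close>

definition gaussian_on_X ::
    "((real ^ 'd::finite) \<Rightarrow>\<^sub>C real) measure \<Rightarrow> (real ^ 'd \<Rightarrow> real) \<Rightarrow>
     ((real ^ 'd \<Rightarrow> real) \<Rightarrow> real ^ 'd \<Rightarrow> real) \<Rightarrow> bool" where
  "gaussian_on_X \<mu> m Q \<longleftrightarrow>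
     prob_space \<mu> \<and> sets \<mu> = sets X_borel \<and>
     (\<forall>f\<in>L2_space unit_cube.
        (\<lambda>v. L2_inner unit_cube f (apply_bcontfun v)) \<in> borel_measurable \<mu> \<and>
        distr \<mu> borel (\<lambda>v. L2_inner unit_cube f (apply_bcontfun v))
          = normal_law (L2_inner unit_cube f m) (L2_inner unit_cube f (Q f)))"

definition pos_def_matrix :: "real ^ 'j ^ 'j::finite \<Rightarrow> bool" where
  "pos_def_matrix A \<longleftrightarrow> transpose A = A \<and> (\<forall>x. x \<noteq> 0 \<longrightarrow> 0 < x \<bullet> (A *v x))"

definition matrix_sqrt :: "real ^ 'j ^ 'j::finite \<Rightarrow> real ^ 'j ^ 'j" where
  "matrix_sqrt A = (THE R. pos_def_matrix R \<and> R ** R = A)"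

definition threshold :: "(real ^ 'd::finite \<Rightarrow> real) \<Rightarrow> real ^ 'd \<Rightarrow> real" where
  "threshold v x = sgn (v x)"

definition likelihood ::
    "((real ^ 'd::finite \<Rightarrow> real) \<Rightarrow> real ^ 'j) \<Rightarrow> real ^ 'j ^ 'j::finite \<Rightarrow> real \<Rightarrow> real \<Rightarrow>
     real ^ 'j \<Rightarrow> ((real ^ 'd) \<Rightarrow>\<^sub>C real) \<Rightarrow> real" where
  "likelihood K \<Sigma> \<epsilon> c y v =
     exp (- (1 / (2 * \<epsilon> powr (2 * c)))
          * (norm (matrix_inv (matrix_sqrt \<Sigma>) *v (y - K (threshold (apply_bcontfun v)))))\<^sup>2)"

definition evidence ::
    "((real ^ 'd::finite) \<Rightarrow>\<^sub>C real) measure \<Rightarrow> ((real ^ 'd \<Rightarrow> real) \<Rightarrow> real ^ 'j) \<Rightarrow>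
     real ^ 'j ^ 'j::finite \<Rightarrow> real \<Rightarrow> real \<Rightarrow> real ^ 'j \<Rightarrow> ennreal" where
  "evidence \<mu>0 K \<Sigma> \<epsilon> c y = (\<integral>\<^sup>+ v. ennreal (likelihood K \<Sigma> \<epsilon> c y v) \<partial>\<mu>0)"

definition posterior ::
    "((real ^ 'd::finite) \<Rightarrow>\<^sub>C real) measure \<Rightarrow> ((real ^ 'd \<Rightarrow> real) \<Rightarrow> real ^ 'j) \<Rightarrow>
     real ^ 'j ^ 'j::finite \<Rightarrow> real \<Rightarrow> real \<Rightarrow> real ^ 'j \<Rightarrow> ((real ^ 'd) \<Rightarrow>\<^sub>C real) measure" where
  "posterior \<mu>0 K \<Sigma> \<epsilon> c y =
     density \<mu>0 (\<lambda>v. ennreal (likelihood K \<Sigma> \<epsilon> c y v) / evidence \<mu>0 K \<Sigma> \<epsilon> c y)"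

definition reference_measure :: "'a measure \<Rightarrow> 'a measure \<Rightarrow> 'a measure \<Rightarrow> bool" where
  "reference_measure \<nu> \<mu> \<mu>' \<longleftrightarrow>
     sigma_finite_measure \<nu> \<and> sets \<mu> = sets \<nu> \<and> sets \<mu>' = sets \<nu> \<and>
     absolutely_continuous \<nu> \<mu> \<and> absolutely_continuous \<nu> \<mu>'"

definition hellinger_dist :: "'a measure \<Rightarrow> 'a measure \<Rightarrow> 'a measure \<Rightarrow> real" where
  "hellinger_dist \<nu> \<mu> \<mu>' =
     sqrt (LINT v|\<nu>. (sqrt (enn2real (RN_deriv \<nu> \<mu> v)) - sqrt (enn2real (RN_deriv \<nu> \<mu>' v)))\<^sup>2)"

text \<open>
  The total variation \<open>\<integral>\<^sub>\<Omega> \<bar>\<nabla>u\<bar>\<close>, where \<open>\<nabla>u\<close> is the distributional gradient; \<open>u\<close> need not be weakly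
  differentiable and the value may be \<open>\<infinity>\<close>.
\<close>

definition total_variation :: "(real ^ 'd::finite) set \<Rightarrow> (real ^ 'd \<Rightarrow> real) \<Rightarrow> ereal" where
  "total_variation \<Omega> u =
     (SUP \<psi> \<in> {\<psi> :: real ^ 'd \<Rightarrow> real ^ 'd.
                 (\<forall>i. test_fun \<Omega> (\<lambda>x. \<psi> x $ i)) \<and> (\<forall>x. norm (\<psi> x) \<le> 1)}.
        ereal (LINT x|lebesgue_on \<Omega>. u x * (\<Sum>i\<in>UNIV. partial_deriv i (\<lambda>x. \<psi> x $ i) x)))"

end

theory Submission
  imports Defs
begin

text \<open>The likelihood sees the field \<open>v\<close> only through the vector \<open>F v = K (S v)\<close>. Since \<open>\<bar>S v\<bar> \<le> 1\<close>
and \<open>K\<close> is bounded on \<open>L\<^sup>1\<close>, this vector is bounded uniformly in \<open>v\<close>. For \<open>\<bar>y\<bar> \<le> \<rho>\<close> the likelihood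
therefore lies between a positive constant and \<open>1\<close>, and it is Lipschitz in \<open>y\<close> uniformly in \<open>v\<close>.
Both properties pass to the normalised densities and, because these stay away from \<open>0\<close>, to their
square roots (\<open>sqrt_normalised_density_diff\<close>); integrating the squared difference gives the Hellinger
bound for the prior as reference measure, and the chain rule for Radon-Nikodym derivatives for every
other one (\<open>hellinger_dist_densities\<close>). Measurability of \<open>F\<close> needs an argument, because
\<open>v \<mapsto> S v\<close> is not continuous: \<open>F\<close> is a pointwise limit of the continuous maps obtained by
replacing \<open>S\<close> by the ramps \<open>t \<mapsto> max (-1) (min 1 (n t))\<close> (\<open>forward_map_measurable\<close>).

For the total variation it suffices to argue under the prior, since the posterior has a density with
respect to it. No derivative of \<open>v\<close> is used. The total variation of \<open>u\<close> is at most the sum over the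
coordinates of the lower limits of \<open>n \<integral> \<bar>u (x + e\<^sub>i / n) - u x\<bar> dx\<close> (\<open>total_variation_finite\<close>), and
for \<open>u = S v\<close> the integrand is at most \<open>2\<close> and vanishes unless \<open>v\<close> changes sign between \<open>x\<close> and
\<open>x + e\<^sub>i / n\<close>. If such a change over a step \<open>h\<close> has probability at most \<open>C h\<close>, uniformly in \<open>x\<close>, then
these integrals have bounded expectation, and Fatou's lemma makes the lower limit finite almost
surely (\<open>AE_total_variation_threshold_finite\<close>). To bound the probability, put
\<open>X = (v x + v y) / 2\<close> and \<open>Y = (v x - v y) / 2\<close>. A sign change forces \<open>\<bar>X\<bar> \<le> \<bar>Y\<bar>\<close>. The field is
stationary, so \<open>X\<close> and \<open>Y\<close> are uncorrelated jointly Gaussian variables, hence independent, and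
\<open>P (\<bar>X\<bar> \<le> \<bar>Y\<bar>)\<close> is at most \<open>2 sd Y / sd X\<close> (\<open>gaussian_pair_abs_le\<close>). The constant Fourier mode keeps
\<open>sd X\<close> away from \<open>0\<close>, and \<open>sd Y\<close> is of order \<open>h\<close> as soon as the sum of \<open>\<bar>k\<bar>\<^sup>2 \<lambda>\<^sub>k powr (\<alpha> / 2)\<close> over
the frequencies converges, where \<open>\<lambda>\<^sub>k \<sim> \<bar>k\<bar> powr (-4)\<close> are the eigenvalues of the covariance
operator. This is exactly the condition \<open>\<alpha> > 1 + d / 2\<close> (\<open>sign_change_probability\<close>).

The remaining work is to express the law of the point values of \<open>v\<close> by these eigenvalues
(\<open>gaussian_pair_char\<close>). The functions \<open>cos (2 \<pi> k \<bullet> x) + sin (2 \<pi> k \<bullet> x)\<close>, with \<open>k\<close> in the integer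
lattice, form a complete orthonormal system of real functions indexed by the lattice itself, on which
weak differentiation acts as multiplication combined with \<open>k \<mapsto> - k\<close> (\<open>trig_complete\<close>, \<open>coef_wpd\<close>).
Hence the elliptic problem is solved coefficient by coefficient (\<open>coef_cov\<close>), this system is an
eigenbasis of the covariance operator, and the fractional power, whichever eigenbasis is used to
define it, multiplies the coefficients by \<open>\<lambda>\<^sub>k powr (\<alpha> / 2)\<close> (\<open>frac_power_coef\<close>). Averages over small
cells turn this information on the pairings of \<open>v\<close> with square integrable functions into information
on point values.\<close>

section \<open>Smooth functions\<close>

text \<open>Coinduction expresses the existence of derivatives of all orders without
an iterated derivative operator: a set of functions closed under differentiation witnesses smoothness.\<close>

coinductive smooth1 :: "(real \<Rightarrow> real) \<Rightarrow> bool" where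
  smooth1I: "(\<And>x. (f has_real_derivative f' x) (at x)) \<Longrightarrow> smooth1 f' \<Longrightarrow> smooth1 f"

lemma smooth1D:
  assumes "smooth1 f"
  obtains f' where "\<And>x. (f has_real_derivative f' x) (at x)" "smooth1 f'"
  using assms by (cases rule: smooth1.cases) auto

lemma smooth1_continuous: "smooth1 f \<Longrightarrow> continuous_on UNIV f"
  by (metis smooth1D DERIV_continuous_on UNIV_I)

text \<open>The closure of the smooth functions under sums and products is closed under
differentiation by the product rule, and so serves as the coinduction set for \<open>smooth1_add\<close> and \<open>smooth1_mult\<close>.\<close>

inductive smooth1_alg :: "(real \<Rightarrow> real) \<Rightarrow> bool" where
  base: "smooth1 f \<Longrightarrow> smooth1_alg f"
| add: "smooth1_alg f \<Longrightarrow> smooth1_alg g \<Longrightarrow> smooth1_alg (\<lambda>x. f x + g x)"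
| mult: "smooth1_alg f \<Longrightarrow> smooth1_alg g \<Longrightarrow> smooth1_alg (\<lambda>x. f x * g x)"

lemma smooth1_alg_deriv:
  "smooth1_alg f \<Longrightarrow> \<exists>f'. (\<forall>x. (f has_real_derivative f' x) (at x)) \<and> smooth1_alg f'"
proof (induction rule: smooth1_alg.induct)
  case (base f)
  then show ?case by (meson smooth1D smooth1_alg.base)
next
  case (add f g)
  then obtain f' g' where "\<forall>x. (f has_real_derivative f' x) (at x)" "smooth1_alg f'"
    "\<forall>x. (g has_real_derivative g' x) (at x)" "smooth1_alg g'" by auto
  then show ?case
    by (intro exI[of _ "\<lambda>x. f' x + g' x"]) (auto intro!: DERIV_add smooth1_alg.add)
next
  case (mult f g)
  then obtain f' g' where "\<forall>x. (f has_real_derivative f' x) (at x)" "smooth1_alg f'"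
    "\<forall>x. (g has_real_derivative g' x) (at x)" "smooth1_alg g'" by auto
  then show ?case using mult
    by (intro exI[of _ "\<lambda>x. f' x * g x + g' x * f x"])
      (auto intro!: DERIV_mult smooth1_alg.add smooth1_alg.mult)
qed

lemma smooth1_alg_smooth1: "smooth1_alg f \<Longrightarrow> smooth1 f"
proof (coinduction arbitrary: f)
  case smooth1
  from smooth1_alg_deriv[OF this] show ?case by blast
qed

lemma smooth1_add: "smooth1 f \<Longrightarrow> smooth1 g \<Longrightarrow> smooth1 (\<lambda>x. f x + g x)"
  and smooth1_mult: "smooth1 f \<Longrightarrow> smooth1 g \<Longrightarrow> smooth1 (\<lambda>x. f x * g x)"
  by (simp_all add: smooth1_alg_smooth1 smooth1_alg.intros)

lemma smooth1_setI:
  assumes "f \<in> S" and step: "\<And>g. g \<in> S \<Longrightarrow> \<exists>g'\<in>S. \<forall>x. (g has_real_derivative g' x) (at x)"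
  shows "smooth1 f"
  using assms(1)
proof (coinduction arbitrary: f)
  case smooth1
  with step show ?case by blast
qed

lemma smooth1_const: "smooth1 (\<lambda>x. c)"
  by (rule smooth1_setI[of _ "range (\<lambda>c x. c)"]) (auto intro!: exI[of _ 0])

lemma smooth1_affine:
  assumes "smooth1 f" shows "smooth1 (\<lambda>x. f (a * x + b))"
proof -
  let ?S = "{(\<lambda>x. c * g (a * x + b)) | g c. smooth1 g}"
  show ?thesis
  proof (rule smooth1_setI[of _ ?S])
    show "(\<lambda>x. f (a * x + b)) \<in> ?S"
      using assms by (auto intro!: exI[of _ f] exI[of _ 1])
  next
    fix h assume "h \<in> ?S"
    then obtain g c where h: "h = (\<lambda>x. c * g (a * x + b))" "smooth1 g" by auto
    then obtain g' where g': "\<And>x. (g has_real_derivative g' x) (at x)" "smooth1 g'"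
      by (meson smooth1D)
    have "(h has_real_derivative (c * a) * g' (a * x + b)) (at x)" for x
      unfolding h(1)
      by (rule derivative_eq_intros DERIV_chain2[OF g'(1)] refl)+ (auto simp: algebra_simps)
    moreover have "(\<lambda>x. (c * a) * g' (a * x + b)) \<in> ?S" using g'(2) by blast
    ultimately show "\<exists>h'\<in>?S. \<forall>x. (h has_real_derivative h' x) (at x)"
      by (intro bexI[of _ "\<lambda>x. (c * a) * g' (a * x + b)"]) auto
  qed
qed

lemma smooth1_sin_cos: "smooth1 (\<lambda>x. a * sin x + b * cos x)"
proof (rule smooth1_setI[of _ "{\<lambda>x. a * sin x + b * cos x | a b. True}"])
  fix g :: "real \<Rightarrow> real" assume "g \<in> {\<lambda>x. a * sin x + b * cos x | a b. True}"
  then obtain a b where g: "g = (\<lambda>x. a * sin x + b * cos x)" by auto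
  have "(g has_real_derivative ((-b) * sin x + a * cos x)) (at x)" for x
    unfolding g by (auto intro!: derivative_eq_intros)
  then show "\<exists>g'\<in>{\<lambda>x. a * sin x + b * cos x | a b. True}. \<forall>x. (g has_real_derivative g' x) (at x)"
    by (intro bexI[of _ "\<lambda>x. (-b) * sin x + a * cos x"]) blast+
qed blast

lemma poly_times_exp_neg_at_top: "((\<lambda>s. poly p s * exp (- s)) \<longlongrightarrow> (0::real)) at_top"
proof -
  have *: "((\<lambda>s::real. s ^ k * exp (- s)) \<longlongrightarrow> 0) at_top" for k
    using tendsto_power_div_exp_0[of k] by (simp add: exp_minus divide_inverse)
  have "((\<lambda>s. \<Sum>i\<le>degree p. coeff p i * (s ^ i * exp (- s))) \<longlongrightarrow> (\<Sum>i\<le>degree p. coeff p i * 0)) at_top"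
    by (intro tendsto_sum tendsto_mult tendsto_const *)
  then show ?thesis
    by (simp add: poly_altdef sum_distrib_right mult.assoc)
qed

definition flat_exp :: "real \<Rightarrow> real" where
  "flat_exp t = (if 0 < t then exp (- (1 / t)) else 0)"

text \<open>The functions \<open>p (1/t) exp (-1/t)\<close> with a polynomial \<open>p\<close>, extended by \<open>0\<close>
to \<open>t \<le> 0\<close>, form a set closed under differentiation. At \<open>t = 0\<close> the difference quotient tends to \<open>0\<close>
because the exponential beats every polynomial in \<open>1/t\<close>.\<close>

lemma flat_exp_poly_deriv:
  fixes p :: "real poly"
  defines "F \<equiv> \<lambda>p t. if 0 < t then poly p (1 / t) * exp (- (1 / t)) else (0::real)"
  shows "(F p has_real_derivative F ((p - pderiv p) * [:0, 0, 1:]) t) (at t)"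
proof -
  consider "t > 0" | "t < 0" | "t = 0" by linarith
  then show ?thesis
  proof cases
    case 1
    have "((\<lambda>t. poly p (1 / t) * exp (- (1 / t))) has_real_derivative
        poly ((p - pderiv p) * [:0, 0, 1:]) (1 / t) * exp (- (1 / t))) (at t)"
      using 1
      by (auto intro!: derivative_eq_intros DERIV_chain2[OF poly_DERIV] simp: field_simps power2_eq_square)
    then have "(F p has_real_derivative poly ((p - pderiv p) * [:0, 0, 1:]) (1 / t) * exp (- (1 / t))) (at t)"
      by (rule has_field_derivative_transform_within_open[of _ _ _ "{0<..}"])
        (use 1 in \<open>auto simp: F_def\<close>)
    then show ?thesis using 1 by (simp add: F_def)
  next
    case 2
    have "((\<lambda>t. 0) has_real_derivative 0) (at t)" by simp
    then have "(F p has_real_derivative 0) (at t)"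
      by (rule has_field_derivative_transform_within_open[of _ _ _ "{..<0}"])
        (use 2 in \<open>auto simp: F_def\<close>)
    then show ?thesis using 2 by (simp add: F_def)
  next
    case 3
    have R: "((\<lambda>h. F p h / h) \<longlongrightarrow> 0) (at_right 0)"
    proof -
      have "((\<lambda>h. poly (p * [:0, 1:]) (inverse h) * exp (- inverse h)) \<longlongrightarrow> (0::real)) (at_right 0)"
        using poly_times_exp_neg_at_top[of "p * [:0, 1:]"]
        by (rule filterlim_compose) (rule filterlim_inverse_at_top_right)
      moreover have "\<forall>\<^sub>F h in at_right 0.
          poly (p * [:0, 1:]) (inverse h) * exp (- inverse h) = F p h / h"
        by (auto simp: eventually_at_filter F_def field_simps)
      ultimately show ?thesis by (rule Lim_transform_eventually)
    qed
    have L: "((\<lambda>h. F p h / h) \<longlongrightarrow> 0) (at_left 0)"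
    proof (rule Lim_transform_eventually[OF tendsto_const])
      show "\<forall>\<^sub>F h in at_left 0. 0 = F p h / h"
        by (auto simp: eventually_at_filter F_def)
    qed
    have "((\<lambda>h. F p h / h) \<longlongrightarrow> 0) (at 0)"
      using L R by (simp add: filterlim_at_split)
    then show ?thesis using 3
      by (simp add: has_field_derivative_iff F_def)
  qed
qed

lemma smooth1_flat_exp: "smooth1 flat_exp"
proof -
  let ?S = "range (\<lambda>p t. if 0 < t then poly p (1 / t) * exp (- (1 / t)) else (0::real))"
  have "smooth1 (\<lambda>t. if 0 < t then poly p (1 / t) * exp (- (1 / t)) else 0)" for p
  proof (rule smooth1_setI[of _ ?S])
    fix g assume "g \<in> ?S"
    then obtain p where g: "g = (\<lambda>t. if 0 < t then poly p (1 / t) * exp (- (1 / t)) else 0)" by auto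
    let ?q = "(p - pderiv p) * [:0, 0, 1:]"
    show "\<exists>g'\<in>?S. \<forall>x. (g has_real_derivative g' x) (at x)"
      unfolding g
      by (intro bexI[of _ "\<lambda>t. if 0 < t then poly ?q (1 / t) * exp (- (1 / t)) else 0"] allI)
        (rule flat_exp_poly_deriv, blast)
  qed blast
  from this[of "[:1:]"] show ?thesis
    by (rule back_subst[of smooth1]) (auto simp: flat_exp_def)
qed

lemma flat_exp_bounds: "0 \<le> flat_exp t" "flat_exp t \<le> 1"
  by (auto simp: flat_exp_def)

lemma flat_exp_tendsto_1: "0 < t \<Longrightarrow> (\<lambda>n. flat_exp (real n * t)) \<longlonglongrightarrow> 1"
proof -
  assume t: "0 < t"
  have "(\<lambda>n. exp (- (inverse (real n) * (1 / t)))) \<longlonglongrightarrow> exp (- (0 * (1 / t)))"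
    by (intro tendsto_intros lim_inverse_n)
  moreover have "\<forall>\<^sub>F n in sequentially. exp (- (inverse (real n) * (1 / t))) = flat_exp (real n * t)"
    using eventually_gt_at_top[of "0::nat"]
  proof eventually_elim
    case (elim n)
    with t have "0 < real n * t" by simp
    then show ?case by (simp add: flat_exp_def divide_simps)
  qed
  ultimately show ?thesis by (simp add: Lim_transform_eventually)
qed

text \<open>The step is the normalised primitive of \<open>flat_exp t * flat_exp (1 - t)\<close>,
a smooth function that is positive exactly on \<open>(0, 1)\<close>.\<close>

lemma smooth_step_exists:
  obtains R where "smooth1 R" "\<And>t. t \<le> 0 \<Longrightarrow> R t = 0" "\<And>t. 1 \<le> t \<Longrightarrow> R t = 1"
proof -
  define \<rho> where "\<rho> t = flat_exp t * flat_exp (-1 * t + 1)" for t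
  have s\<rho>: "smooth1 \<rho>"
    unfolding \<rho>_def[abs_def] by (intro smooth1_mult smooth1_flat_exp smooth1_affine)
  have cont: "continuous_on S \<rho>" for S
    using smooth1_continuous[OF s\<rho>] continuous_on_subset by blast
  have int: "\<rho> integrable_on {a..b}" for a b
    by (rule integrable_continuous_real[OF cont])
  have nn: "0 \<le> \<rho> t" for t by (simp add: \<rho>_def flat_exp_bounds)
  define I where "I = integral {0..1} \<rho>"
  have "I > 0"
  proof -
    have "integral {0..1} \<rho> \<noteq> 0"
    proof
      assume "integral {0..1} \<rho> = 0"
      then have "(\<rho> has_integral 0) (cbox 0 1)"
        using integrable_integral[OF int[of 0 1]] by simp
      then have "\<rho> (1/2) = 0"
        by (rule has_integral_0_cbox_imp_0[OF cont nn]) auto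
      then show False by (simp add: \<rho>_def flat_exp_def)
    qed
    moreover have "integral {0..1} \<rho> \<ge> 0" by (rule integral_nonneg[OF int nn])
    ultimately show ?thesis by (simp add: I_def)
  qed
  define P where "P t = integral {-1..t} \<rho> " for t
  define R where "R t = (if t < 0 then 0 else P t / I)" for t
  have z: "\<rho> t = 0" if "t \<le> 0 \<or> 1 \<le> t" for t using that by (auto simp: \<rho>_def flat_exp_def)
  have P0: "P t = 0" if "t \<le> 0" for t
    unfolding P_def by (rule integral_eq_0_iff[THEN iffD2] integral_unique has_integral_is_0)+ (use that z in auto)
  have P1: "P t = I" if "1 \<le> t" for t
  proof -
    have "integral {0..t} \<rho> = integral {0..1} \<rho> + integral {1..t} \<rho>"
      using Henstock_Kurzweil_Integration.integral_combine[OF _ that int] by simp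
    moreover have "integral {1..t} \<rho> = 0"
      by (rule integral_unique has_integral_is_0)+ (use z in auto)
    moreover have "P t = integral {-1..0} \<rho> + integral {0..t} \<rho>"
      unfolding P_def using Henstock_Kurzweil_Integration.integral_combine[OF _ _ int] that by simp
    ultimately show ?thesis using P0[of 0] by (simp add: I_def P_def)
  qed
  have RP: "R t = P t / I" for t using P0[of t] by (simp add: R_def)
  have dP: "(P has_real_derivative \<rho> t) (at t)" for t
  proof (cases "t < 0")
    case True
    have "((\<lambda>t. 0) has_real_derivative 0) (at t)" by simp
    then have "(P has_real_derivative 0) (at t)"
      by (rule has_field_derivative_transform_within_open[of _ _ _ "{..<0}"])
        (use True P0 in auto)
    then show ?thesis using True z by simp
  next
    case False
    have "(P has_real_derivative \<rho> t) (at t within {-1..t+1})"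
      unfolding P_def using False by (intro integral_has_real_derivative cont) auto
    then show ?thesis using False
      by (subst (asm) at_within_interior) auto
  qed
  have "(R has_real_derivative \<rho> t * (1 / I)) (at t)" for t
  proof -
    have "R = (\<lambda>t. P t * (1 / I))" using RP by auto
    moreover have "((\<lambda>t. P t * (1 / I)) has_real_derivative \<rho> t * (1 / I)) (at t)"
      by (rule DERIV_cmult_right[OF dP])
    ultimately show ?thesis by simp
  qed
  moreover have "smooth1 (\<lambda>t. \<rho> t * (1 / I))"
    by (intro smooth1_mult s\<rho> smooth1_const)
  ultimately have "smooth1 R" by (rule smooth1I)
  then show ?thesis using that[of R] P0 P1 RP \<open>I > 0\<close> by auto
qed

lemma partial_derivI:
  assumes "(f has_derivative f') (at x)"
  shows "partial_deriv i f x = f' (axis i 1)"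
  using frechet_derivative_at[OF assms] by (simp add: partial_deriv_def)

lemma smooth_fun_coinduct:
  assumes "f \<in> S" and "\<And>g. g \<in> S \<Longrightarrow> g differentiable_on UNIV"
    and "\<And>g i. g \<in> S \<Longrightarrow> partial_deriv i g \<in> S"
  shows "smooth_fun f"
proof -
  have "foldr partial_deriv is f \<in> S" for "is"
    by (induction "is") (use assms in auto)
  then show ?thesis using assms(2) by (auto simp: smooth_fun_def)
qed

lemma smooth_fun_partial: "smooth_fun f \<Longrightarrow> smooth_fun (partial_deriv i f)"
proof -
  assume f: "smooth_fun f"
  have "foldr partial_deriv is (partial_deriv i f) = foldr partial_deriv (is @ [i]) f" for "is"
    by simp
  then show ?thesis using f by (simp add: smooth_fun_def del: foldr_append)
qed

lemma smooth_fun_differentiable: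
  assumes "smooth_fun f" shows "f differentiable (at x)"
proof -
  have "foldr partial_deriv [] f differentiable_on UNIV" using assms unfolding smooth_fun_def by blast
  then show ?thesis by (simp add: differentiable_on_def)
qed

lemma smooth_fun_has_derivative:
  "smooth_fun f \<Longrightarrow> (f has_derivative frechet_derivative f (at x)) (at x)"
  by (simp add: smooth_fun_differentiable frechet_derivative_works[symmetric])

lemma smooth_fun_continuous: "smooth_fun f \<Longrightarrow> continuous_on UNIV f"
  by (simp add: differentiable_imp_continuous_on differentiable_on_def smooth_fun_differentiable)

inductive_set smooth_alg :: "(real ^ 'd::finite \<Rightarrow> real) set" where
  smooth: "smooth_fun f \<Longrightarrow> f \<in> smooth_alg"
| ridge: "smooth1 h \<Longrightarrow> (\<lambda>x. h (a \<bullet> x)) \<in> smooth_alg"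
| add: "f \<in> smooth_alg \<Longrightarrow> g \<in> smooth_alg \<Longrightarrow> (\<lambda>x. f x + g x) \<in> smooth_alg"
| mult: "f \<in> smooth_alg \<Longrightarrow> g \<in> smooth_alg \<Longrightarrow> (\<lambda>x. f x * g x) \<in> smooth_alg"

lemma has_derivative_ridge:
  fixes a :: "real ^ 'd::finite"
  assumes "\<And>x. (h has_real_derivative h' x) (at x)"
  shows "((\<lambda>x. h (a \<bullet> x)) has_derivative (\<lambda>v. h' (a \<bullet> x) * (a \<bullet> v))) (at x)"
  using has_derivative_compose[where f="\<lambda>x. a \<bullet> x" and f'="\<lambda>x. a \<bullet> x" and g=h and g'="\<lambda>v. h' (a \<bullet> x) * v" and x=x and s=UNIV]
    assms[of "a \<bullet> x"]
  by (auto simp: has_field_derivative_def bounded_linear_inner_right bounded_linear_imp_has_derivative)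

lemma partial_deriv_ridge:
  assumes "\<And>x. (h has_real_derivative h' x) (at x)"
  shows "partial_deriv i (\<lambda>x. h (a \<bullet> x)) = (\<lambda>x. h' (a \<bullet> x) * a $ i)"
  using partial_derivI[OF has_derivative_ridge[OF assms]] by (auto simp: inner_axis)

lemma partial_deriv_add:
  assumes "f differentiable (at x)" "g differentiable (at x)"
  shows "partial_deriv i (\<lambda>x. f x + g x) x = partial_deriv i f x + partial_deriv i g x"
proof -
  from assms obtain f' g' where "(f has_derivative f') (at x)" "(g has_derivative g') (at x)"
    by (auto simp: differentiable_def)
  from partial_derivI[OF has_derivative_add[OF this]] partial_derivI[OF this(1)] partial_derivI[OF this(2)]
  show ?thesis by simp
qed

lemma partial_deriv_mult:
  assumes "f differentiable (at x)" "g differentiable (at x)"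
  shows "partial_deriv i (\<lambda>x. f x * g x) x = f x * partial_deriv i g x + partial_deriv i f x * g x"
proof -
  from assms obtain f' g' where "(f has_derivative f') (at x)" "(g has_derivative g') (at x)"
    by (auto simp: differentiable_def)
  from partial_derivI[OF has_derivative_mult[OF this]] partial_derivI[OF this(1)] partial_derivI[OF this(2)]
  show ?thesis by simp
qed

text \<open>By the rules for sums, products and ridge functions \<open>x \<mapsto> h (a \<bullet> x)\<close>, this algebra is closed
under partial derivatives.\<close>

lemma smooth_alg_step:
  "f \<in> smooth_alg \<Longrightarrow> (\<forall>x. f differentiable (at x)) \<and> (\<forall>i. partial_deriv i f \<in> smooth_alg)"
proof (induction rule: smooth_alg.induct)
  case (smooth f)
  then show ?case using smooth_fun_differentiable smooth_fun_partial smooth_alg.smooth by blast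
next
  case (ridge h a)
  then obtain h' where h': "\<And>x. (h has_real_derivative h' x) (at x)" "smooth1 h'"
    by (meson smooth1D)
  have "(\<lambda>x. h' (a \<bullet> x) * a $ i) \<in> smooth_alg" for i
    using smooth_alg.mult[OF smooth_alg.ridge[OF h'(2)] smooth_alg.ridge[OF smooth1_const]] .
  then have "partial_deriv i (\<lambda>x. h (a \<bullet> x)) \<in> smooth_alg" for i
    by (subst partial_deriv_ridge[where h=h and h'=h', OF h'(1)])
  then show ?case
    using has_derivative_ridge[where h=h and h'=h', OF h'(1)] by (auto simp: differentiable_def)
next
  case (add f g)
  then have "partial_deriv i (\<lambda>x. f x + g x) = (\<lambda>x. partial_deriv i f x + partial_deriv i g x)" for i
    by (auto simp: partial_deriv_add)
  with add show ?case by (auto intro: smooth_alg.add)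
next
  case (mult f g)
  then have "partial_deriv i (\<lambda>x. f x * g x) = (\<lambda>x. f x * partial_deriv i g x + partial_deriv i f x * g x)" for i
    by (auto simp: partial_deriv_mult)
  moreover have "(\<lambda>x. f x * partial_deriv i g x + partial_deriv i f x * g x) \<in> smooth_alg" for i
    by (rule smooth_alg.add; rule smooth_alg.mult) (use mult in auto)
  ultimately show ?case using mult by auto
qed

lemma smooth_alg_smooth: "f \<in> smooth_alg \<Longrightarrow> smooth_fun f"
  by (erule smooth_fun_coinduct) (auto simp: differentiable_on_def dest: smooth_alg_step)

lemma smooth_fun_add: "smooth_fun f \<Longrightarrow> smooth_fun g \<Longrightarrow> smooth_fun (\<lambda>x. f x + g x)"
  and smooth_fun_mult: "smooth_fun f \<Longrightarrow> smooth_fun g \<Longrightarrow> smooth_fun (\<lambda>x. f x * g x)"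
  and smooth_fun_ridge: "smooth1 h \<Longrightarrow> smooth_fun (\<lambda>x. h (a \<bullet> x))"
  by (simp_all add: smooth_alg_smooth smooth_alg.intros)

lemma smooth_fun_const: "smooth_fun (\<lambda>x. c)"
  by (rule smooth_fun_ridge[OF smooth1_const])

lemma smooth_fun_coord: "smooth1 h \<Longrightarrow> smooth_fun (\<lambda>x. h (x $ i))"
  using smooth_fun_ridge[of h "axis i 1"] by (simp add: inner_axis')

lemma smooth_fun_prod:
  "finite I \<Longrightarrow> (\<And>i. i \<in> I \<Longrightarrow> smooth_fun (f i)) \<Longrightarrow> smooth_fun (\<lambda>x. \<Prod>i\<in>I. f i x)"
  by (induction I rule: finite_induct) (auto intro: smooth_fun_const smooth_fun_mult)

lemma has_derivative_translate:
  fixes f :: "real ^ 'd::finite \<Rightarrow> real"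
  assumes "(f has_derivative f') (at (x + a))"
  shows "((\<lambda>x. f (x + a)) has_derivative f') (at x)"
proof -
  have "((\<lambda>x. x + a) has_derivative (\<lambda>v. v)) (at x)" by (auto intro!: derivative_eq_intros)
  from has_derivative_compose[OF this assms] show ?thesis by simp
qed

lemma partial_deriv_translate:
  fixes f :: "real ^ 'd::finite \<Rightarrow> real"
  assumes "\<And>x. f differentiable (at x)"
  shows "partial_deriv i (\<lambda>x. f (x + a)) = (\<lambda>x. partial_deriv i f (x + a))"
proof
  fix x
  obtain f' where f': "(f has_derivative f') (at (x + a))"
    using assms[of "x + a"] by (auto simp: differentiable_def)
  show "partial_deriv i (\<lambda>x. f (x + a)) x = partial_deriv i f (x + a)"
    using partial_derivI[OF f'] partial_derivI[OF has_derivative_translate[OF f']] by simp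
qed

lemma smooth_fun_translate:
  fixes f :: "real ^ 'd::finite \<Rightarrow> real"
  assumes "smooth_fun f" shows "smooth_fun (\<lambda>x. f (x + a))"
proof (rule smooth_fun_coinduct[of _ "{(\<lambda>x. g (x + a)) | g. smooth_fun g}"])
  fix g assume "g \<in> {(\<lambda>x. g (x + a)) | g::real ^ 'd \<Rightarrow> real. smooth_fun g}"
  then obtain h :: "real ^ 'd \<Rightarrow> real" where h: "g = (\<lambda>x. h (x + a))" "smooth_fun h" by auto
  show "g differentiable_on UNIV"
    unfolding differentiable_on_def h(1) differentiable_def
    using has_derivative_translate[OF smooth_fun_has_derivative[OF h(2)]] by blast
  show "partial_deriv i g \<in> {(\<lambda>x. g (x + a)) | g. smooth_fun g}" for i
    unfolding h(1) using partial_deriv_translate[OF smooth_fun_differentiable[OF h(2)]] smooth_fun_partial[OF h(2)]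
    by blast
qed (use assms in auto)

section \<open>Lebesgue measure on subsets of Euclidean space\<close>

lemma unit_cube_iff: "x \<in> unit_cube \<longleftrightarrow> (\<forall>i. 0 < x $ i \<and> x $ i < 1)"
  by (simp add: unit_cube_def mem_box_cart)

lemma open_unit_cube: "open unit_cube" by (simp add: unit_cube_def open_box)

lemma sets_unit_cube [measurable, simp]: "unit_cube \<in> sets borel" "unit_cube \<in> sets lebesgue"
  by (auto simp: unit_cube_def)

lemma emeasure_unit_cube: "emeasure lebesgue (unit_cube :: (real ^ 'd::finite) set) = 1"
proof -
  have "(\<chi> i. 1) \<bullet> b = (1::real)" if b: "b \<in> Basis" for b :: "real ^ 'd"
  proof -
    obtain i where "b = axis i 1" using b by (auto simp: Basis_vec_def)
    then show ?thesis by (simp add: inner_axis)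
  qed
  then have "emeasure lborel (box 0 (\<chi> i. 1) :: (real ^ 'd) set) = 1"
    by (subst emeasure_lborel_box) (auto intro!: prod.neutral)
  then show ?thesis by (simp add: unit_cube_def)
qed

lemma measure_unit_cube: "measure lebesgue unit_cube = 1"
  by (simp add: measure_def emeasure_unit_cube)

lemma finite_measure_unit_cube: "finite_measure (lebesgue_on unit_cube)"
  by (rule finite_measureI) (simp add: emeasure_restrict_space emeasure_unit_cube)

lemma continuous_measurable_lebesgue:
  "continuous_on UNIV f \<Longrightarrow> f \<in> borel_measurable lebesgue"
  by (intro measurable_completion) (simp add: borel_measurable_continuous_onI)

lemma measurable_lebesgue_onI:
  "f \<in> borel_measurable lebesgue \<Longrightarrow> f \<in> borel_measurable (lebesgue_on \<Omega>)"
  by (rule measurable_restrict_space1)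

lemma AE_lebesgue_on_iff:
  "\<Omega> \<in> sets lebesgue \<Longrightarrow> (AE x in lebesgue_on \<Omega>. P x) \<longleftrightarrow> (AE x in lebesgue. x \<in> \<Omega> \<longrightarrow> P x)"
  by (subst AE_restrict_space_iff) auto

lemma AE_lebesgue_on_subset:
  assumes "AE x in lebesgue_on \<Omega>. P x" "C \<subseteq> \<Omega>" "C \<in> sets lebesgue" "\<Omega> \<in> sets lebesgue"
  shows "AE x in lebesgue_on C. P x"
  using assms by (auto simp: AE_lebesgue_on_iff elim!: eventually_mono)

lemma measurable_lebesgue_on_AE:
  fixes f g :: "'a::euclidean_space \<Rightarrow> real"
  assumes \<Omega>: "\<Omega> \<in> sets lebesgue" and f: "f \<in> borel_measurable (lebesgue_on \<Omega>)"
    and eq: "AE x in lebesgue_on \<Omega>. f x = g x"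
  shows "g \<in> borel_measurable (lebesgue_on \<Omega>)"
proof -
  have "(\<lambda>x. if x \<in> \<Omega> then f x else 0) \<in> borel_measurable lebesgue"
    using f \<Omega> by (simp add: borel_measurable_if)
  moreover have "AE x in lebesgue. (if x \<in> \<Omega> then f x else 0) = (if x \<in> \<Omega> then g x else 0)"
    using eq \<Omega> by (auto simp: AE_lebesgue_on_iff elim!: eventually_mono)
  ultimately have "(\<lambda>x. if x \<in> \<Omega> then g x else 0) \<in> borel_measurable lebesgue"
    by (rule borel_measurable_AE)
  then show ?thesis using \<Omega> by (simp add: borel_measurable_if)
qed

lemma integrable_lebesgue_on_AE:
  fixes f g :: "'a::euclidean_space \<Rightarrow> real"
  assumes "\<Omega> \<in> sets lebesgue" "integrable (lebesgue_on \<Omega>) f" "AE x in lebesgue_on \<Omega>. f x = g x"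
  shows "integrable (lebesgue_on \<Omega>) g"
  using assms integrable_cong_AE_imp[OF assms(2) measurable_lebesgue_on_AE] by blast

lemma lebesgue_on_restrict:
  fixes f :: "'a::euclidean_space \<Rightarrow> real"
  assumes "\<Omega> \<in> sets lebesgue" "\<And>x. x \<notin> \<Omega> \<Longrightarrow> f x = 0"
  shows integral_lebesgue_on_restrict: "(LINT x|lebesgue_on \<Omega>. f x) = (LINT x|lebesgue. f x)"
    and integrable_lebesgue_on_restrict: "integrable (lebesgue_on \<Omega>) f \<longleftrightarrow> integrable lebesgue f"
proof -
  have "(\<lambda>x. indicator \<Omega> x *\<^sub>R f x) = f"
    using assms(2) by (auto simp: indicator_def fun_eq_iff)
  then show "(LINT x|lebesgue_on \<Omega>. f x) = (LINT x|lebesgue. f x)"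
    "integrable (lebesgue_on \<Omega>) f \<longleftrightarrow> integrable lebesgue f"
    using assms(1) by (simp_all add: integral_restrict_space integrable_restrict_space)
qed

lemma lebesgue_on_indicator:
  fixes f :: "'a::euclidean_space \<Rightarrow> real"
  assumes "\<Omega> \<in> sets lebesgue"
  shows integral_lebesgue_on_indicator: "(LINT x|lebesgue_on \<Omega>. f x) = (LINT x|lebesgue. indicator \<Omega> x * f x)"
    and integrable_lebesgue_on_indicator:
      "integrable (lebesgue_on \<Omega>) f \<longleftrightarrow> integrable lebesgue (\<lambda>x. indicator \<Omega> x * f x)"
  using assms by (simp_all add: integral_restrict_space integrable_restrict_space)

lemma lebesgue_translate:
  fixes a :: "'a::euclidean_space"
  shows measurable_lebesgue_translate: "(\<lambda>x. x + a) \<in> lebesgue \<rightarrow>\<^sub>M lebesgue"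
    and distr_lebesgue_translate: "distr lebesgue lebesgue (\<lambda>x. x + a) = lebesgue"
proof -
  have eq: "(\<lambda>x. a + (\<Sum>j\<in>Basis. (1 * (x \<bullet> j)) *\<^sub>R j)) = (\<lambda>x. x + a)"
    by (simp add: euclidean_representation add.commute)
  show "(\<lambda>x. x + a) \<in> lebesgue \<rightarrow>\<^sub>M lebesgue"
    using lebesgue_affine_measurable[of "\<lambda>_. 1" a] unfolding eq by simp
  show "distr lebesgue lebesgue (\<lambda>x. x + a) = lebesgue"
    using lebesgue_affine_euclidean[of "\<lambda>_. 1" a] unfolding eq by (simp add: density_1)
qed

lemma integrable_lebesgue_translate:
  fixes f :: "'a::euclidean_space \<Rightarrow> real"
  assumes "integrable lebesgue f" shows "integrable lebesgue (\<lambda>x. f (x + a))"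
  using integrable_distr[OF measurable_lebesgue_translate, of a f] assms
  by (simp add: distr_lebesgue_translate)

lemma integral_lebesgue_translate:
  fixes f :: "'a::euclidean_space \<Rightarrow> real"
  assumes "f \<in> borel_measurable lebesgue"
  shows "(LINT x|lebesgue. f (x + a)) = (LINT x|lebesgue. f x)"
  using integral_distr[OF measurable_lebesgue_translate assms, of a]
  by (simp add: distr_lebesgue_translate)

lemma sets_lebesgue_box [measurable, simp]: "box a b \<in> sets lebesgue" "cbox a b \<in> sets lebesgue"
  by (auto intro: sets_completionI_sets)

lemma indicator_box_measurable: "(indicator (box a b) :: _ \<Rightarrow> real) \<in> borel_measurable lebesgue"
  by (rule borel_measurable_indicator) simp

section \<open>Test functions and local integrability\<close>

lemma locally_integrable_AE:
  assumes "open \<Omega>" "locally_integrable \<Omega> f" "AE x in lebesgue_on \<Omega>. f x = g x"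
  shows "locally_integrable \<Omega> g"
  unfolding locally_integrable_def
proof (intro allI impI)
  fix C assume C: "compact C \<and> C \<subseteq> \<Omega>"
  then have CL: "C \<in> sets lebesgue" by (simp add: compact_imp_closed lmeasurable_compact fmeasurableD)
  show "integrable (lebesgue_on C) g"
    by (rule integrable_lebesgue_on_AE[OF CL, of f])
      (use C CL assms AE_lebesgue_on_subset[where \<Omega>=\<Omega> and C=C] in \<open>auto simp: locally_integrable_def\<close>)
qed

lemma locally_integrable_translate:
  fixes f :: "real ^ 'd::finite \<Rightarrow> real"
  assumes "locally_integrable \<Omega> f" "\<And>x. x \<in> \<Omega>' \<Longrightarrow> x + a \<in> \<Omega>"
  shows "locally_integrable \<Omega>' (\<lambda>x. f (x + a))"
  unfolding locally_integrable_def
proof (intro allI impI)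
  fix C assume C: "compact C \<and> C \<subseteq> \<Omega>'"
  let ?C = "(+) a ` C"
  have cC: "compact ?C" using C by (intro compact_translation) auto
  have CL: "C \<in> sets lebesgue" "?C \<in> sets lebesgue"
    using C cC by (simp_all add: compact_imp_closed lmeasurable_compact fmeasurableD)
  have "?C \<subseteq> \<Omega>" using C assms(2) by (auto simp: add.commute)
  then have "integrable lebesgue (\<lambda>x. indicator ?C x * f x)"
    using assms(1) cC CL by (simp add: locally_integrable_def flip: integrable_lebesgue_on_indicator)
  from integrable_lebesgue_translate[OF this, of a]
  have "integrable lebesgue (\<lambda>x. indicator C x * f (x + a))"
    by (rule back_subst[of "integrable lebesgue"]) (auto simp: indicator_def fun_eq_iff)
  then show "integrable (lebesgue_on C) (\<lambda>x. f (x + a))"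
    using CL by (simp add: integrable_lebesgue_on_indicator)
qed

lemma integrable_mult_bounded_measurable:
  fixes f g :: "'a \<Rightarrow> real"
  assumes "integrable M f" "g \<in> borel_measurable M" "\<And>x. x \<in> space M \<Longrightarrow> \<bar>g x\<bar> \<le> B"
  shows "integrable M (\<lambda>x. f x * g x)"
proof (rule Bochner_Integration.integrable_bound)
  show "integrable M (\<lambda>x. B * \<bar>f x\<bar>)" using assms(1) by simp
  show "(\<lambda>x. f x * g x) \<in> borel_measurable M" using assms by simp
  show "AE x in M. norm (f x * g x) \<le> norm (B * \<bar>f x\<bar>)"
  proof (rule AE_I2)
    fix x assume "x \<in> space M"
    then have "\<bar>g x\<bar> * \<bar>f x\<bar> \<le> B * \<bar>f x\<bar>" "0 \<le> B"
      using assms(3)[of x] by (auto intro: mult_right_mono)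
    then show "norm (f x * g x) \<le> norm (B * \<bar>f x\<bar>)" by (simp add: abs_mult mult.commute)
  qed
qed

lemma bounded_if_compact_support:
  fixes f :: "'a::euclidean_space \<Rightarrow> real"
  assumes "continuous_on UNIV f" "compact C" "\<And>x. x \<notin> C \<Longrightarrow> f x = 0"
  obtains B where "0 \<le> B" "\<And>x. \<bar>f x\<bar> \<le> B"
proof -
  have "compact (f ` C)" using assms continuous_on_subset by (blast intro: compact_continuous_image)
  then obtain B where B: "\<And>x. x \<in> C \<Longrightarrow> \<bar>f x\<bar> \<le> B"
    using compact_imp_bounded bounded_iff by (metis imageI real_norm_def)
  have "\<bar>f x\<bar> \<le> max B 0" for x by (cases "x \<in> C") (use B assms(3) in \<open>auto simp: le_max_iff_disj\<close>)
  then show ?thesis using that[of "max B 0"] by auto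
qed

lemma locally_integrable_mult:
  assumes g: "locally_integrable \<Omega> g" and C: "compact C" "C \<subseteq> \<Omega>"
    and \<eta>: "continuous_on UNIV \<eta>" "\<And>x. x \<notin> C \<Longrightarrow> \<eta> x = 0"
  shows "integrable lebesgue (\<lambda>x. g x * \<eta> x)"
proof -
  have CL: "C \<in> sets lebesgue" using C by (simp add: lmeasurable_compact fmeasurableD)
  obtain B where B: "\<And>x. \<bar>\<eta> x\<bar> \<le> B" using bounded_if_compact_support[OF \<eta>(1) C(1) \<eta>(2)] by auto
  have "integrable (lebesgue_on C) (\<lambda>x. g x * \<eta> x)"
    by (rule integrable_mult_bounded_measurable[where B=B])
      (use g C \<eta> B in \<open>auto simp: locally_integrable_def intro!: measurable_lebesgue_onI continuous_measurable_lebesgue\<close>)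
  then show ?thesis using \<eta>(2) CL by (subst (asm) integrable_lebesgue_on_restrict) auto
qed

lemma continuous_locally_integrable:
  fixes f :: "real ^ 'd::finite \<Rightarrow> real"
  assumes "continuous_on UNIV f" shows "locally_integrable \<Omega> f"
  unfolding locally_integrable_def
proof (intro allI impI)
  fix C assume C: "compact C \<and> C \<subseteq> \<Omega>"
  then have CL: "C \<in> lmeasurable" by (simp add: lmeasurable_compact)
  have "compact (f ` C)" using C assms continuous_on_subset by (blast intro: compact_continuous_image)
  then obtain B where B: "\<And>x. x \<in> C \<Longrightarrow> \<bar>f x\<bar> \<le> B"
    using compact_imp_bounded bounded_iff by (metis imageI real_norm_def)
  show "integrable (lebesgue_on C) f"
    by (rule finite_measure.integrable_const_bound[OF finite_measure_lebesgue_on[OF CL], where B=B])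
      (use B CL fmeasurableD assms in \<open>auto intro!: AE_I2 measurable_lebesgue_onI continuous_measurable_lebesgue simp: space_restrict_space\<close>)
qed

lemma partial_deriv_zero_outside:
  assumes "closed C" "\<And>x. x \<notin> C \<Longrightarrow> \<phi> x = 0" "x \<notin> C"
  shows "partial_deriv i \<phi> x = 0"
proof -
  have "((\<lambda>x. 0::real) has_derivative (\<lambda>v. 0)) (at x)" by simp
  then have "(\<phi> has_derivative (\<lambda>v. 0)) (at x)"
    by (rule has_derivative_transform_within_open[where s="-C"]) (use assms in auto)
  then show ?thesis by (simp add: partial_derivI)
qed

lemma test_funE:
  assumes "test_fun \<Omega> \<phi>"
  obtains C where "compact C" "C \<subseteq> \<Omega>" "\<And>x. x \<notin> C \<Longrightarrow> \<phi> x = 0"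
    "\<And>x i. x \<notin> C \<Longrightarrow> partial_deriv i \<phi> x = 0" "smooth_fun \<phi>"
proof -
  let ?C = "closure {x. \<phi> x \<noteq> 0}"
  have z: "\<phi> x = 0" if "x \<notin> ?C" for x using that closure_subset[of "{x. \<phi> x \<noteq> 0}"] by auto
  show ?thesis
  proof (rule that[of ?C])
    show "partial_deriv i \<phi> x = 0" if "x \<notin> ?C" for x i
      by (rule partial_deriv_zero_outside[OF closed_closure z that])
    show "\<phi> x = 0" if "x \<notin> ?C" for x by (rule z[OF that])
  qed (use assms in \<open>simp_all add: test_fun_def\<close>)
qed

lemma test_funI:
  assumes "smooth_fun \<phi>" "compact C" "C \<subseteq> \<Omega>" "\<And>x. x \<notin> C \<Longrightarrow> \<phi> x = 0"
  shows "test_fun \<Omega> \<phi>"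
proof -
  have "closure {x. \<phi> x \<noteq> 0} \<subseteq> C"
    using assms by (intro closure_minimal) (auto simp: compact_imp_closed)
  then show ?thesis using assms compact_closure
    by (auto simp: test_fun_def compact_eq_bounded_closed intro: bounded_subset)
qed

text \<open>A smooth function supported in the box that increases to its indicator, since
\<open>flat_exp (n t) \<rightarrow> 1\<close> for \<open>t > 0\<close>.\<close>

definition box_bump :: "nat \<Rightarrow> real ^ 'd::finite \<Rightarrow> real ^ 'd \<Rightarrow> real ^ 'd \<Rightarrow> real" where
  "box_bump n a b x = (\<Prod>i\<in>UNIV. flat_exp (real n * (x $ i - a $ i)) * flat_exp (real n * (b $ i - x $ i)))"

lemma box_bump_bounds: "0 \<le> box_bump n a b x" "box_bump n a b x \<le> 1"
  unfolding box_bump_def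
  by (rule prod_nonneg, simp add: flat_exp_bounds)
    (rule prod_le_1, simp add: flat_exp_bounds mult_le_one)

lemma smooth_box_bump: "smooth_fun (box_bump n a b)"
proof -
  have "smooth_fun (\<lambda>x. flat_exp (real n * (x $ i - a $ i)) * flat_exp (real n * (b $ i - x $ i)))" for i
  proof (rule smooth_fun_coord)
    have "smooth1 (\<lambda>t. flat_exp (real n * t + (- (real n * a $ i))) * flat_exp (- real n * t + real n * b $ i))"
      by (intro smooth1_mult smooth1_affine smooth1_flat_exp)
    moreover have "real n * t + (- (real n * a $ i)) = real n * (t - a $ i)"
      "- real n * t + real n * b $ i = real n * (b $ i - t)" for t by (simp_all add: algebra_simps)
    ultimately show "smooth1 (\<lambda>t. flat_exp (real n * (t - a $ i)) * flat_exp (real n * (b $ i - t)))"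
      by (simp only:)
  qed
  then have "smooth_fun (\<lambda>x. \<Prod>i\<in>UNIV. flat_exp (real n * (x $ i - a $ i)) * flat_exp (real n * (b $ i - x $ i)))"
    by (intro smooth_fun_prod) auto
  then show ?thesis by (simp only: box_bump_def[abs_def])
qed

lemma test_fun_box_bump:
  assumes "cbox a b \<subseteq> \<Omega>" shows "test_fun \<Omega> (box_bump n a b)"
proof (rule test_funI[OF smooth_box_bump compact_cbox assms])
  fix x assume "x \<notin> cbox a b"
  then obtain i where "x $ i < a $ i \<or> b $ i < x $ i" by (auto simp: mem_box_cart not_le)
  then have "flat_exp (real n * (x $ i - a $ i)) * flat_exp (real n * (b $ i - x $ i)) = 0"
    by (auto simp: flat_exp_def zero_less_mult_iff)
  then show "box_bump n a b x = 0" unfolding box_bump_def by (intro prod_zero) auto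
qed

lemma box_bump_tendsto: "(\<lambda>n. box_bump n a b x) \<longlonglongrightarrow> indicator (box a b) x"
proof (cases "x \<in> box a b")
  case True
  have "(\<lambda>n. box_bump n a b x) \<longlonglongrightarrow> (\<Prod>i::'a\<in>UNIV. 1 * 1)"
    unfolding box_bump_def
    by (intro tendsto_prod tendsto_mult flat_exp_tendsto_1) (use True in \<open>auto simp: mem_box_cart\<close>)
  with True show ?thesis by simp
next
  case False
  then obtain i where "x $ i \<le> a $ i \<or> b $ i \<le> x $ i" by (auto simp: mem_box_cart not_less)
  then have "flat_exp (real n * (x $ i - a $ i)) * flat_exp (real n * (b $ i - x $ i)) = 0" for n
    by (auto simp: flat_exp_def zero_less_mult_iff)
  then have "box_bump n a b x = 0" for n unfolding box_bump_def by (intro prod_zero) auto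
  with False show ?thesis by simp
qed

text \<open>Boxes form a generator of the Borel sets that is stable under
intersection, so on each box inside \<open>\<Omega>\<close> all set integrals of \<open>f\<close> vanish; countably many such boxes
cover \<open>\<Omega>\<close>.\<close>

lemma AE_zero_if_box_integrals_zero:
  fixes f :: "real ^ 'd::finite \<Rightarrow> real"
  assumes \<Omega>: "open \<Omega>" and f: "locally_integrable \<Omega> f"
    and zero: "\<And>a b. cbox a b \<subseteq> \<Omega> \<Longrightarrow> (LINT x|lebesgue. indicator (box a b) x * f x) = 0"
  shows "AE x in lebesgue_on \<Omega>. f x = 0"
proof -
  have box: "AE x in lebesgue. x \<in> box a b \<longrightarrow> f x = 0" if ab: "cbox a b \<subseteq> \<Omega>" for a b
  proof -
    define F where "F x = indicator (box a b) x * f x" for x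
    have "integrable (lebesgue_on (cbox a b)) f" using f ab by (auto simp: locally_integrable_def)
    then have "integrable lebesgue (\<lambda>x. indicator (cbox a b) x * f x)"
      by (simp add: integrable_lebesgue_on_indicator)
    then have "integrable lebesgue (\<lambda>x. (indicator (cbox a b) x * f x) * indicator (box a b) x)"
      by (rule integrable_mult_bounded_measurable[where B=1]) (auto simp: indicator_le_1 intro: indicator_box_measurable)
    then have iF: "integrable lebesgue F"
      by (rule back_subst[of "integrable lebesgue"])
        (use box_subset_cbox[of a b] in \<open>auto simp: F_def indicator_def fun_eq_iff\<close>)
    then obtain F' where F': "F' \<in> borel_measurable lborel" and eqF: "AE x in lborel. F x = F' x"
      using completion_ex_borel_measurable_real[of F lborel] by auto
    have eqF_leb: "AE x in lebesgue. F x = F' x" using eqF by (rule AE_completion)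
    have iF': "integrable lborel F'"
    proof -
      have "integrable lebesgue F'"
        by (rule integrable_cong_AE_imp[OF iF measurable_completion[OF F'] eqF_leb])
      then show ?thesis using F' by (simp add: integrable_completion)
    qed
    have tr: "(LINT x|lborel. indicator X x * F' x) = (LINT x|lebesgue. indicator X x * F x)"
      if X: "X \<in> sets borel" for X
    proof -
      have m: "(\<lambda>x. indicator X x * F' x) \<in> borel_measurable lborel"
        using X F' by simp
      have mX: "(indicator X :: _ \<Rightarrow> real) \<in> borel_measurable lebesgue"
        using X by (intro borel_measurable_indicator) auto
      have "(LINT x|lborel. indicator X x * F' x) = (LINT x|lebesgue. indicator X x * F' x)"
        using integral_completion[OF m] by simp
      also have "\<dots> = (LINT x|lebesgue. indicator X x * F x)"
        by (rule integral_cong_AE)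
          (use eqF_leb borel_measurable_times[OF mX borel_measurable_integrable[OF iF]] measurable_completion[OF m]
            in \<open>auto elim!: eventually_mono\<close>)
      finally show ?thesis .
    qed
    have zero_box: "(LINT x|lborel. indicator (box c d) x * F' x) = 0" for c d
    proof -
      obtain c' d' where cd: "box c d \<inter> box a b = box c' d'" "cbox c' d' \<subseteq> cbox a b"
      proof
        show "box c d \<inter> box a b = box (\<chi> i. max (c $ i) (a $ i)) (\<chi> i. min (d $ i) (b $ i))"
          by (auto simp: mem_box_cart)
        show "cbox (\<chi> i. max (c $ i) (a $ i)) (\<chi> i. min (d $ i) (b $ i)) \<subseteq> cbox a b"
          by (auto simp: mem_box_cart)
      qed
      have "(LINT x|lborel. indicator (box c d) x * F' x) = (LINT x|lebesgue. indicator (box c d) x * F x)"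
        by (rule tr) auto
      also have "\<dots> = (LINT x|lebesgue. indicator (box c' d') x * f x)"
        unfolding F_def cd(1)[symmetric] by (simp add: indicator_inter_arith mult.assoc)
      also have "\<dots> = 0" using zero[of c' d'] cd ab by auto
      finally show ?thesis .
    qed
    have zero_all: "(LINT x|lborel. F' x) = 0"
    proof -
      let ?B = "\<lambda>n. box (\<chi> i. - real n) (\<chi> i. real n) :: (real ^ 'd) set"
      have "(\<lambda>n. LINT x|lborel. indicator (?B n) x * F' x) \<longlonglongrightarrow> (LINT x|lborel. F' x)"
      proof (rule integral_dominated_convergence)
        show "integrable lborel (\<lambda>x. \<bar>F' x\<bar>)" using iF' by simp
        show "AE x in lborel. (\<lambda>n. indicator (?B n) x * F' x) \<longlonglongrightarrow> F' x"
        proof (rule AE_I2)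
          fix x :: "real ^ 'd"
          have "\<forall>\<^sub>F n in sequentially. indicator (?B n) x * F' x = F' x"
            using eventually_gt_at_top[of "nat \<lceil>norm x\<rceil>"]
          proof eventually_elim
            case (elim n)
            have "\<bar>x $ i\<bar> < real n" for i
              using component_le_norm_cart[of x i] elim by linarith
            then have "x \<in> ?B n" by (simp add: mem_box_cart abs_less_iff) (smt (verit))
            then show ?case by simp
          qed
          then show "(\<lambda>n. indicator (?B n) x * F' x) \<longlonglongrightarrow> F' x" by (rule tendsto_eventually)
        qed
        show "(\<lambda>x. indicator (?B n) x * F' x) \<in> borel_measurable lborel" for n
          using F' by simp
        show "AE x in lborel. norm (indicator (?B n) x * F' x) \<le> \<bar>F' x\<bar>" for n
          by (intro AE_I2) (simp add: indicator_def)
      qed (fact F')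
      then show ?thesis by (simp add: zero_box LIMSEQ_const_iff)
    qed
    \<comment> \<open>The sets with vanishing integral form a Dynkin system, and the boxes generate the Borel sets.\<close>
    have zero_sets: "(LINT x|lborel. indicator X x * F' x) = 0" if "X \<in> sets borel" for X
    proof -
      let ?E = "range (\<lambda>(a, b). box a b) :: (real ^ 'd) set set"
      have sb: "sets (borel :: (real ^ 'd) measure) = sigma_sets UNIV ?E"
        by (subst borel_eq_box) (simp add: sets_measure_of)
      have st: "Int_stable ?E"
      proof (rule Int_stableI)
        fix X Y assume "X \<in> ?E" "Y \<in> ?E"
        then obtain a b c d where XY: "X = box a b" "Y = box c d" by auto
        have "X \<inter> Y = box (\<chi> i. max (c $ i) (a $ i)) (\<chi> i. min (d $ i) (b $ i))"
          unfolding XY by (auto simp: mem_box_cart)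
        then show "X \<inter> Y \<in> ?E" by auto
      qed
      have "X \<in> sigma_sets UNIV ?E" using that sb by simp
      with st show ?thesis
      proof (induct rule: sigma_sets_induct_disjoint[OF _ subset_UNIV[of ?E, folded Pow_UNIV], consumes 2, case_names basic empty compl union])
        case (basic A) then show ?case using zero_box by auto
      next
        case empty then show ?case by simp
      next
        case (compl A)
        then have A: "A \<in> sets borel" using sb by simp
        have "integrable lborel (\<lambda>x. indicator A x * F' x)"
          using integrable_mult_bounded_measurable[OF iF', of "indicator A" 1] A
          by (auto simp: indicator_def mult.commute)
        then have "(LINT x|lborel. F' x - indicator A x * F' x) = 0"
          using iF' zero_all compl by simp
        moreover have "(\<lambda>x. F' x - indicator A x * F' x) = (\<lambda>x. indicator (UNIV - A) x * F' x)"
          by (auto simp: indicator_def fun_eq_iff)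
        ultimately show ?case by simp
      next
        case (union A)
        then have A: "A n \<in> sets borel" for n using sb by auto
        have "set_lebesgue_integral lborel (\<Union>i. A i) F' = (\<Sum>i. set_lebesgue_integral lborel (A i) F')"
        proof (rule lebesgue_integral_countable_add)
          show "set_integrable lborel (\<Union>i. A i) F'"
            unfolding set_integrable_def
            using integrable_mult_bounded_measurable[OF iF', of "indicator (\<Union>i. A i)" 1] A
            by (auto simp: indicator_def mult.commute)
        qed (use A union in \<open>auto simp: disjoint_family_on_def\<close>)
        then show ?case using union by (simp add: set_lebesgue_integral_def)
      qed
    qed
    have "AE x in lborel. F' x = 0"
      by (rule sigma_finite_measure.density_zero[OF sigma_finite_lborel iF']) (use zero_sets in \<open>auto simp: set_lebesgue_integral_def\<close>)
    then have "AE x in lebesgue. F' x = 0" by (rule AE_completion)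
    with eqF_leb show ?thesis by eventually_elim (auto simp: F_def indicator_def split: if_splits)
  qed
  \<comment> \<open>Countably many closed boxes cover the open set, and the boundary of each is a null set.\<close>
  obtain \<D> where \<D>: "countable \<D>" "\<D> \<subseteq> Pow \<Omega>" "\<And>X. X \<in> \<D> \<Longrightarrow> \<exists>a b. X = cbox a b" "\<Union>\<D> = \<Omega>"
    using open_countable_Union_open_cbox[OF \<Omega>] by metis
  have "AE x in lebesgue. \<forall>X\<in>\<D>. x \<in> X \<longrightarrow> f x = 0"
  proof (rule AE_ball_countable')
    fix X assume X: "X \<in> \<D>"
    then obtain a b where ab: "X = cbox a b" "cbox a b \<subseteq> \<Omega>" using \<D> by blast
    have "AE x in lebesgue. x \<notin> cbox a b - box a b"
      by (rule AE_not_in) (use negligible_frontier_interval[of a b] in \<open>simp only: negligible_iff_null_sets\<close>)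
    with box[OF ab(2)] show "AE x in lebesgue. x \<in> X \<longrightarrow> f x = 0"
      unfolding ab(1) by eventually_elim auto
  qed (use \<D> in auto)
  then have "AE x in lebesgue. x \<in> \<Omega> \<longrightarrow> f x = 0"
    by eventually_elim (use \<D>(4) in blast)
  then show ?thesis using \<Omega> by (simp add: AE_lebesgue_on_iff)
qed

text \<open>The fundamental lemma of the calculus of variations: the indicator of a
box is a bounded limit of test functions.\<close>

lemma AE_zero_if_orthogonal_to_test_fun:
  fixes g :: "real ^ 'd::finite \<Rightarrow> real"
  assumes \<Omega>: "open \<Omega>" and g: "locally_integrable \<Omega> g"
    and zero: "\<And>\<phi>. test_fun \<Omega> \<phi> \<Longrightarrow> (LINT x|lebesgue. g x * \<phi> x) = 0"
  shows "AE x in lebesgue_on \<Omega>. g x = 0"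
proof (rule AE_zero_if_box_integrals_zero[OF \<Omega> g])
  fix a b assume ab: "cbox a b \<subseteq> \<Omega>"
  have "integrable (lebesgue_on (cbox a b)) g" using g ab by (auto simp: locally_integrable_def)
  then have i: "integrable lebesgue (\<lambda>x. indicator (cbox a b) x * g x)"
    by (simp add: integrable_lebesgue_on_indicator)
  have bm: "box_bump n a b \<in> borel_measurable lebesgue" for n
    by (intro continuous_measurable_lebesgue smooth_fun_continuous smooth_box_bump)
  have eq: "g x * box_bump n a b x = (indicator (cbox a b) x * g x) * box_bump n a b x" for n x
  proof (cases "x \<in> cbox a b")
    case False
    with test_fun_box_bump[OF order_refl, of a b n] have "box_bump n a b x = 0"
      by (auto elim!: test_funE)
    then show ?thesis by simp
  qed simp
  have "(\<lambda>n. LINT x|lebesgue. (indicator (cbox a b) x * g x) * box_bump n a b x) \<longlonglongrightarrow>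
     (LINT x|lebesgue. (indicator (cbox a b) x * g x) * indicator (box a b) x)"
  proof (rule integral_dominated_convergence)
    show "integrable lebesgue (\<lambda>x. \<bar>indicator (cbox a b) x * g x\<bar>)" using i by (rule integrable_abs)
    show "AE x in lebesgue. (\<lambda>n. (indicator (cbox a b) x * g x) * box_bump n a b x) \<longlonglongrightarrow>
       (indicator (cbox a b) x * g x) * indicator (box a b) x"
      by (intro AE_I2 tendsto_mult tendsto_const box_bump_tendsto)
    show "AE x in lebesgue. norm ((indicator (cbox a b) x * g x) * box_bump n a b x) \<le> \<bar>indicator (cbox a b) x * g x\<bar>" for n
      using box_bump_bounds[of n a b] by (intro AE_I2) (simp add: abs_mult mult_left_le)
    show "(\<lambda>x. (indicator (cbox a b) x * g x) * box_bump n a b x) \<in> borel_measurable lebesgue" for n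
      using borel_measurable_integrable[OF i] bm by (rule borel_measurable_times)
    show "(\<lambda>x. (indicator (cbox a b) x * g x) * indicator (box a b) x) \<in> borel_measurable lebesgue"
      using borel_measurable_integrable[OF i] indicator_box_measurable by (rule borel_measurable_times)
  qed
  moreover have "(LINT x|lebesgue. (indicator (cbox a b) x * g x) * box_bump n a b x) = 0" for n
    unfolding eq[symmetric] by (rule zero[OF test_fun_box_bump[OF ab]])
  ultimately have "(LINT x|lebesgue. (indicator (cbox a b) x * g x) * indicator (box a b) x) = 0"
    by (simp add: LIMSEQ_const_iff)
  moreover have "(\<lambda>x. (indicator (cbox a b) x * g x) * indicator (box a b) x) = (\<lambda>x. indicator (box a b) x * g x)"
    using box_subset_cbox[of a b] by (auto simp: indicator_def fun_eq_iff)
  ultimately show "(LINT x|lebesgue. indicator (box a b) x * g x) = 0" by simp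
qed

section \<open>Weak derivatives\<close>

lemma weak_pderivD:
  assumes w: "weak_pderiv \<Omega> i u g" and \<phi>: "test_fun \<Omega> \<phi>" and \<Omega>: "\<Omega> \<in> sets lebesgue"
  shows "(LINT x|lebesgue. u x * partial_deriv i \<phi> x) = - (LINT x|lebesgue. g x * \<phi> x)"
proof -
  obtain C where "C \<subseteq> \<Omega>" "\<And>x. x \<notin> C \<Longrightarrow> \<phi> x = 0" "\<And>x. x \<notin> C \<Longrightarrow> partial_deriv i \<phi> x = 0"
    using test_funE[OF \<phi>] by metis
  then have "x \<notin> \<Omega> \<Longrightarrow> u x * partial_deriv i \<phi> x = 0" "x \<notin> \<Omega> \<Longrightarrow> g x * \<phi> x = 0" for x by auto
  then show ?thesis
    using w \<phi> \<Omega> by (simp add: weak_pderiv_def flip: integral_lebesgue_on_restrict[OF \<Omega>])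
qed

lemma weak_pderivI:
  assumes \<Omega>: "\<Omega> \<in> sets lebesgue" and "locally_integrable \<Omega> u" "locally_integrable \<Omega> g"
    and *: "\<And>\<phi>. test_fun \<Omega> \<phi> \<Longrightarrow> (LINT x|lebesgue. u x * partial_deriv i \<phi> x) = - (LINT x|lebesgue. g x * \<phi> x)"
  shows "weak_pderiv \<Omega> i u g"
proof -
  have "(LINT x|lebesgue_on \<Omega>. u x * partial_deriv i \<phi> x) = - (LINT x|lebesgue_on \<Omega>. g x * \<phi> x)"
    if \<phi>: "test_fun \<Omega> \<phi>" for \<phi>
  proof -
    obtain C where "C \<subseteq> \<Omega>" "\<And>x. x \<notin> C \<Longrightarrow> \<phi> x = 0" "\<And>x. x \<notin> C \<Longrightarrow> partial_deriv i \<phi> x = 0"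
      using test_funE[OF \<phi>] by metis
    then have "x \<notin> \<Omega> \<Longrightarrow> u x * partial_deriv i \<phi> x = 0" "x \<notin> \<Omega> \<Longrightarrow> g x * \<phi> x = 0" for x by auto
    then show ?thesis using *[OF \<phi>] by (simp add: integral_lebesgue_on_restrict[OF \<Omega>])
  qed
  then show ?thesis using assms by (simp add: weak_pderiv_def)
qed

lemma continuous_partial_deriv: "smooth_fun \<phi> \<Longrightarrow> continuous_on UNIV (partial_deriv i \<phi>)"
  by (simp add: smooth_fun_continuous smooth_fun_partial)

lemma weak_pderiv_unique:
  fixes u :: "real ^ 'd::finite \<Rightarrow> real"
  assumes \<Omega>: "open \<Omega>" and w: "weak_pderiv \<Omega> i u g" "weak_pderiv \<Omega> i u g'"
  shows "AE x in lebesgue_on \<Omega>. g x = g' x"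
proof -
  have \<Omega>s: "\<Omega> \<in> sets lebesgue" using \<Omega> by simp
  have li: "locally_integrable \<Omega> g" "locally_integrable \<Omega> g'" using w by (auto simp: weak_pderiv_def)
  have "AE x in lebesgue_on \<Omega>. g x - g' x = 0"
  proof (rule AE_zero_if_orthogonal_to_test_fun[OF \<Omega>])
    show "locally_integrable \<Omega> (\<lambda>x. g x - g' x)" using li by (auto simp: locally_integrable_def)
    fix \<phi> assume \<phi>: "test_fun \<Omega> \<phi>"
    obtain C where C: "compact C" "C \<subseteq> \<Omega>" "\<And>x. x \<notin> C \<Longrightarrow> \<phi> x = 0" "smooth_fun \<phi>"
      using test_funE[OF \<phi>] by metis
    have "integrable lebesgue (\<lambda>x. g x * \<phi> x)" "integrable lebesgue (\<lambda>x. g' x * \<phi> x)"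
      using locally_integrable_mult[OF _ C(1,2) smooth_fun_continuous[OF C(4)] C(3)] li by auto
    then show "(LINT x|lebesgue. (g x - g' x) * \<phi> x) = 0"
      using weak_pderivD[OF w(1) \<phi> \<Omega>s] weak_pderivD[OF w(2) \<phi> \<Omega>s] by (simp add: left_diff_distrib)
  qed
  then show ?thesis by simp
qed

lemma integral_mult_AE_cong:
  fixes u u' :: "'a::euclidean_space \<Rightarrow> real"
  assumes "AE x in lebesgue_on \<Omega>. u x = u' x" "\<Omega> \<in> sets lebesgue" "\<And>x. x \<notin> \<Omega> \<Longrightarrow> \<eta> x = 0"
    and "integrable lebesgue (\<lambda>x. u x * \<eta> x)"
  shows "(LINT x|lebesgue. u x * \<eta> x) = (LINT x|lebesgue. u' x * \<eta> x)"
proof -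
  have eq: "AE x in lebesgue. u x * \<eta> x = u' x * \<eta> x"
  proof -
    have "AE x in lebesgue. x \<in> \<Omega> \<longrightarrow> u x = u' x" using assms by (simp add: AE_lebesgue_on_iff)
    then show ?thesis by eventually_elim (use assms(3) in \<open>metis mult_zero_right\<close>)
  qed
  have m: "(\<lambda>x. u x * \<eta> x) \<in> borel_measurable lebesgue" using assms(4) by simp
  show ?thesis by (rule integral_cong_AE[OF m borel_measurable_AE[OF m eq] eq])
qed

lemma weak_pderiv_AE_cong:
  fixes u :: "real ^ 'd::finite \<Rightarrow> real"
  assumes \<Omega>: "open \<Omega>" and w: "weak_pderiv \<Omega> i u g"
    and eq: "AE x in lebesgue_on \<Omega>. u x = u' x" "AE x in lebesgue_on \<Omega>. g x = g' x"
  shows "weak_pderiv \<Omega> i u' g'"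
proof -
  have \<Omega>s: "\<Omega> \<in> sets lebesgue" using \<Omega> by simp
  have li: "locally_integrable \<Omega> u" "locally_integrable \<Omega> g" using w by (auto simp: weak_pderiv_def)
  show ?thesis
  proof (rule weak_pderivI[OF \<Omega>s])
    show "locally_integrable \<Omega> u'" "locally_integrable \<Omega> g'"
      using locally_integrable_AE[OF \<Omega>] li eq by auto
    fix \<phi> assume \<phi>: "test_fun \<Omega> \<phi>"
    obtain C where C: "compact C" "C \<subseteq> \<Omega>" "\<And>x. x \<notin> C \<Longrightarrow> \<phi> x = 0" "smooth_fun \<phi>"
        "\<And>x. x \<notin> C \<Longrightarrow> partial_deriv i \<phi> x = 0"
      using test_funE[OF \<phi>] by metis
    have "integrable lebesgue (\<lambda>x. g x * \<phi> x)"
      by (rule locally_integrable_mult[OF li(2) C(1,2) smooth_fun_continuous[OF C(4)] C(3)])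
    then have "(LINT x|lebesgue. g x * \<phi> x) = (LINT x|lebesgue. g' x * \<phi> x)"
      by (intro integral_mult_AE_cong[OF eq(2) \<Omega>s]) (use C in auto)
    moreover have "integrable lebesgue (\<lambda>x. u x * partial_deriv i \<phi> x)"
      by (rule locally_integrable_mult[OF li(1) C(1,2) continuous_partial_deriv[OF C(4)] C(5)])
    then have "(LINT x|lebesgue. u x * partial_deriv i \<phi> x) = (LINT x|lebesgue. u' x * partial_deriv i \<phi> x)"
      by (intro integral_mult_AE_cong[OF eq(1) \<Omega>s]) (use C in auto)
    ultimately show "(LINT x|lebesgue. u' x * partial_deriv i \<phi> x) = - (LINT x|lebesgue. g' x * \<phi> x)"
      using weak_pderivD[OF w \<phi> \<Omega>s] by simp
  qed
qed

lemma weak_pderiv_wpd: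
  fixes u :: "real ^ 'd::finite \<Rightarrow> real"
  assumes "weak_pderiv \<Omega> i u g" shows "weak_pderiv \<Omega> i u (wpd \<Omega> i u)"
  unfolding wpd_def by (rule someI[of "weak_pderiv \<Omega> i u", OF assms])

lemma wpd_AE_eq:
  fixes u :: "real ^ 'd::finite \<Rightarrow> real"
  assumes "open \<Omega>" "weak_pderiv \<Omega> i u g" shows "AE x in lebesgue_on \<Omega>. wpd \<Omega> i u x = g x"
  by (rule weak_pderiv_unique[OF assms(1) weak_pderiv_wpd[OF assms(2)] assms(2)])

lemma test_fun_translate:
  assumes "test_fun \<Omega> \<phi>" "\<And>x. x \<in> \<Omega> \<Longrightarrow> x + a \<in> \<Omega>'"
  shows "test_fun \<Omega>' (\<lambda>x. \<phi> (x - a))"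
proof -
  obtain C where C: "compact C" "C \<subseteq> \<Omega>" "\<And>x. x \<notin> C \<Longrightarrow> \<phi> x = 0" "smooth_fun \<phi>"
    using test_funE[OF assms(1)] by metis
  show ?thesis
  proof (rule test_funI)
    show "smooth_fun (\<lambda>x. \<phi> (x - a))" using smooth_fun_translate[OF C(4), of "- a"] by simp
    show "compact ((+) a ` C)" using C(1) by (rule compact_translation)
    show "(+) a ` C \<subseteq> \<Omega>'" using C(2) assms(2) by (auto simp: add.commute)
    show "\<phi> (x - a) = 0" if "x \<notin> (+) a ` C" for x
      by (rule C(3)) (use that in \<open>auto simp: image_iff algebra_simps\<close>)
  qed
qed

text \<open>Test functions on \<open>\<Omega>\<close> translate to test functions on \<open>\<Omega>'\<close>, and Lebesgue measure is
translation invariant. Periodicity of weak derivatives is derived from this.\<close>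

lemma weak_pderiv_translate:
  fixes u :: "real ^ 'd::finite \<Rightarrow> real"
  assumes w: "weak_pderiv \<Omega>' i u g" and \<Omega>: "open \<Omega>" "open \<Omega>'"
    and sub: "\<And>x. x \<in> \<Omega> \<Longrightarrow> x + a \<in> \<Omega>'"
  shows "weak_pderiv \<Omega> i (\<lambda>x. u (x + a)) (\<lambda>x. g (x + a))"
proof (rule weak_pderivI)
  have li: "locally_integrable \<Omega>' u" "locally_integrable \<Omega>' g" using w by (auto simp: weak_pderiv_def)
  then show "locally_integrable \<Omega> (\<lambda>x. u (x + a))" "locally_integrable \<Omega> (\<lambda>x. g (x + a))"
    using locally_integrable_translate sub by blast+
  show "\<Omega> \<in> sets lebesgue" using \<Omega> by simp
  fix \<phi> assume "test_fun \<Omega> \<phi>"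
  then have \<phi>': "test_fun \<Omega>' (\<lambda>x. \<phi> (x - a))" (is "test_fun _ ?\<psi>") and sm: "smooth_fun \<phi>"
    using test_fun_translate[OF _ sub] by (auto simp: test_fun_def)
  obtain C where C: "compact C" "C \<subseteq> \<Omega>'" "\<And>x. x \<notin> C \<Longrightarrow> ?\<psi> x = 0" "smooth_fun ?\<psi>"
      "\<And>x. x \<notin> C \<Longrightarrow> partial_deriv i ?\<psi> x = 0"
    using test_funE[OF \<phi>'] by metis
  have pd: "partial_deriv i ?\<psi> = (\<lambda>x. partial_deriv i \<phi> (x - a))"
    using partial_deriv_translate[OF smooth_fun_differentiable[OF sm], of i "- a"] by simp
  have "(LINT x|lebesgue. u x * partial_deriv i ?\<psi> x) = (LINT x|lebesgue. u (x + a) * partial_deriv i ?\<psi> (x + a))"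
    by (rule integral_lebesgue_translate[symmetric]
        borel_measurable_integrable locally_integrable_mult[OF li(1) C(1,2) continuous_partial_deriv[OF C(4)] C(5)])+
  moreover have "(LINT x|lebesgue. g x * ?\<psi> x) = (LINT x|lebesgue. g (x + a) * ?\<psi> (x + a))"
    by (rule integral_lebesgue_translate[symmetric]
        borel_measurable_integrable locally_integrable_mult[OF li(2) C(1,2) smooth_fun_continuous[OF C(4)] C(3)])+
  ultimately show "(LINT x|lebesgue. u (x + a) * partial_deriv i \<phi> x) = - (LINT x|lebesgue. g (x + a) * \<phi> x)"
    using weak_pderivD[OF w \<phi>'] \<Omega> by (simp add: pd)
qed

lemma DERIV_along_axis:
  assumes "smooth_fun \<psi>"
  shows "((\<lambda>t. \<psi> (x + t *\<^sub>R axis i 1)) has_real_derivative partial_deriv i \<psi> (x + t *\<^sub>R axis i 1)) (at t)"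
proof -
  let ?D = "frechet_derivative \<psi> (at (x + t *\<^sub>R axis i 1))"
  have D: "(\<psi> has_derivative ?D) (at (x + t *\<^sub>R axis i 1))"
    by (rule smooth_fun_has_derivative[OF assms])
  have "((\<lambda>t. x + t *\<^sub>R axis i 1) has_derivative (\<lambda>h. h *\<^sub>R axis i 1)) (at t)"
    by (auto intro!: derivative_eq_intros)
  from has_derivative_compose[OF this D]
  have "((\<lambda>t. \<psi> (x + t *\<^sub>R axis i 1)) has_derivative (\<lambda>h. ?D (h *\<^sub>R axis i 1))) (at t)" .
  moreover have "?D (h *\<^sub>R axis i 1) = partial_deriv i \<psi> (x + t *\<^sub>R axis i 1) * h" for h
    using linear_scale[OF has_derivative_linear[OF D], of h "axis i 1"]
    by (simp add: partial_deriv_def)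
  ultimately show ?thesis by (simp add: has_field_derivative_def)
qed

text \<open>The difference quotients of a smooth compactly supported function converge
boundedly to its partial derivative, by the mean value theorem, and vanish outside a fixed compact set,
so dominated convergence applies. This is used both for integration by parts, with \<open>u\<close> constant, and
for estimating the total variation of a bounded \<open>u\<close>.\<close>

lemma diff_quotient_integral_tendsto:
  fixes u \<psi> :: "real ^ 'd::finite \<Rightarrow> real"
  assumes sm: "smooth_fun \<psi>" and C: "compact C" "\<And>x. x \<notin> C \<Longrightarrow> \<psi> x = 0"
    and u: "u \<in> borel_measurable lebesgue" "\<And>x. \<bar>u x\<bar> \<le> B"
    and s: "s \<longlonglongrightarrow> 0" "\<And>n. s n \<noteq> 0" "\<And>n. \<bar>s n\<bar> \<le> 1"
  shows "(\<lambda>n. LINT x|lebesgue. u x * ((\<psi> (x + s n *\<^sub>R axis i 1) - \<psi> x) / s n))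
     \<longlonglongrightarrow> (LINT x|lebesgue. u x * partial_deriv i \<psi> x)"
proof -
  have z: "partial_deriv i \<psi> x = 0" if "x \<notin> C" for x
    by (rule partial_deriv_zero_outside[of C]) (use C that in \<open>auto simp: compact_imp_closed\<close>)
  obtain M where M: "0 \<le> M" "\<And>x. \<bar>partial_deriv i \<psi> x\<bar> \<le> M"
    using bounded_if_compact_support[OF continuous_partial_deriv[OF sm] C(1) z] by auto
  obtain R where R: "\<And>x. x \<in> C \<Longrightarrow> norm x \<le> R"
    using compact_imp_bounded[OF C(1)] by (auto simp: bounded_iff)
  have lip: "\<bar>\<psi> (x + t *\<^sub>R axis i 1) - \<psi> x\<bar> \<le> M * \<bar>t\<bar>" for x t
  proof -
    have "norm (\<psi> (x + t *\<^sub>R axis i 1) - \<psi> (x + 0 *\<^sub>R axis i 1)) \<le> M * norm (t - 0)"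
      by (rule field_differentiable_bound[of UNIV "\<lambda>t. \<psi> (x + t *\<^sub>R axis i 1)"
            "\<lambda>t. partial_deriv i \<psi> (x + t *\<^sub>R axis i 1)"])
        (use M in \<open>auto intro: DERIV_along_axis[OF sm]\<close>)
    then show ?thesis by simp
  qed
  have B: "0 \<le> B" using u(2)[of 0] by linarith
  have mtr: "(\<lambda>x. \<psi> (x + a)) \<in> borel_measurable lebesgue" for a
    by (intro continuous_measurable_lebesgue smooth_fun_continuous smooth_fun_translate sm)
  have mpsi: "\<psi> \<in> borel_measurable lebesgue" using mtr[of 0] by simp
  show ?thesis
  proof (rule integral_dominated_convergence)
    show "integrable lebesgue (\<lambda>x. B * M * indicator (cball 0 (R + 1)) x)"
      by (intro integrable_mult_right integrable_real_indicator) (auto intro: emeasure_bounded_finite[unfolded infinity_ennreal_def])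
    show "(\<lambda>x. u x * partial_deriv i \<psi> x) \<in> borel_measurable lebesgue"
      using u(1) continuous_measurable_lebesgue[OF continuous_partial_deriv[OF sm]] by simp
    show "(\<lambda>x. u x * ((\<psi> (x + s n *\<^sub>R axis i 1) - \<psi> x) / s n)) \<in> borel_measurable lebesgue" for n
      using u(1) mtr mpsi by simp
    show "AE x in lebesgue. (\<lambda>n. u x * ((\<psi> (x + s n *\<^sub>R axis i 1) - \<psi> x) / s n))
        \<longlonglongrightarrow> u x * partial_deriv i \<psi> x"
    proof (intro AE_I2 tendsto_mult tendsto_const)
      fix x
      have "((\<lambda>h. (\<psi> (x + (0 + h) *\<^sub>R axis i 1) - \<psi> (x + 0 *\<^sub>R axis i 1)) / h) \<longlongrightarrow> partial_deriv i \<psi> (x + 0 *\<^sub>R axis i 1)) (at 0)"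
        using DERIV_along_axis[OF sm, of x i 0] unfolding DERIV_def .
      then have "((\<lambda>h. (\<psi> (x + h *\<^sub>R axis i 1) - \<psi> x) / h) \<longlongrightarrow> partial_deriv i \<psi> x) (at 0)"
        by simp
      moreover have "filterlim s (at 0) sequentially" using s by (auto simp: filterlim_at)
      ultimately show "(\<lambda>n. (\<psi> (x + s n *\<^sub>R axis i 1) - \<psi> x) / s n) \<longlonglongrightarrow> partial_deriv i \<psi> x"
        by (rule filterlim_compose)
    qed
    show "AE x in lebesgue. norm (u x * ((\<psi> (x + s n *\<^sub>R axis i 1) - \<psi> x) / s n)) \<le> B * M * indicator (cball 0 (R + 1)) x" for n
    proof (rule AE_I2)
      fix x :: "real ^ 'd"
      show "norm (u x * ((\<psi> (x + s n *\<^sub>R axis i 1) - \<psi> x) / s n)) \<le> B * M * indicator (cball 0 (R + 1)) x"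
      proof (cases "x \<in> cball 0 (R + 1)")
        case True
        have "\<bar>(\<psi> (x + s n *\<^sub>R axis i 1) - \<psi> x) / s n\<bar> \<le> M"
          using lip[of x "s n"] s(2)[of n] by (simp add: abs_divide pos_divide_le_eq)
        then have "\<bar>u x\<bar> * \<bar>(\<psi> (x + s n *\<^sub>R axis i 1) - \<psi> x) / s n\<bar> \<le> B * M"
          using u(2)[of x] B by (intro mult_mono) auto
        then show ?thesis using True by (simp add: abs_mult)
      next
        case False
        then have "norm x > R + 1" by simp
        moreover have "norm x \<le> norm (x + s n *\<^sub>R axis i 1) + norm (s n *\<^sub>R (axis i 1 :: real ^ 'd))"
          using norm_triangle_ineq4[of "x + s n *\<^sub>R axis i 1" "s n *\<^sub>R (axis i 1 :: real ^ 'd)"] by simp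
        ultimately have "norm (x + s n *\<^sub>R axis i 1) > R" using s(3)[of n] by simp
        then have "\<psi> (x + s n *\<^sub>R axis i 1) = 0" "\<psi> x = 0"
          using C(2) R \<open>norm x > R + 1\<close> by (auto simp: not_le[symmetric] intro!: C(2) dest!: R)
        then show ?thesis using False by simp
      qed
    qed
  qed
qed

text \<open>Translation invariance makes the integral of every difference quotient vanish,
and the integral of the derivative is their limit. This replaces Fubini and the fundamental theorem of
calculus in the integration by parts below.\<close>

lemma integral_partial_deriv_zero:
  fixes \<psi> :: "real ^ 'd::finite \<Rightarrow> real"
  assumes sm: "smooth_fun \<psi>" and C: "compact C" "\<And>x. x \<notin> C \<Longrightarrow> \<psi> x = 0"
  shows "(LINT x|lebesgue. partial_deriv i \<psi> x) = 0"
proof -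
  define s where "s n = inverse (real (Suc n))" for n
  have s: "s \<longlonglongrightarrow> 0" "\<And>n. s n \<noteq> 0" "\<And>n. \<bar>s n\<bar> \<le> 1"
    unfolding s_def using LIMSEQ_inverse_real_of_nat by (auto simp: inverse_le_1_iff)
  have int: "integrable lebesgue \<psi>"
    using locally_integrable_mult[OF continuous_locally_integrable[of "\<lambda>_. 1" UNIV] C(1) _ smooth_fun_continuous[OF sm] C(2)]
    by simp
  have "(LINT x|lebesgue. (\<psi> (x + s n *\<^sub>R axis i 1) - \<psi> x) / s n) = 0" for n
    using integral_lebesgue_translate[OF borel_measurable_integrable[OF int]] int integrable_lebesgue_translate[OF int]
    by simp
  moreover have "(\<lambda>n. LINT x|lebesgue. 1 * ((\<psi> (x + s n *\<^sub>R axis i 1) - \<psi> x) / s n))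
     \<longlonglongrightarrow> (LINT x|lebesgue. 1 * partial_deriv i \<psi> x)"
    by (rule diff_quotient_integral_tendsto[OF sm C, where B=1]) (use s in auto)
  ultimately have "(\<lambda>n. 0) \<longlonglongrightarrow> (LINT x|lebesgue. partial_deriv i \<psi> x)" by (simp only: mult_1)
  then show ?thesis by (simp add: LIMSEQ_const_iff)
qed

text \<open>Integration by parts is \<open>integral_partial_deriv_zero\<close> for the product of \<open>f\<close> with a test function.\<close>

lemma weak_pderiv_smooth:
  fixes f :: "real ^ 'd::finite \<Rightarrow> real"
  assumes sm: "smooth_fun f" and \<Omega>: "\<Omega> \<in> sets lebesgue"
  shows "weak_pderiv \<Omega> i f (partial_deriv i f)"
proof (rule weak_pderivI[OF \<Omega>])
  show li: "locally_integrable \<Omega> f" "locally_integrable \<Omega> (partial_deriv i f)"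
    by (intro continuous_locally_integrable smooth_fun_continuous smooth_fun_partial sm)+
  fix \<phi> assume \<phi>: "test_fun \<Omega> \<phi>"
  obtain C where C: "compact C" "C \<subseteq> \<Omega>" "\<And>x. x \<notin> C \<Longrightarrow> \<phi> x = 0" "smooth_fun \<phi>"
      "\<And>x. x \<notin> C \<Longrightarrow> partial_deriv i \<phi> x = 0"
    using test_funE[OF \<phi>] by metis
  have "(LINT x|lebesgue. partial_deriv i (\<lambda>x. f x * \<phi> x) x) = 0"
    by (rule integral_partial_deriv_zero[OF smooth_fun_mult[OF sm C(4)] C(1)]) (simp add: C(3))
  moreover have "partial_deriv i (\<lambda>x. f x * \<phi> x) x = f x * partial_deriv i \<phi> x + partial_deriv i f x * \<phi> x" for x
    by (rule partial_deriv_mult) (simp_all add: smooth_fun_differentiable sm C(4))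
  moreover have "integrable lebesgue (\<lambda>x. f x * partial_deriv i \<phi> x)"
    by (rule locally_integrable_mult[OF li(1) C(1,2) continuous_partial_deriv[OF C(4)] C(5)])
  moreover have "integrable lebesgue (\<lambda>x. partial_deriv i f x * \<phi> x)"
    by (rule locally_integrable_mult[OF li(2) C(1,2) smooth_fun_continuous[OF C(4)] C(3)])
  ultimately show "(LINT x|lebesgue. f x * partial_deriv i \<phi> x) = - (LINT x|lebesgue. partial_deriv i f x * \<phi> x)"
    by simp
qed

lemma continuous_on_suminf_M_test:
  fixes u :: "nat \<Rightarrow> 'a::topological_space \<Rightarrow> real"
  assumes "\<And>n. continuous_on UNIV (u n)" "\<And>n x. \<bar>u n x\<bar> \<le> U n" "summable U"
  shows "continuous_on UNIV (\<lambda>x. \<Sum>n. u n x)"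
proof (rule uniform_limit_theorem)
  show "uniform_limit UNIV (\<lambda>N x. \<Sum>n<N. u n x) (\<lambda>x. \<Sum>n. u n x) sequentially"
    by (rule Weierstrass_m_test) (use assms in auto)
  show "\<forall>\<^sub>F N in sequentially. continuous_on UNIV (\<lambda>x. \<Sum>n<N. u n x)"
    by (intro always_eventually allI continuous_on_sum assms)
qed simp

lemma integral_suminf_mult_sums:
  fixes u :: "nat \<Rightarrow> 'a \<Rightarrow> real"
  assumes "\<And>n. u n \<in> borel_measurable M" "\<And>n x. \<bar>u n x\<bar> \<le> U n" "summable U" "integrable M h"
  shows "(\<lambda>n. LINT x|M. u n x * h x) sums (LINT x|M. (\<Sum>n. u n x) * h x)"
proof -
  have su: "summable (\<lambda>n. \<bar>u n x\<bar>)" for x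
    by (rule summable_comparison_test'[OF assms(3)]) (use assms(2) in auto)
  have i: "integrable M (\<lambda>x. u n x * h x)" for n
    using integrable_mult_bounded_measurable[OF assms(4) assms(1)[of n] assms(2)[of n]]
    by (simp add: mult.commute)
  have "(\<lambda>n. LINT x|M. u n x * h x) sums (LINT x|M. (\<Sum>n. u n x * h x))"
  proof (rule sums_integral)
    show "AE x in M. summable (\<lambda>n. norm (u n x * h x))"
      by (intro AE_I2) (simp add: abs_mult summable_mult2 su)
    show "summable (\<lambda>n. LINT x|M. norm (u n x * h x))"
    proof (rule summable_comparison_test')
      show "summable (\<lambda>n. U n * (LINT x|M. \<bar>h x\<bar>))" by (intro summable_mult2 assms)
      show "norm (LINT x|M. norm (u n x * h x)) \<le> U n * (LINT x|M. \<bar>h x\<bar>)" if "n \<ge> 0" for n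
      proof -
        have "(LINT x|M. norm (u n x * h x)) \<le> (LINT x|M. U n * \<bar>h x\<bar>)"
        proof (rule integral_mono)
          show "integrable M (\<lambda>x. norm (u n x * h x))" using i[of n] by (rule integrable_norm)
          show "integrable M (\<lambda>x. U n * \<bar>h x\<bar>)" using assms(4) by simp
        qed (simp add: abs_mult assms(2) mult_right_mono)
        then show ?thesis by simp
      qed
    qed
  qed (rule i)
  moreover have "(\<Sum>n. u n x * h x) = (\<Sum>n. u n x) * h x" for x
    using summable_rabs_cancel[OF su[of x]] by (rule suminf_mult2[symmetric])
  ultimately show ?thesis by simp
qed

text \<open>A weak derivative is defined by integrals against fixed test functions, so it may be taken
termwise as soon as both series converge uniformly.\<close>

lemma weak_pderiv_suminf:
  fixes u g :: "nat \<Rightarrow> real ^ 'd::finite \<Rightarrow> real"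
  assumes w: "\<And>n. weak_pderiv \<Omega> i (u n) (g n)" and \<Omega>: "\<Omega> \<in> sets lebesgue"
    and u: "\<And>n. continuous_on UNIV (u n)" "\<And>n x. \<bar>u n x\<bar> \<le> U n" "summable U"
    and g: "\<And>n. continuous_on UNIV (g n)" "\<And>n x. \<bar>g n x\<bar> \<le> G n" "summable G"
  shows "weak_pderiv \<Omega> i (\<lambda>x. \<Sum>n. u n x) (\<lambda>x. \<Sum>n. g n x)"
proof (rule weak_pderivI[OF \<Omega>])
  show "locally_integrable \<Omega> (\<lambda>x. \<Sum>n. u n x)" "locally_integrable \<Omega> (\<lambda>x. \<Sum>n. g n x)"
    by (intro continuous_locally_integrable continuous_on_suminf_M_test[OF u] continuous_on_suminf_M_test[OF g])+
  fix \<phi> assume \<phi>: "test_fun \<Omega> \<phi>"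
  obtain C where C: "compact C" "C \<subseteq> \<Omega>" "\<And>x. x \<notin> C \<Longrightarrow> \<phi> x = 0" "smooth_fun \<phi>"
      "\<And>x. x \<notin> C \<Longrightarrow> partial_deriv i \<phi> x = 0"
    using test_funE[OF \<phi>] by metis
  have li1: "locally_integrable UNIV (\<lambda>_. 1::real)" by (rule continuous_locally_integrable) simp
  have i: "integrable lebesgue \<phi>" "integrable lebesgue (partial_deriv i \<phi>)"
    using locally_integrable_mult[OF li1 C(1) _ smooth_fun_continuous[OF C(4)] C(3)]
      locally_integrable_mult[OF li1 C(1) _ continuous_partial_deriv[OF C(4)] C(5)] by auto
  have "(\<lambda>n. LINT x|lebesgue. u n x * partial_deriv i \<phi> x) sums (LINT x|lebesgue. (\<Sum>n. u n x) * partial_deriv i \<phi> x)"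
    by (rule integral_suminf_mult_sums[OF continuous_measurable_lebesgue[OF u(1)] u(2,3) i(2)])
  moreover have "(\<lambda>n. - (LINT x|lebesgue. g n x * \<phi> x)) sums (- (LINT x|lebesgue. (\<Sum>n. g n x) * \<phi> x))"
    by (intro sums_minus integral_suminf_mult_sums[OF continuous_measurable_lebesgue[OF g(1)] g(2,3) i(1)])
  ultimately show "(LINT x|lebesgue. (\<Sum>n. u n x) * partial_deriv i \<phi> x) = - (LINT x|lebesgue. (\<Sum>n. g n x) * \<phi> x)"
    using weak_pderivD[OF w \<phi> \<Omega>] by (simp add: sums_unique2)
qed

section \<open>Folding integrals onto the unit cube\<close>

text \<open>The \<open>2 ^ d\<close> lattice translations that carry the unit cube onto the cubes tiling \<open>[0, 2]\<^sup>d\<close>.\<close>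

definition corner :: "'d::finite set \<Rightarrow> real ^ 'd" where
  "corner S = (\<chi> i. of_bool (i \<in> S))"

lemma corner_empty [simp]: "corner {} = 0"
  by (simp add: corner_def vec_eq_iff)

text \<open>An open neighbourhood of \<open>[0, 2]\<^sup>d\<close>, so that functions supported in the latter are admissible
as test functions.\<close>

definition big_cube :: "(real ^ 'd::finite) set" where
  "big_cube = box (\<chi> i. -1) (\<chi> i. 3)"

lemma open_big_cube: "open big_cube" and bounded_big_cube: "bounded big_cube"
  by (simp_all add: big_cube_def open_box bounded_box)

lemma sets_big_cube [simp]: "big_cube \<in> sets lebesgue"
  by (simp add: big_cube_def)

lemma cube_corner_in_big_cube:
  assumes "x \<in> cbox 0 (\<chi> i. 1)" shows "x + corner S \<in> big_cube"
proof -
  have "-1 < x $ i + of_bool (i \<in> S) \<and> x $ i + of_bool (i \<in> S) < (3::real)" for i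
  proof -
    have "0 \<le> x $ i" "x $ i \<le> 1" using assms by (auto simp: mem_box_cart)
    then show ?thesis by (cases "i \<in> S") auto
  qed
  then show ?thesis by (simp add: big_cube_def mem_box_cart corner_def)
qed

lemma unit_cube_subset_cbox: "unit_cube \<subseteq> cbox 0 (\<chi> i. 1)"
  by (auto simp: unit_cube_iff mem_box_cart less_imp_le)

lemma cbox_subset_big_cube: "cbox 0 (\<chi> i. 2) \<subseteq> (big_cube :: (real ^ 'd::finite) set)"
proof
  fix x :: "real ^ 'd" assume "x \<in> cbox 0 (\<chi> i. 2)"
  then have r: "0 \<le> x $ i" "x $ i \<le> 2" for i by (auto simp: mem_box_cart)
  have "-1 < x $ i \<and> x $ i < 3" for i using r[of i] by linarith
  then show "x \<in> big_cube" by (simp add: big_cube_def mem_box_cart)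
qed

lemma outside_cbox_coord:
  fixes x :: "real ^ 'd::finite"
  assumes "x \<notin> cbox 0 (\<chi> i. 2)" shows "\<exists>i. \<not> (0 \<le> x $ i \<and> x $ i < 2)"
proof -
  obtain i where "x $ i < 0 \<or> 2 < x $ i" using assms by (auto simp: mem_box_cart not_le)
  then show ?thesis by (auto intro!: exI[of _ i])
qed

lemma half_open_cube_measurable: "{x :: real ^ 'd::finite. \<forall>i. 0 \<le> x $ i \<and> x $ i < 1} \<in> sets lebesgue"
proof -
  have "{x :: real ^ 'd::finite. \<forall>i. 0 \<le> x $ i \<and> x $ i < 1} \<in> sets borel" by measurable
  then show ?thesis by (rule sets_completionI_sets[where M=lborel, simplified])
qed

text \<open>The half-open cube \<open>[0, 2)\<^sup>d\<close> is the disjoint union of the \<open>2 ^ d\<close> translates of \<open>[0, 1)\<^sup>d\<close>.\<close>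

lemma integral_fold_unit_cube:
  fixes f :: "real ^ 'd::finite \<Rightarrow> real"
  assumes f: "integrable lebesgue f" and z: "\<And>x i. \<not> (0 \<le> x $ i \<and> x $ i < 2) \<Longrightarrow> f x = 0"
  shows "(LINT x|lebesgue. f x) = (\<Sum>S\<in>UNIV. LINT x|lebesgue_on unit_cube. f (x + corner S))"
proof -
  define H where "H = {x :: real ^ 'd. \<forall>i. 0 \<le> x $ i \<and> x $ i < 1}"
  have Hm: "(indicator H :: _ \<Rightarrow> real) \<in> borel_measurable lebesgue"
    unfolding H_def by (rule borel_measurable_indicator[OF half_open_cube_measurable])
  have Hs: "(\<lambda>x. indicator H (x + a) :: real) \<in> borel_measurable lebesgue" for a
    using measurable_compose[OF measurable_lebesgue_translate Hm] .
  have pt: "f x = (\<Sum>S\<in>UNIV. indicator H (x + (- corner S)) * f x)" for x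
  proof (cases "f x = 0")
    case False
    have r: "0 \<le> x $ i" "x $ i < 2" for i using False z by blast+
    define S0 where "S0 = {i. 1 \<le> x $ i}"
    have "x + (- corner S) \<in> H \<longleftrightarrow> S = S0" for S
    proof
      assume "x + (- corner S) \<in> H"
      then have h: "0 \<le> x $ i - of_bool (i \<in> S)" "x $ i - of_bool (i \<in> S) < 1" for i
        by (auto simp: H_def corner_def)
      have "i \<in> S \<longleftrightarrow> 1 \<le> x $ i" for i using h[of i] by (cases "i \<in> S") auto
      then show "S = S0" by (auto simp: S0_def)
    next
      assume S: "S = S0"
      have "0 \<le> x $ i - of_bool (i \<in> S) \<and> x $ i - of_bool (i \<in> S) < 1" for i
        using r[of i] by (cases "i \<in> S") (auto simp: S S0_def)
      then show "x + (- corner S) \<in> H" by (simp add: H_def corner_def)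
    qed
    then have "(\<Sum>S\<in>UNIV. indicator H (x + (- corner S)) * f x) = (\<Sum>S\<in>UNIV. if S = S0 then f x else 0)"
      by (intro sum.cong) (auto simp: indicator_def)
    then show ?thesis by simp
  qed simp
  have i: "integrable lebesgue (\<lambda>x. f x * indicator H (x + a))" for a
    by (rule integrable_mult_bounded_measurable[OF f Hs, where B=1]) (simp add: indicator_def)
  have "(LINT x|lebesgue. f x) = (LINT x|lebesgue. (\<Sum>S\<in>UNIV. indicator H (x + (- corner S)) * f x))"
    using pt by (rule Bochner_Integration.integral_cong[OF refl])
  also have "\<dots> = (\<Sum>S\<in>UNIV. LINT x|lebesgue. indicator H (x + (- corner S)) * f x)"
    by (rule Bochner_Integration.integral_sum) (use i in \<open>simp only: mult.commute[of "indicator H _"]\<close>)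
  also have "\<dots> = (\<Sum>S\<in>UNIV. LINT x|lebesgue_on unit_cube. f (x + corner S))"
  proof (rule sum.cong)
    fix S :: "'d set"
    have m: "(\<lambda>x. indicator H (x + (- corner S)) * f x) \<in> borel_measurable lebesgue"
      using borel_measurable_integrable[OF i[of "- corner S"]] by (simp add: mult.commute)
    have fm: "(\<lambda>x. f (x + corner S)) \<in> borel_measurable lebesgue"
      using integrable_lebesgue_translate[OF f] by (rule borel_measurable_integrable)
    have "(LINT x|lebesgue. indicator H (x + (- corner S)) * f x) = (LINT x|lebesgue. indicator H x * f (x + corner S))"
      using integral_lebesgue_translate[OF m, of "corner S"] by simp
    also have "\<dots> = (LINT x|lebesgue. indicator unit_cube x * f (x + corner S))"
    proof (rule integral_cong_AE)
      have "AE x in lebesgue. x \<notin> cbox (0::real^'d) (\<chi> i. 1) - box 0 (\<chi> i. 1)"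
        by (rule AE_not_in) (use negligible_frontier_interval[of "0::real^'d" "\<chi> i. 1"] in \<open>simp only: negligible_iff_null_sets\<close>)
      then show "AE x in lebesgue. indicator H x * f (x + corner S) = indicator unit_cube x * f (x + corner S)"
      proof eventually_elim
        case (elim x)
        have "x \<in> H \<longleftrightarrow> x \<in> unit_cube"
        proof
          assume "x \<in> H"
          then have "x \<in> cbox 0 (\<chi> i. 1)" by (auto simp: H_def mem_box_cart less_imp_le)
          with elim show "x \<in> unit_cube" by (simp add: unit_cube_def)
        qed (auto simp: H_def unit_cube_iff less_imp_le)
        then show ?case by (simp add: indicator_def)
      qed
      have uc: "(indicator unit_cube :: _ \<Rightarrow> real) \<in> borel_measurable lebesgue"
        by (rule borel_measurable_indicator) simp
      show "(\<lambda>x. indicator H x * f (x + corner S)) \<in> borel_measurable lebesgue"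
        "(\<lambda>x. indicator unit_cube x * f (x + corner S)) \<in> borel_measurable lebesgue"
        using Hm fm uc by simp_all
    qed
    also have "\<dots> = (LINT x|lebesgue_on unit_cube. f (x + corner S))"
      by (simp add: integral_lebesgue_on_indicator)
    finally show "(LINT x|lebesgue. indicator H (x + (- corner S)) * f x) = (LINT x|lebesgue_on unit_cube. f (x + corner S))" .
  qed simp
  finally show ?thesis .
qed

lemma locally_integrable_big_cube_corner:
  assumes "locally_integrable big_cube g"
  shows "integrable (lebesgue_on unit_cube) (\<lambda>x. g (x + corner S))"
proof -
  have "locally_integrable (cbox 0 (\<chi> i. 1)) (\<lambda>x. g (x + corner S))"
    by (rule locally_integrable_translate[OF assms cube_corner_in_big_cube])
  then have "integrable (lebesgue_on (cbox 0 (\<chi> i. 1))) (\<lambda>x. g (x + corner S))"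
    by (simp add: locally_integrable_def)
  then have "integrable lebesgue (\<lambda>x. (indicator (cbox 0 (\<chi> i. 1)) x * g (x + corner S)) * indicator (box 0 (\<chi> i. 1)) x)"
    by (intro integrable_mult_bounded_measurable[where B=1 and g="indicator _"] indicator_box_measurable)
      (auto simp: integrable_lebesgue_on_indicator)
  then have "integrable lebesgue (\<lambda>x. indicator unit_cube x * g (x + corner S))"
    by (rule back_subst[of "integrable lebesgue"])
      (use box_subset_cbox[of 0 "\<chi> i. 1"] in \<open>auto simp: unit_cube_def indicator_def fun_eq_iff\<close>)
  then show ?thesis by (simp add: integrable_lebesgue_on_indicator)
qed

definition corner_periodic :: "(real ^ 'd::finite \<Rightarrow> real) \<Rightarrow> bool" where
  "corner_periodic T \<longleftrightarrow> (\<forall>x S. T (x + corner S) = T x)"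

lemma corner_periodic_partial_deriv:
  assumes "smooth_fun T" "corner_periodic T" shows "corner_periodic (partial_deriv i T)"
  unfolding corner_periodic_def
proof (intro allI)
  fix x S
  have "(\<lambda>x. T (x + corner S)) = T" using assms(2) by (auto simp: corner_periodic_def)
  then show "partial_deriv i T (x + corner S) = partial_deriv i T x"
    using partial_deriv_translate[OF smooth_fun_differentiable[OF assms(1)], of i "corner S"] by metis
qed

lemma partial_deriv_sum:
  assumes "finite I" "\<And>j. j \<in> I \<Longrightarrow> smooth_fun (f j)"
  shows "smooth_fun (\<lambda>x. \<Sum>j\<in>I. f j x) \<and> partial_deriv i (\<lambda>x. \<Sum>j\<in>I. f j x) x = (\<Sum>j\<in>I. partial_deriv i (f j) x)"
  using assms
proof (induction I rule: finite_induct)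
  case empty
  have "partial_deriv i (\<lambda>x. 0::real) x = 0" by (rule partial_derivI) simp
  then show ?case by (simp add: smooth_fun_const)
next
  case (insert j I)
  then show ?case
    by (simp add: smooth_fun_add partial_deriv_add smooth_fun_differentiable)
qed

text \<open>In one variable, \<open>r t = R t - R (t - 1)\<close> for a smooth step \<open>R\<close> is
supported in \<open>[0, 2]\<close> and satisfies \<open>r t + r (t + 1) = 1\<close> on \<open>[0, 1]\<close>; the function \<open>\<kappa>\<close> is the product of
the \<open>r (x\<^sub>i)\<close>, and its translates sum to the product of the one-dimensional sums.\<close>

lemma partition_of_unity_exists:
  obtains \<kappa>::"real ^ 'd::finite \<Rightarrow> real" where "smooth_fun \<kappa>"
    "\<And>x i. \<not> (0 \<le> x $ i \<and> x $ i < 2) \<Longrightarrow> \<kappa> x = 0"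
    "\<And>x. x \<in> unit_cube \<Longrightarrow> (\<Sum>S\<in>UNIV. \<kappa> (x + corner S)) = 1"
    "\<And>x i. x \<in> unit_cube \<Longrightarrow> (\<Sum>S\<in>UNIV. partial_deriv i \<kappa> (x + corner S)) = 0"
proof -
  obtain R where R: "smooth1 R" "\<And>t. t \<le> 0 \<Longrightarrow> R t = 0" "\<And>t. 1 \<le> t \<Longrightarrow> R t = 1"
    by (rule smooth_step_exists) blast
  define r where "r t = R t + (-1) * R (1 * t + (-1))" for t
  have sr: "smooth1 r" unfolding r_def[abs_def]
    by (rule smooth1_add[OF R(1) smooth1_mult[OF smooth1_const smooth1_affine[OF R(1)]]])
  define \<kappa> :: "real ^ 'd \<Rightarrow> real" where "\<kappa> x = (\<Prod>i\<in>UNIV. r (x $ i))" for x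
  have s\<kappa>: "smooth_fun \<kappa>" unfolding \<kappa>_def[abs_def] by (intro smooth_fun_prod smooth_fun_coord sr) auto
  have one: "(\<Sum>S\<in>UNIV. \<kappa> (x + corner S)) = 1" if x: "x \<in> unit_cube" for x
  proof -
    have "\<kappa> (x + corner S) = (\<Prod>i\<in>S. r (x $ i + 1)) * (\<Prod>i\<in>UNIV - S. r (x $ i))" for S
    proof -
      have "\<kappa> (x + corner S) = (\<Prod>i\<in>S. r (x $ i + of_bool (i \<in> S))) * (\<Prod>i\<in>UNIV - S. r (x $ i + of_bool (i \<in> S)))"
        unfolding \<kappa>_def using prod.subset_diff[of S UNIV "\<lambda>i. r (x $ i + of_bool (i \<in> S))"]
        by (simp add: corner_def mult.commute)
      then show ?thesis by simp
    qed
    then have "(\<Sum>S\<in>UNIV. \<kappa> (x + corner S)) = (\<Prod>i\<in>UNIV. r (x $ i + 1) + r (x $ i))"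
      by (simp add: prod_add)
    also have "\<dots> = (\<Prod>i::'d\<in>UNIV. 1)"
    proof (rule prod.cong[OF refl])
      fix i
      have "0 < x $ i" "x $ i < 1" using x by (auto simp: unit_cube_iff)
      then show "r (x $ i + 1) + r (x $ i) = 1" by (simp add: r_def R)
    qed
    finally show ?thesis by simp
  qed
  have s\<kappa>S: "smooth_fun (\<lambda>x. \<kappa> (x + corner S))" for S by (rule smooth_fun_translate[OF s\<kappa>])
  have zero: "(\<Sum>S\<in>UNIV. partial_deriv i \<kappa> (x + corner S)) = 0" if x: "x \<in> unit_cube" for x i
  proof -
    have "((\<lambda>x. 1::real) has_derivative (\<lambda>v. 0)) (at x)" by simp
    then have "((\<lambda>x. \<Sum>S\<in>UNIV. \<kappa> (x + corner S)) has_derivative (\<lambda>v. 0)) (at x)"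
      by (rule has_derivative_transform_within_open[where s=unit_cube]) (use x one open_unit_cube in auto)
    then have "0 = partial_deriv i (\<lambda>x. \<Sum>S\<in>UNIV. \<kappa> (x + corner S)) x" by (simp add: partial_derivI)
    also have "\<dots> = (\<Sum>S\<in>UNIV. partial_deriv i (\<lambda>x. \<kappa> (x + corner S)) x)"
      using partial_deriv_sum[of UNIV "\<lambda>S x. \<kappa> (x + corner S)"] s\<kappa>S by simp
    also have "\<dots> = (\<Sum>S\<in>UNIV. partial_deriv i \<kappa> (x + corner S))"
      by (simp add: partial_deriv_translate smooth_fun_differentiable s\<kappa>)
    finally show ?thesis by simp
  qed
  show ?thesis
  proof (rule that[OF s\<kappa> _ one zero])
    fix x :: "real ^ 'd" and i assume "\<not> (0 \<le> x $ i \<and> x $ i < 2)"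
    then have "r (x $ i) = 0" by (auto simp: r_def R not_le not_less)
    then show "\<kappa> x = 0" unfolding \<kappa>_def by (intro prod_zero) auto
  qed
qed

text \<open>Folding \<open>g * (\<eta> * T)\<close> onto the unit cube collects the translates of \<open>\<eta>\<close> as a common factor of
the periodic function \<open>g * T\<close>.\<close>

lemma integral_fold_partition:
  fixes g g0 T \<eta> :: "real ^ 'd::finite \<Rightarrow> real"
  assumes g: "locally_integrable big_cube g"
    and per: "\<And>S. AE x in lebesgue_on unit_cube. g (x + corner S) = g0 x"
    and T: "continuous_on UNIV T" "corner_periodic T"
    and \<eta>: "continuous_on UNIV \<eta>" "\<And>x i. \<not> (0 \<le> x $ i \<and> x $ i < 2) \<Longrightarrow> \<eta> x = 0"
    and c: "\<And>x. x \<in> unit_cube \<Longrightarrow> (\<Sum>S\<in>UNIV. \<eta> (x + corner S)) = c"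
  shows "(LINT x|lebesgue. g x * (\<eta> x * T x)) = c * (LINT x|lebesgue_on unit_cube. g0 x * T x)"
proof -
  have z: "\<eta> x * T x = 0" if "x \<notin> cbox 0 (\<chi> i. 2)" for x
  proof -
    from outside_cbox_coord[OF that] obtain j where "\<not> (0 \<le> x $ j \<and> x $ j < 2)" by blast
    then show ?thesis using \<eta>(2) by simp
  qed
  have i: "integrable lebesgue (\<lambda>x. g x * (\<eta> x * T x))"
    by (rule locally_integrable_mult[OF g compact_cbox cbox_subset_big_cube continuous_on_mult[OF \<eta>(1) T(1)] z])
  have g0i: "integrable (lebesgue_on unit_cube) g0"
    by (rule integrable_lebesgue_on_AE[OF _ locally_integrable_big_cube_corner[OF g, of "{}"]])
      (use per[of "{}"] in auto)
  have bdd: "\<exists>B. \<forall>x\<in>unit_cube. \<bar>h x\<bar> \<le> B" if "continuous_on UNIV h" for h :: "real ^ 'd \<Rightarrow> real"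
  proof -
    have "compact (h ` cbox 0 (\<chi> i. 1))"
      by (intro compact_continuous_image continuous_on_subset[OF that]) auto
    then obtain B where "\<And>y. y \<in> h ` cbox 0 (\<chi> i. 1) \<Longrightarrow> \<bar>y\<bar> \<le> B"
      using compact_imp_bounded bounded_iff real_norm_def by metis
    then show ?thesis using unit_cube_subset_cbox by blast
  qed
  have gi: "integrable (lebesgue_on unit_cube) (\<lambda>x. g0 x * (\<eta> (x + corner S) * T x))" for S
  proof -
    have "continuous_on UNIV (\<lambda>x. \<eta> (x + corner S))"
      by (intro continuous_on_compose2[OF \<eta>(1)] continuous_intros) auto
    then have ct: "continuous_on UNIV (\<lambda>x. \<eta> (x + corner S) * T x)"
      by (intro continuous_on_mult T)
    obtain B where "\<forall>x\<in>unit_cube. \<bar>\<eta> (x + corner S) * T x\<bar> \<le> B" using bdd[OF ct] by blast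
    then show ?thesis
      by (intro integrable_mult_bounded_measurable[OF g0i, where B=B] measurable_lebesgue_onI continuous_measurable_lebesgue ct) simp
  qed
  have "(LINT x|lebesgue. g x * (\<eta> x * T x)) =
      (\<Sum>S\<in>UNIV. LINT x|lebesgue_on unit_cube. g (x + corner S) * (\<eta> (x + corner S) * T (x + corner S)))"
    by (rule integral_fold_unit_cube[OF i]) (auto simp: \<eta>(2))
  also have "\<dots> = (\<Sum>S\<in>UNIV. LINT x|lebesgue_on unit_cube. g0 x * (\<eta> (x + corner S) * T x))"
  proof (rule sum.cong[OF refl])
    fix S :: "'d set"
    have ae: "AE x in lebesgue_on unit_cube. g0 x * (\<eta> (x + corner S) * T x) = g (x + corner S) * (\<eta> (x + corner S) * T (x + corner S))"
      using per[of S] by eventually_elim (use T(2) in \<open>auto simp: corner_periodic_def\<close>)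
    show "(LINT x|lebesgue_on unit_cube. g (x + corner S) * (\<eta> (x + corner S) * T (x + corner S))) =
      (LINT x|lebesgue_on unit_cube. g0 x * (\<eta> (x + corner S) * T x))"
      by (rule integral_cong_AE[symmetric])
        (use gi[of S] ae measurable_lebesgue_on_AE[OF _ borel_measurable_integrable[OF gi[of S]] ae] in auto)
  qed
  also have "\<dots> = (LINT x|lebesgue_on unit_cube. (\<Sum>S\<in>UNIV. g0 x * (\<eta> (x + corner S) * T x)))"
    using gi by (simp add: Bochner_Integration.integral_sum)
  also have "\<dots> = (LINT x|lebesgue_on unit_cube. c * (g0 x * T x))"
  proof (rule Bochner_Integration.integral_cong[OF refl])
    fix x :: "real ^ 'd" assume "x \<in> space (lebesgue_on unit_cube)"
    then have "x \<in> unit_cube" by simp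
    have "(\<Sum>S\<in>UNIV. g0 x * (\<eta> (x + corner S) * T x)) = (\<Sum>S\<in>UNIV. \<eta> (x + corner S)) * (g0 x * T x)"
      by (simp add: sum_distrib_left sum_distrib_right mult_ac)
    then show "(\<Sum>S\<in>UNIV. g0 x * (\<eta> (x + corner S) * T x)) = c * (g0 x * T x)"
      using c[OF \<open>x \<in> unit_cube\<close>] by simp
  qed
  finally show ?thesis by simp
qed

text \<open>For a periodic function the boundary terms in the integration by parts over one
period cancel. This is obtained without traces: the periodic test function \<open>T\<close> is multiplied by the
partition of unity \<open>\<kappa>\<close>, the weak derivative on the larger cube is tested against \<open>\<kappa> * T\<close>, and the
result is folded back. The translates of \<open>\<kappa>\<close> sum to \<open>1\<close> and those of its derivative to \<open>0\<close>.\<close>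

lemma periodic_weak_pderiv:
  fixes u g u0 :: "real ^ 'd::finite \<Rightarrow> real"
  assumes w: "weak_pderiv big_cube i u g"
    and per: "\<And>S. AE x in lebesgue_on unit_cube. u (x + corner S) = u0 x"
  shows "weak_pderiv unit_cube i u0 (wpd unit_cube i u0)"
    and "AE x in lebesgue_on unit_cube. g (x + corner S) = wpd unit_cube i u0 x"
    and "integrable (lebesgue_on unit_cube) u0" "integrable (lebesgue_on unit_cube) (wpd unit_cube i u0)"
    and "smooth_fun T \<Longrightarrow> corner_periodic T \<Longrightarrow>
      (LINT x|lebesgue_on unit_cube. wpd unit_cube i u0 x * T x) = - (LINT x|lebesgue_on unit_cube. u0 x * partial_deriv i T x)"
proof -
  have li: "locally_integrable big_cube u" "locally_integrable big_cube g" using w by (auto simp: weak_pderiv_def)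
  have shift: "weak_pderiv unit_cube i u0 (\<lambda>x. g (x + corner S))" for S
  proof (rule weak_pderiv_AE_cong[OF open_unit_cube _ per[of S]])
    show "weak_pderiv unit_cube i (\<lambda>x. u (x + corner S)) (\<lambda>x. g (x + corner S))"
      by (rule weak_pderiv_translate[OF w open_unit_cube open_big_cube])
        (use cube_corner_in_big_cube unit_cube_subset_cbox in blast)
  qed simp
  then show "weak_pderiv unit_cube i u0 (wpd unit_cube i u0)" by (rule weak_pderiv_wpd)
  have gw: "AE x in lebesgue_on unit_cube. g (x + corner S) = wpd unit_cube i u0 x" for S
    using wpd_AE_eq[OF open_unit_cube shift[of S]] by eventually_elim simp
  then show "AE x in lebesgue_on unit_cube. g (x + corner S) = wpd unit_cube i u0 x" .
  show "integrable (lebesgue_on unit_cube) u0"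
    by (rule integrable_lebesgue_on_AE[OF _ locally_integrable_big_cube_corner[OF li(1), of "{}"] per]) simp
  show "integrable (lebesgue_on unit_cube) (wpd unit_cube i u0)"
    by (rule integrable_lebesgue_on_AE[OF _ locally_integrable_big_cube_corner[OF li(2), of "{}"] gw]) simp
  assume T: "smooth_fun T" "corner_periodic T"
  obtain \<kappa> :: "real ^ 'd \<Rightarrow> real" where \<kappa>: "smooth_fun \<kappa>"
    "\<And>x i. \<not> (0 \<le> x $ i \<and> x $ i < 2) \<Longrightarrow> \<kappa> x = 0"
    "\<And>x. x \<in> unit_cube \<Longrightarrow> (\<Sum>S\<in>UNIV. \<kappa> (x + corner S)) = 1"
    "\<And>x i. x \<in> unit_cube \<Longrightarrow> (\<Sum>S\<in>UNIV. partial_deriv i \<kappa> (x + corner S)) = 0"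
    by (rule partition_of_unity_exists) blast
  have out: "\<exists>i. \<not> (0 \<le> x $ i \<and> x $ i < 2)" if "x \<notin> cbox 0 (\<chi> i. 2)" for x :: "real ^ 'd"
    by (rule outside_cbox_coord[OF that])
  have t: "test_fun big_cube (\<lambda>x. \<kappa> x * T x)"
  proof (rule test_funI[OF smooth_fun_mult[OF \<kappa>(1) T(1)] compact_cbox cbox_subset_big_cube])
    fix x :: "real ^ 'd" assume "x \<notin> cbox 0 (\<chi> i. 2)"
    then obtain j where "\<not> (0 \<le> x $ j \<and> x $ j < 2)" using out by blast
    then show "\<kappa> x * T x = 0" using \<kappa>(2) by simp
  qed
  have closed: "closed {x :: real ^ 'd. \<forall>i. 0 \<le> x $ i \<and> x $ i \<le> 2}"
  proof -
    have "{x :: real ^ 'd. \<forall>i. 0 \<le> x $ i \<and> x $ i \<le> 2} = cbox 0 (\<chi> i. 2)" by (auto simp: mem_box_cart)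
    then show ?thesis by (simp only: closed_cbox)
  qed
  have z\<kappa>: "\<kappa> x = 0" if "x \<notin> {x. \<forall>i. 0 \<le> x $ i \<and> x $ i \<le> 2}" for x
  proof -
    from that obtain j where "\<not> (0 \<le> x $ j \<and> x $ j \<le> 2)" by auto
    then have "\<not> (0 \<le> x $ j \<and> x $ j < 2)" by auto
    then show ?thesis by (rule \<kappa>(2))
  qed
  have d\<kappa>: "partial_deriv i \<kappa> x = 0" if "\<not> (0 \<le> x $ j \<and> x $ j < 2)" for x j
  proof (cases "x $ j = 2")
    case False
    show ?thesis
    proof (rule partial_deriv_zero_outside[OF closed z\<kappa>])
      show "x \<notin> {x. \<forall>i. 0 \<le> x $ i \<and> x $ i \<le> 2}" using that False by (auto simp: not_le intro!: exI[of _ j])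
    qed
  next
    case True
    \<comment> \<open>on the face itself the derivative vanishes as a limit of values outside\<close>
    have "((\<lambda>n. partial_deriv i \<kappa> (x + inverse (real (Suc n)) *\<^sub>R axis j 1)) \<longlonglongrightarrow> partial_deriv i \<kappa> (x + 0 *\<^sub>R axis j 1))"
      by (rule continuous_on_tendsto_compose[OF continuous_partial_deriv[OF \<kappa>(1)]])
        (rule tendsto_add[OF tendsto_const tendsto_scaleR[OF LIMSEQ_inverse_real_of_nat tendsto_const]], auto)
    moreover have "partial_deriv i \<kappa> (x + inverse (real (Suc n)) *\<^sub>R axis j 1) = 0" for n
    proof (rule partial_deriv_zero_outside[OF closed z\<kappa>])
      have "x $ j + inverse (real (Suc n)) > 2" using True by simp
      then show "x + inverse (real (Suc n)) *\<^sub>R axis j 1 \<notin> {x. \<forall>i. 0 \<le> x $ i \<and> x $ i \<le> 2}"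
        by (auto simp: axis_def not_le intro!: exI[of _ j])
    qed
    ultimately show ?thesis by (simp add: LIMSEQ_const_iff)
  qed
  have pd: "partial_deriv i (\<lambda>x. \<kappa> x * T x) x = \<kappa> x * partial_deriv i T x + partial_deriv i \<kappa> x * T x" for x
    by (rule partial_deriv_mult) (simp_all add: smooth_fun_differentiable \<kappa>(1) T(1))
  have sT: "smooth_fun (partial_deriv i T)" "corner_periodic (partial_deriv i T)"
    by (simp_all add: smooth_fun_partial T corner_periodic_partial_deriv)
  have i1: "integrable lebesgue (\<lambda>x. u x * (\<kappa> x * partial_deriv i T x))"
    by (rule locally_integrable_mult[OF li(1) compact_cbox cbox_subset_big_cube])
      (intro continuous_on_mult smooth_fun_continuous \<kappa>(1) sT(1), use out \<kappa>(2) in \<open>metis mult_zero_left\<close>)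
  have i2: "integrable lebesgue (\<lambda>x. u x * (partial_deriv i \<kappa> x * T x))"
    by (rule locally_integrable_mult[OF li(1) compact_cbox cbox_subset_big_cube])
      (intro continuous_on_mult smooth_fun_continuous \<kappa>(1) T(1) smooth_fun_partial, use out d\<kappa> in \<open>metis mult_zero_left\<close>)
  have "(LINT x|lebesgue_on unit_cube. wpd unit_cube i u0 x * T x) = (LINT x|lebesgue. g x * (\<kappa> x * T x))"
    using integral_fold_partition[OF li(2) gw smooth_fun_continuous[OF T(1)] T(2) smooth_fun_continuous[OF \<kappa>(1)] \<kappa>(2) \<kappa>(3)] by simp
  also have "\<dots> = - (LINT x|lebesgue. u x * partial_deriv i (\<lambda>x. \<kappa> x * T x) x)"
    using weak_pderivD[OF w t] by simp
  also have "(LINT x|lebesgue. u x * partial_deriv i (\<lambda>x. \<kappa> x * T x) x) =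
      (LINT x|lebesgue. u x * (\<kappa> x * partial_deriv i T x)) + (LINT x|lebesgue. u x * (partial_deriv i \<kappa> x * T x))"
    using i1 i2 by (simp add: pd distrib_left)
  also have "(LINT x|lebesgue. u x * (\<kappa> x * partial_deriv i T x)) = (LINT x|lebesgue_on unit_cube. u0 x * partial_deriv i T x)"
    using integral_fold_partition[OF li(1) per smooth_fun_continuous[OF sT(1)] sT(2) smooth_fun_continuous[OF \<kappa>(1)] \<kappa>(2) \<kappa>(3)] by simp
  also have "(LINT x|lebesgue. u x * (partial_deriv i \<kappa> x * T x)) = 0"
    using integral_fold_partition[OF li(1) per smooth_fun_continuous[OF T(1)] T(2) continuous_partial_deriv[OF \<kappa>(1)] d\<kappa> \<kappa>(4)] by simp
  finally show "(LINT x|lebesgue_on unit_cube. wpd unit_cube i u0 x * T x) = - (LINT x|lebesgue_on unit_cube. u0 x * partial_deriv i T x)"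
    by simp
qed

section \<open>The trigonometric basis\<close>

definition freq :: "int ^ 'd::finite \<Rightarrow> real ^ 'd" where
  "freq k = (\<chi> i. 2 * pi * of_int (k $ i))"

text \<open>Real Fourier modes in the form of the Hartley kernel \<open>cos + sin\<close>: a single function per lattice point, so
that no separate treatment of sines and cosines or of the zero frequency is needed. Differentiation
exchanges the modes \<open>k\<close> and \<open>- k\<close>.\<close>

definition trig :: "int ^ 'd::finite \<Rightarrow> real ^ 'd \<Rightarrow> real" where
  "trig k x = cos (freq k \<bullet> x) + sin (freq k \<bullet> x)"

lemma freq_simps [simp]: "freq 0 = 0" "freq (- k) = - freq k" "freq (k + l) = freq k + freq l" "freq (k - l) = freq k - freq l"
  by (simp_all add: freq_def vec_eq_iff algebra_simps)

lemma trig_0 [simp]: "trig 0 x = 1" by (simp add: trig_def)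

lemma smooth_trig: "smooth_fun (trig k)"
  using smooth_fun_ridge[OF smooth1_sin_cos[of 1 1], of "freq k"]
  by (simp add: trig_def[abs_def] add.commute)

lemma continuous_trig: "continuous_on UNIV (trig k)"
  by (rule smooth_fun_continuous[OF smooth_trig])

lemma trig_measurable: "trig k \<in> borel_measurable lebesgue"
  by (rule continuous_measurable_lebesgue[OF continuous_trig])

lemma partial_deriv_trig: "partial_deriv i (trig k) = (\<lambda>x. freq k $ i * trig (- k) x)"
proof -
  have "((\<lambda>t. cos t + sin t) has_real_derivative cos t - sin t) (at t)" for t :: real
    by (auto intro!: derivative_eq_intros)
  from partial_deriv_ridge[where h="\<lambda>t. cos t + sin t" and h'="\<lambda>t. cos t - sin t", OF this, of i "freq k"]
  show ?thesis by (simp add: trig_def[abs_def] mult.commute)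
qed

lemma abs_trig_le: "\<bar>trig k x\<bar> \<le> 2"
  using abs_triangle_ineq[of "cos (freq k \<bullet> x)" "sin (freq k \<bullet> x)"]
    abs_cos_le_one[of "freq k \<bullet> x"] abs_sin_le_one[of "freq k \<bullet> x"]
  unfolding trig_def by linarith

lemma trig_square: "(trig k x)\<^sup>2 = 1 + sin (2 * (freq k \<bullet> x))"
  using sin_cos_squared_add[of "freq k \<bullet> x"]
  by (simp add: trig_def power2_sum sin_double algebra_simps)

lemma cos_freq: "cos (freq k \<bullet> x) = (trig k x + trig (- k) x) / 2"
  and sin_freq: "sin (freq k \<bullet> x) = (trig k x - trig (- k) x) / 2"
  by (simp_all add: trig_def)

text \<open>Products of modes are combinations of modes, which gives both orthonormality and the
algebra of trigonometric polynomials.\<close>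

lemma trig_mult: "trig k x * trig l x = (trig (k - l) x + trig (l - k) x + trig (k + l) x - trig (- k - l) x) / 2"
proof -
  have "trig k x * trig l x = cos (freq (k - l) \<bullet> x) + sin (freq (k + l) \<bullet> x)"
    by (simp add: trig_def inner_diff_left inner_add_left cos_diff sin_add algebra_simps)
  also have "\<dots> = (trig (k - l) x + trig (- (k - l)) x) / 2 + (trig (k + l) x - trig (- (k + l)) x) / 2"
    by (simp only: cos_freq sin_freq)
  finally show ?thesis by (simp add: add_divide_distrib diff_divide_distrib)
qed

lemma trig_periodic: "trig k (x + (\<chi> i. of_int (m $ i))) = trig k x"
proof -
  have "freq k \<bullet> (\<chi> i. of_int (m $ i)) = 2 * pi * of_int (\<Sum>i\<in>UNIV. k $ i * m $ i)"
    by (simp add: inner_vec_def freq_def sum_distrib_left mult.assoc)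
  then have "freq k \<bullet> (x + (\<chi> i. of_int (m $ i))) = freq k \<bullet> x + 2 * pi * of_int (\<Sum>i\<in>UNIV. k $ i * m $ i)"
    by (simp add: inner_add_right)
  then show ?thesis by (simp add: trig_def cos_add sin_add cos_int_2pin sin_int_2pin del: of_int_sum of_int_mult)
qed

lemma corner_periodic_trig: "corner_periodic (trig k)"
proof -
  have "corner S = (\<chi> i. of_int ((\<chi> i. of_bool (i \<in> S)) $ i))" for S :: "'a set"
    by (simp add: corner_def vec_eq_iff)
  then show ?thesis unfolding corner_periodic_def by (metis trig_periodic)
qed

lemma integrable_trig: "integrable (lebesgue_on unit_cube) (trig k)"
  by (rule finite_measure.integrable_const_bound[OF finite_measure_unit_cube, of _ 2])
    (auto intro!: AE_I2 abs_trig_le measurable_lebesgue_onI trig_measurable)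

lemma integral_trig: "(LINT x|lebesgue_on unit_cube. trig k x) = of_bool (k = 0)"
proof (cases "k = 0")
  case True
  then show ?thesis by (simp add: measure_restrict_space measure_unit_cube)
next
  case False
  then obtain i where i: "k $ i \<noteq> 0" by (auto simp: vec_eq_iff)
  let ?g = "partial_deriv i (trig (- k))"
  have w: "weak_pderiv big_cube i (trig (- k)) ?g" "weak_pderiv unit_cube i (trig (- k)) ?g"
    by (simp_all add: weak_pderiv_smooth smooth_trig)
  have per: "AE x in lebesgue_on unit_cube. trig (- k) (x + corner S) = trig (- k) x" for S
    using corner_periodic_trig[of "- k"] by (simp add: corner_periodic_def)
  have one: "corner_periodic (\<lambda>_. 1)" by (simp add: corner_periodic_def)
  have "partial_deriv i (\<lambda>x. 1::real) x = 0" for x by (rule partial_derivI) simp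
  then have "(LINT x|lebesgue_on unit_cube. wpd unit_cube i (trig (- k)) x) = 0"
    using periodic_weak_pderiv(5)[OF w(1) per smooth_fun_const one] by simp
  moreover have "(LINT x|lebesgue_on unit_cube. wpd unit_cube i (trig (- k)) x) = (LINT x|lebesgue_on unit_cube. ?g x)"
    by (rule integral_cong_AE)
      (use wpd_AE_eq[OF open_unit_cube w(2)] periodic_weak_pderiv(4)[OF w(1) per] in
        \<open>auto intro!: measurable_lebesgue_onI continuous_measurable_lebesgue continuous_partial_deriv smooth_trig\<close>)
  ultimately show ?thesis using i False by (simp add: partial_deriv_trig freq_def)
qed

lemma trig_orthonormal: "L2_inner unit_cube (trig k) (trig l) = of_bool (k = l)"
proof -
  have "L2_inner unit_cube (trig k) (trig l) =
      (LINT x|lebesgue_on unit_cube. (trig (k - l) x + trig (l - k) x + trig (k + l) x - trig (- k - l) x) / 2)"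
    by (simp add: L2_inner_def trig_mult)
  also have "\<dots> = (of_bool (k - l = 0) + of_bool (l - k = 0) + of_bool (k + l = 0) - of_bool (- k - l = 0)) / 2"
    by (simp add: integrable_trig integral_trig)
  also have "\<dots> = of_bool (k = l)"
  proof -
    have "- k - l = - (k + l)" by simp
    then have "- k - l = 0 \<longleftrightarrow> k + l = 0" by (simp only: neg_equal_0_iff_equal)
    moreover have "l - k = 0 \<longleftrightarrow> k = l" by auto
    ultimately show ?thesis by (simp only: right_minus_eq) simp
  qed
  finally show ?thesis .
qed

subsection \<open>Completeness\<close>

inductive trigpoly :: "(real ^ 'd::finite \<Rightarrow> real) \<Rightarrow> bool" where
  base: "trigpoly (\<lambda>x. c * trig k x)"
| add: "trigpoly p \<Longrightarrow> trigpoly q \<Longrightarrow> trigpoly (\<lambda>x. p x + q x)"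

lemma trigpoly_const: "trigpoly (\<lambda>x. c)"
  using trigpoly.base[of c 0] by simp

lemma trigpoly_mult: "trigpoly p \<Longrightarrow> trigpoly q \<Longrightarrow> trigpoly (\<lambda>x. p x * q x)"
proof (induction p arbitrary: q rule: trigpoly.induct)
  case (base c k)
  from \<open>trigpoly q\<close> show ?case
  proof (induction q rule: trigpoly.induct)
    case (base d l)
    have "trigpoly (\<lambda>x. ((c * d / 2) * trig (k - l) x + (c * d / 2) * trig (l - k) x)
        + ((c * d / 2) * trig (k + l) x + (- (c * d / 2)) * trig (- k - l) x))"
      by (intro trigpoly.intros)
    moreover have "((c * d / 2) * trig (k - l) x + (c * d / 2) * trig (l - k) x)
        + ((c * d / 2) * trig (k + l) x + (- (c * d / 2)) * trig (- k - l) x) = (c * trig k x) * (d * trig l x)" for x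
    proof -
      have "(c * trig k x) * (d * trig l x) = (c * d) * (trig k x * trig l x)" by simp
      then show ?thesis unfolding trig_mult by (simp add: algebra_simps)
    qed
    ultimately show ?case by simp
  next
    case (add q1 q2)
    then have "trigpoly (\<lambda>x. c * trig k x * q1 x + c * trig k x * q2 x)" by (intro trigpoly.add)
    then show ?case by (simp add: distrib_left)
  qed
next
  case (add p1 p2)
  then have "trigpoly (\<lambda>x. p1 x * q x + p2 x * q x)" by (intro trigpoly.add) auto
  then show ?case by (simp add: distrib_right)
qed

lemma trigpoly_prod: "finite I \<Longrightarrow> (\<And>i. i \<in> I \<Longrightarrow> trigpoly (p i)) \<Longrightarrow> trigpoly (\<lambda>x. \<Prod>i\<in>I. p i x)"
  by (induction I rule: finite_induct) (auto intro: trigpoly_const trigpoly_mult)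

lemma trigpoly_polynomial:
  fixes p :: "real \<Rightarrow> real"
  assumes "real_polynomial_function p" "trigpoly q" shows "trigpoly (\<lambda>x. p (q x))"
  using assms(1)
proof (induction p rule: real_polynomial_function.induct)
  case (linear f)
  then obtain c where "f = (\<lambda>x. x * c)" using real_bounded_linear[of f] by auto
  then show ?case using trigpoly_mult[OF assms(2) trigpoly_const[of c]] by simp
qed (auto intro: trigpoly_const trigpoly.add trigpoly_mult)

lemma trigpoly_coord: "trigpoly (\<lambda>x. cos (2 * pi * (x $ i - \<theta>)))"
proof -
  let ?k = "axis i 1 :: int ^ 'a"
  have f: "freq ?k \<bullet> x = 2 * pi * x $ i" for x :: "real ^ 'a"
  proof -
    have "freq ?k = axis i (2 * pi)" by (simp add: freq_def vec_eq_iff axis_def)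
    then show ?thesis by (simp add: inner_axis')
  qed
  have "trigpoly (\<lambda>x. ((cos (2 * pi * \<theta>) / 2) * trig ?k x + (cos (2 * pi * \<theta>) / 2) * trig (- ?k) x)
     + ((sin (2 * pi * \<theta>) / 2) * trig ?k x + (- (sin (2 * pi * \<theta>) / 2)) * trig (- ?k) x))"
    by (intro trigpoly.intros)
  moreover have "((cos (2 * pi * \<theta>) / 2) * trig ?k x + (cos (2 * pi * \<theta>) / 2) * trig (- ?k) x)
     + ((sin (2 * pi * \<theta>) / 2) * trig ?k x + (- (sin (2 * pi * \<theta>) / 2)) * trig (- ?k) x)
     = cos (2 * pi * (x $ i - \<theta>))" for x
  proof -
    have "cos (2 * pi * (x $ i - \<theta>)) = cos (freq ?k \<bullet> x) * cos (2 * pi * \<theta>) + sin (freq ?k \<bullet> x) * sin (2 * pi * \<theta>)"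
      unfolding f right_diff_distrib by (rule cos_diff)
    then show ?thesis unfolding cos_freq sin_freq by (simp add: algebra_simps add_divide_distrib diff_divide_distrib)
  qed
  ultimately show ?thesis by simp
qed

lemma trigpoly_orthogonal:
  assumes "trigpoly p" "integrable (lebesgue_on unit_cube) f"
    and "\<And>k. (LINT x|lebesgue_on unit_cube. f x * trig k x) = 0"
  shows "integrable (lebesgue_on unit_cube) (\<lambda>x. f x * p x) \<and> (LINT x|lebesgue_on unit_cube. f x * p x) = 0"
  using assms(1)
proof (induction rule: trigpoly.induct)
  case (base c k)
  have "integrable (lebesgue_on unit_cube) (\<lambda>x. f x * trig k x)"
    by (rule integrable_mult_bounded_measurable[OF assms(2) _ abs_trig_le])
      (intro measurable_lebesgue_onI trig_measurable)
  then have "integrable (lebesgue_on unit_cube) (\<lambda>x. c * (f x * trig k x))"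
    "(LINT x|lebesgue_on unit_cube. c * (f x * trig k x)) = 0"
    using assms(3) by simp_all
  then show ?case by (simp add: mult.left_commute)
next
  case (add p q)
  then show ?case by (simp add: distrib_left)
qed

text \<open>Membership in an interval inside \<open>(0, 1)\<close> is a superlevel condition on one cosine
centred at its midpoint.\<close>

lemma cos_gt_iff_in_interval:
  assumes "0 < a" "a < b" "b < 1" "0 < x" "x < (1::real)"
  shows "cos (pi * (b - a)) < cos (2 * pi * (x - (a + b) / 2)) \<longleftrightarrow> a < x \<and> x < b"
proof -
  define u where "u = \<bar>2 * x - (a + b)\<bar>"
  have u: "0 \<le> u" "u < 2 - (b - a)" using assms by (auto simp: u_def)
  have c: "cos (2 * pi * (x - (a + b) / 2)) = cos (pi * u)"
  proof -
    have "2 * pi * (x - (a + b) / 2) = pi * (2 * x - (a + b))" by (simp add: field_simps)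
    moreover have "pi * u = \<bar>pi * (2 * x - (a + b))\<bar>" by (simp add: u_def abs_mult)
    ultimately show ?thesis by (simp only: cos_abs_real)
  qed
  have s: "0 < b - a" "b - a < 1" using assms by auto
  have "cos (pi * (b - a)) < cos (pi * u) \<longleftrightarrow> u < b - a"
  proof (cases "u \<le> 1")
    case True
    then have "cos (pi * (b - a)) < cos (pi * u) \<longleftrightarrow> pi * u < pi * (b - a)"
      using u s by (intro cos_mono_less_eq) auto
    then show ?thesis by simp
  next
    case False
    have "cos (pi * u) = cos (pi * (2 - u))"
      using cos_2pi_minus[of "pi * u"] by (simp add: algebra_simps)
    moreover have "cos (pi * (b - a)) < cos (pi * (2 - u)) \<longleftrightarrow> pi * (2 - u) < pi * (b - a)"
      using u s False by (intro cos_mono_less_eq) auto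
    ultimately show ?thesis using u s False by auto
  qed
  moreover have "u < b - a \<longleftrightarrow> a < x \<and> x < b" by (auto simp: u_def)
  ultimately show ?thesis using c by simp
qed

text \<open>Weierstrass approximation of the ramps \<open>min 1 (max 0 (n (y - \<kappa>)))\<close>, which
increase to the indicator of \<open>y > \<kappa>\<close>.\<close>

lemma polynomial_step_approximation:
  obtains p :: "nat \<Rightarrow> real \<Rightarrow> real" where "\<And>n. real_polynomial_function (p n)"
    "\<And>n y. y \<in> {-1..1} \<Longrightarrow> \<bar>p n y\<bar> \<le> 2"
    "\<And>y. y \<in> {-1..1} \<Longrightarrow> (\<lambda>n. p n y) \<longlonglongrightarrow> of_bool (\<kappa> < y)"
proof -
  define q where "q n y = min 1 (max 0 (real n * (y - \<kappa>)))" for n y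
  have "\<exists>g. real_polynomial_function g \<and> (\<forall>y\<in>{-1..1}. \<bar>q n y - g y\<bar> < inverse (real (Suc n)))" for n
  proof -
    have "continuous_on {-1..1} (\<lambda>y. min 1 (max 0 (real n * (y - \<kappa>))))"
      by (intro continuous_on_min continuous_on_max continuous_on_mult continuous_on_diff
          continuous_on_const continuous_on_id)
    then have c: "continuous_on {-1..1} (q n)" by (simp only: q_def[abs_def])
    have e: "0 < inverse (real (Suc n))" by simp
    show ?thesis
      by (rule Stone_Weierstrass_real_polynomial_function[OF compact_Icc c e]) blast
  qed
  then have "\<forall>n. \<exists>g. real_polynomial_function g \<and> (\<forall>y\<in>{-1..1}. \<bar>q n y - g y\<bar> < inverse (real (Suc n)))"
    by blast
  from choice[OF this] obtain p where
    "\<forall>n. real_polynomial_function (p n) \<and> (\<forall>y\<in>{-1..1}. \<bar>q n y - p n y\<bar> < inverse (real (Suc n)))"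
    by blast
  then have p: "real_polynomial_function (p n)"
    "y \<in> {-1..1} \<Longrightarrow> \<bar>q n y - p n y\<bar> < inverse (real (Suc n))" for n y
    by blast+
  have q01: "0 \<le> q n y" "q n y \<le> 1" for n y by (auto simp: q_def)
  show ?thesis
  proof (rule that[OF p(1)])
    fix n y assume y: "y \<in> {-1..1::real}"
    have "inverse (real (Suc n)) \<le> 1" by (simp add: inverse_le_1_iff)
    then show "\<bar>p n y\<bar> \<le> 2" using p(2)[OF y, of n] q01[of n y] by linarith
  next
    fix y assume y: "y \<in> {-1..1::real}"
    have "(\<lambda>n. q n y - p n y) \<longlonglongrightarrow> 0"
      by (rule Lim_null_comparison[OF _ LIMSEQ_inverse_real_of_nat])
        (use p(2)[OF y] in \<open>auto intro!: always_eventually less_imp_le\<close>)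
    moreover have "(\<lambda>n. q n y) \<longlonglongrightarrow> of_bool (\<kappa> < y)"
    proof (cases "\<kappa> < y")
      case True
      have "\<forall>\<^sub>F n in sequentially. q n y = 1"
        using eventually_ge_at_top[of "nat \<lceil>1 / (y - \<kappa>)\<rceil>"]
      proof eventually_elim
        case (elim n)
        then have "1 / (y - \<kappa>) \<le> real n" by linarith
        then have "1 \<le> real n * (y - \<kappa>)" using True by (simp add: pos_divide_le_eq)
        then show ?case by (simp add: q_def)
      qed
      then show ?thesis using True by (simp add: tendsto_eventually)
    next
      case False
      then have "real n * (y - \<kappa>) \<le> 0" for n by (simp add: mult_le_0_iff)
      then have "q n y = 0" for n by (simp add: q_def max_absorb1)
      then show ?thesis using False by simp
    qed
    ultimately have "(\<lambda>n. q n y - (q n y - p n y)) \<longlonglongrightarrow> of_bool (\<kappa> < y) - 0" by (intro tendsto_diff)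
    then show "(\<lambda>n. p n y) \<longlonglongrightarrow> of_bool (\<kappa> < y)" by simp
  qed
qed

text \<open>By \<open>cos_gt_iff_in_interval\<close> the indicator of a box in the unit cube is a product
of indicators of superlevel sets of trigonometric polynomials, hence a bounded pointwise limit of
trigonometric polynomials. Thus \<open>f\<close> integrates to \<open>0\<close> over every such box.\<close>

theorem trig_complete:
  fixes f :: "real ^ 'd::finite \<Rightarrow> real"
  assumes f: "integrable (lebesgue_on unit_cube) f"
    and zero: "\<And>k. (LINT x|lebesgue_on unit_cube. f x * trig k x) = 0"
  shows "AE x in lebesgue_on unit_cube. f x = 0"
proof (rule AE_zero_if_box_integrals_zero[OF open_unit_cube])
  show "locally_integrable unit_cube f"
    unfolding locally_integrable_def
  proof (intro allI impI)
    fix C :: "(real ^ 'd) set" assume C: "compact C \<and> C \<subseteq> unit_cube"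
    then have CL: "C \<in> sets lebesgue" by (simp add: lmeasurable_compact fmeasurableD)
    have "integrable lebesgue (\<lambda>x. (indicator unit_cube x * f x) * indicator C x)"
      using f by (intro integrable_mult_bounded_measurable[where B=1 and g="indicator C"] borel_measurable_indicator CL)
        (auto simp: integrable_lebesgue_on_indicator)
    then have "integrable lebesgue (\<lambda>x. indicator C x * f x)"
      by (rule back_subst[of "integrable lebesgue"]) (use C in \<open>auto simp: indicator_def fun_eq_iff\<close>)
    then show "integrable (lebesgue_on C) f" using CL by (simp add: integrable_lebesgue_on_indicator)
  qed
  fix a b :: "real ^ 'd" assume ab: "cbox a b \<subseteq> unit_cube"
  show "(LINT x|lebesgue. indicator (box a b) x * f x) = 0"
  proof (cases "\<forall>i. a $ i < b $ i")
    case False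
    then obtain i where "b $ i \<le> a $ i" by (auto simp: not_less)
    then have "\<not> (a $ i < x $ i \<and> x $ i < b $ i)" for x :: "real ^ 'd" by linarith
    then have "box a b = {}" unfolding mem_box_cart set_eq_iff by blast
    then show ?thesis by simp
  next
    case True
    then have "a \<in> cbox a b" "b \<in> cbox a b" by (auto simp: mem_box_cart less_imp_le)
    then have ab01: "0 < a $ i" "b $ i < 1" for i using ab by (auto simp: unit_cube_iff subset_iff)
    define \<kappa> where "\<kappa> i = cos (pi * (b $ i - a $ i))" for i
    have "\<exists>p :: nat \<Rightarrow> real \<Rightarrow> real. (\<forall>n. real_polynomial_function (p n)) \<and>
      (\<forall>n y. y \<in> {-1..1} \<longrightarrow> \<bar>p n y\<bar> \<le> 2) \<and> (\<forall>y. y \<in> {-1..1} \<longrightarrow> (\<lambda>n. p n y) \<longlonglongrightarrow> of_bool (\<kappa> i < y))" for i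
      by (rule polynomial_step_approximation[of "\<kappa> i"]) blast
    then obtain p :: "'d \<Rightarrow> nat \<Rightarrow> real \<Rightarrow> real" where p: "\<And>i n. real_polynomial_function (p i n)"
      "\<And>i n y. y \<in> {-1..1} \<Longrightarrow> \<bar>p i n y\<bar> \<le> 2"
      "\<And>i y. y \<in> {-1..1} \<Longrightarrow> (\<lambda>n. p i n y) \<longlonglongrightarrow> of_bool (\<kappa> i < y)"
      using choice[of "\<lambda>i p. (\<forall>n. real_polynomial_function (p n)) \<and>
      (\<forall>n y. y \<in> {-1..1} \<longrightarrow> \<bar>p n y\<bar> \<le> 2) \<and> (\<forall>y. y \<in> {-1..1} \<longrightarrow> (\<lambda>n. p n y) \<longlonglongrightarrow> of_bool (\<kappa> i < y))"]
      by blast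
    define c where "c i x = cos (2 * pi * (x $ i - (a $ i + b $ i) / 2))" for i and x :: "real ^ 'd"
    have c1: "c i x \<in> {-1..1}" for i x by (simp add: c_def)
    define P where "P n x = (\<Prod>i\<in>UNIV. p i n (c i x))" for n x
    have tp: "trigpoly (P n)" for n
      unfolding P_def[abs_def] c_def by (rule trigpoly_prod[OF finite trigpoly_polynomial[OF p(1) trigpoly_coord]])
    have P0: "(LINT x|lebesgue_on unit_cube. f x * P n x) = 0" and Pi: "integrable (lebesgue_on unit_cube) (\<lambda>x. f x * P n x)" for n
      using trigpoly_orthogonal[OF tp f zero] by auto
    have "(\<lambda>n. LINT x|lebesgue_on unit_cube. f x * P n x) \<longlonglongrightarrow> (LINT x|lebesgue_on unit_cube. f x * indicator (box a b) x)"
    proof (rule integral_dominated_convergence)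
      show "integrable (lebesgue_on unit_cube) (\<lambda>x. 2 ^ CARD('d) * \<bar>f x\<bar>)" using f by simp
      show "AE x in lebesgue_on unit_cube. norm (f x * P n x) \<le> 2 ^ CARD('d) * \<bar>f x\<bar>" for n
      proof (rule AE_I2)
        fix x
        have "\<bar>P n x\<bar> \<le> (\<Prod>i::'d\<in>UNIV. 2)"
          unfolding P_def abs_prod by (intro prod_mono) (use p(2) c1 in auto)
        then show "norm (f x * P n x) \<le> 2 ^ CARD('d) * \<bar>f x\<bar>"
          by (simp add: abs_mult mult.commute mult_left_mono)
      qed
      show "AE x in lebesgue_on unit_cube. (\<lambda>n. f x * P n x) \<longlonglongrightarrow> f x * indicator (box a b) x"
      proof (rule AE_I2, intro tendsto_mult tendsto_const)
        fix x assume "x \<in> space (lebesgue_on (unit_cube :: (real ^ 'd) set))"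
        then have x: "0 < x $ i" "x $ i < 1" for i by (auto simp: unit_cube_iff)
        have "(\<lambda>n. P n x) \<longlonglongrightarrow> (\<Prod>i\<in>UNIV. of_bool (\<kappa> i < c i x))"
          unfolding P_def by (intro tendsto_prod p c1)
        moreover have "\<kappa> i < c i x \<longleftrightarrow> a $ i < x $ i \<and> x $ i < b $ i" for i
          unfolding \<kappa>_def c_def using True ab01 x by (intro cos_gt_iff_in_interval) auto
        moreover have "(\<Prod>i\<in>UNIV. of_bool (a $ i < x $ i \<and> x $ i < b $ i)) = (indicator (box a b) x :: real)"
        proof (cases "x \<in> box a b")
          case False
          then obtain i where "\<not> (a $ i < x $ i \<and> x $ i < b $ i)" by (auto simp: mem_box_cart)
          then have "(\<Prod>i\<in>UNIV. of_bool (a $ i < x $ i \<and> x $ i < b $ i)) = (0::real)"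
            by (intro prod_zero) (auto intro!: bexI[of _ i])
          with False show ?thesis by simp
        qed (simp add: mem_box_cart)
        ultimately show "(\<lambda>n. P n x) \<longlonglongrightarrow> indicator (box a b) x" by simp
      qed
      show "(\<lambda>x. f x * P n x) \<in> borel_measurable (lebesgue_on unit_cube)" for n
        using Pi by (rule borel_measurable_integrable)
      show "(\<lambda>x. f x * indicator (box a b) x) \<in> borel_measurable (lebesgue_on unit_cube)"
        by (intro borel_measurable_times borel_measurable_integrable[OF f] measurable_lebesgue_onI indicator_box_measurable)
    qed
    then have "(LINT x|lebesgue_on unit_cube. f x * indicator (box a b) x) = 0"
      by (simp add: P0 LIMSEQ_const_iff)
    then have "(LINT x|lebesgue. indicator unit_cube x * (f x * indicator (box a b) x)) = 0"
      by (simp add: integral_lebesgue_on_indicator)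
    moreover have "(\<lambda>x. indicator unit_cube x * (f x * indicator (box a b) x)) = (\<lambda>x. indicator (box a b) x * f x)"
      using ab box_subset_cbox[of a b] by (auto simp: indicator_def fun_eq_iff)
    ultimately show ?thesis by simp
  qed
qed

section \<open>Square integrable functions and Bessel's inequality\<close>

lemma L2_measurable: "f \<in> L2_space \<Omega> \<Longrightarrow> f \<in> borel_measurable (lebesgue_on \<Omega>)"
  and L2_square_integrable: "f \<in> L2_space \<Omega> \<Longrightarrow> integrable (lebesgue_on \<Omega>) (\<lambda>x. (f x)\<^sup>2)"
  by (auto simp: L2_space_def)

lemma L2_mult_integrable:
  assumes "f \<in> L2_space \<Omega>" "g \<in> L2_space \<Omega>"
  shows "integrable (lebesgue_on \<Omega>) (\<lambda>x. f x * g x)"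
proof (rule Bochner_Integration.integrable_bound)
  show "integrable (lebesgue_on \<Omega>) (\<lambda>x. (f x)\<^sup>2 + (g x)\<^sup>2)"
    using assms by (simp add: L2_square_integrable)
  show "(\<lambda>x. f x * g x) \<in> borel_measurable (lebesgue_on \<Omega>)"
    using assms by (auto intro: borel_measurable_times L2_measurable)
  have "\<bar>a * b\<bar> \<le> a\<^sup>2 + b\<^sup>2" for a b :: real
  proof -
    have "0 \<le> (\<bar>a\<bar> - \<bar>b\<bar>)\<^sup>2" by simp
    then have "2 * (\<bar>a\<bar> * \<bar>b\<bar>) \<le> a\<^sup>2 + b\<^sup>2" by (simp add: power2_diff)
    moreover have "0 \<le> \<bar>a\<bar> * \<bar>b\<bar>" by simp
    ultimately show ?thesis unfolding abs_mult by linarith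
  qed
  then show "AE x in lebesgue_on \<Omega>. norm (f x * g x) \<le> norm ((f x)\<^sup>2 + (g x)\<^sup>2)"
    by (intro AE_I2) simp
qed

lemma L2_add: "f \<in> L2_space \<Omega> \<Longrightarrow> g \<in> L2_space \<Omega> \<Longrightarrow> (\<lambda>x. f x + g x) \<in> L2_space \<Omega>"
  using L2_mult_integrable[of f \<Omega> g]
  by (auto simp: L2_space_def power2_sum mult.assoc)

lemma L2_scale: "f \<in> L2_space \<Omega> \<Longrightarrow> (\<lambda>x. c * f x) \<in> L2_space \<Omega>"
  by (auto simp: L2_space_def power_mult_distrib)

lemma L2_diff: "f \<in> L2_space \<Omega> \<Longrightarrow> g \<in> L2_space \<Omega> \<Longrightarrow> (\<lambda>x. f x - g x) \<in> L2_space \<Omega>"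
  using L2_add[OF _ L2_scale[of g \<Omega> "-1"]] by simp

lemma L2_zero: "(\<lambda>x. 0) \<in> L2_space \<Omega>"
  by (simp add: L2_space_def)

lemma L2_sum: "(\<And>i. i \<in> I \<Longrightarrow> f i \<in> L2_space \<Omega>) \<Longrightarrow> (\<lambda>x. \<Sum>i\<in>I. f i x) \<in> L2_space \<Omega>"
  by (induction I rule: infinite_finite_induct) (auto intro: L2_zero L2_add)

lemma L2_AE:
  assumes "\<Omega> \<in> sets lebesgue" "f \<in> L2_space \<Omega>" "AE x in lebesgue_on \<Omega>. f x = g x"
  shows "g \<in> L2_space \<Omega>"
proof -
  have "AE x in lebesgue_on \<Omega>. (f x)\<^sup>2 = (g x)\<^sup>2" using assms(3) by eventually_elim simp
  then show ?thesis
    using measurable_lebesgue_on_AE[OF assms(1) L2_measurable[OF assms(2)] assms(3)]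
      integrable_lebesgue_on_AE[OF assms(1) L2_square_integrable[OF assms(2)]]
    by (simp add: L2_space_def)
qed

lemma L2_bounded:
  assumes "\<Omega> \<in> lmeasurable" "f \<in> borel_measurable (lebesgue_on \<Omega>)" "\<And>x. \<bar>f x\<bar> \<le> B"
  shows "f \<in> L2_space \<Omega>"
proof -
  have "(f x)\<^sup>2 \<le> B\<^sup>2" for x
    using power_mono[OF assms(3)[of x] abs_ge_zero, of 2] by simp
  then have "integrable (lebesgue_on \<Omega>) (\<lambda>x. (f x)\<^sup>2)"
    using assms(2) by (intro finite_measure.integrable_const_bound[OF finite_measure_lebesgue_on[OF assms(1)], where B="B\<^sup>2"])
      (auto intro!: AE_I2)
  then show ?thesis using assms(2) by (simp add: L2_space_def)
qed

lemma lmeasurable_unit_cube: "unit_cube \<in> lmeasurable"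
  by (simp add: unit_cube_def)

lemma L2_unit_cube_integrable:
  assumes "f \<in> L2_space unit_cube" shows "integrable (lebesgue_on unit_cube) f"
proof -
  have "(\<lambda>x. 1) \<in> L2_space unit_cube"
    by (rule L2_bounded[OF lmeasurable_unit_cube, where B=1]) auto
  from L2_mult_integrable[OF assms this] show ?thesis by simp
qed

lemma L2_subset:
  assumes "f \<in> L2_space \<Omega>" "\<Omega>' \<subseteq> \<Omega>" "\<Omega> \<in> sets lebesgue" "\<Omega>' \<in> sets lebesgue"
  shows "f \<in> L2_space \<Omega>'"
proof -
  have "lebesgue_on \<Omega>' = restrict_space (lebesgue_on \<Omega>) \<Omega>'"
    using assms by (simp add: restrict_restrict_space Int_absorb1)
  moreover have sub: "\<Omega>' \<in> sets (lebesgue_on \<Omega>)"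
    using assms by (auto simp: sets_restrict_space Int_absorb1 intro!: image_eqI[of _ _ \<Omega>'])
  moreover have "\<Omega>' \<inter> space (lebesgue_on \<Omega>) \<in> sets (lebesgue_on \<Omega>)"
    using sub assms(2) by (simp add: Int_absorb2)
  ultimately show ?thesis
    using assms(1) integrable_mult_indicator[OF sub, of "\<lambda>x. (f x)\<^sup>2"]
    unfolding L2_space_def by (auto simp: integrable_restrict_space intro: measurable_restrict_space1)
qed

lemma L2_inner_commute: "L2_inner \<Omega> f g = L2_inner \<Omega> g f"
  by (simp add: L2_inner_def mult.commute)

lemma L2_inner_linear:
  assumes "f \<in> L2_space \<Omega>" "g \<in> L2_space \<Omega>" "h \<in> L2_space \<Omega>"
  shows "L2_inner \<Omega> (\<lambda>x. f x + g x) h = L2_inner \<Omega> f h + L2_inner \<Omega> g h"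
    and "L2_inner \<Omega> (\<lambda>x. f x - g x) h = L2_inner \<Omega> f h - L2_inner \<Omega> g h"
  using L2_mult_integrable[OF assms(1,3)] L2_mult_integrable[OF assms(2,3)]
  by (simp_all add: L2_inner_def distrib_right left_diff_distrib)

lemma L2_inner_sum_left:
  assumes "\<And>i. i \<in> I \<Longrightarrow> f i \<in> L2_space \<Omega>" "h \<in> L2_space \<Omega>"
  shows "L2_inner \<Omega> (\<lambda>x. \<Sum>i\<in>I. c i * f i x) h = (\<Sum>i\<in>I. c i * L2_inner \<Omega> (f i) h)"
proof -
  have "L2_inner \<Omega> (\<lambda>x. \<Sum>i\<in>I. c i * f i x) h = (LINT x|lebesgue_on \<Omega>. (\<Sum>i\<in>I. c i * (f i x * h x)))"
    by (simp add: L2_inner_def sum_distrib_right mult.assoc)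
  also have "\<dots> = (\<Sum>i\<in>I. LINT x|lebesgue_on \<Omega>. c i * (f i x * h x))"
    by (rule Bochner_Integration.integral_sum) (use L2_mult_integrable assms in auto)
  finally show ?thesis by (simp add: L2_inner_def)
qed

lemma L2_inner_AE_cong:
  assumes "\<Omega> \<in> sets lebesgue" "AE x in lebesgue_on \<Omega>. f x = f' x" "AE x in lebesgue_on \<Omega>. g x = g' x"
    and "(\<lambda>x. f x * g x) \<in> borel_measurable (lebesgue_on \<Omega>)"
  shows "L2_inner \<Omega> f g = L2_inner \<Omega> f' g'"
proof -
  have eq: "AE x in lebesgue_on \<Omega>. f x * g x = f' x * g' x"
    using assms(2,3) by eventually_elim simp
  show ?thesis unfolding L2_inner_def
    by (rule integral_cong_AE[OF assms(4) measurable_lebesgue_on_AE[OF assms(1,4) eq] eq])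
qed

lemma L2_inner_self_nonneg: "0 \<le> L2_inner \<Omega> f f"
  unfolding L2_inner_def by (intro integral_nonneg_AE AE_I2) simp

text \<open>The squared norm of \<open>f\<close> minus its orthogonal projection is nonnegative.\<close>

lemma bessel_finite:
  assumes f: "f \<in> L2_space \<Omega>" and I: "finite I" and e: "\<And>i. i \<in> I \<Longrightarrow> e i \<in> L2_space \<Omega>"
    and ortho: "\<And>i j. i \<in> I \<Longrightarrow> j \<in> I \<Longrightarrow> L2_inner \<Omega> (e i) (e j) = of_bool (i = j)"
  shows "(\<Sum>i\<in>I. (L2_inner \<Omega> f (e i))\<^sup>2) \<le> L2_inner \<Omega> f f"
proof -
  define c where "c i = L2_inner \<Omega> f (e i)" for i
  define g where "g x = (\<Sum>i\<in>I. c i * e i x)" for x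
  have g: "g \<in> L2_space \<Omega>" unfolding g_def[abs_def] by (intro L2_sum L2_scale e)
  have gh: "L2_inner \<Omega> g h = (\<Sum>i\<in>I. c i * L2_inner \<Omega> (e i) h)" if "h \<in> L2_space \<Omega>" for h
    unfolding g_def[abs_def] by (rule L2_inner_sum_left[OF e that])
  have ge: "L2_inner \<Omega> (e j) g = c j" if j: "j \<in> I" for j
  proof -
    have "L2_inner \<Omega> (e j) g = (\<Sum>i\<in>I. c i * L2_inner \<Omega> (e i) (e j))"
      using gh[OF e[OF j]] by (simp add: L2_inner_commute)
    also have "\<dots> = (\<Sum>i\<in>I. if i = j then c j else 0)"
      by (intro sum.cong) (auto simp: ortho j)
    finally show ?thesis using I j by simp
  qed
  have gg: "L2_inner \<Omega> g g = (\<Sum>i\<in>I. (c i)\<^sup>2)" using gh[OF g] by (simp add: ge power2_eq_square)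
  have gf: "L2_inner \<Omega> g f = (\<Sum>i\<in>I. (c i)\<^sup>2)"
    using gh[OF f] by (simp add: c_def L2_inner_commute power2_eq_square)
  have d: "(\<lambda>x. f x - g x) \<in> L2_space \<Omega>" by (rule L2_diff[OF f g])
  have "0 \<le> L2_inner \<Omega> (\<lambda>x. f x - g x) (\<lambda>x. f x - g x)" by (rule L2_inner_self_nonneg)
  also have "\<dots> = L2_inner \<Omega> f (\<lambda>x. f x - g x) - L2_inner \<Omega> g (\<lambda>x. f x - g x)"
    by (rule L2_inner_linear(2)[OF f g d])
  also have "\<dots> = (L2_inner \<Omega> f f - L2_inner \<Omega> g f) - (L2_inner \<Omega> f g - L2_inner \<Omega> g g)"
    using L2_inner_linear(2)[OF f g f] L2_inner_linear(2)[OF f g g]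
    by (simp add: L2_inner_commute[of _ _ "\<lambda>x. f x - g x"])
  finally show ?thesis using gg gf by (simp add: L2_inner_commute[of _ f g] c_def)
qed

section \<open>Sums over the lattice of frequencies\<close>

text \<open>An enumeration of the lattice, which turns sums over frequencies into ordinary series. All the
series below converge absolutely.\<close>

definition idx :: "nat \<Rightarrow> int ^ 'd::finite" where
  "idx = from_nat_into UNIV"

lemma infinite_lattice: "infinite (UNIV :: (int ^ 'd::finite) set)"
proof -
  have "inj (\<lambda>m::int. (\<chi> i. m) :: int ^ 'd)" by (auto simp: inj_def vec_eq_iff)
  then show ?thesis using infinite_UNIV_int finite_imageD[of "\<lambda>m::int. (\<chi> i. m) :: int ^ 'd" UNIV]
    by (auto dest: finite_subset[OF subset_UNIV])
qed

lemma bij_idx: "bij (idx :: nat \<Rightarrow> int ^ 'd::finite)"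
  unfolding idx_def using bij_betw_from_nat_into[OF _ infinite_lattice] by auto

lemma idx_eq_iff [simp]: "idx m = idx n \<longleftrightarrow> m = n"
  using bij_idx by (auto simp: bij_def inj_def)

lemma idx_surj: obtains n where "k = idx n"
  using bij_idx by (metis bij_pointE)

definition freq_sq :: "int ^ 'd::finite \<Rightarrow> real" where
  "freq_sq k = (\<Sum>i\<in>UNIV. (freq k $ i)\<^sup>2)"

lemma freq_sq_nonneg: "0 \<le> freq_sq k"
  by (simp add: freq_sq_def sum_nonneg)

lemma freq_sq_minus [simp]: "freq_sq (- k) = freq_sq k" by (simp add: freq_sq_def)

lemma freq_component_le: "(freq k $ i)\<^sup>2 \<le> freq_sq k"
  unfolding freq_sq_def by (rule member_le_sum) auto

lemma int_powr_sums_bounded: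
  assumes "1 / 2 < s"
  obtains B where "0 \<le> B" "\<And>F. finite F \<Longrightarrow> (\<Sum>m\<in>F. (1 + (of_int m)\<^sup>2) powr (- s)) \<le> (B::real)"
proof -
  define b where "b m = (1 + (of_int m)\<^sup>2) powr (- s)" for m :: int
  have b0: "0 \<le> b m" for m by (simp add: b_def)
  have "summable (\<lambda>j. b (int j))"
  proof (rule summable_comparison_test')
    show "summable (\<lambda>j::nat. real j powr (- 2 * s))"
      using assms summable_real_powr_iff[of "- 2 * s"] by simp
    fix j :: nat assume "j \<ge> 1"
    have "b (int j) \<le> ((real j)\<^sup>2) powr (- s)"
      unfolding b_def using \<open>j \<ge> 1\<close> assms by (intro powr_mono2') auto
    also have "((real j)\<^sup>2) powr (- s) = real j powr (- 2 * s)"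
      using \<open>j \<ge> 1\<close> by (simp add: powr_powr flip: powr_numeral)
    finally show "norm (b (int j)) \<le> real j powr (- 2 * s)" using b0 by simp
  qed
  note sm = this
  define B where "B = 2 * (\<Sum>j. b (int j))"
  have "(\<Sum>m\<in>F. b m) \<le> B" if F: "finite F" for F
  proof -
    define N where "N = nat (Max (insert 0 (abs ` F)))"
    have FN: "\<bar>m\<bar> \<le> int N" if "m \<in> F" for m
      unfolding N_def using F that by (simp add: le_max_iff_disj)
    have "F \<subseteq> int ` {..N} \<union> (\<lambda>j. - int j) ` {..N}"
    proof
      fix m assume "m \<in> F"
      from FN[OF this] have "m = int (nat m) \<and> nat m \<le> N \<or> m = - int (nat (- m)) \<and> nat (- m) \<le> N" by linarith
      then show "m \<in> int ` {..N} \<union> (\<lambda>j. - int j) ` {..N}" by blast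
    qed
    then have "sum b F \<le> sum b (int ` {..N} \<union> (\<lambda>j. - int j) ` {..N})"
      by (intro sum_mono2) (auto simp: b0)
    also have "\<dots> \<le> sum b (int ` {..N}) + sum b ((\<lambda>j. - int j) ` {..N})"
      by (subst sum.union_inter[symmetric]) (auto intro!: sum_nonneg b0)
    also have "sum b (int ` {..N}) = (\<Sum>j\<le>N. b (int j))"
      by (subst sum.reindex) (auto simp: inj_on_def)
    also have "sum b ((\<lambda>j. - int j) ` {..N}) = (\<Sum>j\<le>N. b (int j))"
      by (subst sum.reindex) (auto simp: inj_on_def b_def)
    also have "(\<Sum>j\<le>N. b (int j)) + (\<Sum>j\<le>N. b (int j)) \<le> B"
      using sum_le_suminf[OF sm, of "{..N}"] b0 by (simp add: B_def)
    finally show ?thesis .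
  qed
  moreover have "0 \<le> B" using suminf_nonneg[OF sm] b0 by (simp add: B_def)
  ultimately show ?thesis using that unfolding b_def by blast
qed

text \<open>Since \<open>1 + k\<^sub>i\<^sup>2 \<le> 1 + \<bar>2 \<pi> k\<bar>\<^sup>2\<close> for each coordinate, the summand is at most the product of
\<open>(1 + k\<^sub>i\<^sup>2) powr (- p / d)\<close>, whose sum over the lattice is a power of a convergent one-dimensional sum
precisely because \<open>p / d > 1 / 2\<close>.\<close>

lemma lattice_summable:
  assumes p: "real CARD('d::finite) / 2 < p"
  shows "summable (\<lambda>n. (1 + freq_sq (idx n :: int ^ 'd)) powr (- p))"
proof -
  let ?d = "real CARD('d)"
  define s where "s = p / ?d"
  have d0: "0 < ?d" by simp
  have s: "1 / 2 < s" using p d0 by (simp add: s_def field_simps)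
  obtain B where B: "0 \<le> B" "\<And>F. finite F \<Longrightarrow> (\<Sum>m\<in>F. (1 + (of_int m)\<^sup>2) powr (- s)) \<le> (B::real)"
    using int_powr_sums_bounded[OF s] by blast
  define b where "b m = (1 + (of_int m)\<^sup>2) powr (- s)" for m :: int
  have b0: "0 \<le> b m" for m by (simp add: b_def)
  have le: "(1 + freq_sq k) powr (- p) \<le> (\<Prod>i\<in>UNIV. b (k $ i))" for k :: "int ^ 'd"
  proof -
    have c: "1 + (of_int (k $ i))\<^sup>2 \<le> 1 + freq_sq k" for i
    proof -
      have "1 \<le> 2 * pi" using pi_gt3 by linarith
      then have "1 \<le> (2 * pi)\<^sup>2" by (rule one_le_power)
      then have "(of_int (k $ i))\<^sup>2 \<le> (2 * pi)\<^sup>2 * (of_int (k $ i))\<^sup>2"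
        using mult_right_mono[of 1 "(2 * pi)\<^sup>2" "(of_int (k $ i))\<^sup>2"] by simp
      also have "\<dots> = (freq k $ i)\<^sup>2" by (simp add: freq_def power_mult_distrib)
      finally show ?thesis using freq_component_le[of k i] by linarith
    qed
    have "(\<Prod>i\<in>UNIV. 1 + (of_int (k $ i))\<^sup>2) \<le> (\<Prod>i::'d\<in>UNIV. 1 + freq_sq k)"
      by (rule prod_mono) (use c in auto)
    then have "(\<Prod>i\<in>UNIV. 1 + (of_int (k $ i))\<^sup>2) \<le> (1 + freq_sq k) powr ?d"
      using freq_sq_nonneg[of k] by (simp add: powr_realpow)
    moreover have "0 < (\<Prod>i\<in>UNIV. 1 + (of_int (k $ i) :: real)\<^sup>2)"
      by (intro prod_pos) (auto intro: add_pos_nonneg)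
    ultimately have "((1 + freq_sq k) powr ?d) powr (- s) \<le> (\<Prod>i\<in>UNIV. 1 + (of_int (k $ i))\<^sup>2) powr (- s)"
      using s by (intro powr_mono2') auto
    moreover have "((1 + freq_sq k) powr ?d) powr (- s) = (1 + freq_sq k) powr (- p)"
      by (simp add: powr_powr s_def)
    ultimately show ?thesis by (simp add: b_def prod_powr_distrib)
  qed
  show ?thesis
  proof (rule summableI_nonneg_bounded[where x="B ^ CARD('d)"])
    fix N
    let ?A = "idx ` {..<N} :: (int ^ 'd) set"
    define G where "G = (\<lambda>(k, i). k $ i) ` (?A \<times> (UNIV :: 'd set))"
    have G: "finite G" by (simp add: G_def)
    have "(\<Sum>n<N. (1 + freq_sq (idx n :: int ^ 'd)) powr (- p)) = (\<Sum>k\<in>?A. (1 + freq_sq k) powr (- p))"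
      by (subst sum.reindex) (auto simp: inj_on_def)
    also have "\<dots> \<le> (\<Sum>k\<in>?A. \<Prod>i\<in>UNIV. b (k $ i))" by (intro sum_mono le)
    also have "\<dots> = (\<Sum>g\<in>vec_nth ` ?A. \<Prod>i\<in>UNIV. b (g i))"
      by (subst sum.reindex) (auto simp: inj_on_def vec_nth_inject)
    also have "\<dots> \<le> (\<Sum>g\<in>PiE (UNIV :: 'd set) (\<lambda>_. G). \<Prod>i\<in>UNIV. b (g i))"
      by (rule sum_mono2) (auto simp: G G_def intro!: finite_PiE prod_nonneg b0)
    also have "\<dots> = (\<Prod>i::'d\<in>UNIV. \<Sum>m\<in>G. b m)"
      by (rule prod_sum_PiE[symmetric]) (auto simp: G)
    also have "\<dots> \<le> (\<Prod>i::'d\<in>UNIV. B)"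
      by (rule prod_mono) (use B(2)[OF G] in \<open>auto simp: b_def intro!: sum_nonneg\<close>)
    finally show "(\<Sum>n<N. (1 + freq_sq (idx n :: int ^ 'd)) powr (- p)) \<le> B ^ CARD('d)" by simp
  qed simp
qed

lemma summable_mult_of_squares:
  fixes a b :: "nat \<Rightarrow> real"
  assumes "summable (\<lambda>n. (a n)\<^sup>2)" "summable (\<lambda>n. (b n)\<^sup>2)" shows "summable (\<lambda>n. \<bar>a n * b n\<bar>)"
proof (rule summable_comparison_test'[OF summable_add[OF assms]])
  fix n
  have "0 \<le> (\<bar>a n\<bar> - \<bar>b n\<bar>)\<^sup>2" by simp
  then have "2 * (\<bar>a n\<bar> * \<bar>b n\<bar>) \<le> (a n)\<^sup>2 + (b n)\<^sup>2" by (simp add: power2_diff)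
  moreover have "0 \<le> \<bar>a n\<bar> * \<bar>b n\<bar>" by simp
  ultimately show "norm \<bar>a n * b n\<bar> \<le> (a n)\<^sup>2 + (b n)\<^sup>2" unfolding abs_mult real_norm_def abs_abs by linarith
qed

section \<open>Absolutely convergent trigonometric series\<close>

abbreviation coef :: "(real ^ 'd::finite \<Rightarrow> real) \<Rightarrow> int ^ 'd \<Rightarrow> real" where
  "coef f k \<equiv> L2_inner unit_cube f (trig k)"

text \<open>The frequencies form a sequence of their own, because a termwise derivative carries the
frequency \<open>k\<close> to \<open>- k\<close>.\<close>

definition trig_series :: "(nat \<Rightarrow> real) \<Rightarrow> (nat \<Rightarrow> int ^ 'd::finite) \<Rightarrow> real ^ 'd \<Rightarrow> real" where
  "trig_series a m x = (\<Sum>n. a n * trig (m n) x)"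

lemma trig_L2: "\<Omega> \<in> lmeasurable \<Longrightarrow> trig k \<in> L2_space \<Omega>"
  by (rule L2_bounded[OF _ _ abs_trig_le]) (auto intro: measurable_lebesgue_onI trig_measurable)

lemma trig_term_bound: "\<bar>a * trig k x\<bar> \<le> 2 * \<bar>a\<bar>"
  using mult_left_mono[OF abs_trig_le[of k x], of "\<bar>a\<bar>"] by (simp add: abs_mult mult.commute)

context
  fixes a :: "nat \<Rightarrow> real" and m :: "nat \<Rightarrow> int ^ 'd::finite"
  assumes a: "summable (\<lambda>n. \<bar>a n\<bar>)"
begin

lemma summable_trig_series: "summable (\<lambda>n. a n * trig (m n) x)"
  by (rule summable_rabs_cancel, rule summable_comparison_test'[OF summable_mult[OF a, of 2]])
    (simp add: trig_term_bound)

lemma continuous_trig_series: "continuous_on UNIV (trig_series a m)"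
  unfolding trig_series_def[abs_def]
  by (rule continuous_on_suminf_M_test[OF _ trig_term_bound summable_mult[OF a]])
    (intro continuous_on_mult continuous_on_const continuous_trig)

lemma trig_series_measurable: "trig_series a m \<in> borel_measurable (lebesgue_on \<Omega>)"
  by (intro measurable_lebesgue_onI continuous_measurable_lebesgue continuous_trig_series)

lemma trig_series_bound: "\<bar>trig_series a m x\<bar> \<le> 2 * (\<Sum>n. \<bar>a n\<bar>)"
proof -
  have s: "summable (\<lambda>n. \<bar>a n * trig (m n) x\<bar>)"
    by (rule summable_comparison_test'[OF summable_mult[OF a, of 2]]) (simp add: trig_term_bound)
  have "\<bar>trig_series a m x\<bar> \<le> (\<Sum>n. \<bar>a n * trig (m n) x\<bar>)"
    unfolding trig_series_def by (rule summable_rabs[OF s])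
  also have "\<dots> \<le> (\<Sum>n. 2 * \<bar>a n\<bar>)" by (rule suminf_le[OF trig_term_bound s summable_mult[OF a]])
  also have "\<dots> = 2 * (\<Sum>n. \<bar>a n\<bar>)" by (rule suminf_mult[OF a])
  finally show ?thesis .
qed

lemma trig_series_L2: "\<Omega> \<in> lmeasurable \<Longrightarrow> trig_series a m \<in> L2_space \<Omega>"
  by (rule L2_bounded[OF _ trig_series_measurable trig_series_bound])

lemma trig_series_inner_sums:
  assumes "integrable (lebesgue_on unit_cube) h"
  shows "(\<lambda>n. a n * coef h (m n)) sums L2_inner unit_cube (trig_series a m) h"
proof -
  have "(\<lambda>n. LINT x|lebesgue_on unit_cube. (a n * trig (m n) x) * h x) sums
      (LINT x|lebesgue_on unit_cube. (\<Sum>n. a n * trig (m n) x) * h x)"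
    by (rule integral_suminf_mult_sums[OF _ trig_term_bound summable_mult[OF a] assms])
      (intro borel_measurable_times borel_measurable_const measurable_lebesgue_onI trig_measurable)
  moreover have "(LINT x|lebesgue_on unit_cube. (a n * trig (m n) x) * h x) = a n * coef h (m n)" for n
  proof -
    have "(LINT x|lebesgue_on unit_cube. (a n * trig (m n) x) * h x) = (LINT x|lebesgue_on unit_cube. a n * (h x * trig (m n) x))"
      by (simp add: mult_ac)
    then show ?thesis by (simp add: L2_inner_def)
  qed
  ultimately show ?thesis by (simp add: L2_inner_def trig_series_def[abs_def])
qed

lemma trig_series_periodic: "trig_series a m (x + (\<chi> i. of_int (k $ i))) = trig_series a m x"
  by (simp add: trig_series_def trig_periodic)

lemma per_ext_trig_series: "per_ext (trig_series a m) = trig_series a m"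
proof
  fix x :: "real ^ 'd"
  have "x = (\<chi> i. frac (x $ i)) + (\<chi> i. of_int ((\<chi> i. \<lfloor>x $ i\<rfloor>) $ i))"
    by (simp add: vec_eq_iff frac_def)
  then show "per_ext (trig_series a m) x = trig_series a m x"
    unfolding per_ext_def by (metis trig_series_periodic)
qed

text \<open>Both series converge uniformly by the Weierstrass test, so \<open>weak_pderiv_suminf\<close> applies.\<close>

lemma weak_pderiv_trig_series:
  assumes "summable (\<lambda>n. \<bar>a n * freq (m n) $ i\<bar>)" and \<Omega>: "\<Omega> \<in> sets lebesgue"
  shows "weak_pderiv \<Omega> i (trig_series a m) (trig_series (\<lambda>n. a n * freq (m n) $ i) (\<lambda>n. - m n))"
  unfolding trig_series_def[abs_def]
proof (rule weak_pderiv_suminf[OF _ \<Omega> _ trig_term_bound summable_mult[OF a] _ trig_term_bound summable_mult[OF assms(1)]])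
  fix n
  have sm: "smooth_fun (\<lambda>x. a n * trig (m n) x)" by (intro smooth_fun_mult smooth_fun_const smooth_trig)
  have "partial_deriv i (\<lambda>x. a n) x = 0" for x :: "real ^ 'd" by (rule partial_derivI) simp
  then have "partial_deriv i (\<lambda>x. a n * trig (m n) x) = (\<lambda>x. a n * freq (m n) $ i * trig (- m n) x)"
    by (auto simp: partial_deriv_mult smooth_fun_differentiable smooth_fun_const smooth_trig partial_deriv_trig)
  then show "weak_pderiv \<Omega> i (\<lambda>x. a n * trig (m n) x) (\<lambda>x. a n * freq (m n) $ i * trig (- m n) x)"
    using weak_pderiv_smooth[OF sm \<Omega>, of i] by simp
qed (intro continuous_on_mult continuous_on_const continuous_trig)+

end

lemma coef_trig: "coef (trig k) l = of_bool (k = l)" by (rule trig_orthonormal)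

lemma coef_trig_series_idx:
  assumes "summable (\<lambda>n. \<bar>a n\<bar>)" shows "coef (trig_series a idx) (idx j :: int ^ 'd::finite) = a j"
proof -
  have "(\<lambda>n. a n * coef (trig (idx j :: int ^ 'd)) (idx n)) sums coef (trig_series a idx) (idx j :: int ^ 'd)"
    by (rule trig_series_inner_sums[OF assms integrable_trig])
  moreover have "a n * coef (trig (idx j :: int ^ 'd)) (idx n) = (if n = j then a n else 0)" for n
    by (auto simp: coef_trig)
  ultimately show ?thesis using sums_unique2[OF _ sums_single[of j a]] by simp
qed

lemma coef_zero_imp_AE_zero:
  assumes "integrable (lebesgue_on unit_cube) f" "\<And>k. coef f k = 0"
  shows "AE x in lebesgue_on unit_cube. f x = 0"
  using trig_complete[OF assms(1)] assms(2) by (simp add: L2_inner_def)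

lemma coef_diff:
  assumes "integrable (lebesgue_on unit_cube) f" "integrable (lebesgue_on unit_cube) g"
  shows "coef (\<lambda>x. f x - g x) k = coef f k - coef g k"
proof -
  have "integrable (lebesgue_on unit_cube) (\<lambda>x. h x * trig k x)" if "integrable (lebesgue_on unit_cube) h" for h
    by (rule integrable_mult_bounded_measurable[OF that _ abs_trig_le]) (intro measurable_lebesgue_onI trig_measurable)
  from this[OF assms(1)] this[OF assms(2)] show ?thesis by (simp add: L2_inner_def left_diff_distrib)
qed

lemma coef_eq_imp_AE_eq:
  assumes "integrable (lebesgue_on unit_cube) f" "integrable (lebesgue_on unit_cube) g" "\<And>k. coef f k = coef g k"
  shows "AE x in lebesgue_on unit_cube. f x = g x"
  using coef_zero_imp_AE_zero[of "\<lambda>x. f x - g x"] assms by (simp add: coef_diff)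

text \<open>The series has the coefficients of \<open>f\<close>, and completeness shows that these determine \<open>f\<close>.\<close>

lemma AE_eq_trig_series:
  assumes "integrable (lebesgue_on unit_cube) f" "summable (\<lambda>n. \<bar>coef f (idx n)\<bar>)"
  shows "AE x in lebesgue_on unit_cube. f x = trig_series (\<lambda>n. coef f (idx n)) idx x"
proof (rule coef_eq_imp_AE_eq[OF assms(1) L2_unit_cube_integrable[OF trig_series_L2[OF assms(2) lmeasurable_unit_cube]]])
  fix k :: "int ^ 'a"
  obtain j where "k = idx j" by (rule idx_surj)
  then show "coef f k = coef (trig_series (\<lambda>n. coef f (idx n)) idx) k"
    by (simp add: coef_trig_series_idx[OF assms(2)])
qed

lemma parseval_sums:
  assumes f: "f \<in> L2_space unit_cube" "summable (\<lambda>n. \<bar>coef f (idx n)\<bar>)" and h: "h \<in> L2_space unit_cube"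
  shows "(\<lambda>n. coef f (idx n) * coef h (idx n)) sums L2_inner unit_cube f h"
proof -
  have "L2_inner unit_cube f h = L2_inner unit_cube (trig_series (\<lambda>n. coef f (idx n)) idx) h"
    by (rule L2_inner_AE_cong[OF _ AE_eq_trig_series[OF L2_unit_cube_integrable[OF f(1)] f(2)]])
      (use L2_mult_integrable[OF f(1) h] in auto)
  then show ?thesis
    using trig_series_inner_sums[OF f(2) L2_unit_cube_integrable[OF h]] by simp
qed

lemma summable_coef_square:
  assumes "f \<in> L2_space unit_cube" shows "summable (\<lambda>n. (coef f (idx n))\<^sup>2)"
proof (rule summableI_nonneg_bounded[where x="L2_inner unit_cube f f"])
  show "(\<Sum>n<N. (coef f (idx n))\<^sup>2) \<le> L2_inner unit_cube f f" for N
    by (rule bessel_finite[OF assms]) (auto simp: trig_L2 lmeasurable_unit_cube trig_orthonormal)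
qed simp

lemma coef_square_le:
  assumes "f \<in> L2_space unit_cube" shows "(coef f k)\<^sup>2 \<le> L2_inner unit_cube f f"
  using bessel_finite[OF assms, of "{k}" trig] by (auto simp: trig_L2 lmeasurable_unit_cube trig_orthonormal)

section \<open>Periodic Sobolev functions and their Fourier coefficients\<close>

lemma unit_cube_subset_big_cube: "unit_cube \<subseteq> big_cube"
  using cube_corner_in_big_cube[of _ "{}"] unit_cube_subset_cbox by auto

lemma per_ext_corner: "x \<in> unit_cube \<Longrightarrow> per_ext u (x + corner S) = u x"
proof -
  assume x: "x \<in> unit_cube"
  have "frac (x $ i + of_bool (i \<in> S)) = x $ i" for i
  proof -
    have "frac (x $ i) = x $ i" using x by (simp add: frac_eq unit_cube_iff less_imp_le)
    then show ?thesis by (simp add: frac_1_eq)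
  qed
  then show ?thesis by (simp add: per_ext_def corner_def)
qed

text \<open>Membership in the periodic Sobolev space says that the periodic extension has weak derivatives on all of
space, in particular on a neighbourhood of \<open>[0, 2]\<^sup>d\<close>; the coefficient formulas are integrations by parts
over one period (\<open>periodic_weak_pderiv\<close>).\<close>

lemma
  fixes \<phi> :: "real ^ 'd::finite \<Rightarrow> real"
  assumes \<phi>: "\<phi> \<in> sobolev_per 2"
  shows sobolev_per_L2: "\<phi> \<in> L2_space unit_cube"
    and sobolev_per_wpd_L2: "wpd unit_cube i \<phi> \<in> L2_space unit_cube"
    and sobolev_per_wpd2_L2: "wpd unit_cube i (wpd unit_cube i \<phi>) \<in> L2_space unit_cube"
    and coef_wpd: "coef (wpd unit_cube i \<phi>) k = - (freq k $ i * coef \<phi> (- k))"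
    and coef_wpd2: "coef (wpd unit_cube i (wpd unit_cube i \<phi>)) k = - ((freq k $ i)\<^sup>2 * coef \<phi> k)"
proof -
  have "per_ext \<phi> \<in> sobolev big_cube (Suc (Suc 0))"
    using \<phi> open_big_cube bounded_big_cube
    unfolding sobolev_per_def mem_Collect_eq numeral_2_eq_2 by blast
  then obtain g h where gh: "per_ext \<phi> \<in> L2_space big_cube" "weak_pderiv big_cube i (per_ext \<phi>) g"
    "g \<in> L2_space big_cube" "weak_pderiv big_cube i g h" "h \<in> L2_space big_cube"
    by auto blast
  have down: "f' \<in> L2_space unit_cube"
    if "f \<in> L2_space big_cube" "AE x in lebesgue_on unit_cube. f (x + corner {}) = f' x" for f f' :: "real ^ 'd \<Rightarrow> real"
    by (rule L2_AE[OF _ L2_subset[OF that(1) unit_cube_subset_big_cube]]) (use that(2) in auto)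
  have per: "AE x in lebesgue_on unit_cube. per_ext \<phi> (x + corner S) = \<phi> x" for S
    by (rule AE_I2) (simp add: per_ext_corner)
  note P1 = periodic_weak_pderiv[OF gh(2) per]
  note P2 = periodic_weak_pderiv[OF gh(4) P1(2)]
  show "\<phi> \<in> L2_space unit_cube" by (rule down[OF gh(1) per])
  show "wpd unit_cube i \<phi> \<in> L2_space unit_cube" by (rule down[OF gh(3) P1(2)])
  show "wpd unit_cube i (wpd unit_cube i \<phi>) \<in> L2_space unit_cube" by (rule down[OF gh(5) P2(2)])
  have step: "(LINT x|lebesgue_on unit_cube. v x * partial_deriv i (trig k) x) = freq k $ i * coef v (- k)"
    for v :: "real ^ 'd \<Rightarrow> real" and k
  proof -
    have "(LINT x|lebesgue_on unit_cube. v x * partial_deriv i (trig k) x)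
        = (LINT x|lebesgue_on unit_cube. freq k $ i * (v x * trig (- k) x))"
      by (rule Bochner_Integration.integral_cong[OF refl]) (simp add: partial_deriv_trig)
    then show ?thesis by (simp add: L2_inner_def)
  qed
  show c1: "coef (wpd unit_cube i \<phi>) k = - (freq k $ i * coef \<phi> (- k))" for k
    using P1(5)[OF smooth_trig corner_periodic_trig] by (simp add: step) (simp add: L2_inner_def)
  show "coef (wpd unit_cube i (wpd unit_cube i \<phi>)) k = - ((freq k $ i)\<^sup>2 * coef \<phi> k)"
    using P2(5)[OF smooth_trig corner_periodic_trig, of k] c1[of "- k"]
    by (simp add: step) (simp add: L2_inner_def power2_eq_square)
qed

lemma
  fixes \<phi> :: "real ^ 'd::finite \<Rightarrow> real"
  assumes \<phi>: "\<phi> \<in> sobolev_per 2"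
  shows sobolev_per_laplacian_L2: "weak_laplacian unit_cube \<phi> \<in> L2_space unit_cube"
    and coef_laplacian: "coef (weak_laplacian unit_cube \<phi>) k = - (freq_sq k * coef \<phi> k)"
proof -
  have eq: "weak_laplacian unit_cube \<phi> = (\<lambda>x. \<Sum>i\<in>UNIV. 1 * wpd unit_cube i (wpd unit_cube i \<phi>) x)"
    by (simp add: weak_laplacian_def[abs_def])
  show "weak_laplacian unit_cube \<phi> \<in> L2_space unit_cube"
    unfolding eq by (intro L2_sum L2_scale sobolev_per_wpd2_L2 \<phi>)
  show "coef (weak_laplacian unit_cube \<phi>) k = - (freq_sq k * coef \<phi> k)"
    unfolding eq using L2_inner_sum_left[OF sobolev_per_wpd2_L2[OF \<phi>] trig_L2[OF lmeasurable_unit_cube], where I=UNIV and c="\<lambda>_. 1"]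
    by (simp add: coef_wpd2[OF \<phi>] sum_negf freq_sq_def sum_distrib_right)
qed

lemma freq_bounds:
  shows "\<bar>freq k $ i\<bar> \<le> 1 + freq_sq k" "\<bar>freq k $ i * freq k $ j\<bar> \<le> freq_sq k"
proof -
  have "0 \<le> (\<bar>freq k $ i\<bar> - 1)\<^sup>2" by simp
  then have "2 * \<bar>freq k $ i\<bar> \<le> 1 + (freq k $ i)\<^sup>2" by (simp add: power2_diff)
  then show "\<bar>freq k $ i\<bar> \<le> 1 + freq_sq k" using freq_component_le[of k i] by linarith
  have "0 \<le> (\<bar>freq k $ i\<bar> - \<bar>freq k $ j\<bar>)\<^sup>2" by simp
  then have "2 * (\<bar>freq k $ i\<bar> * \<bar>freq k $ j\<bar>) \<le> (freq k $ i)\<^sup>2 + (freq k $ j)\<^sup>2" by (simp add: power2_diff)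
  then show "\<bar>freq k $ i * freq k $ j\<bar> \<le> freq_sq k"
    using freq_component_le[of k i] freq_component_le[of k j] unfolding abs_mult by linarith
qed

context
  fixes a :: "nat \<Rightarrow> real" and m :: "nat \<Rightarrow> int ^ 'd::finite"
  assumes a: "summable (\<lambda>n. \<bar>a n\<bar>)" and as: "summable (\<lambda>n. \<bar>a n\<bar> * freq_sq (m n))"
begin

lemma summable_freq1: "summable (\<lambda>n. \<bar>a n * freq (m n) $ i\<bar>)"
proof (rule summable_comparison_test'[OF summable_add[OF a as]])
  fix n show "norm \<bar>a n * freq (m n) $ i\<bar> \<le> \<bar>a n\<bar> + \<bar>a n\<bar> * freq_sq (m n)"
    using mult_left_mono[OF freq_bounds(1)[of "m n" i], of "\<bar>a n\<bar>"] by (simp add: abs_mult distrib_left)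
qed

lemma summable_freq2: "summable (\<lambda>n. \<bar>a n * freq (m n) $ i * freq (- m n) $ j\<bar>)"
proof (rule summable_comparison_test'[OF as])
  fix n show "norm \<bar>a n * freq (m n) $ i * freq (- m n) $ j\<bar> \<le> \<bar>a n\<bar> * freq_sq (m n)"
    using mult_left_mono[OF freq_bounds(2)[of "m n" i j], of "\<bar>a n\<bar>"] by (simp add: abs_mult mult.assoc)
qed

text \<open>The weighted summability makes the series of all derivatives up to order two uniformly
convergent.\<close>

lemma trig_series_sobolev_per: "trig_series a m \<in> sobolev_per 2"
  unfolding sobolev_per_def
proof (intro CollectI allI impI)
  fix \<Omega> :: "(real ^ 'd) set" assume \<Omega>: "open \<Omega> \<and> bounded \<Omega>"
  then have Os: "\<Omega> \<in> lmeasurable" "\<Omega> \<in> sets lebesgue" by (auto intro: lmeasurable_open)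
  have "\<exists>h\<in>L2_space \<Omega>. weak_pderiv \<Omega> j (trig_series (\<lambda>n. a n * freq (m n) $ i) (\<lambda>n. - m n)) h" for i j
    using weak_pderiv_trig_series[OF summable_freq1[of i] summable_freq2[of i j] Os(2)]
      trig_series_L2[OF summable_freq2[of i j] Os(1)] by blast
  then have "trig_series (\<lambda>n. a n * freq (m n) $ i) (\<lambda>n. - m n) \<in> sobolev \<Omega> (Suc 0)" for i
    using trig_series_L2[OF summable_freq1[of i] Os(1)] by simp
  then have "\<forall>i. \<exists>g\<in>sobolev \<Omega> (Suc 0). weak_pderiv \<Omega> i (trig_series a m) g"
    using weak_pderiv_trig_series[OF a summable_freq1 Os(2)] by blast
  then have "trig_series a m \<in> sobolev \<Omega> (Suc (Suc 0))"
    using trig_series_L2[OF a Os(1)] by (simp only: sobolev.simps mem_Collect_eq simp_thms)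
  then show "per_ext (trig_series a m) \<in> sobolev \<Omega> 2"
    by (simp only: per_ext_trig_series[OF a] numeral_2_eq_2)
qed

lemma wpd_trig_series_AE:
  "AE x in lebesgue_on unit_cube. wpd unit_cube i (trig_series a m) x = trig_series (\<lambda>n. a n * freq (m n) $ i) (\<lambda>n. - m n) x"
  by (rule wpd_AE_eq[OF open_unit_cube weak_pderiv_trig_series[OF a summable_freq1]]) simp

end

lemma trig_eq_trig_series: "trig k = trig_series (\<lambda>n. if n = 0 then 1 else 0) (\<lambda>_. k)"
proof
  fix x
  have "(\<lambda>n. (if n = 0 then 1 else 0) * trig k x) = (\<lambda>n. if n = (0::nat) then trig k x else 0)" by auto
  then show "trig k x = trig_series (\<lambda>n. if n = 0 then 1 else 0) (\<lambda>_. k) x"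
    using sums_single[of 0 "\<lambda>_. trig k x"] by (simp add: trig_series_def sums_iff)
qed

lemma trig_sobolev_per: "trig k \<in> sobolev_per 2"
proof -
  have "(\<lambda>n. \<bar>if n = 0 then 1 else 0 :: real\<bar>) = (\<lambda>n::nat. if n = 0 then 1 else 0)" by auto
  then have s: "summable (\<lambda>n::nat. \<bar>if n = 0 then 1 else 0 :: real\<bar>)" by simp
  show ?thesis
    unfolding trig_eq_trig_series by (rule trig_series_sobolev_per[OF s summable_mult2[OF s]])
qed

lemma wpd_trig_AE: "AE x in lebesgue_on unit_cube. wpd unit_cube i (trig k) x = freq k $ i * trig (- k) x"
  using wpd_AE_eq[OF open_unit_cube weak_pderiv_smooth[OF smooth_trig, of unit_cube i k]]
  by (simp add: partial_deriv_trig)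

text \<open>Multiplying by \<open>1 + \<bar>2 \<pi> k\<bar>\<^sup>2\<close> turns the coefficients of \<open>\<phi>\<close> into those of
\<open>\<phi> - \<Delta> \<phi> \<in> L\<^sup>2\<close>, and \<open>(1 + \<bar>2 \<pi> k\<bar>\<^sup>2) powr (-1)\<close> is square summable over the lattice when \<open>d < 4\<close>; the claim
follows by Cauchy-Schwarz.\<close>

lemma summable_coef_sobolev_per:
  fixes \<phi> :: "real ^ 'd::finite \<Rightarrow> real"
  assumes \<phi>: "\<phi> \<in> sobolev_per 2" and d: "CARD('d) \<le> 3"
  shows "summable (\<lambda>n. \<bar>coef \<phi> (idx n)\<bar>)"
proof -
  define u where "u x = \<phi> x - weak_laplacian unit_cube \<phi> x" for x
  have u: "u \<in> L2_space unit_cube"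
    unfolding u_def[abs_def] by (intro L2_diff sobolev_per_L2 sobolev_per_laplacian_L2 \<phi>)
  have cu: "coef u k = (1 + freq_sq k) * coef \<phi> k" for k
    unfolding u_def[abs_def]
    by (subst coef_diff) (auto intro!: L2_unit_cube_integrable sobolev_per_L2 sobolev_per_laplacian_L2 \<phi>
        simp: coef_laplacian[OF \<phi>] algebra_simps)
  have "summable (\<lambda>n. (1 + freq_sq (idx n :: int ^ 'd)) powr (- 2))"
    by (rule lattice_summable) (use d in auto)
  moreover have "(1 + freq_sq k) powr (- 2) = (inverse (1 + freq_sq k))\<^sup>2" for k :: "int ^ 'd"
    using freq_sq_nonneg[of k] by (simp add: powr_minus power_inverse powr_numeral)
  ultimately have "summable (\<lambda>n. (inverse (1 + freq_sq (idx n :: int ^ 'd)))\<^sup>2)" by simp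
  from summable_mult_of_squares[OF this summable_coef_square[OF u]]
  have "summable (\<lambda>n. \<bar>inverse (1 + freq_sq (idx n :: int ^ 'd)) * coef u (idx n)\<bar>)" .
  moreover have "inverse (1 + freq_sq k) * coef u k = coef \<phi> k" for k
    using freq_sq_nonneg[of k] by (simp add: cu)
  ultimately show ?thesis by simp
qed

section \<open>The covariance operator in Fourier coordinates\<close>

locale covariance =
  fixes \<epsilon> \<delta> \<tau> q a1 a2 a3 :: real
  assumes pos: "0 < \<epsilon>" "0 < \<delta>" "0 < \<tau>" "0 \<le> q"
begin

text \<open>The Fourier multiplier of the elliptic operator; \<open>1 / symbol k\<close> is the eigenvalue of the
covariance operator at frequency \<open>k\<close>.\<close>

definition symbol :: "int ^ 'd::finite \<Rightarrow> real" where
  "symbol k = \<delta> * \<epsilon> powr (-2 * a1) * (freq_sq k)\<^sup>2 + q * \<delta> * \<epsilon> powr (-2 * a2) * freq_sq k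
     + \<tau>\<^sup>2 * \<delta> * \<epsilon> powr (-2 * a3)"

abbreviation weak_sol :: "(real ^ 'd::finite \<Rightarrow> real) \<Rightarrow> (real ^ 'd \<Rightarrow> real) \<Rightarrow> bool" where
  "weak_sol \<equiv> cov_weak_solution \<epsilon> \<delta> \<tau> q a1 a2 a3"

abbreviation cov :: "(real ^ 'd::finite \<Rightarrow> real) \<Rightarrow> real ^ 'd \<Rightarrow> real" where
  "cov \<equiv> cov_op \<epsilon> \<delta> \<tau> q a1 a2 a3"

text \<open>The biharmonic and the zero order terms alone control \<open>(1 + \<bar>2 \<pi> k\<bar>\<^sup>2)\<^sup>2\<close>.\<close>

lemma symbol_lower_bound:
  obtains c where "0 < c" "\<And>k. c * (1 + freq_sq k)\<^sup>2 \<le> symbol k"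
proof
  let ?A = "\<delta> * \<epsilon> powr (-2 * a1)" and ?C = "\<tau>\<^sup>2 * \<delta> * \<epsilon> powr (-2 * a3)" and ?B = "q * \<delta> * \<epsilon> powr (-2 * a2)"
  define c where "c = min ?A ?C / 2"
  show "0 < min ?A ?C / 2" using pos by simp
  fix k :: "int ^ 'a"
  have c: "0 < c" "2 * c \<le> ?A" "2 * c \<le> ?C" using pos by (auto simp: c_def)
  have "0 \<le> (1 - freq_sq k)\<^sup>2" by simp
  then have "(1 + freq_sq k)\<^sup>2 \<le> 2 * (freq_sq k)\<^sup>2 + 2" by (simp add: power2_sum power2_diff)
  then have "c * (1 + freq_sq k)\<^sup>2 \<le> c * (2 * (freq_sq k)\<^sup>2 + 2)" using c by (intro mult_left_mono) auto
  also have "\<dots> = (2 * c) * (freq_sq k)\<^sup>2 + 2 * c" by (simp add: algebra_simps)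
  also have "\<dots> \<le> ?A * (freq_sq k)\<^sup>2 + ?C"
    using c by (intro add_mono mult_right_mono) auto
  also have "\<dots> \<le> symbol k" using pos freq_sq_nonneg[of k] by (simp add: symbol_def)
  finally show "min ?A ?C / 2 * (1 + freq_sq k)\<^sup>2 \<le> symbol k" by (simp add: c_def)
qed

lemma symbol_pos: "0 < symbol k"
proof -
  obtain c where c: "0 < c" "\<And>k::int ^ 'a. c * (1 + freq_sq k)\<^sup>2 \<le> symbol k" using symbol_lower_bound by blast
  have "0 < c * (1 + freq_sq k)\<^sup>2" using c(1) freq_sq_nonneg[of k] by simp
  then show ?thesis using c(2)[of k] by linarith
qed

lemma symbol_minus [simp]: "symbol (- k) = symbol k" by (simp add: symbol_def)

text \<open>The modes themselves are admissible test functions in the weak formulation.\<close>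

lemma weak_solution_coef:
  fixes f \<zeta> :: "real ^ 'd::finite \<Rightarrow> real"
  assumes w: "weak_sol f \<zeta>"
  shows "symbol k * coef \<zeta> k = coef f k"
proof -
  have \<zeta>: "\<zeta> \<in> sobolev_per 2" using w by (simp add: cov_weak_solution_def)
  have ae1: "AE x in lebesgue_on unit_cube. weak_laplacian unit_cube (trig k) x = - freq_sq k * trig k x"
  proof (rule coef_eq_imp_AE_eq)
    show "integrable (lebesgue_on unit_cube) (weak_laplacian unit_cube (trig k))"
      by (intro L2_unit_cube_integrable sobolev_per_laplacian_L2 trig_sobolev_per)
    show "integrable (lebesgue_on unit_cube) (\<lambda>x. - freq_sq k * trig k x)"
      using integrable_trig[of k] by simp
    show "coef (weak_laplacian unit_cube (trig k)) l = coef (\<lambda>x. - freq_sq k * trig k x) l" for l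
    proof -
      have "coef (\<lambda>x. - freq_sq k * trig k x) l = - freq_sq k * coef (trig k) l"
        by (simp add: L2_inner_def mult.assoc)
      then show ?thesis by (auto simp: coef_laplacian[OF trig_sobolev_per] coef_trig)
    qed
  qed
  have "L2_inner unit_cube (weak_laplacian unit_cube \<zeta>) (weak_laplacian unit_cube (trig k))
      = L2_inner unit_cube (weak_laplacian unit_cube \<zeta>) (\<lambda>x. - freq_sq k * trig k x)"
    by (rule L2_inner_AE_cong[OF _ _ ae1])
      (auto intro!: borel_measurable_integrable L2_mult_integrable sobolev_per_laplacian_L2 \<zeta> trig_sobolev_per)
  also have "\<dots> = - freq_sq k * coef (weak_laplacian unit_cube \<zeta>) k"
    by (simp add: L2_inner_def mult.left_commute)
  also have "\<dots> = (freq_sq k)\<^sup>2 * coef \<zeta> k" by (simp add: coef_laplacian[OF \<zeta>] power2_eq_square)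
  finally have 1: "L2_inner unit_cube (weak_laplacian unit_cube \<zeta>) (weak_laplacian unit_cube (trig k)) = (freq_sq k)\<^sup>2 * coef \<zeta> k" .
  have 2: "L2_inner unit_cube (wpd unit_cube i \<zeta>) (wpd unit_cube i (trig k)) = (freq k $ i)\<^sup>2 * coef \<zeta> k" for i
  proof -
    have "L2_inner unit_cube (wpd unit_cube i \<zeta>) (wpd unit_cube i (trig k))
        = L2_inner unit_cube (wpd unit_cube i \<zeta>) (\<lambda>x. freq k $ i * trig (- k) x)"
      by (rule L2_inner_AE_cong[OF _ _ wpd_trig_AE])
        (auto intro!: borel_measurable_integrable L2_mult_integrable sobolev_per_wpd_L2 \<zeta> trig_sobolev_per)
    also have "\<dots> = freq k $ i * coef (wpd unit_cube i \<zeta>) (- k)"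
      by (simp add: L2_inner_def mult.left_commute)
    finally show ?thesis by (simp add: coef_wpd[OF \<zeta>] power2_eq_square)
  qed
  have "\<delta> * \<epsilon> powr (-2 * a1) * ((freq_sq k)\<^sup>2 * coef \<zeta> k) + q * \<delta> * \<epsilon> powr (-2 * a2) * (\<Sum>i\<in>UNIV. (freq k $ i)\<^sup>2 * coef \<zeta> k)
      + \<tau>\<^sup>2 * \<delta> * \<epsilon> powr (-2 * a3) * coef \<zeta> k = coef f k"
    using bspec[OF conjunct2[OF w[unfolded cov_weak_solution_def]] trig_sobolev_per[of k]]
    unfolding 1 2 .
  then show ?thesis
    by (simp add: symbol_def distrib_right mult.assoc freq_sq_def sum_distrib_right)
qed

text \<open>The trigonometric series with coefficients \<open>coef f k / symbol k\<close> is the solution. As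
\<open>d \<le> 3\<close>, Cauchy-Schwarz makes even the coefficients times \<open>1 + \<bar>2 \<pi> k\<bar>\<^sup>2\<close> absolutely
summable, so that the series belongs to the periodic Sobolev space by termwise differentiation.
The weak formulation is then Parseval's identity applied to each of its terms.\<close>

lemma weak_solution_exists:
  fixes f :: "real ^ 'd::finite \<Rightarrow> real"
  assumes f: "f \<in> L2_space unit_cube" and d: "CARD('d) \<le> 3"
  shows "\<exists>\<zeta>. weak_sol f \<zeta>"
proof -
  define c where "c n = coef f (idx n) / symbol (idx n :: int ^ 'd)" for n
  obtain c0 where c0: "0 < c0" "\<And>k::int ^ 'd. c0 * (1 + freq_sq k)\<^sup>2 \<le> symbol k" using symbol_lower_bound by blast
  have "summable (\<lambda>n. (1 + freq_sq (idx n :: int ^ 'd)) powr (- 2))"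
    by (rule lattice_summable) (use d in auto)
  moreover have "(1 + freq_sq k) powr (- 2) = (inverse (1 + freq_sq k))\<^sup>2" for k :: "int ^ 'd"
    using freq_sq_nonneg[of k] by (simp add: powr_minus power_inverse powr_numeral)
  ultimately have "summable (\<lambda>n. (inverse (1 + freq_sq (idx n :: int ^ 'd)))\<^sup>2)" by simp
  from summable_mult[OF summable_mult_of_squares[OF summable_coef_square[OF f] this], of "inverse c0"]
  have S: "summable (\<lambda>n. inverse c0 * \<bar>coef f (idx n) * inverse (1 + freq_sq (idx n :: int ^ 'd))\<bar>)" .
  have le: "\<bar>c n\<bar> * (1 + freq_sq (idx n :: int ^ 'd)) \<le> inverse c0 * \<bar>coef f (idx n) * inverse (1 + freq_sq (idx n :: int ^ 'd))\<bar>" for n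
  proof -
    let ?s = "1 + freq_sq (idx n :: int ^ 'd)"
    have s: "0 < ?s" using freq_sq_nonneg[of "idx n :: int ^ 'd"] by linarith
    have "\<bar>c n\<bar> * ?s = \<bar>coef f (idx n)\<bar> * (?s / symbol (idx n :: int ^ 'd))"
      using symbol_pos[of "idx n :: int ^ 'd"] by (simp add: c_def)
    also have "\<dots> \<le> \<bar>coef f (idx n)\<bar> * (?s / (c0 * ?s\<^sup>2))"
      using s c0 by (intro mult_left_mono divide_left_mono) (auto intro!: mult_pos_pos symbol_pos)
    also have "\<dots> = inverse c0 * \<bar>coef f (idx n) * inverse ?s\<bar>"
    proof -
      have "t / (c0 * t\<^sup>2) = inverse c0 * inverse t" if "0 < t" for t
        using that c0(1) by (simp add: power2_eq_square field_simps)
      from this[OF s] show ?thesis using s by (simp only: abs_mult abs_inverse abs_of_pos) simp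
    qed
    finally show ?thesis .
  qed
  have nn: "0 \<le> \<bar>c n\<bar> * freq_sq (idx n :: int ^ 'd)" for n using freq_sq_nonneg by (intro mult_nonneg_nonneg) auto
  have c1: "summable (\<lambda>n. \<bar>c n\<bar>)"
    by (rule summable_comparison_test'[OF S]) (use le nn in \<open>fastforce simp: distrib_left intro: order_trans[rotated]\<close>)
  have c2: "summable (\<lambda>n. \<bar>c n\<bar> * freq_sq (idx n :: int ^ 'd))"
  proof (rule summable_comparison_test'[OF S])
    fix n show "norm (\<bar>c n\<bar> * freq_sq (idx n :: int ^ 'd)) \<le> inverse c0 * \<bar>coef f (idx n) * inverse (1 + freq_sq (idx n :: int ^ 'd))\<bar>"
      using le[of n] nn[of n] by (simp add: distrib_left)
  qed
  define \<zeta> :: "real ^ 'd \<Rightarrow> real" where "\<zeta> = trig_series c idx"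
  have \<zeta>: "\<zeta> \<in> sobolev_per 2" unfolding \<zeta>_def by (rule trig_series_sobolev_per[OF c1 c2])
  have c\<zeta>: "coef \<zeta> (idx n) = c n" for n unfolding \<zeta>_def by (rule coef_trig_series_idx[OF c1])
  have "weak_sol f \<zeta>"
    unfolding cov_weak_solution_def
  proof (intro conjI ballI \<zeta>)
    fix \<phi> :: "real ^ 'd \<Rightarrow> real" assume \<phi>: "\<phi> \<in> sobolev_per 2"
    let ?A = "\<delta> * \<epsilon> powr (-2 * a1)" and ?C = "\<tau>\<^sup>2 * \<delta> * \<epsilon> powr (-2 * a3)" and ?B = "q * \<delta> * \<epsilon> powr (-2 * a2)"
    let ?p = "\<lambda>n. coef \<phi> (idx n)"
    have s1: "summable (\<lambda>n. \<bar>coef \<zeta> (idx n)\<bar>)" by (simp add: c\<zeta> c1)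
    have s2: "summable (\<lambda>n. \<bar>coef (weak_laplacian unit_cube \<zeta>) (idx n)\<bar>)"
      using c2 by (simp add: coef_laplacian[OF \<zeta>] c\<zeta> abs_mult abs_of_nonneg[OF freq_sq_nonneg] mult.commute)
    have "(\<lambda>n. coef (weak_laplacian unit_cube \<zeta>) (idx n) * coef (weak_laplacian unit_cube \<phi>) (idx n)) sums
        L2_inner unit_cube (weak_laplacian unit_cube \<zeta>) (weak_laplacian unit_cube \<phi>)"
      by (rule parseval_sums[OF sobolev_per_laplacian_L2[OF \<zeta>] s2 sobolev_per_laplacian_L2[OF \<phi>]])
    then have t1: "(\<lambda>n. (freq_sq (idx n :: int ^ 'd))\<^sup>2 * (c n * ?p n)) sums
        L2_inner unit_cube (weak_laplacian unit_cube \<zeta>) (weak_laplacian unit_cube \<phi>)"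
      by (simp add: coef_laplacian[OF \<zeta>] coef_laplacian[OF \<phi>] c\<zeta> power2_eq_square mult_ac)
    have t2: "(\<lambda>n. (freq (idx n) $ i)\<^sup>2 * (c n * ?p n)) sums L2_inner unit_cube (wpd unit_cube i \<zeta>) (wpd unit_cube i \<phi>)" for i
    proof -
      have "(\<lambda>n. (c n * freq (idx n) $ i) * coef (wpd unit_cube i \<phi>) (- idx n)) sums
          L2_inner unit_cube (trig_series (\<lambda>n. c n * freq (idx n) $ i) (\<lambda>n. - idx n)) (wpd unit_cube i \<phi>)"
        by (rule trig_series_inner_sums[OF summable_freq1[OF c1 c2] L2_unit_cube_integrable[OF sobolev_per_wpd_L2[OF \<phi>]]])
      moreover have "L2_inner unit_cube (wpd unit_cube i \<zeta>) (wpd unit_cube i \<phi>) =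
          L2_inner unit_cube (trig_series (\<lambda>n. c n * freq (idx n) $ i) (\<lambda>n. - idx n)) (wpd unit_cube i \<phi>)"
        by (rule L2_inner_AE_cong[OF _ wpd_trig_series_AE[OF c1 c2, folded \<zeta>_def]])
          (auto intro!: borel_measurable_integrable L2_mult_integrable sobolev_per_wpd_L2 \<zeta> \<phi>)
      ultimately show ?thesis by (simp add: coef_wpd[OF \<phi>] power2_eq_square mult_ac)
    qed
    have t3: "(\<lambda>n. c n * ?p n) sums L2_inner unit_cube \<zeta> \<phi>"
      using parseval_sums[OF sobolev_per_L2[OF \<zeta>] s1 sobolev_per_L2[OF \<phi>]] by (simp add: c\<zeta>)
    have t4: "(\<lambda>n. coef f (idx n) * ?p n) sums L2_inner unit_cube f \<phi>"
      using parseval_sums[OF sobolev_per_L2[OF \<phi>] summable_coef_sobolev_per[OF \<phi> d] f]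
      by (simp add: mult.commute L2_inner_commute[of _ f])
    have ts: "(\<lambda>n. \<Sum>i\<in>UNIV. (freq (idx n :: int ^ 'd) $ i)\<^sup>2 * (c n * ?p n)) sums
        (\<Sum>i\<in>UNIV. L2_inner unit_cube (wpd unit_cube i \<zeta>) (wpd unit_cube i \<phi>))"
      by (rule sums_sum) (rule t2)
    have "(\<lambda>n. ?A * ((freq_sq (idx n :: int ^ 'd))\<^sup>2 * (c n * ?p n)) + ?B * (\<Sum>i\<in>UNIV. (freq (idx n :: int ^ 'd) $ i)\<^sup>2 * (c n * ?p n))
        + ?C * (c n * ?p n)) sums
       (?A * L2_inner unit_cube (weak_laplacian unit_cube \<zeta>) (weak_laplacian unit_cube \<phi>)
        + ?B * (\<Sum>i\<in>UNIV. L2_inner unit_cube (wpd unit_cube i \<zeta>) (wpd unit_cube i \<phi>))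
        + ?C * L2_inner unit_cube \<zeta> \<phi>)"
      by (intro sums_add sums_mult ts t1 t3)
    moreover have "?A * ((freq_sq (idx n :: int ^ 'd))\<^sup>2 * (c n * ?p n)) + ?B * (\<Sum>i\<in>UNIV. (freq (idx n :: int ^ 'd) $ i)\<^sup>2 * (c n * ?p n))
        + ?C * (c n * ?p n) = coef f (idx n) * ?p n" for n
    proof -
      have "(\<Sum>i\<in>UNIV. (freq (idx n :: int ^ 'd) $ i)\<^sup>2 * (c n * ?p n)) = freq_sq (idx n :: int ^ 'd) * (c n * ?p n)"
        by (simp only: freq_sq_def sum_distrib_right)
      then have "?A * ((freq_sq (idx n :: int ^ 'd))\<^sup>2 * (c n * ?p n)) + ?B * (\<Sum>i\<in>UNIV. (freq (idx n :: int ^ 'd) $ i)\<^sup>2 * (c n * ?p n))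
        + ?C * (c n * ?p n) = (symbol (idx n :: int ^ 'd) * c n) * ?p n"
        by (simp add: symbol_def algebra_simps)
      also have "symbol (idx n :: int ^ 'd) * c n = coef f (idx n)"
        using symbol_pos[of "idx n :: int ^ 'd"] by (simp add: c_def)
      finally show ?thesis .
    qed
    ultimately show "?A * L2_inner unit_cube (weak_laplacian unit_cube \<zeta>) (weak_laplacian unit_cube \<phi>)
        + ?B * (\<Sum>i\<in>UNIV. L2_inner unit_cube (wpd unit_cube i \<zeta>) (wpd unit_cube i \<phi>))
        + ?C * L2_inner unit_cube \<zeta> \<phi> = L2_inner unit_cube f \<phi>"
      using sums_unique2[OF _ t4] by simp
  qed
  then show ?thesis by blast
qed

lemma
  fixes f :: "real ^ 'd::finite \<Rightarrow> real"
  assumes f: "f \<in> L2_space unit_cube" and d: "CARD('d) \<le> 3"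
  shows cov_L2: "cov f \<in> L2_space unit_cube" and coef_cov: "coef (cov f) k = coef f k / symbol k"
proof -
  have w: "weak_sol f (cov f)"
    unfolding cov_op_def using weak_solution_exists[OF f d] by (rule someI_ex)
  then show "cov f \<in> L2_space unit_cube" by (simp add: cov_weak_solution_def sobolev_per_L2)
  show "coef (cov f) k = coef f k / symbol k"
    using weak_solution_coef[OF w, of k] symbol_pos[of k] by (simp add: field_simps)
qed

text \<open>Since \<open>symbol k\<close> grows like \<open>(1 + \<bar>2 \<pi> k\<bar>\<^sup>2)\<^sup>2\<close>, the summand is of order
\<open>(1 + \<bar>2 \<pi> k\<bar>\<^sup>2) powr (r - \<alpha>)\<close>; the exponent \<open>r = 0\<close> is used for the variance of the field and
\<open>r = 1\<close> for that of its increments.\<close>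

lemma summable_symbol_powr:
  assumes "real CARD('d::finite) / 2 < \<alpha> - r" "0 \<le> \<alpha>"
  shows "summable (\<lambda>n. (1 / symbol (idx n :: int ^ 'd)) powr (\<alpha> / 2) * (1 + freq_sq (idx n :: int ^ 'd)) powr r)"
proof -
  obtain c where c: "0 < c" "\<And>k::int ^ 'd. c * (1 + freq_sq k)\<^sup>2 \<le> symbol k" using symbol_lower_bound by blast
  have "summable (\<lambda>n. (1 / c) powr (\<alpha> / 2) * (1 + freq_sq (idx n :: int ^ 'd)) powr (- (\<alpha> - r)))"
    by (intro summable_mult lattice_summable assms)
  then show ?thesis
  proof (rule summable_comparison_test')
    fix n :: nat
    define s where "s = 1 + freq_sq (idx n :: int ^ 'd)"
    have s: "0 < s" using freq_sq_nonneg[of "idx n :: int ^ 'd"] by (simp add: s_def)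
    have "1 / symbol (idx n :: int ^ 'd) \<le> 1 / (c * s\<^sup>2)"
      using c(1) c(2)[of "idx n"] s by (intro divide_left_mono) (auto simp: s_def intro!: mult_pos_pos symbol_pos)
    then have "(1 / symbol (idx n :: int ^ 'd)) powr (\<alpha> / 2) \<le> (1 / (c * s\<^sup>2)) powr (\<alpha> / 2)"
      using assms(2) symbol_pos[of "idx n :: int ^ 'd"] by (intro powr_mono2) auto
    also have "1 / (c * s\<^sup>2) = (1 / c) * s powr (- 2)"
      using s by (simp add: powr_minus powr_numeral divide_inverse)
    also have "((1 / c) * s powr (- 2)) powr (\<alpha> / 2) = (1 / c) powr (\<alpha> / 2) * s powr (- \<alpha>)"
      by (simp only: powr_mult powr_powr) simp
    finally have "(1 / symbol (idx n :: int ^ 'd)) powr (\<alpha> / 2) * s powr r \<le> (1 / c) powr (\<alpha> / 2) * s powr (- \<alpha>) * s powr r"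
      by (rule mult_right_mono) simp
    also have "\<dots> = (1 / c) powr (\<alpha> / 2) * s powr (- (\<alpha> - r))"
      by (simp add: mult.assoc flip: powr_add)
    finally show "norm ((1 / symbol (idx n :: int ^ 'd)) powr (\<alpha> / 2) * (1 + freq_sq (idx n :: int ^ 'd)) powr r)
        \<le> (1 / c) powr (\<alpha> / 2) * (1 + freq_sq (idx n :: int ^ 'd)) powr (- (\<alpha> - r))"
      by (simp add: s_def)
  qed
qed

lemma summable_symbol_powr0:
  assumes "real CARD('d::finite) / 2 < \<alpha>"
  shows "summable (\<lambda>n. (1 / symbol (idx n :: int ^ 'd)) powr (\<alpha> / 2))"
proof -
  have "0 \<le> real CARD('d) / 2" by simp
  then have "0 \<le> \<alpha>" using assms by linarith
  moreover have "1 + freq_sq k \<noteq> 0" for k :: "int ^ 'd" using freq_sq_nonneg[of k] by linarith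
  ultimately show ?thesis using summable_symbol_powr[of \<alpha> 0, where 'd='d] assms by simp
qed

lemma trig_eigenbasis:
  assumes d: "CARD('d::finite) \<le> 3"
  shows "orthonormal_eigenbasis unit_cube cov (\<lambda>n. trig (idx n :: int ^ 'd)) (\<lambda>n. 1 / symbol (idx n :: int ^ 'd))"
  unfolding orthonormal_eigenbasis_def
proof (intro conjI allI ballI impI)
  fix m n :: nat
  show tL: "trig (idx n :: int ^ 'd) \<in> L2_space unit_cube" for n by (rule trig_L2[OF lmeasurable_unit_cube])
  show "L2_inner unit_cube (trig (idx m)) (trig (idx n :: int ^ 'd)) = (if m = n then 1 else 0)"
    by (simp add: trig_orthonormal)
  show "0 \<le> 1 / symbol (idx n :: int ^ 'd)" using symbol_pos[of "idx n :: int ^ 'd"] by simp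
  show "AE x in lebesgue_on unit_cube. cov (trig (idx n :: int ^ 'd)) x = 1 / symbol (idx n :: int ^ 'd) * trig (idx n :: int ^ 'd) x"
  proof (rule coef_eq_imp_AE_eq)
    show "integrable (lebesgue_on unit_cube) (cov (trig (idx n :: int ^ 'd)))"
      by (rule L2_unit_cube_integrable[OF cov_L2[OF tL d]])
    show "integrable (lebesgue_on unit_cube) (\<lambda>x. 1 / symbol (idx n :: int ^ 'd) * trig (idx n :: int ^ 'd) x)"
      by (intro L2_unit_cube_integrable L2_scale tL)
    fix k :: "int ^ 'd"
    have "coef (\<lambda>x. 1 / symbol (idx n :: int ^ 'd) * trig (idx n :: int ^ 'd) x) k = 1 / symbol (idx n :: int ^ 'd) * coef (trig (idx n)) k"
      by (simp add: L2_inner_def)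
    then show "coef (cov (trig (idx n))) k = coef (\<lambda>x. 1 / symbol (idx n :: int ^ 'd) * trig (idx n :: int ^ 'd) x) k"
      by (auto simp: coef_cov[OF tL d] coef_trig)
  qed
next
  fix f :: "real ^ 'd \<Rightarrow> real" assume f: "f \<in> L2_space unit_cube" and z: "\<forall>n. coef f (idx n) = 0"
  show "AE x in lebesgue_on unit_cube. f x = 0"
  proof (rule coef_zero_imp_AE_zero[OF L2_unit_cube_integrable[OF f]])
    fix k :: "int ^ 'd"
    obtain n where "k = idx n" by (rule idx_surj)
    then show "coef f k = 0" using z by simp
  qed
qed

text \<open>The eigenspaces of the covariance operator are finite-dimensional because the symbol
tends to infinity.\<close>

lemma finite_symbol_level:
  "finite {l :: int ^ 'd::finite. symbol l = c}"
proof -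
  obtain c0 where c0: "0 < c0" "\<And>k::int ^ 'd. c0 * (1 + freq_sq k)\<^sup>2 \<le> symbol k" using symbol_lower_bound by blast
  let ?N = "\<lceil>c / c0\<rceil>"
  have "\<bar>l $ i\<bar> \<le> ?N" if l: "symbol l = c" for l :: "int ^ 'd" and i
  proof -
    have s1: "1 \<le> 1 + freq_sq l" using freq_sq_nonneg[of l] by simp
    have "(of_int (l $ i))\<^sup>2 \<le> (freq l $ i)\<^sup>2"
    proof -
      have "1 \<le> 2 * pi" using pi_gt3 by linarith
      then have "1 \<le> (2 * pi)\<^sup>2" by (rule one_le_power)
      then have "1 * (of_int (l $ i))\<^sup>2 \<le> (2 * pi)\<^sup>2 * (of_int (l $ i) :: real)\<^sup>2"
        by (rule mult_right_mono) simp
      then show ?thesis by (simp add: freq_def power_mult_distrib)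
    qed
    moreover have "\<bar>of_int (l $ i)\<bar> \<le> (of_int (l $ i) :: real)\<^sup>2"
    proof -
      have "\<bar>l $ i\<bar> \<le> (l $ i)\<^sup>2"
      proof (cases "l $ i = 0")
        case False
        then have "\<bar>l $ i\<bar> * 1 \<le> \<bar>l $ i\<bar> * \<bar>l $ i\<bar>" by (intro mult_left_mono) auto
        then show ?thesis by (simp add: power2_eq_square)
      qed simp
      then show ?thesis by (metis of_int_abs of_int_le_iff of_int_power)
    qed
    ultimately have "\<bar>of_int (l $ i)\<bar> \<le> 1 + freq_sq l" using freq_component_le[of l i] by linarith
    also have "\<dots> \<le> (1 + freq_sq l)\<^sup>2" using self_le_power[OF s1, of 2] by simp
    also have "\<dots> \<le> c / c0" using c0(1) c0(2)[of l] l by (simp add: field_simps)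
    finally show ?thesis by linarith
  qed
  then have "{l :: int ^ 'd. symbol l = c} \<subseteq> vec_lambda ` (PiE (UNIV :: 'd set) (\<lambda>_. {- ?N..?N}))"
    by (intro subsetI image_eqI[where x="vec_nth _"]) (auto simp: abs_le_iff vec_nth_inverse minus_le_iff)
  then show ?thesis by (rule finite_subset) (intro finite_imageI finite_PiE, auto)
qed

text \<open>Convergence holds already for the trigonometric eigenbasis, so the choice in the
definition of the fractional power is not vacuous.\<close>

lemma frac_power_exists:
  assumes d: "CARD('d::finite) \<le> 3" and \<alpha>: "real CARD('d) / 2 < \<alpha>" and f: "(f :: real ^ 'd \<Rightarrow> real) \<in> L2_space unit_cube"
  shows "\<exists>g. g \<in> L2_space unit_cube \<and> (\<exists>e lam. orthonormal_eigenbasis unit_cube cov e lam \<and>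
    (\<lambda>N. L2_nrm unit_cube (\<lambda>x. g x - (\<Sum>n<N. lam n powr (\<alpha> / 2) * L2_inner unit_cube f (e n) * e n x))) \<longlonglongrightarrow> 0)"
proof -
  define a where "a n = (1 / symbol (idx n :: int ^ 'd)) powr (\<alpha> / 2) * coef f (idx n)" for n
  note S = summable_symbol_powr0[OF \<alpha>]
  let ?B = "sqrt (L2_inner unit_cube f f)"
  have cb: "\<bar>coef f k\<bar> \<le> ?B" for k
    using coef_square_le[OF f, of k] real_sqrt_le_mono by fastforce
  have a: "summable (\<lambda>n. \<bar>a n\<bar>)"
    by (rule summable_comparison_test'[OF summable_mult2[OF S, of ?B]])
      (simp add: a_def abs_mult mult_left_mono cb)
  define g where "g = trig_series a (idx :: nat \<Rightarrow> int ^ 'd)"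
  have gL: "g \<in> L2_space unit_cube" unfolding g_def by (rule trig_series_L2[OF a lmeasurable_unit_cube])
  define T where "T N = (\<Sum>n. \<bar>a (n + N)\<bar>)" for N
  have T0: "T \<longlonglongrightarrow> 0" unfolding T_def using suminf_exist_split2[OF a] .
  have "L2_nrm unit_cube (\<lambda>x. g x - (\<Sum>n<N. a n * trig (idx n) x)) \<le> 2 * T N" for N
  proof -
    have a': "summable (\<lambda>n. \<bar>a (n + N)\<bar>)" using a by (simp add: summable_iff_shift[of "\<lambda>n. \<bar>a n\<bar>"])
    have eq: "g x - (\<Sum>n<N. a n * trig (idx n) x) = trig_series (\<lambda>n. a (n + N)) (\<lambda>n. idx (n + N)) x" for x
      unfolding g_def trig_series_def using suminf_split_initial_segment[OF summable_trig_series[OF a, of idx x], of N] by simp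
    let ?h = "trig_series (\<lambda>n. a (n + N)) (\<lambda>n. idx (n + N) :: int ^ 'd)"
    have TN: "0 \<le> T N" unfolding T_def by (rule suminf_nonneg[OF a']) simp
    have "(?h x)\<^sup>2 \<le> (2 * T N)\<^sup>2" for x
      using power_mono[OF trig_series_bound[OF a', of "\<lambda>n. idx (n + N)" x] abs_ge_zero, of 2] by (simp add: T_def)
    then have "L2_inner unit_cube ?h ?h \<le> (LINT x|lebesgue_on (unit_cube :: (real ^ 'd) set). (2 * T N)\<^sup>2)"
      unfolding L2_inner_def power2_eq_square[symmetric]
      by (intro integral_mono L2_square_integrable trig_series_L2[OF a' lmeasurable_unit_cube]
          finite_measure.integrable_const[OF finite_measure_unit_cube]) auto
    also have "\<dots> = (2 * T N)\<^sup>2" by (simp add: measure_restrict_space measure_unit_cube)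
    finally show ?thesis
      unfolding L2_nrm_def eq using TN by (intro real_le_lsqrt) (auto simp: L2_inner_self_nonneg)
  qed
  then have "(\<lambda>N. L2_nrm unit_cube (\<lambda>x. g x - (\<Sum>n<N. a n * trig (idx n) x))) \<longlonglongrightarrow> 0"
    by (intro tendsto_sandwich[OF _ _ tendsto_const tendsto_mult_right_zero[OF T0, of 2]])
      (auto simp: L2_nrm_def L2_inner_self_nonneg)
  then have "(\<lambda>N. L2_nrm unit_cube (\<lambda>x. g x - (\<Sum>n<N. (1 / symbol (idx n :: int ^ 'd)) powr (\<alpha> / 2) * L2_inner unit_cube f (trig (idx n)) * trig (idx n) x))) \<longlonglongrightarrow> 0"
    by (simp add: a_def)
  then show ?thesis using gL trig_eigenbasis[OF d] by blast
qed

text \<open>The fractional power is defined through an unspecified eigenbasis \<open>e\<close>, which has to be compared with the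
trigonometric one. Applying the covariance operator shows that \<open>e n\<close> has a nonzero coefficient at
frequency \<open>l\<close> only if their eigenvalues agree. Hence each eigenvalue belongs to finitely many members
of either basis: the \<open>e n\<close> with that eigenvalue are orthonormal combinations of finitely many modes,
and Bessel's inequality bounds their number. Each mode \<open>trig k\<close> is thus a finite combination of
those \<open>e n\<close>, on which the partial sums defining the fractional power eventually act as the scalar
\<open>(1 / symbol k) powr (\<alpha> / 2)\<close>.\<close>

lemma frac_power_coef:
  assumes d: "CARD('d::finite) \<le> 3" and \<alpha>: "real CARD('d) / 2 < \<alpha>" and f: "(f :: real ^ 'd \<Rightarrow> real) \<in> L2_space unit_cube"
  defines "g \<equiv> frac_power unit_cube cov (\<alpha> / 2) f"
  shows "g \<in> L2_space unit_cube" and "coef g k = (1 / symbol k) powr (\<alpha> / 2) * coef f k"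
proof -
  have "g \<in> L2_space unit_cube \<and> (\<exists>e lam. orthonormal_eigenbasis unit_cube cov e lam \<and>
    (\<lambda>N. L2_nrm unit_cube (\<lambda>x. g x - (\<Sum>n<N. lam n powr (\<alpha> / 2) * L2_inner unit_cube f (e n) * e n x))) \<longlonglongrightarrow> 0)"
    unfolding g_def frac_power_def using frac_power_exists[OF d \<alpha> f] by (rule someI_ex)
  then obtain e lam where g: "g \<in> L2_space unit_cube" and eb: "orthonormal_eigenbasis unit_cube cov e lam"
    and lim: "(\<lambda>N. L2_nrm unit_cube (\<lambda>x. g x - (\<Sum>n<N. lam n powr (\<alpha> / 2) * L2_inner unit_cube f (e n) * e n x))) \<longlonglongrightarrow> 0"
    by blast
  show "g \<in> L2_space unit_cube" by (rule g)
  have eL: "e n \<in> L2_space unit_cube" for n using eb by (simp add: orthonormal_eigenbasis_def)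
  have eo: "L2_inner unit_cube (e m) (e n) = of_bool (m = n)" for m n
    using eb by (simp add: orthonormal_eigenbasis_def)
  have ec: "AE x in lebesgue_on unit_cube. h x = 0" if "h \<in> L2_space unit_cube" "\<And>n. L2_inner unit_cube h (e n) = 0" for h
    using eb that by (simp add: orthonormal_eigenbasis_def)
  have tL: "trig k \<in> L2_space unit_cube" for k :: "int ^ 'd" by (rule trig_L2[OF lmeasurable_unit_cube])
  \<comment> \<open>the two eigenbases are matched: a nonzero coefficient forces equal eigenvalues\<close>
  have lam: "lam n = 1 / symbol l" if nz: "coef (e n) l \<noteq> 0" for n l
  proof -
    have "AE x in lebesgue_on unit_cube. cov (e n) x = lam n * e n x"
      using eb by (simp add: orthonormal_eigenbasis_def)
    then have "coef (cov (e n)) l = coef (\<lambda>x. lam n * e n x) l"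
      by (intro L2_inner_AE_cong) (auto intro!: borel_measurable_integrable L2_mult_integrable cov_L2 eL d tL)
    also have "\<dots> = lam n * coef (e n) l" by (simp add: L2_inner_def mult.assoc)
    finally have "coef (e n) l / symbol l = lam n * coef (e n) l" by (simp add: coef_cov[OF eL d])
    then show ?thesis using nz symbol_pos[of l] by (simp add: field_simps)
  qed
  define M where "M = {n. lam n = 1 / symbol k}"
  define L where "L = {l :: int ^ 'd. symbol l = symbol k}"
  have finL: "finite L" unfolding L_def by (rule finite_symbol_level)
  have e_exp: "(\<Sum>l\<in>L. (coef (e n) l)\<^sup>2) = 1" if n: "n \<in> M" for n
  proof -
    have out: "coef (e n) l = 0" if "l \<notin> L" for l
      using lam[of n l] n that symbol_pos[of l] symbol_pos[of k] by (auto simp: M_def L_def)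
    have "AE x in lebesgue_on unit_cube. e n x = (\<Sum>l\<in>L. coef (e n) l * trig l x)"
    proof (rule coef_eq_imp_AE_eq)
      show "integrable (lebesgue_on unit_cube) (e n)" by (rule L2_unit_cube_integrable[OF eL])
      show "integrable (lebesgue_on unit_cube) (\<lambda>x. \<Sum>l\<in>L. coef (e n) l * trig l x)"
        by (intro L2_unit_cube_integrable L2_sum L2_scale tL)
      fix j
      have "coef (\<lambda>x. \<Sum>l\<in>L. coef (e n) l * trig l x) j = (\<Sum>l\<in>L. coef (e n) l * coef (trig l) j)"
        by (rule L2_inner_sum_left[OF tL tL])
      also have "\<dots> = (\<Sum>l\<in>L. if l = j then coef (e n) j else 0)" by (intro sum.cong) (auto simp: coef_trig)
      also have "\<dots> = coef (e n) j" using finL out by simp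
      finally show "coef (e n) j = coef (\<lambda>x. \<Sum>l\<in>L. coef (e n) l * trig l x) j" by simp
    qed
    then have "L2_inner unit_cube (e n) (e n) = L2_inner unit_cube (\<lambda>x. \<Sum>l\<in>L. coef (e n) l * trig l x) (e n)"
      by (intro L2_inner_AE_cong) (auto intro!: borel_measurable_integrable L2_mult_integrable eL)
    also have "\<dots> = (\<Sum>l\<in>L. coef (e n) l * L2_inner unit_cube (trig l) (e n))"
      by (rule L2_inner_sum_left[OF tL eL])
    finally show ?thesis by (simp add: eo power2_eq_square L2_inner_commute[of _ "trig _"])
  qed
  \<comment> \<open>Bessel's inequality for the modes in \<open>L\<close>, summed over \<open>l\<close>, bounds the number of basis elements by the number of modes.\<close>
  have finM: "finite M"
  proof (rule ccontr)
    assume "infinite M"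
    then obtain F where F: "F \<subseteq> M" "finite F" "card F = card L + 1" using infinite_arbitrarily_large by blast
    have "real (card F) = (\<Sum>n\<in>F. \<Sum>l\<in>L. (coef (e n) l)\<^sup>2)" using F e_exp by (simp add: subset_iff)
    also have "\<dots> = (\<Sum>l\<in>L. \<Sum>n\<in>F. (L2_inner unit_cube (trig l) (e n))\<^sup>2)"
      by (subst sum.swap) (simp add: L2_inner_commute[of _ "trig _"])
    also have "\<dots> \<le> (\<Sum>l\<in>L. L2_inner unit_cube (trig l) (trig l))"
      by (intro sum_mono bessel_finite tL F eL) (simp add: eo)
    also have "\<dots> = real (card L)" by (simp add: trig_orthonormal)
    finally show False using F(3) by simp
  qed
  have outM: "coef (e n) k = 0" if "n \<notin> M" for n using lam[of n k] that by (auto simp: M_def)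
  have t_exp: "AE x in lebesgue_on unit_cube. trig k x - (\<Sum>n\<in>M. coef (e n) k * e n x) = 0"
  proof (rule ec)
    show "(\<lambda>x. trig k x - (\<Sum>n\<in>M. coef (e n) k * e n x)) \<in> L2_space unit_cube"
      by (intro L2_diff L2_sum L2_scale tL eL)
    fix j
    have "L2_inner unit_cube (\<lambda>x. trig k x - (\<Sum>n\<in>M. coef (e n) k * e n x)) (e j)
      = L2_inner unit_cube (trig k) (e j) - (\<Sum>n\<in>M. coef (e n) k * L2_inner unit_cube (e n) (e j))"
      by (subst L2_inner_linear(2)) (auto intro!: L2_sum L2_scale tL eL simp: L2_inner_sum_left[OF eL eL])
    also have "(\<Sum>n\<in>M. coef (e n) k * L2_inner unit_cube (e n) (e j)) = (\<Sum>n\<in>M. if n = j then coef (e j) k else 0)"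
      by (intro sum.cong) (auto simp: eo)
    also have "\<dots> = coef (e j) k" using finM outM by simp
    finally show "L2_inner unit_cube (\<lambda>x. trig k x - (\<Sum>n\<in>M. coef (e n) k * e n x)) (e j) = 0"
      by (simp add: L2_inner_commute[of _ "trig _"])
  qed
  \<comment> \<open>Taking the inner product of \<open>f\<close> with the finite expansion of \<open>trig k\<close> in the basis \<open>e\<close>.\<close>
  have cf: "coef f k = (\<Sum>n\<in>M. coef (e n) k * L2_inner unit_cube f (e n))"
  proof -
    have "L2_inner unit_cube (trig k) f = L2_inner unit_cube (\<lambda>x. \<Sum>n\<in>M. coef (e n) k * e n x) f"
      by (rule L2_inner_AE_cong) (use t_exp in \<open>auto intro!: borel_measurable_integrable L2_mult_integrable tL f\<close>)
    also have "\<dots> = (\<Sum>n\<in>M. coef (e n) k * L2_inner unit_cube (e n) f)" by (rule L2_inner_sum_left[OF eL f])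
    finally show ?thesis by (simp add: L2_inner_commute[of _ f])
  qed
  define h where "h N x = (\<Sum>n<N. lam n powr (\<alpha> / 2) * L2_inner unit_cube f (e n) * e n x)" for N x
  have hL: "h N \<in> L2_space unit_cube" for N unfolding h_def[abs_def] by (intro L2_sum L2_scale eL)
  have "(\<lambda>N. coef g k - coef (h N) k) \<longlonglongrightarrow> 0"
  proof (rule Lim_null_comparison[OF _ lim])
    show "\<forall>\<^sub>F N in sequentially. norm (coef g k - coef (h N) k) \<le>
        L2_nrm unit_cube (\<lambda>x. g x - (\<Sum>n<N. lam n powr (\<alpha> / 2) * L2_inner unit_cube f (e n) * e n x))"
    proof (intro always_eventually allI)
      fix N
      have dL: "(\<lambda>x. g x - h N x) \<in> L2_space unit_cube" by (rule L2_diff[OF g hL])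
      have "(coef (\<lambda>x. g x - h N x) k)\<^sup>2 \<le> L2_inner unit_cube (\<lambda>x. g x - h N x) (\<lambda>x. g x - h N x)"
        by (rule coef_square_le[OF dL])
      then have "\<bar>coef (\<lambda>x. g x - h N x) k\<bar> \<le> L2_nrm unit_cube (\<lambda>x. g x - h N x)"
        unfolding L2_nrm_def using real_sqrt_le_mono by fastforce
      then show "norm (coef g k - coef (h N) k) \<le> L2_nrm unit_cube (\<lambda>x. g x - (\<Sum>n<N. lam n powr (\<alpha> / 2) * L2_inner unit_cube f (e n) * e n x))"
        using L2_inner_linear(2)[OF g hL tL] by (simp add: h_def)
    qed
  qed
  moreover have "\<forall>\<^sub>F N in sequentially. coef g k - coef (h N) k = coef g k - (1 / symbol k) powr (\<alpha> / 2) * coef f k"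
  proof -
    obtain N0 where N0: "M \<subseteq> {..<N0}" using finM finite_nat_iff_bounded by blast
    show ?thesis
      using eventually_ge_at_top[of N0]
    proof eventually_elim
      case (elim N)
      have "coef (h N) k = (\<Sum>n<N. lam n powr (\<alpha> / 2) * L2_inner unit_cube f (e n) * coef (e n) k)"
        unfolding h_def[abs_def] by (rule L2_inner_sum_left[OF eL tL])
      also have "\<dots> = (\<Sum>n\<in>M. lam n powr (\<alpha> / 2) * L2_inner unit_cube f (e n) * coef (e n) k)"
        by (rule sum.mono_neutral_right) (use N0 elim outM in auto)
      also have "\<dots> = (\<Sum>n\<in>M. (1 / symbol k) powr (\<alpha> / 2) * (coef (e n) k * L2_inner unit_cube f (e n)))"
        by (intro sum.cong) (auto simp: M_def)
      also have "\<dots> = (1 / symbol k) powr (\<alpha> / 2) * coef f k" by (simp only: cf sum_distrib_left)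
      finally show ?case by simp
    qed
  qed
  ultimately have "(\<lambda>N. coef g k - (1 / symbol k) powr (\<alpha> / 2) * coef f k) \<longlonglongrightarrow> 0"
    by (rule Lim_transform_eventually)
  then show "coef g k = (1 / symbol k) powr (\<alpha> / 2) * coef f k" by (simp add: LIMSEQ_const_iff)
qed

text \<open>Parseval's identity; the coefficients of the fractional power are absolutely summable because those of \<open>f\<close>
are bounded.\<close>

theorem frac_power_quadratic_form:
  assumes d: "CARD('d::finite) \<le> 3" and \<alpha>: "real CARD('d) / 2 < \<alpha>" and f: "(f :: real ^ 'd \<Rightarrow> real) \<in> L2_space unit_cube"
  shows "(\<lambda>n. (1 / symbol (idx n :: int ^ 'd)) powr (\<alpha> / 2) * (coef f (idx n))\<^sup>2) sums
    L2_inner unit_cube f (frac_power unit_cube cov (\<alpha> / 2) f)"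
proof -
  let ?g = "frac_power unit_cube cov (\<alpha> / 2) f"
  note G = frac_power_coef[OF d \<alpha> f]
  note S = summable_symbol_powr0[OF \<alpha>]
  have cb: "\<bar>coef f k\<bar> \<le> sqrt (L2_inner unit_cube f f)" for k
    using coef_square_le[OF f, of k] real_sqrt_le_mono by fastforce
  have a: "summable (\<lambda>n. \<bar>coef ?g (idx n)\<bar>)"
    by (rule summable_comparison_test'[OF summable_mult2[OF S, of "sqrt (L2_inner unit_cube f f)"]])
      (simp add: G(2) abs_mult mult_left_mono cb)
  from parseval_sums[OF G(1) a f] show ?thesis
    by (simp add: G(2) L2_inner_commute[of _ f] power2_eq_square mult.assoc)
qed

end

section \<open>Independence of uncorrelated jointly Gaussian variables\<close>

lemma (in prob_space) integrable_weighted_iexp: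
  assumes [measurable]: "w \<in> borel_measurable M" "Y \<in> borel_measurable M" and w: "\<And>x. \<bar>w x\<bar> \<le> K"
  shows "integrable M (\<lambda>x. of_real (w x) * iexp (Y x))"
proof (rule integrable_const_bound[of _ K])
  show "AE x in M. cmod (of_real (w x) * iexp (Y x)) \<le> K"
    using w by (intro AE_I2) (simp add: norm_mult)
qed measurable

text \<open>A nonnegative weight normalised to mean one defines a new probability
measure, under which \<open>Y\<close> has an unchanged characteristic function; Levy's uniqueness theorem in one
dimension then identifies the two laws.\<close>

lemma (in prob_space) weighted_char_determines_weighted_law:
  assumes wm [measurable]: "w \<in> borel_measurable M" and w: "\<And>x. 0 \<le> w x" "\<And>x. w x \<le> K"
    and Y [measurable]: "Y \<in> borel_measurable M" and c: "0 < c"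
    and eq: "\<And>t. (CLINT x|M. of_real (w x) * iexp (t * Y x)) = of_real c * (CLINT x|M. iexp (t * Y x))"
    and A [measurable]: "A \<in> sets borel"
  shows "(LINT x|M. w x * indicator A (Y x)) = c * (LINT x|M. indicator A (Y x))"
proof -
  have wK: "\<bar>w x\<bar> \<le> K" for x using w[of x] by simp
  have wi: "integrable M w" by (rule integrable_const_bound[of _ K]) (use wK in auto)
  have "(CLINT x|M. of_real (w x)) = of_real c" using eq[of 0] by (simp add: prob_space)
  then have Ew: "(LINT x|M. w x) = c" by (simp only: integral_complex_of_real of_real_eq_iff)
  define N where "N = density M (\<lambda>x. ennreal (w x / c))"
  have "emeasure N (space N) = (\<integral>\<^sup>+x. ennreal (w x / c) \<partial>M)"
    by (simp add: N_def emeasure_density cong: nn_integral_cong)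
  also have "\<dots> = ennreal (LINT x|M. w x / c)"
    by (rule nn_integral_eq_integral) (use wi w c in auto)
  also have "\<dots> = 1" using Ew c by simp
  finally interpret N: prob_space N by (rule prob_spaceI)
  have YN [measurable]: "Y \<in> borel_measurable N" by (simp add: N_def)
  have "char (distr N borel Y) t = char (distr M borel Y) t" for t
  proof -
    have "char (distr N borel Y) t = (CLINT x|N. iexp (t * Y x))"
      by (simp add: char_def integral_distr)
    also have "\<dots> = (CLINT x|M. (w x / c) *\<^sub>R iexp (t * Y x))"
      unfolding N_def by (rule integral_density) (use w c in auto)
    also have "\<dots> = (CLINT x|M. of_real (1 / c) * (of_real (w x) * iexp (t * Y x)))"
      by (simp add: scaleR_conv_of_real)
    also have "\<dots> = of_real (1 / c) * (of_real c * (CLINT x|M. iexp (t * Y x)))"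
      by (simp only: integral_mult_right_zero eq)
    also have "\<dots> = (CLINT x|M. iexp (t * Y x))" using c by simp
    also have "\<dots> = char (distr M borel Y) t" by (simp add: char_def integral_distr)
    finally show ?thesis .
  qed
  then have "distr N borel Y = distr M borel Y"
    by (intro Levy_uniqueness ext) (auto intro: real_distribution_distr N.real_distribution_distr)
  then have "(LINT x|N. indicator A (Y x) :: real) = (LINT x|M. indicator A (Y x))"
    using integral_distr[OF YN, of "indicator A :: real \<Rightarrow> real"] integral_distr[OF Y, of "indicator A :: real \<Rightarrow> real"] by simp
  moreover have "(LINT x|N. indicator A (Y x) :: real) = (LINT x|M. (w x / c) *\<^sub>R indicator A (Y x))"
    unfolding N_def by (rule integral_density) (use w c in auto)
  ultimately show ?thesis using c by (simp add: field_simps)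
qed

text \<open>Independence from a factorising joint characteristic function, by means of the
one-dimensional uniqueness theorem only. For fixed \<open>s\<close>, the weights \<open>1 + cos (s X)\<close> and
\<open>1 + sin (s X)\<close> are nonnegative and rescale the characteristic function of \<open>Y\<close>, so that
\<open>E (exp (i s X) ; Y \<in> A) = \<phi> s P (Y \<in> A)\<close>. A second application, with the indicator of \<open>Y \<in> A\<close> as
weight for \<open>X\<close>, yields the product rule. The evenness and positivity of \<open>\<phi>\<close> hold for centred
Gaussians.\<close>

lemma (in prob_space) factorising_char_imp_indep:
  assumes X [measurable]: "X \<in> borel_measurable M" and Y [measurable]: "Y \<in> borel_measurable M"
    and H: "\<And>s t. (CLINT x|M. iexp (s * X x + t * Y x)) = of_real (\<phi> s * \<psi> t)"
    and \<phi>: "\<And>s. \<phi> (- s) = \<phi> s" "\<And>s. 0 < \<phi> s" "\<phi> 0 = 1" and \<psi>: "\<psi> 0 = 1"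
  shows "distr M borel X \<Otimes>\<^sub>M distr M borel Y = distr M (borel \<Otimes>\<^sub>M borel) (\<lambda>x. (X x, Y x))"
proof -
  have iexp_add: "iexp (a + b) = iexp a * iexp b" for a b
    by (simp add: exp_add distrib_left)
  have iexp_cos_sin: "iexp r = of_real (cos r) + \<i> * of_real (sin r)" for r
    by (simp add: exp_Euler cos_of_real sin_of_real)
  have HY: "(CLINT x|M. iexp (t * Y x)) = of_real (\<psi> t)" for t using H[of 0 t] \<phi>(3) by simp
  have HX: "(CLINT x|M. iexp (s * X x)) = of_real (\<phi> s)" for s using H[of s 0] \<psi> by simp
  have i1: "integrable M (\<lambda>x. iexp (s * X x + t * Y x))" for s t
    using integrable_weighted_iexp[of "\<lambda>_. 1" "\<lambda>x. s * X x + t * Y x" 1] by simp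
  have i0: "integrable M (\<lambda>x. iexp (t * Y x))" for t using i1[of 0 t] by simp
  have bi: "integrable M (\<lambda>x. f x * indicator A (Y x))"
    if [measurable]: "f \<in> borel_measurable M" "A \<in> sets borel" and "\<And>x. \<bar>f x\<bar> \<le> 1" for f :: "'a \<Rightarrow> real" and A
    by (rule integrable_const_bound[of _ 1]) (use that(3) in \<open>auto simp: indicator_def\<close>)
  \<comment> \<open>The weight must be nonnegative, hence \<open>1 + cos\<close> in place of \<open>cos\<close>.\<close>
  have C: "(LINT x|M. cos (s * X x) * indicator A (Y x)) = \<phi> s * (LINT x|M. indicator A (Y x))"
    if A [measurable]: "A \<in> sets borel" for s A
  proof -
    have "(LINT x|M. (1 + cos (s * X x)) * indicator A (Y x)) = (1 + \<phi> s) * (LINT x|M. indicator A (Y x))"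
    proof (rule weighted_char_determines_weighted_law[where K=2])
      show "0 \<le> 1 + cos (s * X x)" "1 + cos (s * X x) \<le> 2" for x
        using cos_ge_minus_one[of "s * X x"] cos_le_one[of "s * X x"] by linarith+
      show "0 < 1 + \<phi> s" using \<phi>(2)[of s] by simp
      fix t
      have "of_real (1 + cos (s * X x)) * iexp (t * Y x) =
          iexp (t * Y x) + (iexp (s * X x + t * Y x) + iexp (- s * X x + t * Y x)) / 2" for x
      proof -
        have "complex_of_real (cos (s * X x)) = (iexp (s * X x) + iexp (- s * X x)) / 2"
          by (simp add: cos_of_real[symmetric] cos_exp_eq)
        then have "of_real (1 + cos (s * X x)) * iexp (t * Y x) =
            iexp (t * Y x) + (iexp (s * X x) * iexp (t * Y x) + iexp (- s * X x) * iexp (t * Y x)) / 2"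
          by (simp only: of_real_add of_real_1) (simp only: distrib_right add_divide_distrib mult_1 times_divide_eq_left)
        then show ?thesis by (simp only: iexp_add)
      qed
      then have "(CLINT x|M. of_real (1 + cos (s * X x)) * iexp (t * Y x)) =
          (CLINT x|M. iexp (t * Y x) + (iexp (s * X x + t * Y x) + iexp (- s * X x + t * Y x)) / 2)"
        by simp
      also have "\<dots> = of_real (\<psi> t) + (of_real (\<phi> s * \<psi> t) + of_real (\<phi> (- s) * \<psi> t)) / 2"
        using i0[of t] i1[of s t] i1[of "- s" t] by (simp only: Bochner_Integration.integral_add Bochner_Integration.integrable_add integrable_divide_zero integral_divide_zero H HY)
      also have "\<dots> = of_real (1 + \<phi> s) * (CLINT x|M. iexp (t * Y x))"
        unfolding HY \<phi>(1) by (simp add: distrib_right)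
      finally show "(CLINT x|M. of_real (1 + cos (s * X x)) * iexp (t * Y x)) = of_real (1 + \<phi> s) * (CLINT x|M. iexp (t * Y x))" .
    qed measurable
    then show ?thesis
      using bi[OF _ A, of "\<lambda>x. cos (s * X x)"] bi[OF _ A, of "\<lambda>x. 1"] by (simp add: distrib_right)
  qed
  \<comment> \<open>By evenness of \<open>\<phi>\<close> the weight \<open>1 + sin (s X)\<close> does not change the characteristic function at all.\<close>
  have S: "(LINT x|M. sin (s * X x) * indicator A (Y x)) = 0" if A [measurable]: "A \<in> sets borel" for s A
  proof -
    have "(LINT x|M. (1 + sin (s * X x)) * indicator A (Y x)) = 1 * (LINT x|M. indicator A (Y x))"
    proof (rule weighted_char_determines_weighted_law[where K=2])
      show "0 \<le> 1 + sin (s * X x)" "1 + sin (s * X x) \<le> 2" for x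
        using sin_ge_minus_one[of "s * X x"] sin_le_one[of "s * X x"] by linarith+
      fix t
      have "of_real (1 + sin (s * X x)) * iexp (t * Y x) =
          iexp (t * Y x) + (iexp (s * X x + t * Y x) - iexp (- s * X x + t * Y x)) / (2 * \<i>)" for x
      proof -
        have "complex_of_real (sin (s * X x)) = (iexp (s * X x) - iexp (- s * X x)) / (2 * \<i>)"
          by (simp add: sin_of_real[symmetric] sin_exp_eq)
        then have "of_real (1 + sin (s * X x)) * iexp (t * Y x) =
            iexp (t * Y x) + (iexp (s * X x) * iexp (t * Y x) - iexp (- s * X x) * iexp (t * Y x)) / (2 * \<i>)"
          by (simp only: of_real_add of_real_1)
            (simp only: distrib_right left_diff_distrib diff_divide_distrib mult_1 times_divide_eq_left)
        then show ?thesis by (simp only: iexp_add)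
      qed
      then have "(CLINT x|M. of_real (1 + sin (s * X x)) * iexp (t * Y x)) =
          (CLINT x|M. iexp (t * Y x) + (iexp (s * X x + t * Y x) - iexp (- s * X x + t * Y x)) / (2 * \<i>))"
        by simp
      also have "\<dots> = of_real (\<psi> t) + (of_real (\<phi> s * \<psi> t) - of_real (\<phi> (- s) * \<psi> t)) / (2 * \<i>)"
        using i0[of t] i1[of s t] i1[of "- s" t]
        by (simp only: Bochner_Integration.integral_add Bochner_Integration.integral_diff Bochner_Integration.integrable_diff integrable_divide_zero integral_divide_zero H HY)
      also have "\<dots> = of_real 1 * (CLINT x|M. iexp (t * Y x))" unfolding HY \<phi>(1) by simp
      finally show "(CLINT x|M. of_real (1 + sin (s * X x)) * iexp (t * Y x)) = of_real 1 * (CLINT x|M. iexp (t * Y x))" .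
      show "(\<lambda>x. 1 + sin (s * X x)) \<in> borel_measurable M" by measurable
    qed (use Y A in auto)
    then show ?thesis
      using bi[OF _ A, of "\<lambda>x. sin (s * X x)"] bi[OF _ A, of "\<lambda>x. 1"] by (simp add: distrib_right)
  qed
  have P: "(LINT x|M. indicator A (Y x) * indicator B (X x)) = (LINT x|M. indicator A (Y x)) * (LINT x|M. indicator B (X x) :: real)"
    if A [measurable]: "A \<in> sets borel" and B [measurable]: "B \<in> sets borel" for A B :: "real set"
  proof (cases "(LINT x|M. indicator A (Y x) :: real) = 0")
    case True
    have "AE x in M. (indicator A (Y x) :: real) = 0"
      using True bi[OF _ A, of "\<lambda>x. 1"] by (subst (asm) integral_nonneg_eq_0_iff_AE) auto
    then have "AE x in M. (indicator A (Y x) * indicator B (X x) :: real) = 0" by eventually_elim simp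
    then have "(LINT x|M. indicator A (Y x) * indicator B (X x) :: real) = 0"
      by (rule integral_eq_zero_AE)
    then show ?thesis using True by simp
  next
    case False
    show ?thesis
    proof (rule weighted_char_determines_weighted_law[where K=1])
      have "0 \<le> (LINT x|M. indicator A (Y x) :: real)" by (intro integral_nonneg_AE AE_I2) simp
      then show "0 < (LINT x|M. indicator A (Y x) :: real)" using False by linarith
      fix s
      have "(CLINT x|M. of_real (indicator A (Y x)) * iexp (s * X x)) =
          (CLINT x|M. of_real (cos (s * X x) * indicator A (Y x)) + \<i> * of_real (sin (s * X x) * indicator A (Y x)))"
        by (rule Bochner_Integration.integral_cong[OF refl], subst iexp_cos_sin) (simp add: distrib_left mult_ac)
      also have "\<dots> = of_real (LINT x|M. cos (s * X x) * indicator A (Y x)) + \<i> * of_real (LINT x|M. sin (s * X x) * indicator A (Y x))"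
        using bi[OF _ A, of "\<lambda>x. cos (s * X x)"] bi[OF _ A, of "\<lambda>x. sin (s * X x)"]
        by (subst Bochner_Integration.integral_add) (auto simp: integral_complex_of_real simp del: of_real_mult)
      also have "\<dots> = of_real (LINT x|M. indicator A (Y x)) * (CLINT x|M. iexp (s * X x))"
        unfolding C[OF A] S[OF A] HX by (simp add: mult.commute)
      finally show "(CLINT x|M. of_real (indicator A (Y x)) * iexp (s * X x)) = of_real (LINT x|M. indicator A (Y x)) * (CLINT x|M. iexp (s * X x))" .
    qed (auto simp: indicator_def)
  qed
  show ?thesis
  proof (rule pair_measure_eqI)
    show "sigma_finite_measure (distr M borel X)" "sigma_finite_measure (distr M borel Y)"
      by (auto intro!: prob_space_imp_sigma_finite prob_space_distr)
    fix B A assume "B \<in> sets (distr M borel X)" "A \<in> sets (distr M borel Y)"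
    then have [measurable]: "B \<in> sets borel" "A \<in> sets borel" by auto
    have "emeasure (distr M (borel \<Otimes>\<^sub>M borel) (\<lambda>x. (X x, Y x))) (B \<times> A) = emeasure M ((X -` B \<inter> space M) \<inter> (Y -` A \<inter> space M))"
      by (subst emeasure_distr) (auto intro!: arg_cong[where f="emeasure M"])
    also have "\<dots> = ennreal (prob ((X -` B \<inter> space M) \<inter> (Y -` A \<inter> space M)))" by (rule emeasure_eq_measure)
    also have "prob ((X -` B \<inter> space M) \<inter> (Y -` A \<inter> space M)) = (LINT x|M. indicator A (Y x) * indicator B (X x))"
    proof -
      have "prob ((X -` B \<inter> space M) \<inter> (Y -` A \<inter> space M)) = (LINT x|M. indicator ((X -` B \<inter> space M) \<inter> (Y -` A \<inter> space M)) x)"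
        by simp
      also have "\<dots> = (LINT x|M. indicator A (Y x) * indicator B (X x))"
        by (intro Bochner_Integration.integral_cong) (auto simp: indicator_def)
      finally show ?thesis .
    qed
    also have "\<dots> = (LINT x|M. indicator A (Y x)) * (LINT x|M. indicator B (X x))" by (rule P) auto
    also have "(LINT x|M. indicator A (Y x)) = prob (Y -` A \<inter> space M)"
    proof -
      have "(LINT x|M. indicator A (Y x)) = (LINT x|M. indicator (Y -` A \<inter> space M) x :: real)"
        by (intro Bochner_Integration.integral_cong) (auto simp: indicator_def)
      then show ?thesis by simp
    qed
    also have "(LINT x|M. indicator B (X x)) = prob (X -` B \<inter> space M)"
    proof -
      have "(LINT x|M. indicator B (X x)) = (LINT x|M. indicator (X -` B \<inter> space M) x :: real)"
        by (intro Bochner_Integration.integral_cong) (auto simp: indicator_def)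
      then show ?thesis by simp
    qed
    finally show "emeasure (distr M borel X) B * emeasure (distr M borel Y) A
        = emeasure (distr M (borel \<Otimes>\<^sub>M borel) (\<lambda>x. (X x, Y x))) (B \<times> A)"
      by (simp add: emeasure_distr emeasure_eq_measure ennreal_mult' mult.commute)
  qed simp
qed

lemma sets_normal_law [simp]: "sets (normal_law m v) = sets borel"
  by (simp add: normal_law_def)

lemma real_distribution_normal_law: "0 \<le> v \<Longrightarrow> real_distribution (normal_law m v)"
proof -
  assume v: "0 \<le> v"
  have "prob_space (normal_law m v)"
    using v by (auto simp: normal_law_def intro!: prob_space_return prob_space_normal_density)
  then show ?thesis by (simp add: real_distribution_def real_distribution_axioms_def)
qed

lemma char_normal_law:
  assumes "0 \<le> v" shows "char (normal_law 0 v) t = of_real (exp (- (t\<^sup>2 * v) / 2))"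
proof (cases "v = 0")
  case True
  then show ?thesis by (simp add: normal_law_def char_def integral_return)
next
  case False
  define \<sigma> where "\<sigma> = sqrt v"
  have \<sigma>: "0 < \<sigma>" "\<sigma>\<^sup>2 = v" using False assms by (auto simp: \<sigma>_def)
  have "char (normal_law 0 v) t = (CLINT x|lborel. normal_density 0 \<sigma> x *\<^sub>R iexp (t * x))"
    using False by (simp add: normal_law_def char_def integral_density \<sigma>_def)
  also have "\<dots> = \<bar>\<sigma>\<bar> *\<^sub>R (CLINT x|lborel. normal_density 0 \<sigma> (0 + \<sigma> * x) *\<^sub>R iexp (t * (0 + \<sigma> * x)))"
    using \<sigma> by (intro lborel_integral_real_affine) auto
  also have "\<dots> = (CLINT x|lborel. std_normal_density x *\<^sub>R iexp ((t * \<sigma>) * x))"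
  proof -
    have "\<sigma> * normal_density 0 \<sigma> (\<sigma> * x) = std_normal_density x" for x
      using \<sigma>(1) by (simp add: normal_density_def real_sqrt_mult power_mult_distrib field_simps)
    then have "\<sigma> *\<^sub>R (normal_density 0 \<sigma> (0 + \<sigma> * x) *\<^sub>R iexp (t * (0 + \<sigma> * x))) = std_normal_density x *\<^sub>R iexp ((t * \<sigma>) * x)" for x
      by (simp add: mult.assoc)
    then show ?thesis using \<sigma>(1) by (simp only: integral_scaleR_right[symmetric] abs_of_pos)
  qed
  also have "\<dots> = char std_normal_distribution (t * \<sigma>)"
    by (simp add: char_def integral_density)
  also have "\<dots> = of_real (exp (- (t\<^sup>2 * v) / 2))"
    using \<sigma> by (simp add: char_std_normal_distribution power_mult_distrib)
  finally show ?thesis .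
qed

lemma abs_moment_normal_law:
  assumes "0 \<le> s" shows "(\<integral>\<^sup>+x. ennreal \<bar>x\<bar> \<partial>normal_law 0 (s\<^sup>2)) \<le> ennreal s"
proof (cases "s = 0")
  case True
  then show ?thesis by (simp add: normal_law_def nn_integral_return)
next
  case False
  then have s: "0 < s" using assms by simp
  have hb: "has_bochner_integral lborel (\<lambda>x. normal_density 0 s x * \<bar>x\<bar>) (s * sqrt (2 / pi))"
    using normal_moment_abs_odd[of s 0 0] s by simp
  have "(\<integral>\<^sup>+x. ennreal \<bar>x\<bar> \<partial>normal_law 0 (s\<^sup>2)) = (\<integral>\<^sup>+x. ennreal (normal_density 0 s x) * ennreal \<bar>x\<bar> \<partial>lborel)"
    using s by (simp add: normal_law_def nn_integral_density)
  also have "\<dots> = (\<integral>\<^sup>+x. ennreal (normal_density 0 s x * \<bar>x\<bar>) \<partial>lborel)"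
    by (simp add: ennreal_mult)
  also have "\<dots> = ennreal (s * sqrt (2 / pi))"
    using hb by (subst nn_integral_eq_integral) (auto simp: has_bochner_integral_iff)
  also have "\<dots> \<le> ennreal s"
  proof -
    have "2 / pi \<le> 1" using pi_gt3 by simp
    then have "sqrt (2 / pi) \<le> 1" by simp
    then show ?thesis using s by (intro ennreal_leI) (simp add: mult_left_le)
  qed
  finally show ?thesis .
qed

lemma normal_law_small_ball:
  assumes "0 < \<sigma>" "0 \<le> r" shows "emeasure (normal_law 0 (\<sigma>\<^sup>2)) {x. \<bar>x\<bar> \<le> r} \<le> ennreal (2 * r / \<sigma>)"
proof -
  have dens: "normal_density 0 \<sigma> x \<le> 1 / \<sigma>" for x
  proof -
    have "1 \<le> 2 * pi" using pi_gt3 by simp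
    then have "1 \<le> sqrt (2 * pi)" by simp
    then have "\<sigma> * 1 \<le> \<sigma> * sqrt (2 * pi)" using assms by (intro mult_left_mono) auto
    also have "\<dots> = sqrt (2 * pi * \<sigma>\<^sup>2)" using assms by (simp add: real_sqrt_mult)
    finally have "1 / sqrt (2 * pi * \<sigma>\<^sup>2) \<le> 1 / \<sigma>" using assms by (intro divide_left_mono) auto
    moreover have "exp (- (x - 0)\<^sup>2 / (2 * \<sigma>\<^sup>2)) \<le> 1" by simp
    ultimately have "1 / sqrt (2 * pi * \<sigma>\<^sup>2) * exp (- (x - 0)\<^sup>2 / (2 * \<sigma>\<^sup>2)) \<le> 1 / \<sigma> * 1"
      using assms by (intro mult_mono) auto
    then show ?thesis by (simp add: normal_density_def)
  qed
  have I: "{x. \<bar>x\<bar> \<le> r} = {-r..r}" by auto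
  have "emeasure (normal_law 0 (\<sigma>\<^sup>2)) {x. \<bar>x\<bar> \<le> r} = (\<integral>\<^sup>+x. ennreal (normal_density 0 \<sigma> x) * indicator {-r..r} x \<partial>lborel)"
    using assms unfolding I by (simp add: normal_law_def emeasure_density)
  also have "\<dots> \<le> (\<integral>\<^sup>+x. ennreal (1 / \<sigma>) * indicator {-r..r} x \<partial>lborel)"
    by (intro nn_integral_mono mult_right_mono ennreal_leI dens) auto
  also have "\<dots> = ennreal (1 / \<sigma>) * ennreal (2 * r)"
    using assms by (simp add: nn_integral_cmult_indicator)
  also have "\<dots> = ennreal (2 * r / \<sigma>)" using assms by (simp flip: ennreal_mult)
  finally show ?thesis .
qed

text \<open>The factorised characteristic function makes \<open>X\<close> and \<open>Y\<close> independent centred normal variables. Given \<open>Y\<close>,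
the density of \<open>X\<close>, which is below \<open>1 / \<sigma>\<close>, is integrated over an interval of length \<open>2 \<bar>Y\<bar>\<close>, and the
mean of \<open>\<bar>Y\<bar>\<close> is at most \<open>\<rho>\<close>. For \<open>\<rho> = 0\<close> the law of \<open>Y\<close> is a point mass.\<close>

lemma (in prob_space) gaussian_pair_abs_le:
  assumes X [measurable]: "X \<in> borel_measurable M" and Y [measurable]: "Y \<in> borel_measurable M"
    and H: "\<And>s t. (CLINT x|M. iexp (s * X x + t * Y x)) = of_real (exp (- (s\<^sup>2 * \<sigma>\<^sup>2 + t\<^sup>2 * \<rho>\<^sup>2) / 2))"
    and pos: "0 < \<sigma>" "0 \<le> \<rho>"
  shows "emeasure M {x \<in> space M. \<bar>X x\<bar> \<le> \<bar>Y x\<bar>} \<le> ennreal (2 * \<rho> / \<sigma>)"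
proof -
  have lX: "distr M borel X = normal_law 0 (\<sigma>\<^sup>2)"
  proof (rule Levy_uniqueness)
    show "char (distr M borel X) = char (normal_law 0 (\<sigma>\<^sup>2))"
    proof
      fix s
      have "char (distr M borel X) s = (CLINT x|M. iexp (s * X x + 0 * Y x))"
        by (simp add: char_def integral_distr)
      then show "char (distr M borel X) s = char (normal_law 0 (\<sigma>\<^sup>2)) s"
        unfolding H by (simp add: char_normal_law)
    qed
  qed (auto intro: real_distribution_distr real_distribution_normal_law)
  have lY: "distr M borel Y = normal_law 0 (\<rho>\<^sup>2)"
  proof (rule Levy_uniqueness)
    show "char (distr M borel Y) = char (normal_law 0 (\<rho>\<^sup>2))"
    proof
      fix t
      have "char (distr M borel Y) t = (CLINT x|M. iexp (0 * X x + t * Y x))"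
        by (simp add: char_def integral_distr)
      then show "char (distr M borel Y) t = char (normal_law 0 (\<rho>\<^sup>2)) t"
        unfolding H by (simp add: char_normal_law)
    qed
  qed (auto intro: real_distribution_distr real_distribution_normal_law)
  have pr: "normal_law 0 (\<sigma>\<^sup>2) \<Otimes>\<^sub>M normal_law 0 (\<rho>\<^sup>2) = distr M (borel \<Otimes>\<^sub>M borel) (\<lambda>x. (X x, Y x))"
    unfolding lX[symmetric] lY[symmetric]
  proof (rule factorising_char_imp_indep[OF X Y])
    show "(CLINT x|M. iexp (s * X x + t * Y x)) = of_real (exp (- (s\<^sup>2 * \<sigma>\<^sup>2) / 2) * exp (- (t\<^sup>2 * \<rho>\<^sup>2) / 2))" for s t
      using H[of s t] by (simp add: exp_add[symmetric] add_divide_distrib)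
  qed auto
  interpret P1: prob_space "normal_law 0 (\<sigma>\<^sup>2)"
    using real_distribution_normal_law[of "\<sigma>\<^sup>2" 0] by (simp add: real_distribution_def)
  interpret P2: prob_space "normal_law 0 (\<rho>\<^sup>2)"
    using real_distribution_normal_law[of "\<rho>\<^sup>2" 0] by (simp add: real_distribution_def)
  interpret P: pair_sigma_finite "normal_law 0 (\<sigma>\<^sup>2)" "normal_law 0 (\<rho>\<^sup>2)" ..
  let ?Q = "{(x, y). \<bar>x\<bar> \<le> \<bar>y\<bar>} :: (real \<times> real) set"
  have Qb: "?Q \<in> sets (borel \<Otimes>\<^sub>M borel)"
  proof -
    have "{p \<in> space (borel \<Otimes>\<^sub>M borel). \<bar>fst p\<bar> \<le> \<bar>snd p :: real\<bar>} \<in> sets (borel \<Otimes>\<^sub>M borel)" by measurable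
    then show ?thesis by (rule back_subst[of "\<lambda>A. A \<in> _"]) (auto simp: space_pair_measure)
  qed
  have Q: "?Q \<in> sets (normal_law 0 (\<sigma>\<^sup>2) \<Otimes>\<^sub>M normal_law 0 (\<rho>\<^sup>2))"
    by (subst sets_pair_measure_cong[OF sets_normal_law sets_normal_law]) (rule Qb)
  have "emeasure M {x \<in> space M. \<bar>X x\<bar> \<le> \<bar>Y x\<bar>} = emeasure (distr M (borel \<Otimes>\<^sub>M borel) (\<lambda>x. (X x, Y x))) ?Q"
    using Qb by (subst emeasure_distr) (auto intro!: arg_cong[where f="emeasure M"])
  also have "\<dots> = (\<integral>\<^sup>+y. emeasure (normal_law 0 (\<sigma>\<^sup>2)) ((\<lambda>x. (x, y)) -` ?Q) \<partial>normal_law 0 (\<rho>\<^sup>2))"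
    unfolding pr[symmetric] by (rule P.emeasure_pair_measure_alt2[OF Q])
  also have "\<dots> \<le> (\<integral>\<^sup>+y. ennreal (2 / \<sigma>) * ennreal \<bar>y\<bar> \<partial>normal_law 0 (\<rho>\<^sup>2))"
  proof (rule nn_integral_mono)
    fix y
    have "emeasure (normal_law 0 (\<sigma>\<^sup>2)) ((\<lambda>x. (x, y)) -` ?Q) \<le> ennreal (2 * \<bar>y\<bar> / \<sigma>)"
      using normal_law_small_ball[OF pos(1), of "\<bar>y\<bar>"] by (simp add: vimage_def)
    also have "\<dots> = ennreal (2 / \<sigma>) * ennreal \<bar>y\<bar>" using pos by (simp flip: ennreal_mult)
    finally show "emeasure (normal_law 0 (\<sigma>\<^sup>2)) ((\<lambda>x. (x, y)) -` ?Q) \<le> ennreal (2 / \<sigma>) * ennreal \<bar>y\<bar>" .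
  qed
  also have "\<dots> = ennreal (2 / \<sigma>) * (\<integral>\<^sup>+y. ennreal \<bar>y\<bar> \<partial>normal_law 0 (\<rho>\<^sup>2))"
    by (rule nn_integral_cmult) (simp add: measurable_cong_sets[OF sets_normal_law refl])
  also have "\<dots> \<le> ennreal (2 / \<sigma>) * ennreal \<rho>"
    by (intro mult_left_mono abs_moment_normal_law pos) simp
  also have "\<dots> = ennreal (2 * \<rho> / \<sigma>)" using pos by (simp flip: ennreal_mult)
  finally show ?thesis .
qed

section \<open>Point values of a periodic Gaussian field\<close>

lemma X_space_int_shift:
  assumes v: "v \<in> X_space" shows "apply_bcontfun v (x + (\<chi> i. of_int (m $ i))) = apply_bcontfun v x"
proof -
  have step: "apply_bcontfun v (x + of_nat n *\<^sub>R axis i 1) = apply_bcontfun v x" for x n i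
  proof (induction n)
    case (Suc n)
    have "x + of_nat (Suc n) *\<^sub>R axis i 1 = (x + of_nat n *\<^sub>R axis i 1) + axis i 1"
      by (simp add: algebra_simps)
    then show ?case using v Suc by (simp only: X_space_def mem_Collect_eq)
  qed simp
  have int: "apply_bcontfun v (x + of_int k *\<^sub>R axis i 1) = apply_bcontfun v x" for x k i
  proof (cases k)
    case (nonneg n)
    then show ?thesis using step[of x n i] by simp
  next
    case (neg n)
    then have z: "of_int k + of_nat (Suc n) = (0 :: real)" by simp
    have "(x + of_int k *\<^sub>R axis i 1) + of_nat (Suc n) *\<^sub>R axis i 1 = x + (of_int k + of_nat (Suc n)) *\<^sub>R axis i 1"
      by (simp only: add.assoc scaleR_add_left)
    then have "(x + of_int k *\<^sub>R axis i 1) + of_nat (Suc n) *\<^sub>R axis i 1 = x"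
      unfolding z by simp
    then show ?thesis using step[of "x + of_int k *\<^sub>R axis i 1" "Suc n" i] by (simp only:)
  qed
  have "apply_bcontfun v (x + (\<Sum>i\<in>I. of_int (m $ i) *\<^sub>R axis i 1)) = apply_bcontfun v x" if "finite I" for I x
    using that
  proof (induction I arbitrary: x rule: finite_induct)
    case (insert i I)
    have eq: "x + (\<Sum>i\<in>insert i I. of_int (m $ i) *\<^sub>R axis i 1) = (x + of_int (m $ i) *\<^sub>R axis i 1) + (\<Sum>i\<in>I. of_int (m $ i) *\<^sub>R axis i 1)"
      using insert by (simp add: add.assoc)
    show ?case unfolding eq insert.IH int ..
  qed simp
  moreover have "(\<Sum>i\<in>UNIV. of_int (m $ i) *\<^sub>R axis i 1) = (\<chi> i. (of_int (m $ i) :: real))"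
    using basis_expansion[of "\<chi> i. (of_int (m $ i) :: real)"] by (simp add: scalar_mult_eq_scaleR)
  ultimately show ?thesis using finite by metis
qed

definition frac_vec :: "real ^ 'd::finite \<Rightarrow> real ^ 'd" where
  "frac_vec x = (\<chi> i. frac (x $ i))"

lemma frac_vec_shift: "x = frac_vec x + (\<chi> i. of_int ((\<chi> i. \<lfloor>x $ i\<rfloor>) $ i))"
  by (simp add: frac_vec_def vec_eq_iff frac_def)

lemma X_space_frac: "v \<in> X_space \<Longrightarrow> apply_bcontfun v (frac_vec x) = apply_bcontfun v x"
  using X_space_int_shift[of v "frac_vec x" "\<chi> i. \<lfloor>x $ i\<rfloor>"] frac_vec_shift[of x] by simp

lemma trig_frac: "trig k (frac_vec x) = trig k x"
  using trig_periodic[of k "frac_vec x" "\<chi> i. \<lfloor>x $ i\<rfloor>"] frac_vec_shift[of x] by simp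

text \<open>Small boxes inside the unit cube with one corner at the fractional part of \<open>x\<close>. Boxes centred there
would leave the cube when a coordinate of \<open>x\<close> is an integer.\<close>

definition cell :: "real ^ 'd::finite \<Rightarrow> nat \<Rightarrow> (real ^ 'd) set" where
  "cell x n = box (frac_vec x) (\<chi> i. frac (x $ i) + (1 - frac (x $ i)) / real (Suc n))"

definition cell_average :: "real ^ 'd::finite \<Rightarrow> nat \<Rightarrow> real ^ 'd \<Rightarrow> real" where
  "cell_average x n z = indicator (cell x n) z / measure lebesgue (cell x n)"

lemma cell_subset: "cell x n \<subseteq> unit_cube"
proof
  fix z assume z: "z \<in> cell x n"
  have "0 < z $ i \<and> z $ i < 1" for i
  proof -
    have l: "frac (x $ i) < z $ i" "z $ i < frac (x $ i) + (1 - frac (x $ i)) / real (Suc n)"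
      using z by (auto simp: cell_def mem_box_cart frac_vec_def)
    have "(1 - frac (x $ i)) / real (Suc n) \<le> (1 - frac (x $ i)) / 1"
      using frac_lt_1[of "x $ i"] by (intro divide_left_mono) auto
    then have "(1 - frac (x $ i)) / real (Suc n) \<le> 1 - frac (x $ i)" by (simp only: div_by_1)
    then show ?thesis using l frac_ge_0[of "x $ i"] by (intro conjI) linarith+
  qed
  then show "z \<in> unit_cube" by (simp add: unit_cube_iff)
qed

lemma cell_sets [simp]: "cell x n \<in> sets lebesgue" "cell x n \<in> lmeasurable"
  by (simp_all add: cell_def)

lemma measure_cell_pos: "0 < measure lebesgue (cell x n)"
proof -
  have "cell x n \<noteq> {}"
  proof -
    have "frac (x $ i) < (frac (x $ i) + (frac (x $ i) + (1 - frac (x $ i)) / real (Suc n))) / 2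
       \<and> (frac (x $ i) + (frac (x $ i) + (1 - frac (x $ i)) / real (Suc n))) / 2
         < frac (x $ i) + (1 - frac (x $ i)) / real (Suc n)" for i
    proof -
      have "0 < (1 - frac (x $ i)) / real (Suc n)" using frac_lt_1[of "x $ i"] by simp
      moreover have "f < (f + (f + t)) / 2 \<and> (f + (f + t)) / 2 < f + t" if "0 < t" for f t :: real
        using that by simp
      ultimately show ?thesis by blast
    qed
    then have "(\<chi> i. (frac (x $ i) + (frac (x $ i) + (1 - frac (x $ i)) / real (Suc n))) / 2) \<in> cell x n"
      by (simp only: cell_def mem_box_cart frac_vec_def vec_lambda_beta simp_thms)
    then show ?thesis by auto
  qed
  then have "\<not> negligible (cell x n)" unfolding cell_def by (simp add: negligible_interval)
  then show ?thesis using negligible_iff_measure0[of "cell x n"] by (simp add: zero_less_measure_iff)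
qed

lemma cell_average_measurable: "cell_average x n \<in> borel_measurable (lebesgue_on \<Omega>)"
  unfolding cell_average_def[abs_def]
  by (intro borel_measurable_divide borel_measurable_const measurable_lebesgue_onI borel_measurable_indicator) simp

lemma cell_average_L2: "cell_average x n \<in> L2_space unit_cube"
  by (rule L2_bounded[OF lmeasurable_unit_cube cell_average_measurable, where B="1 / measure lebesgue (cell x n)"])
    (simp add: cell_average_def indicator_def measure_nonneg)

lemma integral_cell_average: "(LINT z|lebesgue_on unit_cube. cell_average x n z) = 1"
proof -
  have "(LINT z|lebesgue_on unit_cube. cell_average x n z) = (LINT z|lebesgue. indicator (cell x n) z / measure lebesgue (cell x n))"
    unfolding integral_lebesgue_on_indicator[OF sets_unit_cube(2)]
    by (rule Bochner_Integration.integral_cong) (use cell_subset[of x n] in \<open>auto simp: cell_average_def indicator_def\<close>)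
  also have "\<dots> = 1" using measure_cell_pos[of x n] by simp
  finally show ?thesis .
qed

lemma cell_average_near:
  assumes w: "continuous_on UNIV w" "\<And>z. \<bar>w z\<bar> \<le> B" and near: "\<And>z. z \<in> cell x n \<Longrightarrow> \<bar>w z - c\<bar> \<le> e"
  shows "\<bar>L2_inner unit_cube (cell_average x n) w - c\<bar> \<le> e"
proof -
  have wm: "w \<in> borel_measurable (lebesgue_on unit_cube)"
    by (intro measurable_lebesgue_onI continuous_measurable_lebesgue w)
  have wL: "w \<in> L2_space unit_cube" by (rule L2_bounded[OF lmeasurable_unit_cube wm w(2)])
  have i1: "integrable (lebesgue_on unit_cube) (\<lambda>z. cell_average x n z * w z)"
    by (rule L2_mult_integrable[OF cell_average_L2 wL])
  have i2: "integrable (lebesgue_on unit_cube) (cell_average x n)"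
    by (rule L2_unit_cube_integrable[OF cell_average_L2])
  have nn: "0 \<le> cell_average x n z" for z by (simp add: cell_average_def)
  have "L2_inner unit_cube (cell_average x n) w - c = (LINT z|lebesgue_on unit_cube. cell_average x n z * w z - cell_average x n z * c)"
    using i1 i2 integral_cell_average[of x n] by (simp add: L2_inner_def)
  also have "\<bar>\<dots>\<bar> \<le> (LINT z|lebesgue_on unit_cube. cell_average x n z * e)"
  proof (rule integral_abs_bound_integral)
    show "integrable (lebesgue_on unit_cube) (\<lambda>z. cell_average x n z * w z - cell_average x n z * c)"
      "integrable (lebesgue_on unit_cube) (\<lambda>z. cell_average x n z * e)" using i1 i2 by simp_all
    fix z
    show "\<bar>cell_average x n z * w z - cell_average x n z * c\<bar> \<le> cell_average x n z * e"
    proof (cases "z \<in> cell x n")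
      case True
      have "\<bar>cell_average x n z * w z - cell_average x n z * c\<bar> = cell_average x n z * \<bar>w z - c\<bar>"
        using nn[of z] by (simp add: abs_mult flip: right_diff_distrib)
      then show ?thesis using near[OF True] nn[of z] by (simp add: mult_left_mono)
    qed (simp add: cell_average_def)
  qed
  also have "\<dots> = e" using integral_cell_average[of x n] by simp
  finally show ?thesis .
qed

lemma cell_average_bound:
  assumes "continuous_on UNIV w" "\<And>z. \<bar>w z\<bar> \<le> B"
  shows "\<bar>L2_inner unit_cube (cell_average x n) w\<bar> \<le> B"
  using cell_average_near[OF assms, of x n 0 B] assms(2) by simp

text \<open>Continuity at the corner of the shrinking cells; periodicity identifies the value there
with the value at \<open>x\<close>.\<close>

lemma cell_average_tendsto:
  fixes w :: "real ^ 'd::finite \<Rightarrow> real"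
  assumes w: "continuous_on UNIV w" "\<And>z. \<bar>w z\<bar> \<le> B" "w (frac_vec x) = w x"
  shows "(\<lambda>n. L2_inner unit_cube (cell_average x n) w) \<longlonglongrightarrow> w x"
proof (rule LIMSEQ_I)
  fix r :: real assume r: "0 < r"
  have "isCont w (frac_vec x)" using w(1) by (simp add: continuous_on_eq_continuous_at)
  then obtain \<delta> where \<delta>: "0 < \<delta>" "\<And>z. dist z (frac_vec x) < \<delta> \<Longrightarrow> dist (w z) (w (frac_vec x)) < r / 2"
    unfolding continuous_at_eps_delta using r by (metis half_gt_zero)
  obtain N where N: "real CARD('d) / \<delta> < real N" using reals_Archimedean2 by blast
  show "\<exists>N. \<forall>n\<ge>N. norm (L2_inner unit_cube (cell_average x n) w - w x) < r"
  proof (intro exI[of _ N] allI impI)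
    fix n assume n: "N \<le> n"
    have "\<bar>w z - w x\<bar> \<le> r / 2" if z: "z \<in> cell x n" for z
    proof -
      have "\<bar>(z - frac_vec x) $ i\<bar> \<le> 1 / real (Suc n)" for i
      proof -
        have "frac (x $ i) < z $ i" "z $ i < frac (x $ i) + (1 - frac (x $ i)) / real (Suc n)"
          using z by (auto simp: cell_def mem_box_cart frac_vec_def)
        moreover have "(1 - frac (x $ i)) / real (Suc n) \<le> 1 / real (Suc n)"
          by (intro divide_right_mono) auto
        ultimately show ?thesis by (simp add: frac_vec_def)
      qed
      then have "norm (z - frac_vec x) \<le> (\<Sum>i::'d\<in>UNIV. 1 / real (Suc n))"
        by (intro order_trans[OF norm_le_l1_cart] sum_mono)
      also have "\<dots> = real CARD('d) / real (Suc n)" by simp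
      also have "\<dots> < \<delta>"
      proof -
        have "real CARD('d) / \<delta> < real (Suc n)" using N n by simp
        then show ?thesis using \<delta>(1) by (simp add: field_simps)
      qed
      finally have "dist (w z) (w (frac_vec x)) < r / 2" by (intro \<delta>) (simp add: dist_norm)
      then show ?thesis by (simp add: w(3) dist_real_def)
    qed
    from cell_average_near[where x=x and n=n and c="w x" and e="r / 2", OF w(1,2) this] show "norm (L2_inner unit_cube (cell_average x n) w - w x) < r"
      using r by simp
  qed
qed

lemma bcontfun_abs_bound:
  fixes v :: "'a::metric_space \<Rightarrow>\<^sub>C real"
  shows "\<bar>apply_bcontfun v x\<bar> \<le> norm v"
  using norm_bounded[of v x] by simp

lemma continuous_bcontfun: "continuous_on UNIV (apply_bcontfun v)"
  using apply_bcontfun[of v] by (simp add: bcontfun_def)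

lemma bcontfun_L2:
  fixes v :: "(real ^ 'd::finite) \<Rightarrow>\<^sub>C real"
  shows "apply_bcontfun v \<in> L2_space unit_cube"
  by (rule L2_bounded[OF lmeasurable_unit_cube _ bcontfun_abs_bound])
    (intro measurable_lebesgue_onI continuous_measurable_lebesgue continuous_bcontfun)

lemma continuous_eval: "continuous_on UNIV (\<lambda>v :: 'a::metric_space \<Rightarrow>\<^sub>C real. apply_bcontfun v x)"
  unfolding continuous_on_iff
proof (intro ballI allI impI)
  fix v :: "'a \<Rightarrow>\<^sub>C real" and e :: real assume "0 < e"
  then show "\<exists>d>0. \<forall>w\<in>UNIV. dist w v < d \<longrightarrow> dist (apply_bcontfun w x) (apply_bcontfun v x) < e"
    by (intro exI[of _ e]) (auto intro: le_less_trans[OF dist_bounded])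
qed

lemma space_X_borel: "space X_borel = X_space"
  by (simp add: X_borel_def space_restrict_space)

lemma eval_measurable:
  assumes "sets \<mu> = sets X_borel"
  shows "(\<lambda>v. apply_bcontfun v x) \<in> borel_measurable \<mu>"
proof -
  have "(\<lambda>v. apply_bcontfun v x) \<in> borel_measurable X_borel"
    unfolding X_borel_def
    by (intro measurable_restrict_space1 borel_measurable_continuous_onI continuous_eval)
  then show ?thesis using measurable_cong_sets[OF assms refl] by blast
qed

text \<open>The reflection \<open>k \<mapsto> - k\<close> permutes the lattice and reverses the sign of the absolutely
convergent sum.\<close>

lemma has_sum_odd_lattice:
  fixes g :: "int ^ 'd::finite \<Rightarrow> real"
  assumes "summable (\<lambda>n. \<bar>g (idx n)\<bar>)" "\<And>k. g (- k) = - g k"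
  shows "(\<Sum>n. g (idx n)) = 0"
proof -
  have s: "(\<lambda>n. g (idx n)) sums (\<Sum>n. g (idx n))" using summable_rabs_cancel[OF assms(1)] by (rule summable_sums)
  have h: "((\<lambda>n. g (idx n)) has_sum (\<Sum>n. g (idx n))) UNIV"
    by (rule norm_summable_imp_has_sum) (use assms(1) s in auto)
  then have k: "(g has_sum (\<Sum>n. g (idx n))) UNIV"
    using has_sum_reindex_bij_betw[of idx UNIV "UNIV :: (int ^ 'd) set" g] bij_idx by auto
  have "bij (uminus :: int ^ 'd \<Rightarrow> int ^ 'd)" by (rule bij_uminus)
  then have "((\<lambda>k. g (- k)) has_sum (\<Sum>n. g (idx n))) UNIV"
    using has_sum_reindex_bij_betw[of uminus UNIV "UNIV :: (int ^ 'd) set" g] k by auto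
  then have "((\<lambda>k. - g k) has_sum (\<Sum>n. g (idx n))) UNIV" by (simp add: assms(2))
  moreover have "((\<lambda>k. - g k) has_sum (- (\<Sum>n. g (idx n)))) UNIV" using k by (simp add: has_sum_uminus)
  ultimately have "(\<Sum>n. g (idx n)) = - (\<Sum>n. g (idx n))" by (rule has_sum_unique)
  then show ?thesis by simp
qed

context covariance
begin

text \<open>The eigenvalues of the fractional power, which is the covariance of the field.\<close>

definition weight :: "real \<Rightarrow> int ^ 'd::finite \<Rightarrow> real" where
  "weight \<alpha> k = (1 / symbol k) powr (\<alpha> / 2)"

lemma weight_nonneg: "0 \<le> weight \<alpha> k" and weight_pos: "0 < weight \<alpha> k" and weight_minus: "weight \<alpha> (- k) = weight \<alpha> k"
  using symbol_pos[of k] by (simp_all add: weight_def)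

text \<open>The hypothesis gives the law of pairings of \<open>v\<close> with square integrable functions, but point evaluation is
not of this form. Pairings with \<open>a\<close> and \<open>b\<close> times normalised indicators of shrinking cells converge to
the combination of point values, and their variances converge by Tannery's theorem, because \<open>\<alpha> > d / 2\<close>
makes the weights summable.\<close>

lemma gaussian_pair_char:
  fixes \<mu> :: "((real ^ 'd::finite) \<Rightarrow>\<^sub>C real) measure"
  assumes d: "CARD('d) \<le> 3" and \<alpha>: "real CARD('d) / 2 < \<alpha>"
    and G: "gaussian_on_X \<mu> (\<lambda>x. 0) (frac_power unit_cube cov (\<alpha> / 2))"
  shows "(CLINT v|\<mu>. iexp (a * apply_bcontfun v x + b * apply_bcontfun v y)) =
    of_real (exp (- (\<Sum>n. weight \<alpha> (idx n :: int ^ 'd) * (a * trig (idx n) x + b * trig (idx n) y)\<^sup>2) / 2))"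
proof -
  interpret prob_space \<mu> using G by (simp add: gaussian_on_X_def)
  have sets: "sets \<mu> = sets X_borel" using G by (simp add: gaussian_on_X_def)
  have space: "space \<mu> = X_space" using sets_eq_imp_space_eq[OF sets] by (simp add: space_X_borel)
  define F where "F N z = a * cell_average x N z + b * cell_average y N z" for N z
  have FL: "F N \<in> L2_space unit_cube" for N
    unfolding F_def[abs_def] by (intro L2_add L2_scale cell_average_L2)
  have FI: "L2_inner unit_cube (F N) w = a * L2_inner unit_cube (cell_average x N) w + b * L2_inner unit_cube (cell_average y N) w"
    if "w \<in> L2_space unit_cube" for N w
    unfolding F_def[abs_def]
    by (subst L2_inner_linear(1)[OF L2_scale[OF cell_average_L2] L2_scale[OF cell_average_L2] that])
      (simp add: L2_inner_def mult.assoc)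
  let ?m = "\<lambda>n. weight \<alpha> (idx n :: int ^ 'd)"
  define V where "V N = (\<Sum>n. ?m n * (coef (F N) (idx n))\<^sup>2)" for N
  have Q: "(\<lambda>n. ?m n * (coef (F N) (idx n))\<^sup>2) sums L2_inner unit_cube (F N) (frac_power unit_cube cov (\<alpha> / 2) (F N))" for N
    using frac_power_quadratic_form[OF d \<alpha> FL[of N]] by (simp add: weight_def)
  have V: "L2_inner unit_cube (F N) (frac_power unit_cube cov (\<alpha> / 2) (F N)) = V N" for N
    using sums_unique[OF Q[of N]] by (simp add: V_def)
  have V0: "0 \<le> V N" for N
    unfolding V_def using sums_summable[OF Q[of N]] by (rule suminf_nonneg) (simp add: weight_nonneg)
  have Lm: "(\<lambda>v. L2_inner unit_cube (F N) (apply_bcontfun v)) \<in> borel_measurable \<mu>" for N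
    using G FL by (simp add: gaussian_on_X_def)
  have E: "(CLINT v|\<mu>. iexp (L2_inner unit_cube (F N) (apply_bcontfun v))) = of_real (exp (- V N / 2))" for N
  proof -
    have "distr \<mu> borel (\<lambda>v. L2_inner unit_cube (F N) (apply_bcontfun v)) = normal_law 0 (V N)"
      using G FL[of N] V[of N] by (simp add: gaussian_on_X_def) (simp add: L2_inner_def)
    then have "char (distr \<mu> borel (\<lambda>v. L2_inner unit_cube (F N) (apply_bcontfun v))) 1 = of_real (exp (- V N / 2))"
      by (simp add: char_normal_law V0)
    then show ?thesis by (simp add: char_def integral_distr[OF Lm])
  qed
  have lim1: "(\<lambda>N. CLINT v|\<mu>. iexp (L2_inner unit_cube (F N) (apply_bcontfun v))) \<longlonglongrightarrow>
      (CLINT v|\<mu>. iexp (a * apply_bcontfun v x + b * apply_bcontfun v y))"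
  proof (rule integral_dominated_convergence[where w="\<lambda>_. 1"])
    show "(\<lambda>v. iexp (a * apply_bcontfun v x + b * apply_bcontfun v y)) \<in> borel_measurable \<mu>"
      using eval_measurable[OF sets, of x] eval_measurable[OF sets, of y] by measurable
    show "(\<lambda>v. iexp (L2_inner unit_cube (F N) (apply_bcontfun v))) \<in> borel_measurable \<mu>" for N
      using Lm[of N] by measurable
    show "AE v in \<mu>. (\<lambda>N. iexp (L2_inner unit_cube (F N) (apply_bcontfun v))) \<longlonglongrightarrow> iexp (a * apply_bcontfun v x + b * apply_bcontfun v y)"
    proof (rule AE_I2)
      fix v assume "v \<in> space \<mu>"
      then have v: "v \<in> X_space" using space by simp
      have "(\<lambda>N. L2_inner unit_cube (F N) (apply_bcontfun v)) \<longlonglongrightarrow> a * apply_bcontfun v x + b * apply_bcontfun v y"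
        unfolding FI[OF bcontfun_L2]
        by (intro tendsto_intros cell_average_tendsto[OF continuous_bcontfun bcontfun_abs_bound X_space_frac[OF v]])
      then show "(\<lambda>N. iexp (L2_inner unit_cube (F N) (apply_bcontfun v))) \<longlonglongrightarrow> iexp (a * apply_bcontfun v x + b * apply_bcontfun v y)"
        by (intro tendsto_intros)
    qed
  qed auto
  have lim2: "V \<longlonglongrightarrow> (\<Sum>n. ?m n * (a * trig (idx n) x + b * trig (idx n) y)\<^sup>2)"
  proof -
    have ccoef: "coef (F N) k = a * L2_inner unit_cube (cell_average x N) (trig k) + b * L2_inner unit_cube (cell_average y N) (trig k)" for N k
      by (rule FI[OF trig_L2[OF lmeasurable_unit_cube]])
    have "(\<lambda>N. coef (F N) k) \<longlonglongrightarrow> a * trig k x + b * trig k y" for k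
      unfolding ccoef by (intro tendsto_intros cell_average_tendsto[OF continuous_trig abs_trig_le trig_frac])
    then have t: "(\<lambda>N. ?m n * (coef (F N) (idx n))\<^sup>2) \<longlonglongrightarrow> ?m n * (a * trig (idx n) x + b * trig (idx n) y)\<^sup>2" for n
      by (intro tendsto_intros)
    have cb: "(coef (F N) k)\<^sup>2 \<le> (\<bar>a\<bar> * 2 + \<bar>b\<bar> * 2)\<^sup>2" for N k
    proof -
      have "\<bar>coef (F N) k\<bar> \<le> \<bar>a\<bar> * \<bar>L2_inner unit_cube (cell_average x N) (trig k)\<bar> + \<bar>b\<bar> * \<bar>L2_inner unit_cube (cell_average y N) (trig k)\<bar>"
        unfolding ccoef abs_mult[symmetric] by (rule abs_triangle_ineq)
      also have "\<dots> \<le> \<bar>a\<bar> * 2 + \<bar>b\<bar> * 2"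
        by (intro add_mono mult_left_mono cell_average_bound[OF continuous_trig abs_trig_le]) auto
      finally show ?thesis using power_mono[OF _ abs_ge_zero, of "coef (F N) k" _ 2] by simp
    qed
    have sm: "summable (\<lambda>n. ?m n * (\<bar>a\<bar> * 2 + \<bar>b\<bar> * 2)\<^sup>2)"
      using summable_symbol_powr0[OF \<alpha>] by (intro summable_mult2) (simp add: weight_def)
    have "(\<lambda>N. \<Sum>n. ?m n * (coef (F N) (idx n))\<^sup>2) \<longlonglongrightarrow> (\<Sum>n. ?m n * (a * trig (idx n) x + b * trig (idx n) y)\<^sup>2)"
      by (rule conjunct2[OF conjunct2[OF tannerys_theorem[where M="\<lambda>n. ?m n * (\<bar>a\<bar> * 2 + \<bar>b\<bar> * 2)\<^sup>2"]]])
        (use t sm in \<open>auto intro!: always_eventually mult_left_mono cb simp: weight_nonneg abs_mult\<close>)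
    then show ?thesis by (simp add: V_def[abs_def])
  qed
  have "(\<lambda>N. of_real (exp (- V N / 2)) :: complex) \<longlonglongrightarrow>
      of_real (exp (- (\<Sum>n. ?m n * (a * trig (idx n) x + b * trig (idx n) y)\<^sup>2) / 2))"
    by (intro tendsto_of_real tendsto_intros lim2) auto
  then show ?thesis using lim1 unfolding E by (rule LIMSEQ_unique[rotated])
qed

text \<open>The variance of the field is the same at every point: \<open>(trig k x)\<^sup>2 = 1 + sin (2 freq k \<bullet> x)\<close>, and the
weights are even in \<open>k\<close> while the sine is odd. Equivalently, the sum and the difference of two point
values are uncorrelated.\<close>

lemma stationary_cross_term:
  fixes x y :: "real ^ 'd::finite"
  assumes \<alpha>: "real CARD('d) / 2 < \<alpha>"
  shows "(\<Sum>n. weight \<alpha> (idx n :: int ^ 'd) * ((trig (idx n) x)\<^sup>2 - (trig (idx n) y)\<^sup>2)) = 0"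
proof (rule has_sum_odd_lattice[where g="\<lambda>k. weight \<alpha> k * ((trig k x)\<^sup>2 - (trig k y)\<^sup>2)"])
  show "weight \<alpha> (- k) * ((trig (- k) x)\<^sup>2 - (trig (- k) y)\<^sup>2) = - (weight \<alpha> k * ((trig k x)\<^sup>2 - (trig k y)\<^sup>2))" for k :: "int ^ 'd"
    unfolding trig_square weight_minus by (simp add: algebra_simps)
  have sm: "summable (\<lambda>n. weight \<alpha> (idx n :: int ^ 'd) * 2)"
    using summable_symbol_powr0[OF \<alpha>] by (intro summable_mult2) (simp add: weight_def)
  show "summable (\<lambda>n. \<bar>weight \<alpha> (idx n :: int ^ 'd) * ((trig (idx n) x)\<^sup>2 - (trig (idx n) y)\<^sup>2)\<bar>)"
  proof (rule summable_comparison_test'[OF sm])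
    fix n
    have "\<bar>(trig (idx n) x)\<^sup>2 - (trig (idx n) y)\<^sup>2\<bar> \<le> 2"
      unfolding trig_square
      using abs_sin_le_one[of "2 * (freq (idx n) \<bullet> x)"] abs_sin_le_one[of "2 * (freq (idx n) \<bullet> y)"] by linarith
    then show "norm \<bar>weight \<alpha> (idx n :: int ^ 'd) * ((trig (idx n) x)\<^sup>2 - (trig (idx n) y)\<^sup>2)\<bar> \<le> weight \<alpha> (idx n :: int ^ 'd) * 2"
      by (simp add: abs_mult weight_nonneg mult_left_mono)
  qed
qed

text \<open>With \<open>X = (v x + v y) / 2\<close> and \<open>Y = (v x - v y) / 2\<close> a sign change means \<open>\<bar>X\<bar> \<le> \<bar>Y\<bar>\<close>.
The variance of \<open>X\<close> is at least the weight of the constant mode, whatever \<open>x\<close> and \<open>y\<close> are. That of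
\<open>Y\<close> is at most \<open>h\<^sup>2\<close> times the sum of the weights times \<open>1 + \<bar>2 \<pi> k\<bar>\<^sup>2\<close>, since each mode is Lipschitz with
constant proportional to \<open>\<bar>k\<bar>\<close>; this sum is finite because \<open>\<alpha> - 1 > d / 2\<close>.\<close>

lemma sign_change_probability:
  fixes \<mu> :: "((real ^ 'd::finite) \<Rightarrow>\<^sub>C real) measure"
  assumes d: "CARD('d) \<le> 3" and \<alpha>: "1 + real CARD('d) / 2 < \<alpha>"
    and G: "gaussian_on_X \<mu> (\<lambda>x. 0) (frac_power unit_cube cov (\<alpha> / 2))"
  obtains C where "0 \<le> C" "\<And>x i h. 0 \<le> h \<Longrightarrow>
    emeasure \<mu> {v \<in> space \<mu>. sgn (apply_bcontfun v (x + h *\<^sub>R axis i 1)) \<noteq> sgn (apply_bcontfun v x)} \<le> ennreal (C * h)"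
proof -
  interpret prob_space \<mu> using G by (simp add: gaussian_on_X_def)
  have sets: "sets \<mu> = sets X_borel" using G by (simp add: gaussian_on_X_def)
  have \<alpha>': "real CARD('d) / 2 < \<alpha>" and \<alpha>1: "real CARD('d) / 2 < \<alpha> - 1" and \<alpha>0: "0 \<le> \<alpha>"
    using \<alpha> of_nat_0_le_iff[of "CARD('d)", where 'a=real] by linarith+
  let ?m = "\<lambda>n. weight \<alpha> (idx n :: int ^ 'd)"
  have sm: "summable ?m" using summable_symbol_powr0[OF \<alpha>'] by (simp add: weight_def)
  have smf: "summable (\<lambda>n. ?m n * (1 + freq_sq (idx n :: int ^ 'd)))"
  proof -
    have "0 < 1 + freq_sq k" for k :: "int ^ 'd" using freq_sq_nonneg[of k] by linarith
    then show ?thesis using summable_symbol_powr[OF \<alpha>1 \<alpha>0] by (simp add: weight_def abs_of_pos)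
  qed
  have sq: "summable (\<lambda>n. ?m n * (a * trig (idx n) x + b * trig (idx n) y)\<^sup>2)" for a b and x y :: "real ^ 'd"
  proof (rule summable_comparison_test'[OF summable_mult2[OF sm, of "(\<bar>a\<bar> * 2 + \<bar>b\<bar> * 2)\<^sup>2"]])
    fix n
    have "\<bar>a * trig (idx n) x + b * trig (idx n) y\<bar> \<le> \<bar>a\<bar> * 2 + \<bar>b\<bar> * 2"
      by (rule order_trans[OF abs_triangle_ineq]) (unfold abs_mult, intro add_mono mult_left_mono abs_trig_le, auto)
    from power_mono[OF this abs_ge_zero, of 2]
    show "norm (?m n * (a * trig (idx n) x + b * trig (idx n) y)\<^sup>2) \<le> ?m n * (\<bar>a\<bar> * 2 + \<bar>b\<bar> * 2)\<^sup>2"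
      by (simp add: abs_mult weight_nonneg mult_left_mono)
  qed
  define K where "K = (\<Sum>n. ?m n * (1 + freq_sq (idx n :: int ^ 'd)))"
  have K0: "0 \<le> K" unfolding K_def using smf
    by (rule suminf_nonneg) (intro mult_nonneg_nonneg weight_nonneg add_nonneg_nonneg freq_sq_nonneg, simp)
  define w0 where "w0 = weight \<alpha> (0 :: int ^ 'd)"
  have w0: "0 < w0" by (simp add: w0_def weight_pos)
  define C where "C = 2 * sqrt K / sqrt w0"
  show ?thesis
  proof (rule that[of C])
    show "0 \<le> C" using K0 w0 by (simp add: C_def)
    fix x :: "real ^ 'd" and i h assume h: "0 \<le> (h :: real)"
    define y where "y = x + h *\<^sub>R axis i 1"
    define s2 where "s2 = (\<Sum>n. ?m n * ((1/2) * trig (idx n) x + (1/2) * trig (idx n) y)\<^sup>2)"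
    define r2 where "r2 = (\<Sum>n. ?m n * ((1/2) * trig (idx n) x + (-1/2) * trig (idx n) y)\<^sup>2)"
    have r0: "0 \<le> r2" unfolding r2_def using sq by (rule suminf_nonneg) (simp add: weight_nonneg)
    \<comment> \<open>The constant mode equals \<open>1\<close> at both points and contributes exactly \<open>w0\<close>.\<close>
    have s0: "w0 \<le> s2"
    proof -
      obtain n0 where n0: "idx n0 = (0 :: int ^ 'd)" by (metis idx_surj)
      have "(\<Sum>n\<in>{n0}. ?m n * ((1/2) * trig (idx n) x + (1/2) * trig (idx n) y)\<^sup>2) \<le> s2"
        unfolding s2_def by (rule sum_le_suminf[OF sq]) (auto simp: weight_nonneg)
      then show ?thesis by (simp add: n0 w0_def)
    qed
    have rh: "r2 \<le> h\<^sup>2 * K"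
    proof -
      have "?m n * ((1/2) * trig (idx n) x + (-1/2) * trig (idx n) y)\<^sup>2 \<le> h\<^sup>2 * (?m n * (1 + freq_sq (idx n :: int ^ 'd)))" for n
      proof -
        let ?p = "freq (idx n) \<bullet> x" and ?q = "freq (idx n) \<bullet> y"
        have lip: "\<bar>cos p - cos q\<bar> \<le> \<bar>p - q\<bar>" "\<bar>sin p - sin q\<bar> \<le> \<bar>p - q\<bar>" for p q :: real
        proof -
          have "norm (cos p - cos q) \<le> 1 * norm (p - q)"
            by (rule field_differentiable_bound[of UNIV cos "\<lambda>x. - sin x"]) (auto intro!: derivative_eq_intros)
          then show "\<bar>cos p - cos q\<bar> \<le> \<bar>p - q\<bar>" by simp
          have "norm (sin p - sin q) \<le> 1 * norm (p - q)"
            by (rule field_differentiable_bound[of UNIV sin cos]) (auto intro!: derivative_eq_intros)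
          then show "\<bar>sin p - sin q\<bar> \<le> \<bar>p - q\<bar>" by simp
        qed
        have "?p - ?q = - (h * freq (idx n) $ i)"
          by (simp add: y_def inner_add_right inner_axis)
        then have pq: "\<bar>?p - ?q\<bar> = h * \<bar>freq (idx n) $ i\<bar>" using h by (simp add: abs_mult)
        have "\<bar>trig (idx n) x - trig (idx n) y\<bar> \<le> 2 * (h * \<bar>freq (idx n) $ i\<bar>)"
          using lip[of ?p ?q] unfolding pq trig_def by linarith
        then have "\<bar>(1/2) * trig (idx n) x + (-1/2) * trig (idx n) y\<bar> \<le> h * \<bar>freq (idx n) $ i\<bar>" by linarith
        from power_mono[OF this abs_ge_zero, of 2]
        have "((1/2) * trig (idx n) x + (-1/2) * trig (idx n) y)\<^sup>2 \<le> h\<^sup>2 * (freq (idx n) $ i)\<^sup>2"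
          by (simp add: power_mult_distrib)
        also have "\<dots> \<le> h\<^sup>2 * (1 + freq_sq (idx n :: int ^ 'd))"
          using freq_component_le[of "idx n :: int ^ 'd" i] by (intro mult_left_mono) auto
        finally have "?m n * ((1/2) * trig (idx n) x + (-1/2) * trig (idx n) y)\<^sup>2 \<le> ?m n * (h\<^sup>2 * (1 + freq_sq (idx n :: int ^ 'd)))"
          by (rule mult_left_mono[OF _ weight_nonneg])
        then show ?thesis by (simp add: mult.left_commute)
      qed
      then have "r2 \<le> (\<Sum>n. h\<^sup>2 * (?m n * (1 + freq_sq (idx n :: int ^ 'd))))"
        unfolding r2_def by (rule suminf_le[OF _ sq summable_mult[OF smf]])
      also have "\<dots> = h\<^sup>2 * K" unfolding K_def by (rule suminf_mult[OF smf])
      finally show ?thesis .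
    qed
    define X :: "((real ^ 'd) \<Rightarrow>\<^sub>C real) \<Rightarrow> real" where "X v = (apply_bcontfun v x + apply_bcontfun v y) / 2" for v
    define Y :: "((real ^ 'd) \<Rightarrow>\<^sub>C real) \<Rightarrow> real" where "Y v = (apply_bcontfun v x - apply_bcontfun v y) / 2" for v
    have Xm: "X \<in> borel_measurable \<mu>" and Ym: "Y \<in> borel_measurable \<mu>"
      unfolding X_def[abs_def] Y_def[abs_def] using eval_measurable[OF sets, of x] eval_measurable[OF sets, of y] by simp_all
    have char: "(CLINT v|\<mu>. iexp (s * X v + t * Y v)) = of_real (exp (- (s\<^sup>2 * (sqrt s2)\<^sup>2 + t\<^sup>2 * (sqrt r2)\<^sup>2) / 2))" for s t
    proof -
      let ?u = "\<lambda>n. trig (idx n) x" and ?w = "\<lambda>n. trig (idx n) y"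
      have e1: "s * X v + t * Y v = (s + t) / 2 * apply_bcontfun v x + (s - t) / 2 * apply_bcontfun v y" for v
        by (simp add: X_def Y_def field_simps)
      \<comment> \<open>Expanding the square leaves the cross term \<open>s t\<close> with the difference of the two pointwise variances, which vanishes.\<close>
      have cs: "summable (\<lambda>n. ?m n * ((?u n)\<^sup>2 - (?w n)\<^sup>2))"
        using summable_diff[OF sq[of 1 x 0 y] sq[of 0 x 1 y]] by (simp add: right_diff_distrib)
      have "(\<Sum>n. ?m n * ((s + t) / 2 * ?u n + (s - t) / 2 * ?w n)\<^sup>2) =
          (\<Sum>n. s\<^sup>2 * (?m n * ((1/2) * ?u n + (1/2) * ?w n)\<^sup>2) + t\<^sup>2 * (?m n * ((1/2) * ?u n + (-1/2) * ?w n)\<^sup>2)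
            + (s * t / 2) * (?m n * ((?u n)\<^sup>2 - (?w n)\<^sup>2)))"
        by (intro arg_cong[where f=suminf] ext) (simp add: power2_eq_square field_simps)
      also have "\<dots> = s\<^sup>2 * s2 + t\<^sup>2 * r2 + (s * t / 2) * (\<Sum>n. ?m n * ((?u n)\<^sup>2 - (?w n)\<^sup>2))"
        unfolding s2_def r2_def
        by (intro sums_unique[symmetric] sums_add sums_mult summable_sums sq cs)
      also have "(\<Sum>n. ?m n * ((?u n)\<^sup>2 - (?w n)\<^sup>2)) = 0" by (rule stationary_cross_term[OF \<alpha>'])
      finally have e2: "(\<Sum>n. ?m n * ((s + t) / 2 * ?u n + (s - t) / 2 * ?w n)\<^sup>2) = s\<^sup>2 * (sqrt s2)\<^sup>2 + t\<^sup>2 * (sqrt r2)\<^sup>2"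
        using r0 s0 w0 by simp
      show ?thesis unfolding e1 gaussian_pair_char[OF d \<alpha>' G] e2 by simp
    qed
    have "emeasure \<mu> {v \<in> space \<mu>. sgn (apply_bcontfun v y) \<noteq> sgn (apply_bcontfun v x)} \<le> emeasure \<mu> {v \<in> space \<mu>. \<bar>X v\<bar> \<le> \<bar>Y v\<bar>}"
    proof (rule emeasure_mono)
      have "\<bar>X v\<bar> \<le> \<bar>Y v\<bar>" if "sgn (apply_bcontfun v y) \<noteq> sgn (apply_bcontfun v x)" for v
      proof -
        have "\<bar>p + r\<bar> \<le> \<bar>p - r\<bar>" if "sgn r \<noteq> sgn p" for p r :: real
          using that by (auto simp: sgn_if abs_if split: if_splits)
        from this[OF that] show ?thesis by (simp add: X_def Y_def)
      qed
      then show "{v \<in> space \<mu>. sgn (apply_bcontfun v y) \<noteq> sgn (apply_bcontfun v x)} \<subseteq> {v \<in> space \<mu>. \<bar>X v\<bar> \<le> \<bar>Y v\<bar>}" by auto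
      show "{v \<in> space \<mu>. \<bar>X v\<bar> \<le> \<bar>Y v\<bar>} \<in> events" using Xm Ym by measurable
    qed
    also have "\<dots> \<le> ennreal (2 * sqrt r2 / sqrt s2)"
      by (rule gaussian_pair_abs_le[OF Xm Ym char]) (use s0 w0 r0 in auto)
    also have "\<dots> \<le> ennreal (C * h)"
    proof (rule ennreal_leI)
      have "sqrt r2 \<le> h * sqrt K" using real_sqrt_le_mono[OF rh] h by (simp add: real_sqrt_mult)
      moreover have "sqrt w0 \<le> sqrt s2" using s0 by simp
      ultimately have "2 * sqrt r2 / sqrt s2 \<le> 2 * (h * sqrt K) / sqrt w0"
        using w0 r0 h K0 by (intro frac_le) auto
      then show "2 * sqrt r2 / sqrt s2 \<le> C * h" by (simp add: C_def mult_ac)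
    qed
    finally show "emeasure \<mu> {v \<in> space \<mu>. sgn (apply_bcontfun v (x + h *\<^sub>R axis i 1)) \<noteq> sgn (apply_bcontfun v x)} \<le> ennreal (C * h)"
      by (simp add: y_def)
  qed
qed

end

section \<open>Total variation and difference quotients\<close>

text \<open>The \<open>L\<^sup>1\<close> norm over the unit cube of the forward difference quotient in direction \<open>i\<close> with step
\<open>1 / (n + 1)\<close>.\<close>

definition diff_quotient_mass :: "(real ^ 'd::finite \<Rightarrow> real) \<Rightarrow> 'd \<Rightarrow> nat \<Rightarrow> ennreal" where
  "diff_quotient_mass u i n =
     (\<integral>\<^sup>+x. ennreal (real (Suc n)) * ennreal \<bar>u (x + inverse (real (Suc n)) *\<^sub>R axis i 1) - u x\<bar> * indicator unit_cube x \<partial>lborel)"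

text \<open>The derivative of \<open>\<psi>\<close> is approximated by backward difference quotients; a
translation moves the difference onto \<open>u\<close> as a forward one, and \<open>\<bar>\<psi>\<bar> \<le> 1\<close> is supported in the cube.\<close>

lemma integral_partial_deriv_le_diff_quotients:
  fixes u \<psi> :: "real ^ 'd::finite \<Rightarrow> real"
  assumes u: "u \<in> borel_measurable borel" "\<And>x. \<bar>u x\<bar> \<le> 1"
    and \<psi>: "test_fun unit_cube \<psi>" "\<And>x. \<bar>\<psi> x\<bar> \<le> 1"
  shows "ennreal \<bar>LINT x|lebesgue. u x * partial_deriv i \<psi> x\<bar> \<le> liminf (diff_quotient_mass u i)"
proof -
  obtain C where C: "compact C" "C \<subseteq> unit_cube" "\<And>x. x \<notin> C \<Longrightarrow> \<psi> x = 0" "smooth_fun \<psi>"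
    using test_funE[OF \<psi>(1)] by metis
  have um: "u \<in> borel_measurable lebesgue" using u(1) by (intro measurable_completion) simp
  define s where "s n = inverse (real (Suc n))" for n
  have s: "s \<longlonglongrightarrow> 0" "0 < s n" "s n \<le> 1" for n
    unfolding s_def using LIMSEQ_inverse_real_of_nat by (auto simp: inverse_le_1_iff)
  define b where "b n = (LINT x|lebesgue. u x * ((\<psi> (x + (- s n) *\<^sub>R axis i 1) - \<psi> x) / (- s n)))" for n
  have lim: "b \<longlonglongrightarrow> (LINT x|lebesgue. u x * partial_deriv i \<psi> x)"
    unfolding b_def
    by (rule diff_quotient_integral_tendsto[OF C(4,1,3) um u(2)])
      (use s tendsto_minus[OF s(1)] in \<open>auto simp: less_imp_neq[symmetric] abs_of_pos\<close>)
  have pi: "integrable lebesgue \<psi>"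
    using locally_integrable_mult[OF continuous_locally_integrable[of "\<lambda>_. 1" UNIV] C(1) _ smooth_fun_continuous[OF C(4)] C(3)]
    by simp
  have ui: "integrable lebesgue (\<lambda>x. u x * f x)" if "integrable lebesgue f" for f
    using integrable_mult_bounded_measurable[OF that um u(2)] by (simp add: mult.commute)
  have le: "ennreal \<bar>b n\<bar> \<le> diff_quotient_mass u i n" for n
  proof -
    let ?e = "s n *\<^sub>R axis i 1 :: real ^ 'd"
    have pt: "integrable lebesgue (\<lambda>x. \<psi> (x - ?e))" using integrable_lebesgue_translate[OF pi, of "- ?e"] by simp
    have ut: "integrable lebesgue (\<lambda>x. u (x + ?e) * \<psi> x)" using integrable_lebesgue_translate[OF ui[OF pt], of ?e] by simp
    have "b n = (LINT x|lebesgue. (u x * \<psi> x - u x * \<psi> (x - ?e)) / s n)"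
      unfolding b_def using s(2)[of n]
      by (intro Bochner_Integration.integral_cong) (auto simp: field_simps)
    also have "\<dots> = ((LINT x|lebesgue. u x * \<psi> x) - (LINT x|lebesgue. u x * \<psi> (x - ?e))) / s n"
      using ui[OF pi] ui[OF pt] by simp
    also have "(LINT x|lebesgue. u x * \<psi> (x - ?e)) = (LINT x|lebesgue. u (x + ?e) * \<psi> x)"
      using integral_lebesgue_translate[OF borel_measurable_integrable[OF ui[OF pt]], of ?e] by simp
    also have "((LINT x|lebesgue. u x * \<psi> x) - (LINT x|lebesgue. u (x + ?e) * \<psi> x)) / s n
        = (LINT x|lebesgue. real (Suc n) * ((u x - u (x + ?e)) * \<psi> x))"
    proof -
      have "(LINT x|lebesgue. real (Suc n) * ((u x - u (x + ?e)) * \<psi> x))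
          = real (Suc n) * (LINT x|lebesgue. u x * \<psi> x - u (x + ?e) * \<psi> x)"
        by (simp only: left_diff_distrib integral_mult_right_zero)
      also have "(LINT x|lebesgue. u x * \<psi> x - u (x + ?e) * \<psi> x)
          = (LINT x|lebesgue. u x * \<psi> x) - (LINT x|lebesgue. u (x + ?e) * \<psi> x)"
        by (rule Bochner_Integration.integral_diff[OF ui[OF pi] ut])
      finally show ?thesis by (simp only: s_def divide_inverse inverse_inverse_eq mult.commute)
    qed
    finally have bn: "b n = (LINT x|lebesgue. real (Suc n) * ((u x - u (x + ?e)) * \<psi> x))" .
    have i: "integrable lebesgue (\<lambda>x. real (Suc n) * ((u x - u (x + ?e)) * \<psi> x))"
      using ui[OF pi] ut by (simp add: left_diff_distrib)
    have "ennreal \<bar>b n\<bar> \<le> (\<integral>\<^sup>+x. ennreal \<bar>real (Suc n) * ((u x - u (x + ?e)) * \<psi> x)\<bar> \<partial>lebesgue)"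
      unfolding bn using integral_norm_bound_ennreal[OF i] by simp
    also have "\<dots> = (\<integral>\<^sup>+x. ennreal \<bar>real (Suc n) * ((u x - u (x + ?e)) * \<psi> x)\<bar> \<partial>lborel)"
      by (rule nn_integral_completion)
    also have "\<dots> \<le> diff_quotient_mass u i n"
      unfolding diff_quotient_mass_def
    proof (rule nn_integral_mono)
      fix x :: "real ^ 'd"
      show "ennreal \<bar>real (Suc n) * ((u x - u (x + ?e)) * \<psi> x)\<bar> \<le>
         ennreal (real (Suc n)) * ennreal \<bar>u (x + inverse (real (Suc n)) *\<^sub>R axis i 1) - u x\<bar> * indicator unit_cube x"
      proof (cases "x \<in> unit_cube")
        case True
        have "\<bar>u x - u (x + ?e)\<bar> * \<bar>\<psi> x\<bar> \<le> \<bar>u (x + ?e) - u x\<bar> * 1"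
          using \<psi>(2)[of x] by (intro mult_mono) auto
        then have "real (Suc n) * (\<bar>u x - u (x + ?e)\<bar> * \<bar>\<psi> x\<bar>) \<le> real (Suc n) * \<bar>u (x + ?e) - u x\<bar>"
          by (intro mult_left_mono) auto
        then have "ennreal \<bar>real (Suc n) * ((u x - u (x + ?e)) * \<psi> x)\<bar> \<le> ennreal (real (Suc n) * \<bar>u (x + ?e) - u x\<bar>)"
          by (intro ennreal_leI) (simp add: abs_mult)
        then show ?thesis using True by (simp add: ennreal_mult s_def)
      next
        case False
        then have "\<psi> x = 0" using C by auto
        then show ?thesis by simp
      qed
    qed
    finally show ?thesis .
  qed
  have "(\<lambda>n. ennreal \<bar>b n\<bar>) \<longlonglongrightarrow> ennreal \<bar>LINT x|lebesgue. u x * partial_deriv i \<psi> x\<bar>"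
    by (intro tendsto_ennrealI tendsto_rabs lim)
  then have "ennreal \<bar>LINT x|lebesgue. u x * partial_deriv i \<psi> x\<bar> = liminf (\<lambda>n. ennreal \<bar>b n\<bar>)"
    by (intro lim_imp_Liminf[symmetric]) auto
  also have "\<dots> \<le> liminf (diff_quotient_mass u i)"
    by (intro Liminf_mono always_eventually allI le)
  finally show ?thesis .
qed

text \<open>The components of an admissible vector field are themselves bounded by one, so
the divergence is estimated one coordinate at a time.\<close>

lemma total_variation_finite:
  fixes u :: "real ^ 'd::finite \<Rightarrow> real"
  assumes u: "u \<in> borel_measurable borel" "\<And>x. \<bar>u x\<bar> \<le> 1"
    and fin: "\<And>i. liminf (diff_quotient_mass u i) < \<infinity>"
  shows "total_variation unit_cube u < \<infinity>"
proof -
  define g where "g i = enn2real (liminf (diff_quotient_mass u i))" for i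
  have g: "ennreal (g i) = liminf (diff_quotient_mass u i)" "0 \<le> g i" for i
    using fin[of i] by (auto simp: g_def ennreal_enn2real_if infinity_ennreal_def less_top)
  have um: "u \<in> borel_measurable lebesgue" using u(1) by (intro measurable_completion) simp
  have "total_variation unit_cube u \<le> ereal (\<Sum>i\<in>UNIV. g i)"
    unfolding total_variation_def
  proof (rule SUP_least)
    fix \<psi> :: "real ^ 'd \<Rightarrow> real ^ 'd"
    assume "\<psi> \<in> {\<psi>. (\<forall>i. test_fun unit_cube (\<lambda>x. \<psi> x $ i)) \<and> (\<forall>x. norm (\<psi> x) \<le> 1)}"
    then have t: "test_fun unit_cube (\<lambda>x. \<psi> x $ i)" and b: "\<bar>\<psi> x $ i\<bar> \<le> 1" for i x
      using order_trans[OF component_le_norm_cart[of "\<psi> x" i]] by auto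
    let ?L = "\<lambda>i. LINT x|lebesgue. u x * partial_deriv i (\<lambda>x. \<psi> x $ i) x"
    have int: "integrable lebesgue (\<lambda>x. u x * partial_deriv i (\<lambda>x. \<psi> x $ i) x)"
      and z: "\<And>x. x \<notin> unit_cube \<Longrightarrow> partial_deriv i (\<lambda>x. \<psi> x $ i) x = 0" for i
    proof -
      obtain C where C: "compact C" "C \<subseteq> unit_cube" "smooth_fun (\<lambda>x. \<psi> x $ i)"
        "\<And>x. x \<notin> C \<Longrightarrow> partial_deriv i (\<lambda>x. \<psi> x $ i) x = 0"
        using test_funE[OF t[of i]] by metis
      have "integrable lebesgue (\<lambda>x. 1 * partial_deriv i (\<lambda>x. \<psi> x $ i) x)"
        by (rule locally_integrable_mult[OF continuous_locally_integrable C(1) subset_UNIV continuous_partial_deriv[OF C(3)] C(4)]) auto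
      then have "integrable lebesgue (partial_deriv i (\<lambda>x. \<psi> x $ i))" by simp
      from integrable_mult_bounded_measurable[OF this um u(2)]
      show "integrable lebesgue (\<lambda>x. u x * partial_deriv i (\<lambda>x. \<psi> x $ i) x)" by (simp add: mult.commute)
      show "\<And>x. x \<notin> unit_cube \<Longrightarrow> partial_deriv i (\<lambda>x. \<psi> x $ i) x = 0" using C by blast
    qed
    have "(LINT x|lebesgue_on unit_cube. u x * (\<Sum>i\<in>UNIV. partial_deriv i (\<lambda>x. \<psi> x $ i) x)) =
        (LINT x|lebesgue. u x * (\<Sum>i\<in>UNIV. partial_deriv i (\<lambda>x. \<psi> x $ i) x))"
      by (rule integral_lebesgue_on_restrict) (auto simp: z)
    also have "\<dots> = (LINT x|lebesgue. (\<Sum>i\<in>UNIV. u x * partial_deriv i (\<lambda>x. \<psi> x $ i) x))"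
      by (simp add: sum_distrib_left)
    also have "\<dots> = (\<Sum>i\<in>UNIV. ?L i)" by (rule Bochner_Integration.integral_sum) (rule int)
    also have "\<dots> \<le> (\<Sum>i\<in>UNIV. g i)"
    proof (rule sum_mono)
      fix i
      have "ennreal \<bar>?L i\<bar> \<le> ennreal (g i)"
        unfolding g by (rule integral_partial_deriv_le_diff_quotients[OF u t b])
      then show "?L i \<le> g i" using g(2)[of i] by (simp add: ennreal_le_iff)
    qed
    finally show "ereal (LINT x|lebesgue_on unit_cube. u x * (\<Sum>i\<in>UNIV. partial_deriv i (\<lambda>x. \<psi> x $ i) x)) \<le> ereal (\<Sum>i\<in>UNIV. g i)"
      by simp
  qed
  then show ?thesis by (rule le_less_trans) simp
qed

text \<open>Evaluation is measurable in the field for a fixed point and continuous in the point for a fixed field.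
Rounding the point down to a grid of mesh \<open>1 / (n + 1)\<close> leaves countably many points, and the rounded
evaluations converge by continuity.\<close>

lemma eval_jointly_measurable:
  fixes \<mu> :: "((real ^ 'd::finite) \<Rightarrow>\<^sub>C real) measure"
  assumes sets: "sets \<mu> = sets X_borel"
  shows "(\<lambda>p. apply_bcontfun (fst p) (snd p)) \<in> borel_measurable (\<mu> \<Otimes>\<^sub>M borel)"
proof -
  define r :: "nat \<Rightarrow> int ^ 'd \<Rightarrow> real ^ 'd" where "r n k = (\<chi> i. of_int (k $ i) / real (Suc n))" for n k
  define fl :: "nat \<Rightarrow> real ^ 'd \<Rightarrow> int ^ 'd" where "fl n x = (\<chi> i. \<lfloor>real (Suc n) * x $ i\<rfloor>)" for n x
  have flm: "fl n \<in> borel \<rightarrow>\<^sub>M count_space UNIV" for n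
  proof -
    have "fl n -` {k} \<inter> space borel = {x. \<forall>i. \<lfloor>real (Suc n) * x $ i\<rfloor> = k $ i}" for k
      by (auto simp: fl_def vec_eq_iff)
    moreover have "{x :: real ^ 'd. \<forall>i. \<lfloor>real (Suc n) * x $ i\<rfloor> = k $ i} \<in> sets borel" for k
      by measurable
    ultimately show ?thesis by (subst measurable_count_space_eq2_countable) auto
  qed
  have m: "(\<lambda>p. apply_bcontfun (fst p) (r n (fl n (snd p)))) \<in> borel_measurable (\<mu> \<Otimes>\<^sub>M borel)" for n
  proof (rule measurable_compose_countable[where g="\<lambda>p. fl n (snd p)" and f="\<lambda>k p. apply_bcontfun (fst p) (r n k)"])
    show "(\<lambda>p. apply_bcontfun (fst p) (r n k)) \<in> borel_measurable (\<mu> \<Otimes>\<^sub>M borel)" for k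
      using measurable_compose[OF measurable_fst eval_measurable[OF sets, of "r n k"]] .
    show "(\<lambda>p. fl n (snd p)) \<in> \<mu> \<Otimes>\<^sub>M borel \<rightarrow>\<^sub>M count_space UNIV"
      using measurable_compose[OF measurable_snd flm] .
  qed
  show ?thesis
  proof (rule borel_measurable_LIMSEQ_metric[OF m])
    fix p :: "((real ^ 'd) \<Rightarrow>\<^sub>C real) \<times> (real ^ 'd)"
    let ?x = "snd p"
    have "(\<lambda>n. r n (fl n ?x)) \<longlonglongrightarrow> ?x"
    proof (rule vec_tendstoI)
      fix i
      have "(\<lambda>n. r n (fl n ?x) $ i - ?x $ i) \<longlonglongrightarrow> 0"
      proof (rule Lim_null_comparison[OF _ LIMSEQ_inverse_real_of_nat], intro always_eventually allI)
        fix n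
        let ?t = "real (Suc n) * ?x $ i"
        have "\<bar>of_int \<lfloor>?t\<rfloor> - ?t\<bar> \<le> 1" by linarith
        then have "\<bar>of_int \<lfloor>?t\<rfloor> - ?t\<bar> / real (Suc n) \<le> 1 / real (Suc n)" by (intro divide_right_mono) auto
        moreover have "r n (fl n ?x) $ i - ?x $ i = (of_int \<lfloor>?t\<rfloor> - ?t) / real (Suc n)"
          unfolding r_def fl_def vec_lambda_beta diff_divide_distrib by (subst nonzero_mult_div_cancel_left) auto
        ultimately show "norm (r n (fl n ?x) $ i - ?x $ i) \<le> inverse (real (Suc n))"
          by (simp add: abs_divide inverse_eq_divide)
      qed
      then show "(\<lambda>n. r n (fl n ?x) $ i) \<longlonglongrightarrow> ?x $ i" by (simp add: LIM_zero_iff)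
    qed
    then show "(\<lambda>n. apply_bcontfun (fst p) (r n (fl n ?x))) \<longlonglongrightarrow> apply_bcontfun (fst p) ?x"
      by (intro continuous_on_tendsto_compose[OF continuous_bcontfun]) auto
  qed
qed

lemma threshold_measurable: "threshold (apply_bcontfun v) \<in> borel_measurable borel"
proof -
  have "apply_bcontfun v \<in> borel_measurable borel"
    by (rule borel_measurable_continuous_onI[OF continuous_bcontfun])
  then show ?thesis unfolding threshold_def[abs_def] by measurable
qed

lemma abs_threshold_le: "\<bar>threshold w x\<bar> \<le> 1"
  by (simp add: threshold_def sgn_if)

context covariance
begin

text \<open>By Tonelli's theorem and \<open>sign_change_probability\<close> the expected difference quotient masses of the
thresholded field are at most \<open>(1 / h) * 2 * C h = 2 C\<close>. Fatou's lemma bounds the expectation of their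
lower limit, which is therefore finite almost surely.\<close>

theorem AE_total_variation_threshold_finite:
  fixes \<mu> :: "((real ^ 'd::finite) \<Rightarrow>\<^sub>C real) measure"
  assumes d: "CARD('d) \<le> 3" and \<alpha>: "1 + real CARD('d) / 2 < \<alpha>"
    and G: "gaussian_on_X \<mu> (\<lambda>x. 0) (frac_power unit_cube cov (\<alpha> / 2))"
  shows "AE v in \<mu>. total_variation unit_cube (threshold (apply_bcontfun v)) < \<infinity>"
proof -
  interpret prob_space \<mu> using G by (simp add: gaussian_on_X_def)
  have sets: "sets \<mu> = sets X_borel" using G by (simp add: gaussian_on_X_def)
  interpret pair_sigma_finite \<mu> "lborel :: (real ^ 'd) measure" ..
  obtain C where C: "0 \<le> C" "\<And>x i h. 0 \<le> h \<Longrightarrow>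
    emeasure \<mu> {v \<in> space \<mu>. sgn (apply_bcontfun v (x + h *\<^sub>R axis i 1)) \<noteq> sgn (apply_bcontfun v x)} \<le> ennreal (C * h)"
    using sign_change_probability[OF d \<alpha> G] by blast
  let ?S = "\<lambda>v x. threshold (apply_bcontfun v) x"
  have ev: "(\<lambda>p. apply_bcontfun (fst p) (snd p + a)) \<in> borel_measurable (\<mu> \<Otimes>\<^sub>M lborel)" for a :: "real ^ 'd"
  proof -
    have "(\<lambda>p. (fst p, snd p + a)) \<in> \<mu> \<Otimes>\<^sub>M lborel \<rightarrow>\<^sub>M \<mu> \<Otimes>\<^sub>M borel" by measurable
    from measurable_compose[OF this eval_jointly_measurable[OF sets]] show ?thesis by simp
  qed
  have ev0: "(\<lambda>p. apply_bcontfun (fst p) (snd p)) \<in> borel_measurable (\<mu> \<Otimes>\<^sub>M borel)"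
    by (rule eval_jointly_measurable[OF sets])
  have indm: "(\<lambda>p. indicator unit_cube (snd p) :: ennreal) \<in> borel_measurable (\<mu> \<Otimes>\<^sub>M (lborel :: (real ^ 'd) measure))"
    by (rule measurable_compose[OF measurable_snd borel_measurable_indicator]) simp
  have jm: "(\<lambda>p. ennreal (real (Suc n)) * ennreal \<bar>?S (fst p) (snd p + inverse (real (Suc n)) *\<^sub>R axis i 1) - ?S (fst p) (snd p)\<bar> * indicator unit_cube (snd p))
      \<in> borel_measurable (\<mu> \<Otimes>\<^sub>M lborel)" for n i
    using indm ev0 unfolding threshold_def using ev[of "inverse (real (Suc n)) *\<^sub>R axis i 1"] by measurable
  have dm: "(\<lambda>v. diff_quotient_mass (?S v) i n) \<in> borel_measurable \<mu>" for i n
    unfolding diff_quotient_mass_def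
    using lborel.borel_measurable_nn_integral_fst[OF jm[of n i]] by simp
  have E: "(\<integral>\<^sup>+v. diff_quotient_mass (?S v) i n \<partial>\<mu>) \<le> ennreal (2 * C)" for i n
  proof -
    let ?h = "inverse (real (Suc n))"
    let ?e = "?h *\<^sub>R axis i 1 :: real ^ 'd"
    have "(\<integral>\<^sup>+v. diff_quotient_mass (?S v) i n \<partial>\<mu>) =
        (\<integral>\<^sup>+x. \<integral>\<^sup>+v. ennreal (real (Suc n)) * ennreal \<bar>?S v (x + ?e) - ?S v x\<bar> * indicator unit_cube x \<partial>\<mu> \<partial>lborel)"
      unfolding diff_quotient_mass_def using Fubini[OF jm[of n i]] by simp
    also have "\<dots> \<le> (\<integral>\<^sup>+x. ennreal (2 * C) * indicator (unit_cube :: (real ^ 'd) set) x \<partial>lborel)"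
    proof (rule nn_integral_mono)
      fix x :: "real ^ 'd"
      let ?A = "{v \<in> space \<mu>. sgn (apply_bcontfun v (x + ?e)) \<noteq> sgn (apply_bcontfun v x)}"
      have A: "?A \<in> sets \<mu>" using eval_measurable[OF sets, of "x + ?e"] eval_measurable[OF sets, of x] by measurable
      have "(\<integral>\<^sup>+v. ennreal (real (Suc n)) * ennreal \<bar>?S v (x + ?e) - ?S v x\<bar> * indicator unit_cube x \<partial>\<mu>)
          \<le> (\<integral>\<^sup>+v. (ennreal (2 * real (Suc n)) * indicator unit_cube x) * indicator ?A v \<partial>\<mu>)"
      proof (rule nn_integral_mono)
        fix v assume v: "v \<in> space \<mu>"
        show "ennreal (real (Suc n)) * ennreal \<bar>?S v (x + ?e) - ?S v x\<bar> * indicator unit_cube x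
            \<le> (ennreal (2 * real (Suc n)) * indicator unit_cube x) * indicator ?A v"
        proof (cases "v \<in> ?A")
          case True
          have "\<bar>?S v (x + ?e) - ?S v x\<bar> \<le> 2"
            using abs_threshold_le[of "apply_bcontfun v" "x + ?e"] abs_threshold_le[of "apply_bcontfun v" x] by linarith
          then have "real (Suc n) * \<bar>?S v (x + ?e) - ?S v x\<bar> \<le> real (Suc n) * 2" by (rule mult_left_mono) simp
          then have "ennreal (real (Suc n) * \<bar>?S v (x + ?e) - ?S v x\<bar>) \<le> ennreal (2 * real (Suc n))" unfolding mult.commute[of 2] by (rule ennreal_leI)
          then have "ennreal (real (Suc n)) * ennreal \<bar>?S v (x + ?e) - ?S v x\<bar> \<le> ennreal (2 * real (Suc n))"
            by (simp add: ennreal_mult)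
          then show ?thesis using True by (simp add: indicator_def)
        next
          case False
          then have "?S v (x + ?e) = ?S v x" using v by (simp add: threshold_def)
          then show ?thesis by simp
        qed
      qed
      also have "\<dots> = (ennreal (2 * real (Suc n)) * indicator unit_cube x) * emeasure \<mu> ?A"
        by (rule nn_integral_cmult_indicator[OF A])
      also have "\<dots> \<le> (ennreal (2 * real (Suc n)) * indicator unit_cube x) * ennreal (C * ?h)"
        by (intro mult_left_mono C) auto
      also have "\<dots> = ennreal (2 * real (Suc n) * (C * ?h)) * indicator unit_cube x"
        using C(1) by (simp add: ennreal_mult mult_ac)
      also have "2 * real (Suc n) * (C * ?h) = 2 * C * (real (Suc n) * ?h)" by (simp only: mult_ac)
      also have "real (Suc n) * ?h = 1" by (rule right_inverse) simp
      also have "2 * C * 1 = 2 * C" by simp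
      finally show "(\<integral>\<^sup>+v. ennreal (real (Suc n)) * ennreal \<bar>?S v (x + ?e) - ?S v x\<bar> * indicator unit_cube x \<partial>\<mu>)
          \<le> ennreal (2 * C) * indicator unit_cube x" .
    qed
    also have "\<dots> = ennreal (2 * C)"
      using emeasure_unit_cube[where 'd='d] by (simp add: nn_integral_cmult_indicator)
    finally show ?thesis .
  qed
  have "AE v in \<mu>. liminf (diff_quotient_mass (?S v) i) \<noteq> \<infinity>" for i
  proof (rule nn_integral_PInf_AE)
    show "(\<lambda>v. liminf (diff_quotient_mass (?S v) i)) \<in> borel_measurable \<mu>"
      by (intro borel_measurable_liminf dm)
    have "(\<integral>\<^sup>+v. liminf (diff_quotient_mass (?S v) i) \<partial>\<mu>) \<le> liminf (\<lambda>n. \<integral>\<^sup>+v. diff_quotient_mass (?S v) i n \<partial>\<mu>)"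
      by (rule nn_integral_liminf[OF dm])
    also have "\<dots> \<le> liminf (\<lambda>n. ennreal (2 * C))" by (intro Liminf_mono always_eventually allI E)
    also have "\<dots> = ennreal (2 * C)" by (simp add: Liminf_const)
    finally show "(\<integral>\<^sup>+v. liminf (diff_quotient_mass (?S v) i) \<partial>\<mu>) \<noteq> \<infinity>"
      by (auto simp: infinity_ennreal_def top_unique)
  qed
  then have "AE v in \<mu>. \<forall>i. liminf (diff_quotient_mass (?S v) i) \<noteq> \<infinity>"
    using AE_finite_allI[of "UNIV :: 'd set"] by (simp add: AE_all_countable)
  then show ?thesis
  proof eventually_elim
    case (elim v)
    show ?case
      by (rule total_variation_finite[OF threshold_measurable abs_threshold_le])
        (use elim in \<open>auto simp: infinity_ennreal_def less_top\<close>)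
  qed
qed

end

section \<open>Measurability of the likelihood\<close>

text \<open>Boundedness alone controls \<open>K f\<close>; linearity makes it control differences, that is, continuity.\<close>

lemma bounded_linear_L1_bound:
  fixes K :: "(real ^ 'd::finite \<Rightarrow> real) \<Rightarrow> real ^ 'j::finite"
  assumes "bounded_linear_L1 unit_cube K"
  obtains B where "0 \<le> B" "\<And>f g. f \<in> L1_space unit_cube \<Longrightarrow> g \<in> L1_space unit_cube \<Longrightarrow>
     norm (K f - K g) \<le> B * (LINT x|lebesgue_on unit_cube. \<bar>f x - g x\<bar>)"
    "\<And>f. f \<in> L1_space unit_cube \<Longrightarrow> norm (K f) \<le> B * (LINT x|lebesgue_on unit_cube. \<bar>f x\<bar>)"
proof -
  obtain B where B: "\<And>f. f \<in> L1_space unit_cube \<Longrightarrow> norm (K f) \<le> B * (LINT x|lebesgue_on unit_cube. \<bar>f x\<bar>)"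
    using assms unfolding bounded_linear_L1_def by metis
  have B': "norm (K f) \<le> max B 0 * (LINT x|lebesgue_on unit_cube. \<bar>f x\<bar>)" if "f \<in> L1_space unit_cube" for f
    by (rule order_trans[OF B[OF that]]) (intro mult_right_mono integral_nonneg_AE AE_I2, auto)
  show ?thesis
  proof (rule that[of "max B 0"])
    fix f g :: "real ^ 'd \<Rightarrow> real"
    assume f: "f \<in> L1_space unit_cube" and g: "g \<in> L1_space unit_cube"
    have g': "(\<lambda>x. (-1) * g x) \<in> L1_space unit_cube" using g by (simp add: L1_space_def)
    have "K (\<lambda>x. f x + (-1) * g x) = K f + (-1) *\<^sub>R K g"
      using assms f g g' unfolding bounded_linear_L1_def by metis
    then have "K f - K g = K (\<lambda>x. f x - g x)" by simp
    moreover have "(\<lambda>x. f x - g x) \<in> L1_space unit_cube" using f g by (simp add: L1_space_def)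
    ultimately show "norm (K f - K g) \<le> max B 0 * (LINT x|lebesgue_on unit_cube. \<bar>f x - g x\<bar>)"
      using B'[of "\<lambda>x. f x - g x"] by simp
  qed (use B' in auto)
qed

lemma bounded_in_L1:
  assumes "f \<in> borel_measurable borel" "\<And>x. \<bar>f x\<bar> \<le> 1" shows "f \<in> L1_space unit_cube"
proof -
  have "f \<in> borel_measurable lebesgue" using assms(1) by (intro measurable_completion) simp
  then show ?thesis
    using L2_unit_cube_integrable[OF L2_bounded[OF lmeasurable_unit_cube measurable_lebesgue_onI assms(2)]]
    by (simp add: L1_space_def)
qed

lemma L1_norm_le:
  assumes "f \<in> L1_space unit_cube" "\<And>x. \<bar>f x\<bar> \<le> c"
  shows "(LINT x|lebesgue_on unit_cube. \<bar>f x\<bar>) \<le> c"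
proof -
  have "(LINT x|lebesgue_on (unit_cube :: (real ^ 'a) set). \<bar>f x\<bar>) \<le> (LINT x|lebesgue_on (unit_cube :: (real ^ 'a) set). c)"
    using assms by (intro integral_mono finite_measure.integrable_const[OF finite_measure_unit_cube]) (auto simp: L1_space_def)
  then show ?thesis by (simp add: measure_restrict_space measure_unit_cube)
qed

lemma threshold_L1: "threshold (apply_bcontfun v) \<in> L1_space unit_cube"
  by (rule bounded_in_L1[OF threshold_measurable abs_threshold_le])

text \<open>Lipschitz ramps that converge to the sign function pointwise, including at \<open>0\<close>.\<close>

definition clamp :: "nat \<Rightarrow> real \<Rightarrow> real" where
  "clamp n t = max (- 1) (min 1 (real n * t))"

lemma clamp_bound: "\<bar>clamp n t\<bar> \<le> 1"
  by (simp add: clamp_def abs_le_iff)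

lemma clamp_lipschitz: "\<bar>clamp n s - clamp n t\<bar> \<le> real n * \<bar>s - t\<bar>"
proof -
  have "\<bar>clamp n s - clamp n t\<bar> \<le> \<bar>real n * s - real n * t\<bar>" by (simp add: clamp_def max_def min_def)
  also have "\<dots> = real n * \<bar>s - t\<bar>" by (simp add: abs_mult flip: right_diff_distrib)
  finally show ?thesis .
qed

lemma clamp_tendsto_sgn: "(\<lambda>n. clamp n t) \<longlonglongrightarrow> sgn t"
proof (cases "t = 0")
  case False
  have "\<forall>\<^sub>F n in sequentially. clamp n t = sgn t"
    using eventually_ge_at_top[of "nat \<lceil>1 / \<bar>t\<bar>\<rceil>"]
  proof eventually_elim
    case (elim n)
    then have "1 / \<bar>t\<bar> \<le> real n" by linarith
    then have "1 \<le> real n * \<bar>t\<bar>" using False by (simp add: pos_divide_le_eq)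
    then show ?case using False by (cases "0 < t") (auto simp: clamp_def)
  qed
  then show ?thesis by (rule tendsto_eventually)
qed (simp add: clamp_def)

lemma clamp_field_L1: "(\<lambda>x. clamp n (apply_bcontfun v x)) \<in> L1_space unit_cube"
proof (rule bounded_in_L1[OF _ clamp_bound])
  have "apply_bcontfun v \<in> borel_measurable borel"
    by (rule borel_measurable_continuous_onI[OF continuous_bcontfun])
  then show "(\<lambda>x. clamp n (apply_bcontfun v x)) \<in> borel_measurable borel"
    unfolding clamp_def by measurable
qed

text \<open>For each \<open>n\<close> the ramp makes \<open>v \<mapsto> K (clamp n v)\<close> Lipschitz in the sup norm. As \<open>n \<rightarrow> \<infinity>\<close>
the ramps of a fixed \<open>v\<close> converge to \<open>S v\<close> in \<open>L\<^sup>1\<close> by dominated convergence, so the forward map is a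
pointwise limit of continuous maps.\<close>

lemma forward_map_measurable:
  fixes K :: "(real ^ 'd::finite \<Rightarrow> real) \<Rightarrow> real ^ 'j::finite"
  assumes K: "bounded_linear_L1 unit_cube K" and sets: "sets \<mu> = sets X_borel"
  shows "(\<lambda>v. K (threshold (apply_bcontfun v))) \<in> borel_measurable \<mu>"
proof -
  obtain B where B: "0 \<le> B" "\<And>f g. f \<in> L1_space unit_cube \<Longrightarrow> g \<in> L1_space unit_cube \<Longrightarrow>
     norm (K f - K g) \<le> B * (LINT x|lebesgue_on unit_cube. \<bar>f x - g x\<bar>)"
    using bounded_linear_L1_bound[OF K] by metis
  have cont: "continuous_on UNIV (\<lambda>v. K (\<lambda>x. clamp n (apply_bcontfun v x)))" for n
    unfolding continuous_on_iff
  proof (intro ballI allI impI)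
    fix v :: "(real ^ 'd) \<Rightarrow>\<^sub>C real" and e :: real assume e: "0 < e"
    show "\<exists>d>0. \<forall>w\<in>UNIV. dist w v < d \<longrightarrow> dist (K (\<lambda>x. clamp n (apply_bcontfun w x))) (K (\<lambda>x. clamp n (apply_bcontfun v x))) < e"
    proof (intro exI[of _ "e / (B * real n + 1)"] conjI ballI impI)
      have p: "0 < B * real n + 1" using B(1) by (simp add: add_nonneg_pos)
      show "0 < e / (B * real n + 1)" using e p by simp
      fix w assume w: "dist w v < e / (B * real n + 1)"
      have "norm (K (\<lambda>x. clamp n (apply_bcontfun w x)) - K (\<lambda>x. clamp n (apply_bcontfun v x)))
          \<le> B * (LINT x|lebesgue_on unit_cube. \<bar>clamp n (apply_bcontfun w x) - clamp n (apply_bcontfun v x)\<bar>)"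
        by (rule B(2)[OF clamp_field_L1 clamp_field_L1])
      also have "\<dots> \<le> B * (real n * dist w v)"
      proof (intro mult_left_mono L1_norm_le B(1))
        show "(\<lambda>x. clamp n (apply_bcontfun w x) - clamp n (apply_bcontfun v x)) \<in> L1_space unit_cube"
          using clamp_field_L1[of n w] clamp_field_L1[of n v] by (simp add: L1_space_def)
        fix x
        have "\<bar>clamp n (apply_bcontfun w x) - clamp n (apply_bcontfun v x)\<bar> \<le> real n * \<bar>apply_bcontfun w x - apply_bcontfun v x\<bar>"
          by (rule clamp_lipschitz)
        also have "\<dots> \<le> real n * dist w v"
          using dist_bounded[of w x v] by (intro mult_left_mono) (auto simp: dist_real_def)
        finally show "\<bar>clamp n (apply_bcontfun w x) - clamp n (apply_bcontfun v x)\<bar> \<le> real n * dist w v" .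
      qed
      also have "\<dots> \<le> (B * real n + 1) * dist w v" by (simp add: distrib_right)
      also have "\<dots> < e" using w p by (simp add: pos_less_divide_eq mult.commute)
      finally show "dist (K (\<lambda>x. clamp n (apply_bcontfun w x))) (K (\<lambda>x. clamp n (apply_bcontfun v x))) < e"
        by (simp add: dist_norm)
    qed
  qed
  have m: "(\<lambda>v. K (\<lambda>x. clamp n (apply_bcontfun v x))) \<in> borel_measurable \<mu>" for n
  proof -
    have "(\<lambda>v. K (\<lambda>x. clamp n (apply_bcontfun v x))) \<in> borel_measurable X_borel"
      unfolding X_borel_def by (intro measurable_restrict_space1 borel_measurable_continuous_onI cont)
    then show ?thesis using measurable_cong_sets[OF sets refl] by blast
  qed
  show ?thesis
  proof (rule borel_measurable_LIMSEQ_metric[OF m])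
    fix v :: "(real ^ 'd) \<Rightarrow>\<^sub>C real"
    let ?t = "threshold (apply_bcontfun v)"
    have "(\<lambda>n. LINT x|lebesgue_on unit_cube. \<bar>clamp n (apply_bcontfun v x) - ?t x\<bar>) \<longlonglongrightarrow> (LINT x|lebesgue_on (unit_cube :: (real ^ 'd) set). 0)"
    proof (rule integral_dominated_convergence[where w="\<lambda>_. 2"])
      show "integrable (lebesgue_on (unit_cube :: (real ^ 'd) set)) (\<lambda>_. 2 :: real)"
        by (rule finite_measure.integrable_const[OF finite_measure_unit_cube])
      show "(\<lambda>x. \<bar>clamp n (apply_bcontfun v x) - ?t x\<bar>) \<in> borel_measurable (lebesgue_on unit_cube)" for n
        using clamp_field_L1[of n v] threshold_L1[of v] by (auto simp: L1_space_def intro!: borel_measurable_integrable)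
      show "AE x in lebesgue_on unit_cube. (\<lambda>n. \<bar>clamp n (apply_bcontfun v x) - ?t x\<bar>) \<longlonglongrightarrow> 0"
        by (intro AE_I2 tendsto_rabs_zero LIM_zero) (simp add: threshold_def clamp_tendsto_sgn)
      show "AE x in lebesgue_on unit_cube. norm \<bar>clamp n (apply_bcontfun v x) - ?t x\<bar> \<le> 2" for n
      proof (rule AE_I2)
        fix x
        show "norm \<bar>clamp n (apply_bcontfun v x) - ?t x\<bar> \<le> 2"
          using clamp_bound[of n "apply_bcontfun v x"] abs_threshold_le[of "apply_bcontfun v" x]
          by (simp add: abs_le_iff)
      qed
    qed simp
    then have l0: "(\<lambda>n. B * (LINT x|lebesgue_on unit_cube. \<bar>clamp n (apply_bcontfun v x) - ?t x\<bar>)) \<longlonglongrightarrow> 0"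
      by (intro tendsto_mult_right_zero) simp
    have "(\<lambda>n. K (\<lambda>x. clamp n (apply_bcontfun v x)) - K ?t) \<longlonglongrightarrow> 0"
      by (rule Lim_null_comparison[OF _ l0]) (intro always_eventually allI B(2) clamp_field_L1 threshold_L1)
    then show "(\<lambda>n. K (\<lambda>x. clamp n (apply_bcontfun v x))) \<longlonglongrightarrow> K ?t" by (rule LIM_zero_cancel)
  qed
qed

section \<open>Stability of normalised densities in the Hellinger distance\<close>

lemma (in prob_space) prob_space_normalised_density:
  fixes l :: "'a \<Rightarrow> real"
  assumes [measurable]: "l \<in> borel_measurable M" and l: "\<And>v. 0 \<le> l v" "\<And>v. l v \<le> 1"
    and Z: "0 < expectation l"
  shows "prob_space (density M (\<lambda>v. ennreal (l v / expectation l)))"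
proof (rule prob_spaceI)
  have li: "integrable M l" by (rule integrable_const_bound[of _ 1]) (use l in auto)
  have "emeasure (density M (\<lambda>v. ennreal (l v / expectation l))) (space M) = (\<integral>\<^sup>+v. ennreal (l v / expectation l) \<partial>M)"
    by (simp add: emeasure_density cong: nn_integral_cong)
  also have "\<dots> = ennreal (LINT v|M. l v / expectation l)"
    by (rule nn_integral_eq_integral) (use li l Z in auto)
  also have "\<dots> = 1" using Z by simp
  finally show "emeasure (density M (\<lambda>v. ennreal (l v / expectation l))) (space (density M (\<lambda>v. ennreal (l v / expectation l)))) = 1"
    by simp
qed

text \<open>The reference measure \<open>\<nu>\<close> dominates \<open>M\<close> because the densities are strictly positive. With
\<open>r = dM/d\<nu>\<close>, the two Radon-Nikodym derivatives are \<open>r p1\<close> and \<open>r p2\<close>, the factor \<open>r\<close> comes out of the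
squared difference of square roots, and the Hellinger integral becomes one over \<open>M\<close>.\<close>

lemma (in prob_space) hellinger_dist_densities:
  fixes p1 p2 :: "'a \<Rightarrow> real"
  assumes [measurable]: "p1 \<in> borel_measurable M" "p2 \<in> borel_measurable M"
    and pos: "\<And>v. 0 < p1 v" "\<And>v. 0 < p2 v"
    and diff: "\<And>v. \<bar>sqrt (p1 v) - sqrt (p2 v)\<bar> \<le> E"
    and ref: "reference_measure \<nu> (density M (\<lambda>v. ennreal (p1 v))) (density M (\<lambda>v. ennreal (p2 v)))"
  shows "hellinger_dist \<nu> (density M (\<lambda>v. ennreal (p1 v))) (density M (\<lambda>v. ennreal (p2 v))) \<le> E"
proof -
  let ?m1 = "density M (\<lambda>v. ennreal (p1 v))" and ?m2 = "density M (\<lambda>v. ennreal (p2 v))"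
  interpret N: sigma_finite_measure \<nu> using ref by (simp add: reference_measure_def)
  have sets: "sets \<nu> = sets M" using ref by (simp add: reference_measure_def)
  have mcong: "borel_measurable \<nu> = borel_measurable M" by (rule measurable_cong_sets[OF sets refl])
  \<comment> \<open>A \<open>\<nu>\<close>-null set is null for the first density, which is positive everywhere, and hence for \<open>M\<close>.\<close>
  have ac: "absolutely_continuous \<nu> M"
    unfolding absolutely_continuous_def
  proof
    fix A assume "A \<in> null_sets \<nu>"
    then have "A \<in> null_sets ?m1" using ref by (auto simp: reference_measure_def absolutely_continuous_def)
    then have "A \<in> sets M" "AE v in M. v \<in> A \<longrightarrow> ennreal (p1 v) = 0"
      by (auto simp: null_sets_density_iff)
    then have "AE v in M. v \<notin> A"
      using pos(1) by (auto elim!: eventually_mono simp: ennreal_eq_0_iff not_le[symmetric])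
    then show "A \<in> null_sets M" using \<open>A \<in> sets M\<close> by (simp add: AE_iff_null_sets)
  qed
  define r where "r = RN_deriv \<nu> M"
  have rm [measurable]: "r \<in> borel_measurable \<nu>" by (simp add: r_def)
  have dr: "density \<nu> r = M" unfolding r_def by (rule N.density_RN_deriv[OF ac sets[symmetric]])
  have rfin: "AE v in \<nu>. r v \<noteq> \<infinity>"
    unfolding r_def by (rule N.RN_deriv_finite[OF _ ac sets[symmetric]]) (rule sigma_finite_measure_axioms)
  have rn: "AE v in \<nu>. r v * ennreal (p v) = RN_deriv \<nu> (density M (\<lambda>v. ennreal (p v))) v"
    if pm: "p \<in> borel_measurable M" for p
  proof (rule N.RN_deriv_unique)
    have pm': "(\<lambda>v. ennreal (p v)) \<in> borel_measurable \<nu>" using pm by (simp add: mcong)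
    then show "(\<lambda>v. r v * ennreal (p v)) \<in> borel_measurable \<nu>" by measurable
    show "density \<nu> (\<lambda>v. r v * ennreal (p v)) = density M (\<lambda>v. ennreal (p v))"
      using density_density_eq[OF rm pm'] by (simp add: dr)
  qed
  let ?h = "\<lambda>v. (sqrt (p1 v) - sqrt (p2 v))\<^sup>2"
  have hm: "?h \<in> borel_measurable \<nu>" unfolding mcong by measurable
  have em: "(\<lambda>v. enn2real (r v)) \<in> borel_measurable \<nu>" by measurable
  have "(LINT v|\<nu>. (sqrt (enn2real (RN_deriv \<nu> ?m1 v)) - sqrt (enn2real (RN_deriv \<nu> ?m2 v)))\<^sup>2)
      = (LINT v|\<nu>. enn2real (r v) *\<^sub>R ?h v)"
  proof (rule integral_cong_AE)
    show "AE v in \<nu>. (sqrt (enn2real (RN_deriv \<nu> ?m1 v)) - sqrt (enn2real (RN_deriv \<nu> ?m2 v)))\<^sup>2 = enn2real (r v) *\<^sub>R ?h v"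
      using rn[of p1, OF assms(1)] rn[of p2, OF assms(2)] rfin
    proof eventually_elim
      case (elim v)
      have "enn2real (RN_deriv \<nu> ?m1 v) = enn2real (r v) * p1 v" "enn2real (RN_deriv \<nu> ?m2 v) = enn2real (r v) * p2 v"
        using elim(1,2)[symmetric] pos[of v] by (simp_all add: enn2real_mult less_imp_le)
      then show ?case
        by (simp add: real_sqrt_mult power_mult_distrib flip: right_diff_distrib)
    qed
  qed (use hm em in measurable)
  also have "\<dots> = (LINT v|density \<nu> (\<lambda>v. ennreal (enn2real (r v))). ?h v)"
    by (rule integral_density[symmetric, OF hm em]) simp
  also have "density \<nu> (\<lambda>v. ennreal (enn2real (r v))) = M"
  proof -
    have "density \<nu> (\<lambda>v. ennreal (enn2real (r v))) = density \<nu> r"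
      using rfin by (intro density_cong) (auto elim!: eventually_mono simp: ennreal_enn2real_if)
    then show ?thesis by (simp add: dr)
  qed
  also have "(LINT v|M. ?h v) \<le> E\<^sup>2"
  proof -
    have hE: "?h v \<le> E\<^sup>2" for v using power_mono[OF diff[of v] abs_ge_zero, of 2] by simp
    have hi: "integrable M ?h" by (rule integrable_const_bound[of _ "E\<^sup>2"]) (use hE in auto)
    have "(LINT v|M. ?h v) \<le> (LINT v|M. E\<^sup>2)" by (rule integral_mono[OF hi]) (use hE in auto)
    then show ?thesis by (simp add: prob_space)
  qed
  finally have "(LINT v|\<nu>. (sqrt (enn2real (RN_deriv \<nu> ?m1 v)) - sqrt (enn2real (RN_deriv \<nu> ?m2 v)))\<^sup>2) \<le> E\<^sup>2" .
  moreover have "0 \<le> E" using diff[of undefined] abs_ge_zero order_trans by blast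
  ultimately show ?thesis unfolding hellinger_dist_def by (intro real_le_lsqrt)
qed

text \<open>The normalising constants differ by at most \<open>D\<close> as well, and both lie in \<open>[l0, 1]\<close>; this gives the bound
\<open>2 D / l0\<^sup>2\<close> for the normalised densities. Since they are at least \<open>l0\<close>, dividing by the sum of the square
roots costs a factor \<open>1 / sqrt l0\<close>.\<close>

lemma (in prob_space) sqrt_normalised_density_diff:
  fixes l1 l2 :: "'a \<Rightarrow> real"
  assumes [measurable]: "l1 \<in> borel_measurable M" "l2 \<in> borel_measurable M"
    and l0: "0 < l0" and l1: "\<And>v. l0 \<le> l1 v" "\<And>v. l1 v \<le> 1" and l2: "\<And>v. l0 \<le> l2 v" "\<And>v. l2 v \<le> 1"
    and D: "\<And>v. \<bar>l1 v - l2 v\<bar> \<le> D"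
  shows "\<bar>sqrt (l1 v / expectation l1) - sqrt (l2 v / expectation l2)\<bar> \<le> D * (2 / l0\<^sup>2) / sqrt l0"
proof -
  have "\<bar>l1 v\<bar> \<le> 1" for v using l1[of v] l0 by linarith
  then have i1: "integrable M l1" by (intro integrable_const_bound[of _ 1]) auto
  have "\<bar>l2 v\<bar> \<le> 1" for v using l2[of v] l0 by linarith
  then have i2: "integrable M l2" by (intro integrable_const_bound[of _ 1]) auto
  let ?Z1 = "expectation l1" and ?Z2 = "expectation l2"
  have Zb: "l0 \<le> expectation l" "expectation l \<le> 1"
    if "integrable M l" "\<And>v. l0 \<le> l v" "\<And>v. l v \<le> 1" for l
    using integral_mono[of M "\<lambda>_. l0" l] integral_mono[of M l "\<lambda>_. 1"] that by (auto simp: prob_space)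
  note Z1 = Zb[OF i1 l1] and Z2 = Zb[OF i2 l2]
  have D0: "0 \<le> D" using D[of v] by linarith
  have Z: "\<bar>?Z1 - ?Z2\<bar> \<le> D"
  proof -
    have "\<bar>?Z1 - ?Z2\<bar> = \<bar>LINT v|M. l1 v - l2 v\<bar>" using i1 i2 by simp
    also have "\<dots> \<le> (LINT v|M. \<bar>l1 v - l2 v\<bar>)" by (rule integral_abs_bound)
    also have "\<dots> \<le> (LINT v|M. D)" by (rule integral_mono) (use i1 i2 D in auto)
    finally show ?thesis by (simp add: prob_space)
  qed
  have zz: "l0\<^sup>2 \<le> ?Z1 * ?Z2" unfolding power2_eq_square using Z1 Z2 l0 by (intro mult_mono) auto
  have "l1 v / ?Z1 - l2 v / ?Z2 = (?Z2 * (l1 v - l2 v) + l2 v * (?Z2 - ?Z1)) / (?Z1 * ?Z2)"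
    using Z1 Z2 l0 by (simp add: field_simps)
  then have "\<bar>l1 v / ?Z1 - l2 v / ?Z2\<bar> = \<bar>?Z2 * (l1 v - l2 v) + l2 v * (?Z2 - ?Z1)\<bar> / (?Z1 * ?Z2)"
    using Z1 Z2 l0 by (simp add: abs_mult)
  also have "\<dots> \<le> (2 * D) / l0\<^sup>2"
  proof (rule frac_le)
    have "\<bar>?Z2 * (l1 v - l2 v)\<bar> \<le> 1 * D" "\<bar>l2 v * (?Z2 - ?Z1)\<bar> \<le> 1 * D"
      unfolding abs_mult using Z2 l0 l2[of v] D[of v] Z D0 by (intro mult_mono; simp add: abs_minus_commute)+
    then show "\<bar>?Z2 * (l1 v - l2 v) + l2 v * (?Z2 - ?Z1)\<bar> \<le> 2 * D" by linarith
  qed (use D0 l0 zz in auto)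
  finally have P: "\<bar>l1 v / ?Z1 - l2 v / ?Z2\<bar> \<le> (2 * D) / l0\<^sup>2" .
  have s: "l0 \<le> l v / expectation l" if "l0 \<le> expectation l" "expectation l \<le> 1" "l0 \<le> l v" for l
  proof -
    have "l0 * expectation l \<le> l0 * 1" using that l0 by (intro mult_left_mono) auto
    then have "l0 * expectation l \<le> l v" using that by linarith
    then show ?thesis using that l0 by (simp add: pos_le_divide_eq)
  qed
  let ?a = "sqrt (l1 v / ?Z1)" and ?b = "sqrt (l2 v / ?Z2)"
  have ab: "sqrt l0 \<le> ?a" "0 \<le> ?b" using s[OF Z1 l1(1)] s[OF Z2 l2(1)] l0 by auto
  have "(?a - ?b) * (?a + ?b) = l1 v / ?Z1 - l2 v / ?Z2"
    
  proof -
    have "0 \<le> l1 v / ?Z1" "0 \<le> l2 v / ?Z2" using s[OF Z1 l1(1)] s[OF Z2 l2(1)] l0 by linarith+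
    then have "?a * ?a = l1 v / ?Z1" "?b * ?b = l2 v / ?Z2" by (simp_all only: real_sqrt_mult_self abs_of_nonneg)
    then show ?thesis by (simp only: square_diff_square_factored[symmetric] mult.commute[of "?a - ?b"])
  qed
  then have "\<bar>?a - ?b\<bar> * \<bar>?a + ?b\<bar> \<le> (2 * D) / l0\<^sup>2" using P by (simp flip: abs_mult)
  moreover have "\<bar>?a - ?b\<bar> * sqrt l0 \<le> \<bar>?a - ?b\<bar> * \<bar>?a + ?b\<bar>"
  proof (rule mult_left_mono)
    show "sqrt l0 \<le> \<bar>?a + ?b\<bar>" using ab by linarith
  qed simp
  ultimately have "\<bar>?a - ?b\<bar> * sqrt l0 \<le> (2 * D) / l0\<^sup>2" by linarith
  then have "\<bar>?a - ?b\<bar> \<le> (2 * D) / l0\<^sup>2 / sqrt l0" using l0 by (subst pos_le_divide_eq) auto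
  then show ?thesis by (simp add: mult.commute)
qed

lemma exp_neg_lipschitz:
  fixes a b :: real
  assumes "0 \<le> a" "0 \<le> b" shows "\<bar>exp (- a) - exp (- b)\<bar> \<le> \<bar>a - b\<bar>"
proof -
  have *: "exp (- a) - exp (- b) \<le> b - a" if "0 \<le> a" "a \<le> b" for a b :: real
  proof -
    have "1 - (b - a) \<le> exp (- (b - a))" using exp_ge_add_one_self[of "- (b - a)"] by linarith
    then have le: "1 - exp (- (b - a)) \<le> b - a" by linarith
    have "exp (- a) - exp (- b) = exp (- a) * (1 - exp (- (b - a)))"
      by (simp add: right_diff_distrib flip: exp_add)
    also have "\<dots> \<le> 1 * (1 - exp (- (b - a)))"
      using that by (intro mult_right_mono) auto
    also have "\<dots> \<le> b - a" using le by simp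
    finally show ?thesis .
  qed
  show ?thesis
  proof (cases "a \<le> b")
    case True
    then show ?thesis using *[OF assms(1) True] by simp
  next
    case False
    then show ?thesis using *[OF assms(2), of a] by simp
  qed
qed

theorem proposition2p3:
  fixes \<epsilon> c \<delta> \<tau> q a1 a2 a3 \<alpha> :: real
    and K :: "(real ^ 'd::finite \<Rightarrow> real) \<Rightarrow> real ^ 'j::finite"
    and \<Sigma> :: "real ^ 'j ^ 'j"
    and \<mu>0 :: "((real ^ 'd) \<Rightarrow>\<^sub>C real) measure"
  assumes dim: "CARD('d) = 2 \<or> CARD('d) = 3"
    and \<epsilon>: "0 < \<epsilon>" "\<epsilon> < 1"
    and c: "0 \<le> c"
    and coeffs: "0 < \<delta>" "0 < \<tau>" "0 \<le> q" "0 \<le> a1" "0 \<le> a2" "0 \<le> a3"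
    and K: "bounded_linear_L1 unit_cube K"
    and \<Sigma>: "pos_def_matrix \<Sigma>"
    and \<alpha>: "real CARD('d) / 2 < \<alpha>"
    and prior: "gaussian_on_X \<mu>0 (\<lambda>x. 0)
                  (frac_power unit_cube (cov_op \<epsilon> \<delta> \<tau> q a1 a2 a3) (\<alpha> / 2))"
  shows "(\<forall>y. 0 < evidence \<mu>0 K \<Sigma> \<epsilon> c y \<and> evidence \<mu>0 K \<Sigma> \<epsilon> c y < \<infinity> \<and>
              prob_space (posterior \<mu>0 K \<Sigma> \<epsilon> c y)) \<and>
         (\<forall>\<rho>>0. \<exists>L. \<forall>y y'. norm y < \<rho> \<and> norm y' < \<rho> \<longrightarrow>
            (\<forall>\<nu>. reference_measure \<nu> (posterior \<mu>0 K \<Sigma> \<epsilon> c y) (posterior \<mu>0 K \<Sigma> \<epsilon> c y') \<longrightarrow>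
               hellinger_dist \<nu> (posterior \<mu>0 K \<Sigma> \<epsilon> c y) (posterior \<mu>0 K \<Sigma> \<epsilon> c y')
                 \<le> L * norm (y - y'))) \<and>
         (1 + real CARD('d) / 2 < \<alpha> \<longrightarrow>
            (\<forall>y. AE v in posterior \<mu>0 K \<Sigma> \<epsilon> c y.
               total_variation unit_cube (threshold (apply_bcontfun v)) < \<infinity>))"
proof -
  interpret prob_space \<mu>0 using prior by (simp add: gaussian_on_X_def)
  interpret covariance \<epsilon> \<delta> \<tau> q a1 a2 a3 by unfold_locales (use \<epsilon> coeffs in auto)
  have sets: "sets \<mu>0 = sets X_borel" using prior by (simp add: gaussian_on_X_def)
  define F where "F v = K (threshold (apply_bcontfun v))" for v
  have Fm [measurable]: "F \<in> borel_measurable \<mu>0"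
    unfolding F_def[abs_def] by (rule forward_map_measurable[OF K sets])
  obtain B where B: "0 \<le> B" "\<And>f. f \<in> L1_space unit_cube \<Longrightarrow> norm (K f) \<le> B * (LINT x|lebesgue_on unit_cube. \<bar>f x\<bar>)"
    using bounded_linear_L1_bound[OF K] by metis
  have FB: "norm (F v) \<le> B" for v
  proof -
    have "norm (F v) \<le> B * (LINT x|lebesgue_on unit_cube. \<bar>threshold (apply_bcontfun v) x\<bar>)"
      unfolding F_def by (rule B(2)[OF threshold_L1])
    also have "\<dots> \<le> B * 1" by (intro mult_left_mono L1_norm_le threshold_L1 abs_threshold_le B(1))
    finally show ?thesis by simp
  qed
  let ?A = "matrix_inv (matrix_sqrt \<Sigma>)"
  have blA: "bounded_linear ((*v) ?A)" by (rule matrix_vector_mul_bounded_linear)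
  obtain a where a: "0 < a" "\<And>z. norm (?A *v z) \<le> norm z * a"
    using bounded_linear.pos_bounded[OF blA] by blast
  define \<kappa> where "\<kappa> = 1 / (2 * \<epsilon> powr (2 * c))"
  have \<kappa>: "0 \<le> \<kappa>" by (simp add: \<kappa>_def)
  define \<Phi> where "\<Phi> y v = \<kappa> * (norm (?A *v (y - F v)))\<^sup>2" for y v
  define l where "l y v = exp (- \<Phi> y v)" for y v
  have lik: "likelihood K \<Sigma> \<epsilon> c y v = l y v" for y v
    by (simp add: likelihood_def l_def \<Phi>_def F_def \<kappa>_def)
  have \<Phi>0: "0 \<le> \<Phi> y v" for y v by (simp add: \<Phi>_def \<kappa>)
  have lm [measurable]: "l y \<in> borel_measurable \<mu>0" for y
  proof -
    have [measurable]: "((*v) ?A) \<in> borel_measurable borel"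
      by (rule borel_measurable_continuous_onI[OF linear_continuous_on[OF blA]])
    show ?thesis unfolding l_def[abs_def] \<Phi>_def by measurable
  qed
  have l01: "0 \<le> l y v" "l y v \<le> 1" "0 < l y v" for y v using \<Phi>0[of y v] by (auto simp: l_def)
  have rad: "norm (?A *v (y - F v)) \<le> (\<rho> + B) * a" if "norm y \<le> \<rho>" for y v \<rho>
  proof -
    have "norm (y - F v) \<le> \<rho> + B" using norm_triangle_ineq4[of y "F v"] FB[of v] that by linarith
    then show ?thesis using a(2)[of "y - F v"] mult_right_mono[of "norm (y - F v)" "\<rho> + B" a] a(1) by linarith
  qed
  define lo where "lo \<rho> = exp (- (\<kappa> * ((\<rho> + B) * a)\<^sup>2))" for \<rho>
  have llo: "lo \<rho> \<le> l y v" if "norm y \<le> \<rho>" for y v \<rho>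
    unfolding lo_def l_def \<Phi>_def using power_mono[OF rad[OF that, of v] norm_ge_zero, of 2] \<kappa>
    by (simp add: mult_left_mono)
  have li: "integrable \<mu>0 (l y)" for y by (rule integrable_const_bound[of _ 1]) (use l01 in auto)
  have Zpos: "0 < expectation (l y)" for y
  proof -
    have "expectation (\<lambda>_. lo (norm y)) \<le> expectation (l y)"
      by (rule integral_mono) (use li llo in auto)
    moreover have "0 < lo (norm y)" by (simp add: lo_def)
    ultimately show ?thesis by (simp add: prob_space)
  qed
  have ev: "evidence \<mu>0 K \<Sigma> \<epsilon> c y = ennreal (expectation (l y))" for y
    unfolding evidence_def lik by (rule nn_integral_eq_integral[OF li]) (simp add: l01)
  have post: "posterior \<mu>0 K \<Sigma> \<epsilon> c y = density \<mu>0 (\<lambda>v. ennreal (l y v / expectation (l y)))" for y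
    unfolding posterior_def ev lik by (simp add: divide_ennreal l01 Zpos)
  have lip: "\<bar>l y v - l y' v\<bar> \<le> \<kappa> * (2 * ((\<rho> + B) * a)) * a * norm (y - y')"
    if "norm y \<le> \<rho>" "norm y' \<le> \<rho>" for y y' v \<rho>
  proof -
    let ?p = "norm (?A *v (y - F v))" and ?q = "norm (?A *v (y' - F v))"
    have "?A *v (y - F v) - ?A *v (y' - F v) = ?A *v (y - y')"
      by (simp add: matrix_vector_mult_diff_distrib)
    then have "\<bar>?p - ?q\<bar> \<le> norm (?A *v (y - y'))" using norm_triangle_ineq3 by metis
    then have d: "\<bar>?p - ?q\<bar> \<le> norm (y - y') * a" using a(2)[of "y - y'"] by linarith
    have "\<bar>l y v - l y' v\<bar> \<le> \<bar>\<Phi> y v - \<Phi> y' v\<bar>"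
      unfolding l_def by (rule exp_neg_lipschitz[OF \<Phi>0 \<Phi>0])
    also have "\<dots> = \<kappa> * (\<bar>?p + ?q\<bar> * \<bar>?p - ?q\<bar>)"
    proof -
      have "\<Phi> y v - \<Phi> y' v = \<kappa> * ((?p + ?q) * (?p - ?q))"
        unfolding \<Phi>_def by (simp add: power2_eq_square algebra_simps)
      then show ?thesis using \<kappa> by (simp add: abs_mult)
    qed
    also have "\<dots> \<le> \<kappa> * ((2 * ((\<rho> + B) * a)) * (norm (y - y') * a))"
    proof (intro mult_left_mono mult_mono d \<kappa>)
      show "\<bar>?p + ?q\<bar> \<le> 2 * ((\<rho> + B) * a)" using rad[OF that(1), of v] rad[OF that(2), of v] by simp
      then show "0 \<le> 2 * ((\<rho> + B) * a)" by linarith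
    qed auto
    finally show ?thesis by (simp add: mult_ac)
  qed
  have part1: "0 < evidence \<mu>0 K \<Sigma> \<epsilon> c y \<and> evidence \<mu>0 K \<Sigma> \<epsilon> c y < \<infinity> \<and> prob_space (posterior \<mu>0 K \<Sigma> \<epsilon> c y)" for y
    unfolding post ev using prob_space_normalised_density[OF lm[of y] l01(1,2) Zpos[of y]] Zpos[of y] by simp
  have part2: "\<exists>L. \<forall>y y'. norm y < \<rho> \<and> norm y' < \<rho> \<longrightarrow>
            (\<forall>\<nu>. reference_measure \<nu> (posterior \<mu>0 K \<Sigma> \<epsilon> c y) (posterior \<mu>0 K \<Sigma> \<epsilon> c y') \<longrightarrow>
               hellinger_dist \<nu> (posterior \<mu>0 K \<Sigma> \<epsilon> c y) (posterior \<mu>0 K \<Sigma> \<epsilon> c y')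
                 \<le> L * norm (y - y'))" for \<rho>
  proof (intro exI allI impI)
    fix y y' :: "real ^ 'j" and \<nu>
    assume "norm y < \<rho> \<and> norm y' < \<rho>"
    then have yr: "norm y \<le> \<rho>" "norm y' \<le> \<rho>" by auto
    assume ref: "reference_measure \<nu> (posterior \<mu>0 K \<Sigma> \<epsilon> c y) (posterior \<mu>0 K \<Sigma> \<epsilon> c y')"
    let ?L = "\<kappa> * (2 * ((\<rho> + B) * a)) * a"
    have lo0: "0 < lo \<rho>" by (simp add: lo_def)
    have pp: "0 < l z v / expectation (l z)" for z v using l01(3)[of z v] Zpos[of z] by simp
    have "hellinger_dist \<nu> (posterior \<mu>0 K \<Sigma> \<epsilon> c y) (posterior \<mu>0 K \<Sigma> \<epsilon> c y')
        \<le> ?L * norm (y - y') * (2 / (lo \<rho>)\<^sup>2) / sqrt (lo \<rho>)"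
      unfolding post
    proof (rule hellinger_dist_densities[OF _ _ pp pp _ ref[unfolded post]])
      show "\<bar>sqrt (l y v / expectation (l y)) - sqrt (l y' v / expectation (l y'))\<bar>
          \<le> ?L * norm (y - y') * (2 / (lo \<rho>)\<^sup>2) / sqrt (lo \<rho>)" for v
        by (rule sqrt_normalised_density_diff[OF lm lm lo0 llo[OF yr(1)] l01(2) llo[OF yr(2)] l01(2) lip[OF yr]])
    qed measurable
    also have "\<dots> = (?L * (2 / (lo \<rho>)\<^sup>2) / sqrt (lo \<rho>)) * norm (y - y')" by simp
    finally show "hellinger_dist \<nu> (posterior \<mu>0 K \<Sigma> \<epsilon> c y) (posterior \<mu>0 K \<Sigma> \<epsilon> c y')
        \<le> (?L * (2 / (lo \<rho>)\<^sup>2) / sqrt (lo \<rho>)) * norm (y - y')" .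
  qed
  have part3: "AE v in posterior \<mu>0 K \<Sigma> \<epsilon> c y. total_variation unit_cube (threshold (apply_bcontfun v)) < \<infinity>"
    if \<alpha>1: "1 + real CARD('d) / 2 < \<alpha>" for y :: "real ^ 'j"
  proof -
    have "CARD('d) \<le> 3" using dim by auto
    from AE_total_variation_threshold_finite[OF this \<alpha>1 prior]
    show ?thesis unfolding post by (subst AE_density) (auto elim!: eventually_mono)
  qed
  show ?thesis using part1 part2 part3 by blast
qed

end
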